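(* Let $1<p\le N$ and $p<q<s<p^*$. Assume there are constants $\rho_0>0$ and $\gamma>p-1$ such that $\rho(x)\ge \rho_0(1+x_N)^\gamma$ for a.e. $x\in\mathbb{R}^N_+$. Let $a,b\in\mathcal{K}_0$ satisfy $$\frac{a^{1/q}}{b^{1/s}}\in L^{\frac{sq}{s-q}}(\mathbb{R}^N_+),$$ and suppose that the set $$\mathcal{D}_1=\left\{u\in E:\ A(u)^{s-p}>\left(\frac{q}{p}\right)^{s-q}\eta\,B(u)^{q-p}\|u\|^{p(s-q)}\right\},\qquad \eta=\frac{(s-p)^{s-p}}{(q-p)^{q-p}(s-q)^{s-q}},$$ where $A(u)=\int_{\mathbb{R}^N_+}a|u|^q\,dx$ and $B(u)=\int_{\mathbb{R}^N_+}b|u|^s\,dx$, is nonempty. Then the problem $$-\mathrm{div}(\rho(x)|\nabla u|^{p-2}\nabla u)=a(x)|u|^{q-2}u-b(x)|u|^{s-2}u \ \text{ in } \mathbb{R}^N_+,\qquad |\nabla u|^{p-2}\nabla u\cdot\nu=0\ \text{ on } \mathbb{R}^{N-1},$$ has a nontrivial and nonnegative weak solution $u\in E$.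
   Context: $p^*=Np/(N-p)$ if $p<N$ and $p^*=\infty$ if $p=N$. $\mathbb{R}^N_+=\{(x',x_N): x'\in\mathbb{R}^{N-1},\ x_N>0\}$, with boundary identified with $\mathbb{R}^{N-1}$ and unit outer normal $\nu$. The functions $\rho,a,b$ are positive and integrable on every bounded subset of $\mathbb{R}^N_+$. $C_\delta^\infty(\mathbb{R}^N_+)$ is the set of restrictions to $\mathbb{R}^N_+$ of functions in $C_0^\infty(\mathbb{R}^N)$ (smooth, compactly supported). $E$ is the completion (closure) of $C_\delta^\infty(\mathbb{R}^N_+)$ with respect to $\|u\|=\left(\int_{\mathbb{R}^N_+}\rho|\nabla u|^p\,dx\right)^{1/p}$; under the lower bound on $\rho$ it is identified with a space of weakly differentiable functions in $L^p(\mathbb{R}^N_+,(1+x_N)^{\gamma-p}dx)$. $\mathcal{K}_0=\{k\in C(\overline{\mathbb{R}^N_+},(0,\infty)): \lim_{|x|\to\infty}k(x)(1+x_N)^{p-\gamma}=0\}$. A weak solution of the problem is a function $u\in E$ such that $$\int_{\mathbb{R}^N_+}\rho|\nabla u|^{p-2}\nabla u\cdot\nabla\varphi\,dx=\int_{\mathbb{R}^N_+}\left(a|u|^{q-2}u-b|u|^{s-2}u\right)\varphi\,dx\quad\text{for every }\varphi\in C_\delta^\infty(\mathbb{R}^N_+).$$ *)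

theory Defs
  imports "HOL-Analysis.Analysis"
begin

text \<open>
  A point of \<open>R^N\<close> is a pair \<open>(x', x\<^sub>N)\<close> of type \<open>(real^'m) \<times> real\<close>, so \<open>N = CARD('m) + 1\<close> is an
  arbitrary integer \<open>\<ge> 2\<close> (the case \<open>N = 1\<close> is excluded by \<open>1 < p \<le> N\<close>).  The product norm
  is the Euclidean one.  Functions on the half-space are total functions whose values outside
  it (outside its closure, for the coefficients) are irrelevant.
\<close>

definition halfspace :: "((real^'m) \<times> real) set" where
  "halfspace = {x. 0 < snd x}"

abbreviation dxH :: "((real^'m) \<times> real) measure" where
  "dxH \<equiv> lebesgue_on halfspace"

definition crit_exp :: "real \<Rightarrow> real \<Rightarrow> ereal" where
  "crit_exp N p = (if p < N then ereal (N * p / (N - p)) else \<infinity>)"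

definition in_Lp :: "'a measure \<Rightarrow> real \<Rightarrow> ('a \<Rightarrow> real) \<Rightarrow> bool" where
  "in_Lp M r f \<longleftrightarrow> f \<in> borel_measurable M \<and> integrable M (\<lambda>x. \<bar>f x\<bar> powr r)"

definition pos_loc_integrable :: "(((real^'m) \<times> real) \<Rightarrow> real) \<Rightarrow> bool" where
  "pos_loc_integrable w \<longleftrightarrow> (\<forall>x\<in>halfspace. 0 < w x) \<and>
     (\<forall>S. S \<in> sets lebesgue \<and> S \<subseteq> halfspace \<and> bounded S \<longrightarrow> integrable (lebesgue_on S) w)"

definition K0 :: "real \<Rightarrow> real \<Rightarrow> (((real^'m) \<times> real) \<Rightarrow> real) set" where
  "K0 p \<gamma> = {k. continuous_on (closure halfspace) k \<and> (\<forall>x\<in>closure halfspace. 0 < k x) \<and>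
     ((\<lambda>x. k x * (1 + snd x) powr (p - \<gamma>)) \<longlongrightarrow> 0)
       (inf at_infinity (principal (closure halfspace)))}"


subsection \<open>Smooth functions, test functions\<close>

definition grad :: "('a::euclidean_space \<Rightarrow> real) \<Rightarrow> 'a \<Rightarrow> 'a" where
  "grad f x = (THE D. GDERIV f x :> D)"

primrec C_k :: "nat \<Rightarrow> ('a::euclidean_space \<Rightarrow> real) \<Rightarrow> bool" where
  "C_k 0 f \<longleftrightarrow> continuous_on UNIV f"
| "C_k (Suc n) f \<longleftrightarrow> f differentiable_on UNIV \<and> (\<forall>i\<in>Basis. C_k n (\<lambda>x. grad f x \<bullet> i))"

definition Cc_infty :: "'a::euclidean_space set \<Rightarrow> ('a \<Rightarrow> real) set" where
  "Cc_infty \<Omega> = {f. (\<forall>n. C_k n f) \<and> compact (closure {x. f x \<noteq> 0}) \<and> closure {x. f x \<noteq> 0} \<subseteq> \<Omega>}"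

definition C_delta :: "(((real^'m) \<times> real) \<Rightarrow> real) set" where
  "C_delta = {\<phi>. \<exists>f \<in> Cc_infty UNIV. \<forall>x\<in>halfspace. \<phi> x = f x}"


subsection \<open>Weak gradients and the energy space\<close>

definition loc_integrable :: "(((real^'m) \<times> real) \<Rightarrow> 'b::euclidean_space) \<Rightarrow> bool" where
  "loc_integrable f \<longleftrightarrow> (\<forall>K. compact K \<and> K \<subseteq> halfspace \<longrightarrow> integrable (lebesgue_on K) f)"

definition has_weak_gradient ::
  "(((real^'m) \<times> real) \<Rightarrow> real) \<Rightarrow> (((real^'m) \<times> real) \<Rightarrow> (real^'m) \<times> real) \<Rightarrow> bool" where
  "has_weak_gradient u G \<longleftrightarrow> loc_integrable u \<and> loc_integrable G \<and>
     (\<forall>\<phi> \<in> Cc_infty halfspace. (\<integral>x. u x *\<^sub>R grad \<phi> x \<partial>dxH) = - (\<integral>x. \<phi> x *\<^sub>R G x \<partial>dxH))"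

text \<open>The weak gradient is unique almost everywhere; \<open>wgrad u\<close> is a representative.\<close>

definition wgrad :: "(((real^'m) \<times> real) \<Rightarrow> real) \<Rightarrow> ((real^'m) \<times> real) \<Rightarrow> (real^'m) \<times> real" where
  "wgrad u = (SOME G. has_weak_gradient u G)"

definition E_norm ::
  "(((real^'m) \<times> real) \<Rightarrow> real) \<Rightarrow> real \<Rightarrow> (((real^'m) \<times> real) \<Rightarrow> real) \<Rightarrow> real" where
  "E_norm \<rho> p u = (\<integral>x. \<rho> x * norm (wgrad u x) powr p \<partial>dxH) powr (1 / p)"

text \<open>
  The completion of \<open>C_delta\<close> in the norm \<open>E_norm \<rho> p\<close>, realised as a space of functions.
  If \<open>\<rho> \<ge> \<rho>\<^sub>0 (1 + x\<^sub>N)^\<gamma>\<close> with \<open>\<gamma> > p - 1\<close>, Hardy's inequality on \<open>C_delta\<close> shows that a Cauchy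
  sequence in this norm also converges in \<open>L^p((1 + x\<^sub>N)^(\<gamma> - p) dx)\<close>; its limit there is
  weakly differentiable and represents the element of the completion.  The two
  convergences are stated with Lebesgue integrals in \<open>[0,\<infinity>]\<close>, since the Bochner integral
  of a non-integrable function is \<open>0\<close>.
\<close>

definition E_space ::
  "(((real^'m) \<times> real) \<Rightarrow> real) \<Rightarrow> real \<Rightarrow> real \<Rightarrow> (((real^'m) \<times> real) \<Rightarrow> real) set" where
  "E_space \<rho> p \<gamma> = {u.
     in_Lp (density dxH (\<lambda>x. ennreal ((1 + snd x) powr (\<gamma> - p)))) p u \<and>
     (\<exists>G. has_weak_gradient u G) \<and>
     (\<exists>\<phi>. (\<forall>n::nat. \<phi> n \<in> C_delta) \<and>
        (\<lambda>n. \<integral>\<^sup>+x. ennreal (\<rho> x * norm (grad (\<phi> n) x - wgrad u x) powr p) \<partial>dxH) \<longlonglongrightarrow> 0 \<and>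
        (\<lambda>n. \<integral>\<^sup>+x. ennreal ((1 + snd x) powr (\<gamma> - p) * \<bar>\<phi> n x - u x\<bar> powr p) \<partial>dxH) \<longlonglongrightarrow> 0)}"


subsection \<open>The problem\<close>

definition pow_int ::
  "(((real^'m) \<times> real) \<Rightarrow> real) \<Rightarrow> real \<Rightarrow> (((real^'m) \<times> real) \<Rightarrow> real) \<Rightarrow> real" where
  "pow_int k r u = (\<integral>x. k x * \<bar>u x\<bar> powr r \<partial>dxH)"

definition eta :: "real \<Rightarrow> real \<Rightarrow> real \<Rightarrow> real" where
  "eta p q s = (s - p) powr (s - p) / ((q - p) powr (q - p) * (s - q) powr (s - q))"

definition D1 ::
  "(((real^'m) \<times> real) \<Rightarrow> real) \<Rightarrow> (((real^'m) \<times> real) \<Rightarrow> real) \<Rightarrow> (((real^'m) \<times> real) \<Rightarrow> real) \<Rightarrow>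
   real \<Rightarrow> real \<Rightarrow> real \<Rightarrow> real \<Rightarrow> (((real^'m) \<times> real) \<Rightarrow> real) set" where
  "D1 \<rho> a b p q s \<gamma> = {u \<in> E_space \<rho> p \<gamma>.
     pow_int a q u powr (s - p) >
       (q / p) powr (s - q) * eta p q s * pow_int b s u powr (q - p) * E_norm \<rho> p u powr (p * (s - q))}"

text \<open>
  Weak solutions of \<open>-div(\<rho> |\<nabla>u|^(p-2) \<nabla>u) = a |u|^(q-2) u - b |u|^(s-2) u\<close> in the half-space with
  \<open>|\<nabla>u|^(p-2) \<nabla>u \<cdot> \<nu> = 0\<close> on its boundary; the boundary condition is encoded by test functions
  that need not vanish there.  Since \<open>0 powr r = 0\<close>, the vector \<open>|\<nabla>u|^(p-2) \<nabla>u\<close> is \<open>0\<close> where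
  \<open>\<nabla>u = 0\<close>, also for \<open>p \<le> 2\<close>.
\<close>

definition weak_solution ::
  "(((real^'m) \<times> real) \<Rightarrow> real) \<Rightarrow> (((real^'m) \<times> real) \<Rightarrow> real) \<Rightarrow> (((real^'m) \<times> real) \<Rightarrow> real) \<Rightarrow>
   real \<Rightarrow> real \<Rightarrow> real \<Rightarrow> real \<Rightarrow> (((real^'m) \<times> real) \<Rightarrow> real) \<Rightarrow> bool" where
  "weak_solution \<rho> a b p q s \<gamma> u \<longleftrightarrow> u \<in> E_space \<rho> p \<gamma> \<and>
     (\<forall>\<phi> \<in> C_delta.
        integrable dxH (\<lambda>x. \<rho> x * ((norm (wgrad u x) powr (p - 2) *\<^sub>R wgrad u x) \<bullet> grad \<phi> x)) \<and>
        integrable dxH (\<lambda>x. (a x * \<bar>u x\<bar> powr (q - 2) * u x - b x * \<bar>u x\<bar> powr (s - 2) * u x) * \<phi> x) \<and>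
        (\<integral>x. \<rho> x * ((norm (wgrad u x) powr (p - 2) *\<^sub>R wgrad u x) \<bullet> grad \<phi> x) \<partial>dxH) =
        (\<integral>x. (a x * \<bar>u x\<bar> powr (q - 2) * u x - b x * \<bar>u x\<bar> powr (s - 2) * u x) * \<phi> x \<partial>dxH))"

end

theory Submission
  imports Defs "HOL-Complex_Analysis.Great_Picard"
begin

text \<open>
  The energy \<open>I u = \<parallel>u\<parallel>\<^sup>p / p - A u / q + B u / s\<close> is minimised over the closure of the test
  functions. The integrability of \<open>a\<^sup>1\<^sup>/\<^sup>q / b\<^sup>1\<^sup>/\<^sup>s\<close> makes \<open>I\<close> coercive by Young's
  inequality, and optimising \<open>I (t u)\<close> over \<open>t > 0\<close> for an element of \<open>\<D>\<^sub>1\<close> gives \<open>inf I < 0\<close>.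
  A minimising sequence of nonnegative test functions converges almost everywhere along a
  subsequence by a Rellich argument (Poincare's inequality on small cells). The term \<open>A\<close> is
  continuous along it, again by Young's inequality, and \<open>B\<close> is convex, so the uniform convexity of
  \<open>\<bar>x\<bar>\<^sup>p\<close> makes the gradients a Cauchy sequence. The limit minimises \<open>I\<close> and so
  solves the Euler-Lagrange equation. Hardy's inequality, which uses \<open>\<gamma> > p - 1\<close>, and a Sobolev
  inequality with exponent \<open>s < p\<^sup>*\<close> on unit cells make \<open>A\<close> and \<open>B\<close> finite and
  continuous on \<open>E\<close>. The latter is derived from
  \<open>f x - f y = \<integral> d/d\<tau> f (x + \<tau>\<^sup>k (y - x)) d\<tau>\<close>: taking \<open>k\<close> large spreads the singularity
  enough for every subcritical exponent, without potential theory.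
\<close>

section \<open>Powers of norms\<close>

text \<open>Two difficulties shape the argument. The domain is unbounded and \<rho> is only locally
  integrable, so compactness yields at first no more than a limit almost everywhere. It is therefore
  demanded of the A-term alone: when two late members of the minimising sequence are compared with
  their midpoint, the energy of the midpoint is at least the infimum, the B-term has the favourable
  sign by convexity, and the A-terms cancel in the limit. What is left bounds the convexity defect
  of the gradients, so they converge strongly without weak topologies or duality, and strong
  convergence is what the nonlinear flux in the equation needs. Secondly, E is a closure and its
  gradient is chosen only up to null sets; estimates are therefore proved for smooth compactly
  supported functions and carried over by continuity to pairs (u, G) of limits. Functionals are kept
  as r-th powers of norms, with a factor 2^r in place of Minkowski's inequality, and integrability
  predicates accompany them because a non-integrable function has Bochner integral 0.\<close>

lemma powr_add_le:
  fixes x y r :: real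
  assumes "0 \<le> x" "0 \<le> y" "0 \<le> r"
  shows "(x + y) powr r \<le> 2 powr r * (x powr r + y powr r)"
proof -
  have "(x + y) powr r \<le> (2 * max x y) powr r"
    using assms by (intro powr_mono2) auto
  also have "\<dots> = 2 powr r * max x y powr r"
    using assms by (simp add: powr_mult)
  also have "\<dots> \<le> 2 powr r * (x powr r + y powr r)"
    by (intro mult_left_mono) (auto simp: max_def)
  finally show ?thesis .
qed

lemma norm_add_powr_le:
  fixes x y :: "'b::real_normed_vector"
  assumes "0 \<le> r"
  shows "norm (x + y) powr r \<le> 2 powr r * (norm x powr r + norm y powr r)"
  by (rule order_trans[OF powr_mono2[OF assms _ norm_triangle_ineq] powr_add_le]) (use assms in auto)

lemma norm_diff_powr_le:
  fixes x y :: "'b::real_normed_vector"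
  assumes "0 \<le> r"
  shows "norm (x - y) powr r \<le> 2 powr r * (norm x powr r + norm y powr r)"
  using norm_add_powr_le[OF assms, of x "- y"] by simp

text \<open>Strict convexity of the power function: the mean value theorem and the strictly
  increasing derivative. At x = 0 the difference of the two sides is computed directly as (1 - r)
  c^r < 0.\<close>

lemma powr_tangent_strict:
  fixes x c r :: real
  assumes r: "1 < r" and "0 \<le> x" "0 < c" "x \<noteq> c"
  shows "c powr r + r * c powr (r - 1) * (x - c) < x powr r"
proof (cases "x = 0")
  case True
  have "c powr r = c powr (r - 1) * c"
    using assms by (simp add: powr_diff)
  then have "c powr r + r * c powr (r - 1) * (x - c) = (1 - r) * (c powr (r - 1) * c)"
    using True by (simp add: algebra_simps)
  also have "\<dots> < 0" using assms by (simp add: mult_neg_pos)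
  finally show ?thesis using True by simp
next
  case False
  then have x: "0 < x" using assms by simp
  have d: "((\<lambda>t. t powr r) has_real_derivative r * t powr (r - 1)) (at t)" if "0 < t" for t
    using that by (auto intro!: derivative_eq_intros simp: powr_diff)
  show ?thesis
  proof (cases "c < x")
    case True
    obtain z where z: "c < z" "z < x" "x powr r - c powr r = (x - c) * (r * z powr (r - 1))"
      using MVT2[OF True, of "\<lambda>t. t powr r" "\<lambda>t. r * t powr (r - 1)"] d assms by force
    have "c powr (r - 1) < z powr (r - 1)" using z assms by (intro powr_less_mono2) auto
    then have "(x - c) * (r * c powr (r - 1)) < (x - c) * (r * z powr (r - 1))" using True r by simp
    then show ?thesis using z(3) by (simp add: algebra_simps)
  next
    case False
    then have xc: "x < c" using assms by simp
    obtain z where z: "x < z" "z < c" "c powr r - x powr r = (c - x) * (r * z powr (r - 1))"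
      using MVT2[OF xc, of "\<lambda>t. t powr r" "\<lambda>t. r * t powr (r - 1)"] d x by force
    have "z powr (r - 1) < c powr (r - 1)" using z x assms by (intro powr_less_mono2) auto
    then have "(c - x) * (r * z powr (r - 1)) < (c - x) * (r * c powr (r - 1))" using xc r by simp
    then show ?thesis using z(3) by (simp add: algebra_simps)
  qed
qed

lemma powr_tangent:
  fixes x c r :: real
  assumes r: "1 \<le> r" and "0 \<le> x" "0 \<le> c"
  shows "c powr r + r * c powr (r - 1) * (x - c) \<le> x powr r"
proof -
  consider "c = 0" | "x = c" | "r = 1" "0 < c" | "1 < r" "x \<noteq> c" "0 < c" using assms by linarith
  then show ?thesis
    using assms by cases (auto dest: powr_tangent_strict[of r x c])
qed

lemma powr_diff_le:
  fixes x y r :: real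
  assumes "1 \<le> r" "0 \<le> x" "0 \<le> y"
  shows "\<bar>x powr r - y powr r\<bar> \<le> r * max x y powr (r - 1) * \<bar>x - y\<bar>"
proof -
  have *: "u powr r - v powr r \<le> r * u powr (r - 1) * (u - v)" if "0 \<le> u" "0 \<le> v" for u v
    using powr_tangent[of r v u] that assms by (simp add: algebra_simps)
  show ?thesis
  proof (cases "x \<le> y")
    case True
    then show ?thesis using *[of y x] powr_mono2[of r x y] assms by (simp add: max_def abs_if)
  next
    case False
    then show ?thesis using *[of x y] powr_mono2[of r y x] assms by (simp add: max_def abs_if)
  qed
qed

text \<open>If x is close to y relative to the size of y, continuity of t^r at 1 gives a small
  relative error; otherwise both norms are bounded by a multiple of norm (x - y). This replaces the
  triangle inequality for the r-th root in the proof that \<open>Nw\<close> is continuous.\<close>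

lemma powr_perturbation:
  fixes r e :: real
  assumes r: "1 \<le> r" and "0 < e"
  obtains C where "0 \<le> C"
    "\<And>x y::'b::real_normed_vector. \<bar>norm x powr r - norm y powr r\<bar> \<le> e * norm y powr r + C * norm (x - y) powr r"
proof -
  have "isCont (\<lambda>t::real. t powr r) 1" by (intro continuous_intros) auto
  then obtain d where d: "0 < d" "\<And>t. \<bar>t - 1\<bar> < d \<Longrightarrow> \<bar>t powr r - 1\<bar> < e"
    using \<open>0 < e\<close> unfolding continuous_at_eps_delta by (auto simp: dist_real_def)
  define K where "K = (1 + 1/d) powr r"
  have K: "0 \<le> K" by (simp add: K_def)
  have "\<bar>norm x powr r - norm y powr r\<bar> \<le> e * norm y powr r + K * norm (x - y) powr r" for x y :: 'b
  proof (cases "norm (x - y) < d * norm y")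
    case True
    then have y: "0 < norm y" using d(1) by (metis mult_zero_right norm_ge_zero not_less zero_less_norm_iff norm_zero)
    have "\<bar>norm x / norm y - 1\<bar> = \<bar>norm x - norm y\<bar> / norm y" using y by (simp add: field_simps abs_if)
    also have "\<dots> < d" using True y norm_triangle_ineq3[of x y] by (simp add: pos_divide_less_eq)
    finally have "\<bar>(norm x / norm y) powr r - 1\<bar> < e" by (rule d(2))
    then have "\<bar>(norm x / norm y) powr r - 1\<bar> * norm y powr r \<le> e * norm y powr r"
      by (intro mult_right_mono) auto
    moreover have "\<bar>(norm x / norm y) powr r - 1\<bar> * norm y powr r = \<bar>((norm x / norm y) powr r - 1) * norm y powr r\<bar>"
      by (simp add: abs_mult)
    moreover have "((norm x / norm y) powr r - 1) * norm y powr r = norm x powr r - norm y powr r"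
      using y by (simp add: powr_divide field_simps)
    ultimately have "\<bar>norm x powr r - norm y powr r\<bar> \<le> e * norm y powr r" by simp
    then show ?thesis using K by (smt (verit) mult_nonneg_nonneg powr_ge_zero)
  next
    case False
    then have y: "norm y \<le> 1/d * norm (x - y)" using d(1) by (simp add: field_simps)
    have x: "norm x \<le> (1 + 1/d) * norm (x - y)"
      using y norm_triangle_sub[of x y] by (simp add: algebra_simps)
    have "norm z powr r \<le> K * norm (x - y) powr r" if "norm z \<le> (1 + 1/d) * norm (x - y)" for z :: 'b
    proof -
      have "norm z powr r \<le> ((1 + 1/d) * norm (x - y)) powr r"
        using that r by (intro powr_mono2) auto
      then show ?thesis using d(1) by (simp add: K_def powr_mult)
    qed
    moreover have "norm y \<le> (1 + 1/d) * norm (x - y)"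
      using y norm_ge_zero[of "x - y"] unfolding distrib_right mult_1 by linarith
    ultimately have "norm x powr r \<le> K * norm (x - y) powr r" "norm y powr r \<le> K * norm (x - y) powr r"
      using x by blast+
    then have "\<bar>norm x powr r - norm y powr r\<bar> \<le> K * norm (x - y) powr r"
      by (smt (verit) powr_ge_zero)
    then show ?thesis using \<open>0 < e\<close> by (smt (verit) mult_nonneg_nonneg powr_ge_zero)
  qed
  with K show ?thesis by (rule that)
qed

text \<open>For vectors of equal norm the parallelogram law makes the midpoint strictly shorter; for
  different norms the triangle inequality reduces to strict convexity of the scalar power, used at
  the mean \<open>c\<close> of the two norms.\<close>

lemma norm_powr_strict_midpoint:
  fixes x y :: "'b::real_inner"
  assumes r: "1 < r" and "x \<noteq> y"
  shows "norm ((1/2) *\<^sub>R (x + y)) powr r < (norm x powr r + norm y powr r) / 2"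
proof (cases "norm x = norm y")
  case True
  then have x: "0 < norm x" using assms by force
  have "norm (x + y) ^ 2 + norm (x - y) ^ 2 = 4 * norm x ^ 2"
    using True by (simp add: power2_norm_eq_inner inner_simps inner_commute norm_eq)
  moreover have "0 < norm (x - y) ^ 2" using assms by simp
  ultimately have "norm (x + y) ^ 2 < (2 * norm x) ^ 2" by (simp add: power2_eq_square)
  then have "norm (x + y) < 2 * norm x" by (rule power_less_imp_less_base) simp
  then have "norm ((1/2) *\<^sub>R (x + y)) powr r < norm x powr r"
    using r by (intro powr_less_mono2) auto
  then show ?thesis using True by simp
next
  case False
  define c where "c = (norm x + norm y) / 2"
  have c: "0 < c" "norm x \<noteq> c" "norm y \<noteq> c"
  proof -
    consider "norm x < norm y" | "norm y < norm x" using False by linarith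
    then have "0 < c \<and> norm x \<noteq> c \<and> norm y \<noteq> c"
    proof cases
      case 1
      then show ?thesis using le_less_trans[OF norm_ge_zero 1] by (simp add: c_def field_simps add_nonneg_pos)
    next
      case 2
      then show ?thesis using le_less_trans[OF norm_ge_zero 2] by (simp add: c_def field_simps add_pos_nonneg)
    qed
    then show "0 < c" "norm x \<noteq> c" "norm y \<noteq> c" by auto
  qed
  have "norm ((1/2) *\<^sub>R (x + y)) powr r \<le> c powr r"
    using r norm_triangle_ineq[of x y] by (intro powr_mono2) (auto simp: c_def)
  moreover have "2 * c powr r < norm x powr r + norm y powr r"
  proof -
    have "r * c powr (r - 1) * (norm x - c) + r * c powr (r - 1) * (norm y - c) = 0"
      by (simp add: c_def field_simps)
    then show ?thesis
      using powr_tangent_strict[OF r norm_ge_zero c(1,2)] powr_tangent_strict[OF r norm_ge_zero c(1,3)]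
      by linarith
  qed
  ultimately show ?thesis by simp
qed

text \<open>A compactness substitute for Clarkson's inequalities that treats all r > 1 at once: the
  constant is not explicit, but only its existence for each e matters.\<close>

lemma powr_uniformly_convex:
  fixes r e :: real
  assumes r: "1 < r" and e: "0 < e"
  obtains C where "0 \<le> C"
    "\<And>x y::'b::euclidean_space. norm (x - y) powr r \<le> e * (norm x powr r + norm y powr r)
       + C * ((norm x powr r + norm y powr r) / 2 - norm ((1/2) *\<^sub>R (x + y)) powr r)"
proof -
  define D :: "'b \<Rightarrow> 'b \<Rightarrow> real" where
    "D x y = (norm x powr r + norm y powr r) / 2 - norm ((1/2) *\<^sub>R (x + y)) powr r" for x y
  \<comment> \<open>Both sides are homogeneous of degree r, so pairs with total power 1 suffice. On
    this compact set of pairs that are not close to each other the defect \<open>D\<close> is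
    positive, hence bounded below by some d > 0.\<close>
  define S where "S = {z :: 'b \<times> 'b. norm (fst z) powr r + norm (snd z) powr r = 1 \<and> e \<le> norm (fst z - snd z) powr r}"
  have cont: "continuous_on UNIV (\<lambda>z::'b\<times>'b. norm (f z) powr r)" if "continuous_on UNIV f" for f :: "'b\<times>'b \<Rightarrow> 'b"
    using r that by (intro continuous_intros continuous_on_powr') auto
  have Dnn: "0 \<le> D x y" for x y
    using norm_powr_strict_midpoint[OF r, of x y] r
    by (cases "x = y") (auto simp: D_def simp flip: scaleR_2)
  have "closed S"
    unfolding S_def by (intro closed_Collect_conj closed_Collect_eq closed_Collect_le cont continuous_intros)
  moreover have "bounded S"
  proof (rule boundedI[of _ 2])
    fix z assume "z \<in> S"
    then have "norm (fst z) powr r \<le> 1 powr r" "norm (snd z) powr r \<le> 1 powr r"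
      using powr_ge_zero[of "norm (fst z)" r] powr_ge_zero[of "norm (snd z)" r] unfolding S_def mem_Collect_eq powr_one_eq_one by linarith+
    then have "norm (fst z) \<le> 1" "norm (snd z) \<le> 1"
      using r by (metis norm_ge_zero not_less powr_less_mono2 zero_le_one dual_order.strict_trans zero_less_one)+
    then show "norm z \<le> 2" using norm_Pair_le[of "fst z" "snd z"] by simp
  qed
  ultimately have "compact S" by (simp add: compact_eq_bounded_closed)
  have contD: "continuous_on S (\<lambda>z. D (fst z) (snd z))"
    unfolding D_def by (intro continuous_intros continuous_on_subset[OF cont]) auto
  have Spos: "0 < D (fst z) (snd z)" if "z \<in> S" for z
  proof -
    have "fst z \<noteq> snd z" using that e by (auto simp: S_def)
    then show ?thesis using norm_powr_strict_midpoint[OF r, of "fst z" "snd z"] by (simp add: D_def)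
  qed
  obtain d where d: "0 < d" "\<And>z. z \<in> S \<Longrightarrow> d \<le> D (fst z) (snd z)"
  proof (cases "S = {}")
    case True then show ?thesis using that[of 1] by simp
  next
    case False
    obtain z0 where "z0 \<in> S" "\<And>z. z \<in> S \<Longrightarrow> D (fst z0) (snd z0) \<le> D (fst z) (snd z)"
      using continuous_attains_inf[OF \<open>compact S\<close> False contD] by auto
    then show ?thesis using that Spos by blast
  qed
  have "norm (x - y) powr r \<le> e * (norm x powr r + norm y powr r) + 2 powr r / d * D x y" for x y
  proof (cases "norm (x - y) powr r \<le> e * (norm x powr r + norm y powr r)")
    case True
    then show ?thesis using Dnn[of x y] d(1) by (smt (verit) divide_nonneg_nonneg mult_nonneg_nonneg powr_ge_zero)
  next
    case False
    define T where "T = norm x powr r + norm y powr r"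
    have T: "0 < T"
    proof (rule ccontr)
      assume "\<not> 0 < T"
      then have "T = 0" by (simp add: T_def add_nonneg_nonneg antisym_conv2)
      then have "x = 0" "y = 0"
        by (auto simp: T_def add_nonneg_eq_0_iff)
      then show False using False by simp
    qed
    \<comment> \<open>The scaling factor with l^r = 1/T moves the pair into \<open>S\<close>. The
      lower bound d T for the defect and norm (x - y)^r at most 2^r T then give the constant
      2^r/d.\<close>
    define l where "l = T powr (- 1 / r)"
    have l: "0 < l" "l powr r = 1 / T" using T r powr_powr[of T "- 1 / r" r] powr_minus_divide[of T 1] by (simp_all add: l_def)
    have sc: "norm (l *\<^sub>R z) powr r = norm z powr r / T" for z :: 'b
      using l by (simp add: powr_mult)
    have DT: "D (l *\<^sub>R x) (l *\<^sub>R y) = D x y / T"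
    proof -
      have "(1/2) *\<^sub>R (l *\<^sub>R x + l *\<^sub>R y) = l *\<^sub>R ((1/2) *\<^sub>R (x + y))" by (simp add: algebra_simps)
      then show ?thesis unfolding D_def by (simp only: sc diff_divide_distrib add_divide_distrib) simp
    qed
    have "norm (l *\<^sub>R x - l *\<^sub>R y) powr r = norm (x - y) powr r / T"
      using sc[of "x - y"] by (simp add: algebra_simps)
    then have "(l *\<^sub>R x, l *\<^sub>R y) \<in> S"
      using False T by (simp add: S_def sc pos_le_divide_eq del: norm_scaleR flip: add_divide_distrib T_def)
    from d(2)[OF this] have "d * T \<le> D x y" using T by (simp add: DT pos_le_divide_eq)
    have "norm (x - y) powr r \<le> 2 powr r * T"
      unfolding T_def using r by (intro norm_diff_powr_le) auto
    also have "\<dots> \<le> 2 powr r * (D x y / d)"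
      using \<open>d * T \<le> D x y\<close> d(1) by (intro mult_left_mono) (auto simp: field_simps)
    finally show ?thesis using e T by (smt (verit) T_def mult_nonneg_nonneg times_divide_eq_left times_divide_eq_right)
  qed
  with d(1) show ?thesis
    using that[of "2 powr r / d"] unfolding D_def by simp
qed

text \<open>The formula remains correct at the origin: the inner product there is 0, and the
  remainder divided by norm h is norm h^(r-1), which tends to 0 because r > 1.\<close>

lemma has_derivative_norm_powr:
  fixes x :: "'b::real_inner"
  assumes r: "1 < r"
  shows "((\<lambda>x. norm x powr r) has_derivative (\<lambda>h. r * norm x powr (r - 2) * (x \<bullet> h))) (at x)"
proof (cases "x = 0")
  case True
  have "((\<lambda>h::'b. norm h powr (r - 1)) \<longlongrightarrow> norm (0::'b) powr (r - 1)) (at 0)"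
    using r by (intro tendsto_powr' tendsto_norm tendsto_ident_at) auto
  then have "((\<lambda>h::'b. norm h powr (r - 1)) \<longlongrightarrow> 0) (at 0)" by simp
  moreover have "norm h powr (r - 1) = norm (norm h powr r) / norm h" if "h \<noteq> 0" for h :: 'b
    using that by (simp add: powr_diff)
  ultimately have "((\<lambda>h::'b. norm (norm h powr r) / norm h) \<longlongrightarrow> 0) (at 0)"
    using Lim_transform_eventually[of "\<lambda>h::'b. norm h powr (r - 1)" 0 "at 0" "\<lambda>h. norm (norm h powr r) / norm h"]
    by (simp add: eventually_at_filter)
  then show ?thesis using True by (simp add: has_derivative_at)
next
  case False
  have "((\<lambda>x. norm x powr r) has_derivative (\<lambda>h. r * norm x powr (r - 1) * (h \<bullet> sgn x))) (at x)"
    using False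
    by (auto intro!: derivative_eq_intros has_derivative_norm simp: fun_eq_iff powr_diff)
  moreover have "r * norm x powr (r - 1) * (h \<bullet> sgn x) = r * norm x powr (r - 2) * (x \<bullet> h)" for h
  proof -
    have "norm x powr (r - 1) = norm x powr (r - 2) * norm x powr 1" by (subst powr_add[symmetric]) simp
    then show ?thesis using False by (simp add: sgn_div_norm inner_commute)
  qed
  ultimately show ?thesis by simp
qed

section \<open>Weighted Lebesgue spaces\<close>

locale weighted_Lp =
  fixes M :: "'x measure" and w :: "'x \<Rightarrow> real" and r :: real
  assumes w_measurable [measurable]: "w \<in> borel_measurable M"
    and w_pos: "\<And>x. x \<in> space M \<Longrightarrow> 0 < w x"
    and r_gt_1: "1 < r"
begin

definition Lw :: "('x \<Rightarrow> 'b::euclidean_space) \<Rightarrow> bool" where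
  "Lw F \<longleftrightarrow> F \<in> borel_measurable M \<and> integrable M (\<lambda>x. w x * norm (F x) powr r)"

text \<open>The r-th power of the weighted norm, without the root: in this form it is a summand of
  the energy and scales by the r-th power of the modulus of a scalar.\<close>

definition Nw :: "('x \<Rightarrow> 'b::euclidean_space) \<Rightarrow> real" where
  "Nw F = (\<integral>x. w x * norm (F x) powr r \<partial>M)"

lemma Lw_measurable [measurable_dest]: "Lw F \<Longrightarrow> F \<in> borel_measurable M"
  by (simp add: Lw_def)

lemma Lw_integrable: "Lw F \<Longrightarrow> integrable M (\<lambda>x. w x * norm (F x) powr r)"
  by (simp add: Lw_def)

lemma Nw_nonneg: "0 \<le> Nw F"
  unfolding Nw_def using w_pos by (intro integral_nonneg_AE AE_I2) (simp add: less_imp_le)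

lemma Lw_dominated:
  assumes "F \<in> borel_measurable M" "integrable M g"
    and "\<And>x. x \<in> space M \<Longrightarrow> w x * norm (F x) powr r \<le> g x"
  shows "Lw F"
  unfolding Lw_def
proof (intro conjI assms(1) Bochner_Integration.integrable_bound[OF assms(2)])
  show "(\<lambda>x. w x * norm (F x) powr r) \<in> borel_measurable M" using assms(1) by measurable
  show "AE x in M. norm (w x * norm (F x) powr r) \<le> norm (g x)"
    using assms(3) w_pos by (intro AE_I2) (smt (verit) mult_nonneg_nonneg powr_ge_zero real_norm_def)
qed

lemma Lw_scaleR:
  assumes "Lw F" shows "Lw (\<lambda>x. c *\<^sub>R F x)"
  using assms unfolding Lw_def by (auto simp: powr_mult mult.left_commute[of "w x" for x])

lemma Nw_scaleR: "Nw (\<lambda>x. c *\<^sub>R F x) = \<bar>c\<bar> powr r * Nw F"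
  unfolding Nw_def by (simp add: powr_mult mult.left_commute[of "w x" for x])

lemma Lw_add_Nw_add_le:
  assumes "Lw F" "Lw G"
  shows Lw_add: "Lw (\<lambda>x. F x + G x)" and Nw_add_le: "Nw (\<lambda>x. F x + G x) \<le> 2 powr r * (Nw F + Nw G)"
proof -
  have *: "w x * norm (F x + G x) powr r \<le> 2 powr r * (w x * norm (F x) powr r + w x * norm (G x) powr r)"
    if "x \<in> space M" for x
    using mult_left_mono[OF norm_add_powr_le[of r "F x" "G x"], of "w x"] w_pos[OF that] r_gt_1
    by (simp add: algebra_simps)
  have i: "integrable M (\<lambda>x. 2 powr r * (w x * norm (F x) powr r + w x * norm (G x) powr r))"
    using assms by (simp add: Lw_def)
  show L: "Lw (\<lambda>x. F x + G x)"
    using assms by (intro Lw_dominated[OF _ i *]) (auto simp: Lw_def)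
  have "Nw (\<lambda>x. F x + G x) \<le> (\<integral>x. 2 powr r * (w x * norm (F x) powr r + w x * norm (G x) powr r) \<partial>M)"
    unfolding Nw_def using * by (intro integral_mono[OF Lw_integrable[OF L] i]) auto
  then show "Nw (\<lambda>x. F x + G x) \<le> 2 powr r * (Nw F + Nw G)"
    using assms by (simp add: Nw_def Lw_def)
qed

lemma Lw_uminus: "Lw F \<Longrightarrow> Lw (\<lambda>x. - F x)"
  unfolding Lw_def by simp

lemma Nw_minus_commute: "Nw (\<lambda>x. F x - G x) = Nw (\<lambda>x. G x - F x)"
  by (simp add: Nw_def norm_minus_commute)

lemma Lw_diff: "Lw F \<Longrightarrow> Lw G \<Longrightarrow> Lw (\<lambda>x. F x - G x)"
  using Lw_add[OF _ Lw_uminus, of F G] by simp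

lemma Nw_diff_le: "Lw F \<Longrightarrow> Lw G \<Longrightarrow> Nw (\<lambda>x. F x - G x) \<le> 2 powr r * (Nw F + Nw G)"
  using Nw_add_le[OF _ Lw_uminus, of F G] by (simp add: Nw_def)

lemma Nw_triangle:
  assumes "Lw F" "Lw G" "Lw H"
  shows "Nw (\<lambda>x. F x - H x) \<le> 2 powr r * (Nw (\<lambda>x. F x - G x) + Nw (\<lambda>x. G x - H x))"
  using Nw_add_le[OF Lw_diff[OF assms(1,2)] Lw_diff[OF assms(2,3)]] by simp

lemma Nw_cong_AE:
  assumes "AE x in M. F x = G x" "F \<in> borel_measurable M" "G \<in> borel_measurable M"
  shows "Nw F = Nw G"
  unfolding Nw_def using assms by (intro integral_cong_AE) auto

lemma nn_integral_eq_Nw: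
  assumes "Lw F" shows "(\<integral>\<^sup>+x. ennreal (w x * norm (F x) powr r) \<partial>M) = ennreal (Nw F)"
  unfolding Nw_def using assms w_pos
  by (intro nn_integral_eq_integral) (auto simp: Lw_def less_imp_le intro!: AE_I2)

lemma LwI_nn_integral:
  assumes "F \<in> borel_measurable M" "(\<integral>\<^sup>+x. ennreal (w x * norm (F x) powr r) \<partial>M) \<le> ennreal K" "0 \<le> K"
  shows "Lw F" "Nw F \<le> K"
proof -
  have "integrable M (\<lambda>x. w x * norm (F x) powr r)"
    using assms w_pos
    by (intro integrableI_nonneg) (auto intro!: AE_I2 simp: less_imp_le intro: le_less_trans)
  then show L: "Lw F" using assms by (simp add: Lw_def)
  show "Nw F \<le> K" using assms(2,3) unfolding nn_integral_eq_Nw[OF L] by simp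
qed

text \<open>Integrated form of \<open>powr_perturbation\<close>: the relative error e' is chosen so
  that it costs at most e/2 on \<open>F0\<close>, and the distance d then pays for the constant
  \<open>C\<close> that e' requires.\<close>

lemma Nw_continuous:
  fixes F0 :: "'x \<Rightarrow> 'b::euclidean_space"
  assumes F0: "Lw F0" and e: "0 < e"
  obtains d where "0 < d" "\<And>F. Lw F \<Longrightarrow> Nw (\<lambda>x. F x - F0 x) < d \<Longrightarrow> \<bar>Nw F - Nw F0\<bar> < e"
proof -
  define e' where "e' = e / (2 * (Nw F0 + 1))"
  have e': "0 < e'" using e Nw_nonneg[of F0] by (simp add: e'_def)
  have *: "e' * Nw F0 \<le> e / 2" using e Nw_nonneg[of F0] by (simp add: e'_def field_simps)
  obtain C where C: "0 \<le> C" "\<And>x y::'b. \<bar>norm x powr r - norm y powr r\<bar> \<le> e' * norm y powr r + C * norm (x - y) powr r"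
    using powr_perturbation[of r e'] r_gt_1 e' by auto
  have "\<bar>Nw F - Nw F0\<bar> < e" if F: "Lw F" and d: "Nw (\<lambda>x. F x - F0 x) < e / (2 * (C + 1))" for F
  proof -
    note i = Lw_integrable[OF F] Lw_integrable[OF F0] Lw_integrable[OF Lw_diff[OF F F0]]
    have "\<bar>Nw F - Nw F0\<bar> = \<bar>\<integral>x. w x * norm (F x) powr r - w x * norm (F0 x) powr r \<partial>M\<bar>"
      unfolding Nw_def using i by simp
    also have "\<dots> \<le> (\<integral>x. \<bar>w x * norm (F x) powr r - w x * norm (F0 x) powr r\<bar> \<partial>M)"
      by (rule integral_abs_bound)
    also have "\<dots> \<le> (\<integral>x. e' * (w x * norm (F0 x) powr r) + C * (w x * norm (F x - F0 x) powr r) \<partial>M)"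
    proof (rule integral_mono)
      fix x assume "x \<in> space M"
      then have "w x * \<bar>norm (F x) powr r - norm (F0 x) powr r\<bar> \<le> w x * (e' * norm (F0 x) powr r + C * norm (F x - F0 x) powr r)"
        using w_pos by (intro mult_left_mono C) (auto simp: less_imp_le)
      then show "\<bar>w x * norm (F x) powr r - w x * norm (F0 x) powr r\<bar> \<le> e' * (w x * norm (F0 x) powr r) + C * (w x * norm (F x - F0 x) powr r)"
        using abs_mult_pos'[of "w x" "norm (F x) powr r - norm (F0 x) powr r"] w_pos[OF \<open>x \<in> space M\<close>]
        by (simp add: algebra_simps)
    qed (use i in auto)
    also have "\<dots> = e' * Nw F0 + C * Nw (\<lambda>x. F x - F0 x)"
      unfolding Nw_def using i by simp
    also have "C * Nw (\<lambda>x. F x - F0 x) \<le> C * (e / (2 * (C + 1)))"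
      using d C by (intro mult_left_mono) auto
    also have "\<dots> < e / 2" using e C by (simp add: field_simps)
    finally show ?thesis using * by simp
  qed
  then show ?thesis using that[of "e / (2 * (C + 1))"] e C(1) by simp
qed

lemma Nw_tendsto:
  assumes "\<And>n. Lw (F n)" "Lw G" "(\<lambda>n. Nw (\<lambda>x. F n x - G x)) \<longlonglongrightarrow> 0"
  shows "(\<lambda>n. Nw (F n)) \<longlonglongrightarrow> Nw G"
proof (rule tendstoI)
  fix e :: real assume "0 < e"
  then obtain d where d: "0 < d" "\<And>F. Lw F \<Longrightarrow> Nw (\<lambda>x. F x - G x) < d \<Longrightarrow> \<bar>Nw F - Nw G\<bar> < e"
    using Nw_continuous[OF assms(2)] by metis
  show "\<forall>\<^sub>F n in sequentially. dist (Nw (F n)) (Nw G) < e"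
    using order_tendstoD(2)[OF assms(3) d(1)] by eventually_elim (simp add: d assms(1) dist_real_def)
qed

definition Cauchy_Nw :: "(nat \<Rightarrow> 'x \<Rightarrow> 'b::euclidean_space) \<Rightarrow> bool" where
  "Cauchy_Nw F \<longleftrightarrow> (\<forall>e>0. \<exists>k. \<forall>m\<ge>k. \<forall>n\<ge>k. Nw (\<lambda>x. F m x - F n x) < e)"

lemma Cauchy_Nw_midpoint:
  fixes F :: "nat \<Rightarrow> 'x \<Rightarrow> 'b::euclidean_space"
  assumes L: "\<And>n. Lw (F n)" and K: "\<And>n. Nw (F n) \<le> K"
    and mid: "\<And>e. 0 < e \<Longrightarrow> \<exists>k. \<forall>m\<ge>k. \<forall>n\<ge>k. (Nw (F m) + Nw (F n)) / 2 - Nw (\<lambda>x. (1/2) *\<^sub>R (F m x + F n x)) < e"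
  shows "Cauchy_Nw F"
  unfolding Cauchy_Nw_def
proof (intro allI impI)
  fix e :: real assume e: "0 < e"
  have K0: "0 \<le> K" using K[of 0] Nw_nonneg[of "F 0"] by simp
  define e' where "e' = e / (4 * (K + 1))"
  have e': "0 < e'" "e' * (2 * K) \<le> e / 2" using e K0 by (simp_all add: e'_def field_simps)
  obtain C where C: "0 \<le> C" "\<And>x y::'b. norm (x - y) powr r \<le> e' * (norm x powr r + norm y powr r)
       + C * ((norm x powr r + norm y powr r) / 2 - norm ((1/2) *\<^sub>R (x + y)) powr r)"
    using powr_uniformly_convex[OF r_gt_1 e'(1)] by metis
  obtain k where k: "\<And>m n. k \<le> m \<Longrightarrow> k \<le> n \<Longrightarrow>
      (Nw (F m) + Nw (F n)) / 2 - Nw (\<lambda>x. (1/2) *\<^sub>R (F m x + F n x)) < e / (2 * (C + 1))"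
    using mid[of "e / (2 * (C + 1))"] e C(1) by (meson add_nonneg_pos divide_pos_pos mult_pos_pos zero_less_numeral zero_less_one)
  have "Nw (\<lambda>x. F m x - F n x) < e" if mn: "k \<le> m" "k \<le> n" for m n
  proof -
    note Lm = Lw_scaleR[OF Lw_add[OF L[of m] L[of n]], of "1/2"]
    note i = Lw_integrable[OF L[of m]] Lw_integrable[OF L[of n]] Lw_integrable[OF Lw_diff[OF L[of m] L[of n]]]
       Lw_integrable[OF Lm]
    have "Nw (\<lambda>x. F m x - F n x) \<le> (\<integral>x. e' * (w x * norm (F m x) powr r + w x * norm (F n x) powr r)
       + C * ((w x * norm (F m x) powr r + w x * norm (F n x) powr r) / 2 - w x * norm ((1/2) *\<^sub>R (F m x + F n x)) powr r) \<partial>M)"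
      unfolding Nw_def
    proof (rule integral_mono)
      fix x assume "x \<in> space M"
      then show "w x * norm (F m x - F n x) powr r \<le> e' * (w x * norm (F m x) powr r + w x * norm (F n x) powr r)
       + C * ((w x * norm (F m x) powr r + w x * norm (F n x) powr r) / 2 - w x * norm ((1/2) *\<^sub>R (F m x + F n x)) powr r)"
        using mult_left_mono[OF C(2)[of "F m x" "F n x"], of "w x"] w_pos by (simp add: algebra_simps less_imp_le)
    qed (use i in \<open>auto intro!: integrable_add integrable_diff integrable_mult_right integrable_divide\<close>)
    also have "\<dots> = e' * (Nw (F m) + Nw (F n)) + C * ((Nw (F m) + Nw (F n)) / 2 - Nw (\<lambda>x. (1/2) *\<^sub>R (F m x + F n x)))"
      unfolding Nw_def using i by (simp del: norm_scaleR)
    also have "e' * (Nw (F m) + Nw (F n)) \<le> e' * (2 * K)"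
      using K[of m] K[of n] e' by (intro mult_left_mono) auto
    also have "C * ((Nw (F m) + Nw (F n)) / 2 - Nw (\<lambda>x. (1/2) *\<^sub>R (F m x + F n x))) \<le> C * (e / (2 * (C + 1)))"
      using k[OF mn] C by (intro mult_left_mono) auto
    also have "\<dots> < e / 2" using e C by (simp add: field_simps)
    finally show ?thesis using e' by simp
  qed
  then show "\<exists>k. \<forall>m\<ge>k. \<forall>n\<ge>k. Nw (\<lambda>x. F m x - F n x) < e" by blast
qed

text \<open>Fatou's lemma is applied to integrals in [0,\<infinity>], so that integrability of the
  limit is obtained together with the bound.\<close>

lemma Lw_Fatou:
  assumes L: "\<And>n. Lw (F n)" and K: "\<And>n. Nw (F n) \<le> K"
    and G: "G \<in> borel_measurable M" and lim: "AE x in M. (\<lambda>n. F n x) \<longlonglongrightarrow> G x"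
  shows "Lw G" "Nw G \<le> K"
proof -
  have K0: "0 \<le> K" using K[of 0] Nw_nonneg[of "F 0"] by simp
  have "(\<integral>\<^sup>+x. ennreal (w x * norm (G x) powr r) \<partial>M) = (\<integral>\<^sup>+x. liminf (\<lambda>n. ennreal (w x * norm (F n x) powr r)) \<partial>M)"
    using lim
  proof (intro nn_integral_cong_AE, eventually_elim)
    case (elim x)
    have "(\<lambda>n. ennreal (w x * norm (F n x) powr r)) \<longlonglongrightarrow> ennreal (w x * norm (G x) powr r)"
      using elim r_gt_1 by (intro tendsto_ennrealI tendsto_mult tendsto_const tendsto_powr' tendsto_norm) auto
    then show ?case by (rule lim_imp_Liminf[symmetric, rotated]) simp
  qed
  also have "\<dots> \<le> liminf (\<lambda>n. \<integral>\<^sup>+x. ennreal (w x * norm (F n x) powr r) \<partial>M)"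
    using Lw_measurable[OF L] by (intro nn_integral_liminf) measurable
  also have "\<dots> = liminf (\<lambda>n. ennreal (Nw (F n)))" by (simp add: nn_integral_eq_Nw[OF L])
  also have "\<dots> \<le> liminf (\<lambda>n. ennreal K)" using K by (intro Liminf_mono always_eventually) (auto intro: ennreal_leI)
  also have "\<dots> = ennreal K" by (simp add: Liminf_const)
  finally show "Lw G" "Nw G \<le> K" using LwI_nn_integral[OF G _ K0] by auto
qed

text \<open>The Riesz-Fischer argument: along a subsequence with rapidly decreasing increments the
  telescoping series converges almost everywhere. Membership of the limit is left to
  \<open>Cauchy_Nw_tendsto\<close>.\<close>

lemma Cauchy_Nw_AE_subseq:
  assumes L: "\<And>n. Lw (F n)" and C: "Cauchy_Nw F"
  obtains \<sigma> G where "strict_mono \<sigma>" "G \<in> borel_measurable M" "AE x in M. (\<lambda>n. F (\<sigma> n) x) \<longlonglongrightarrow> G x"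
proof -
  \<comment> \<open>Small enough that the integrals of the increments remain summable, bounded by
    (1/2)^k, after division by the r-th power of (1/2)^k.\<close>
  define c where "c k = (1/2) ^ k * ((1/2) ^ k) powr r" for k :: nat
  have c: "0 < c k" for k by (simp add: c_def)
  from C have "\<exists>k. \<forall>m\<ge>k. \<forall>n\<ge>k. Nw (\<lambda>x. F m x - F n x) < c j" for j
    using c unfolding Cauchy_Nw_def by blast
  then obtain K where K: "\<And>j m n. K j \<le> m \<Longrightarrow> K j \<le> n \<Longrightarrow> Nw (\<lambda>x. F m x - F n x) < c j" by metis
  \<comment> \<open>The maximum with \<open>Suc i\<close> makes the sequence strictly increasing;
    the maximum with \<open>K (Suc j)\<close> puts it beyond the threshold that belongs to
    \<open>c (Suc j)\<close>.\<close>
  define \<sigma> where "\<sigma> = rec_nat (K 0) (\<lambda>j i. max (Suc i) (K (Suc j)))"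
  have \<sigma>: "\<sigma> j < \<sigma> (Suc j)" "K j \<le> \<sigma> j" for j by (simp add: \<sigma>_def) (cases j; simp add: \<sigma>_def)
  have mono: "strict_mono \<sigma>" using \<sigma>(1) by (simp add: strict_mono_Suc_iff)
  define D where "D j x = F (\<sigma> (Suc j)) x - F (\<sigma> j) x" for j x
  have LD: "Lw (D j)" for j unfolding D_def[abs_def] by (intro Lw_diff L)
  have [measurable]: "F j \<in> borel_measurable M" "D j \<in> borel_measurable M" for j using L LD by (auto simp: Lw_def)
  have ND: "Nw (D j) \<le> c j" for j
    unfolding D_def[abs_def] using K[of j "\<sigma> (Suc j)" "\<sigma> j"] \<sigma>[of j] by (intro less_imp_le) simp
  have "(\<integral>\<^sup>+x. (\<Sum>j. ennreal (w x * norm (D j x) powr r / ((1/2) ^ j) powr r)) \<partial>M)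
      = (\<Sum>j. \<integral>\<^sup>+x. ennreal (w x * norm (D j x) powr r / ((1/2) ^ j) powr r) \<partial>M)"
    by (intro nn_integral_suminf) measurable
  also have "\<dots> \<le> (\<Sum>j. ennreal ((1/2) ^ j))"
  proof (intro suminf_le summableI)
    fix j
    have "(\<integral>\<^sup>+x. ennreal (w x * norm (D j x) powr r / ((1/2) ^ j) powr r) \<partial>M)
       = (\<integral>\<^sup>+x. ennreal (1 / ((1/2) ^ j) powr r) * ennreal (w x * norm (D j x) powr r) \<partial>M)"
      using w_pos by (intro nn_integral_cong) (simp add: ennreal_mult'[symmetric] less_imp_le)
    also have "\<dots> = ennreal (1 / ((1/2) ^ j) powr r * Nw (D j))"
      by (subst nn_integral_cmult) (auto simp: nn_integral_eq_Nw[OF LD] ennreal_mult'[symmetric])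
    also have "\<dots> \<le> ennreal ((1/2) ^ j)"
      using ND[of j] by (intro ennreal_leI) (simp add: c_def field_simps)
    finally show "(\<integral>\<^sup>+x. ennreal (w x * norm (D j x) powr r / ((1/2) ^ j) powr r) \<partial>M) \<le> ennreal ((1/2) ^ j)" .
  qed
  also have "\<dots> = ennreal (\<Sum>j. (1/2) ^ j)" by (intro suminf_ennreal2) auto
  finally have "(\<integral>\<^sup>+x. (\<Sum>j. ennreal (w x * norm (D j x) powr r / ((1/2) ^ j) powr r)) \<partial>M) \<noteq> \<infinity>"
    by (auto simp: top_unique)
  then have "AE x in M. (\<Sum>j. ennreal (w x * norm (D j x) powr r / ((1/2) ^ j) powr r)) \<noteq> \<infinity>"
    by (intro nn_integral_PInf_AE) auto
  then have conv: "AE x in M. convergent (\<lambda>n. F (\<sigma> n) x)"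
    using AE_space
  proof eventually_elim
    case (elim x)
    then have w: "0 < w x" by (simp add: w_pos)
    define z where "z j = w x * norm (D j x) powr r / ((1/2) ^ j) powr r" for j
    have z0: "0 \<le> z j" for j using w by (simp add: z_def)
    have "summable z" using elim(1) z0 unfolding z_def by (intro summable_suminf_not_top) auto
    then have "z \<longlonglongrightarrow> 0" by (rule summable_LIMSEQ_zero)
    then have "\<forall>\<^sub>F j in sequentially. z j < w x" by (rule order_tendstoD(2)) (rule w)
    \<comment> \<open>At almost every point the summable terms \<open>z j\<close> eventually drop
      below the positive number \<open>w x\<close>, which says exactly that the increment is below
      (1/2)^j.\<close>
    then have "\<forall>\<^sub>F j in sequentially. norm (D j x) \<le> (1/2) ^ j"
    proof eventually_elim
      case (elim j)
      then have "norm (D j x) powr r < ((1/2) ^ j) powr r" using w by (simp add: z_def field_simps)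
      then show ?case using r_gt_1
        by (metis less_eq_real_def not_less powr_less_mono2 zero_le_power zero_le_divide_1_iff zero_le_numeral less_trans zero_less_one)
    qed
    then have "summable (\<lambda>j. D j x)"
      by (rule summable_comparison_test_ev) (simp add: summable_geometric)
    then have "(\<lambda>n. \<Sum>j<n. D j x) \<longlonglongrightarrow> (\<Sum>j. D j x)" by (rule summable_LIMSEQ)
    moreover have "(\<Sum>j<n. D j x) = F (\<sigma> n) x - F (\<sigma> 0) x" for n
      unfolding D_def by (rule sum_lessThan_telescope)
    ultimately have "(\<lambda>n. (F (\<sigma> n) x - F (\<sigma> 0) x) + F (\<sigma> 0) x) \<longlonglongrightarrow> (\<Sum>j. D j x) + F (\<sigma> 0) x"
      by (intro tendsto_add tendsto_const) simp
    then show ?case by (auto simp: convergent_def)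
  qed
  define G where "G x = lim (\<lambda>n. F (\<sigma> n) x)" for x
  have "G \<in> borel_measurable M" unfolding G_def[abs_def] by (rule borel_measurable_lim_metric) measurable
  moreover have "AE x in M. (\<lambda>n. F (\<sigma> n) x) \<longlonglongrightarrow> G x"
    using conv by eventually_elim (simp add: G_def convergent_LIMSEQ_iff)
  ultimately show ?thesis using mono that by blast
qed

text \<open>Fatou's lemma in the second index, with the first fixed, upgrades almost everywhere
  convergence of a subsequence to norm convergence of the whole sequence. The limit is prescribed by
  its pointwise values, so one u can serve as the limit for several weights.\<close>

lemma Cauchy_Nw_tendsto:
  assumes L: "\<And>n. Lw (F n)" and C: "Cauchy_Nw F"
    and \<sigma>: "strict_mono \<sigma>" and G: "G \<in> borel_measurable M" and lim: "AE x in M. (\<lambda>n. F (\<sigma> n) x) \<longlonglongrightarrow> G x"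
  shows "Lw G" "(\<lambda>n. Nw (\<lambda>x. F n x - G x)) \<longlonglongrightarrow> 0"
proof -
  have *: "\<exists>k. \<forall>n\<ge>k. Lw (\<lambda>x. F n x - G x) \<and> Nw (\<lambda>x. F n x - G x) \<le> e" if "0 < e" for e
  proof -
    obtain k where k: "\<And>m n. k \<le> m \<Longrightarrow> k \<le> n \<Longrightarrow> Nw (\<lambda>x. F m x - F n x) < e"
      using C \<open>0 < e\<close> unfolding Cauchy_Nw_def by metis
    have "Lw (\<lambda>x. F n x - G x) \<and> Nw (\<lambda>x. F n x - G x) \<le> e" if n: "k \<le> n" for n
    proof -
      have "k \<le> \<sigma> (j + k)" for j using seq_suble[OF \<sigma>, of "j + k"] by simp
      then have "Nw (\<lambda>x. F n x - F (\<sigma> (j + k)) x) \<le> e" for j using k[OF n] by (simp add: less_imp_le)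
      moreover have "AE x in M. (\<lambda>j. F n x - F (\<sigma> (j + k)) x) \<longlonglongrightarrow> F n x - G x"
        using lim by eventually_elim (rule tendsto_diff[OF tendsto_const], rule LIMSEQ_ignore_initial_segment)
      ultimately show ?thesis using Lw_Fatou[of "\<lambda>j x. F n x - F (\<sigma> (j + k)) x" e "\<lambda>x. F n x - G x"]
          Lw_diff[OF L L] borel_measurable_diff[OF Lw_measurable[OF L] G] by blast
    qed
    then show ?thesis by blast
  qed
  from *[of 1] obtain n where "Lw (\<lambda>x. F n x - G x)" by auto
  from Lw_diff[OF L[of n] this] show "Lw G" by simp
  show "(\<lambda>n. Nw (\<lambda>x. F n x - G x)) \<longlonglongrightarrow> 0"
  proof (rule LIMSEQ_I)
    fix e :: real assume "0 < e"
    then show "\<exists>k. \<forall>n\<ge>k. norm (Nw (\<lambda>x. F n x - G x) - 0) < e"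
      using *[of "e/2"] Nw_nonneg by (simp, smt (verit) field_sum_of_halves)
  qed
qed

lemma Nw_tendsto_imp_Cauchy:
  assumes L: "\<And>n. Lw (F n)" "Lw G" and lim: "(\<lambda>n. Nw (\<lambda>x. F n x - G x)) \<longlonglongrightarrow> 0"
  shows "Cauchy_Nw F"
  unfolding Cauchy_Nw_def
proof (intro allI impI)
  fix e :: real assume e: "0 < e"
  define d where "d = e / (2 * 2 powr r)"
  have "0 < d" using e by (simp add: d_def)
  then obtain k where k: "\<And>n. k \<le> n \<Longrightarrow> Nw (\<lambda>x. F n x - G x) < d"
    using order_tendstoD(2)[OF lim] unfolding eventually_sequentially by blast
  have "Nw (\<lambda>x. F m x - F n x) < e" if "k \<le> m" "k \<le> n" for m n
  proof -
    have "Nw (\<lambda>x. F m x - F n x) \<le> 2 powr r * (Nw (\<lambda>x. F m x - G x) + Nw (\<lambda>x. G x - F n x))"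
      by (intro Nw_triangle L)
    also have "\<dots> < 2 powr r * (d + d)"
      using k that by (intro mult_strict_left_mono add_strict_mono) (auto simp: Nw_minus_commute[of G])
    finally show ?thesis using e by (simp add: d_def)
  qed
  then show "\<exists>k. \<forall>m\<ge>k. \<forall>n\<ge>k. Nw (\<lambda>x. F m x - F n x) < e" by blast
qed

text \<open>Differentiation under the integral along the sequence 1/(n+1). One-sided quotients
  suffice for the Euler-Lagrange equation because the direction H may be replaced by its
  negative.\<close>

lemma Nw_directional_derivative:
  assumes F: "Lw F" and H: "Lw H"
  shows "integrable M (\<lambda>x. w x * (norm (F x) powr (r - 2) * (F x \<bullet> H x)))" (is ?I)
    and "(\<lambda>n. (Nw (\<lambda>x. F x + (1 / real (Suc n)) *\<^sub>R H x) - Nw F) / (1 / real (Suc n)))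
       \<longlonglongrightarrow> r * (\<integral>x. w x * (norm (F x) powr (r - 2) * (F x \<bullet> H x)) \<partial>M)" (is ?T)
proof -
  have [measurable]: "F \<in> borel_measurable M" "H \<in> borel_measurable M" using F H by (auto simp: Lw_def)
  define t where "t n = 1 / real (Suc n)" for n
  have t: "0 < t n" "t n \<le> 1" for n by (auto simp: t_def)
  define q where "q n x = (norm (F x + t n *\<^sub>R H x) powr r - norm (F x) powr r) / t n" for n x
  define q' where "q' x = r * (norm (F x) powr (r - 2) * (F x \<bullet> H x))" for x
  \<comment> \<open>An integrable majorant of all difference quotients: \<open>powr_diff_le\<close>
    bounds them by r m^r with m = norm F + norm H, using t at most 1.\<close>
  define g where "g x = r * (2 powr r * (norm (F x) powr r + norm (H x) powr r))" for x
  have lim: "(\<lambda>n. w x * q n x) \<longlonglongrightarrow> w x * q' x" for x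
  proof -
    have "((\<lambda>h. norm (F x + h *\<^sub>R H x) powr r) has_derivative (\<lambda>h. r * norm (F x) powr (r - 2) * (F x \<bullet> (h *\<^sub>R H x)))) (at 0)"
      by (rule has_derivative_compose[of "\<lambda>h. F x + h *\<^sub>R H x" "\<lambda>h. h *\<^sub>R H x"])
         (auto intro!: derivative_eq_intros has_derivative_norm_powr[OF r_gt_1, THEN has_derivative_eq_rhs])
    moreover have "(\<lambda>h. r * norm (F x) powr (r - 2) * (F x \<bullet> (h *\<^sub>R H x))) = (*) (q' x)"
      by (auto simp: q'_def)
    ultimately have "((\<lambda>h. norm (F x + h *\<^sub>R H x) powr r) has_real_derivative q' x) (at 0)"
      by (simp add: has_field_derivative_def)
    then have "((\<lambda>h. (norm (F x + h *\<^sub>R H x) powr r - norm (F x) powr r) / h) \<longlongrightarrow> q' x) (at 0)"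
      by (simp add: DERIV_def)
    moreover have "filterlim t (at 0) sequentially"
      unfolding filterlim_at
    proof
      have "t = (\<lambda>n. 1 / real (Suc n))" by (simp add: t_def fun_eq_iff)
      then show "t \<longlonglongrightarrow> 0" using LIMSEQ_Suc[OF lim_1_over_n] by simp
      show "\<forall>\<^sub>F n in sequentially. t n \<in> UNIV \<and> t n \<noteq> 0" using t(1) by (simp add: less_imp_neq[symmetric])
    qed
    ultimately have "(\<lambda>n. q n x) \<longlonglongrightarrow> q' x" unfolding q_def by (rule filterlim_compose)
    then show ?thesis by (intro tendsto_intros)
  qed
  have bound: "norm (w x * q n x) \<le> w x * g x" if "x \<in> space M" for n x
  proof -
    define m where "m = norm (F x) + norm (H x)"
    have th: "t n * norm (H x) \<le> norm (H x)" using t[of n] by (intro mult_left_le_one_le) (auto simp: less_imp_le)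
    have n1: "norm (F x + t n *\<^sub>R H x) \<le> m"
      using norm_triangle_ineq[of "F x" "t n *\<^sub>R H x"] th t(1)[of n] by (simp add: m_def)
    have n2: "\<bar>norm (F x + t n *\<^sub>R H x) - norm (F x)\<bar> \<le> t n * norm (H x)"
      using norm_triangle_ineq3[of "F x + t n *\<^sub>R H x" "F x"] t(1)[of n] by simp
    have "\<bar>norm (F x + t n *\<^sub>R H x) powr r - norm (F x) powr r\<bar>
        \<le> r * max (norm (F x + t n *\<^sub>R H x)) (norm (F x)) powr (r - 1) * \<bar>norm (F x + t n *\<^sub>R H x) - norm (F x)\<bar>"
      using r_gt_1 by (intro powr_diff_le) auto
    also have "\<dots> \<le> r * m powr (r - 1) * (t n * norm (H x))"
      using r_gt_1 n1 n2 by (intro mult_mono powr_mono2) (auto simp: m_def le_max_iff_disj)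
    also have "\<dots> \<le> r * m powr (r - 1) * (t n * m)"
      using r_gt_1 t(1)[of n] by (intro mult_left_mono) (auto simp: m_def)
    also have "\<dots> = t n * (r * m powr r)"
    proof -
      have "m powr r = m powr (r - 1) * m powr 1" by (subst powr_add[symmetric]) simp
      then show ?thesis by (simp add: m_def)
    qed
    also have "\<dots> \<le> t n * g x"
      using r_gt_1 t(1)[of n] unfolding g_def m_def by (intro mult_left_mono powr_add_le) auto
    finally have "\<bar>q n x\<bar> \<le> g x" using t(1)[of n] by (simp add: q_def field_simps)
    then show ?thesis using w_pos[OF that] by (simp add: abs_mult)
  qed
  have ig: "integrable M (\<lambda>x. w x * g x)"
  proof -
    have "(\<lambda>x. w x * g x) = (\<lambda>x. (r * 2 powr r) * (w x * norm (F x) powr r) + (r * 2 powr r) * (w x * norm (H x) powr r))"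
      by (simp add: fun_eq_iff g_def algebra_simps)
    then show ?thesis using Lw_integrable[OF F] Lw_integrable[OF H] by (auto simp del: norm_scaleR)
  qed
  have meas: "(\<lambda>x. w x * q' x) \<in> borel_measurable M" "(\<lambda>x. w x * q n x) \<in> borel_measurable M" for n
    unfolding q'_def q_def by measurable
  have i1: "integrable M (\<lambda>x. w x * q' x)" and T1: "(\<lambda>n. \<integral>x. w x * q n x \<partial>M) \<longlonglongrightarrow> (\<integral>x. w x * q' x \<partial>M)"
    using integrable_dominated_convergence[OF meas(1) meas(2) ig, of "\<lambda>n. n"]
      integral_dominated_convergence[OF meas(1) meas(2) ig, of "\<lambda>n. n"] lim bound by (auto intro!: AE_I2)
  have eq: "w x * q' x = r * (w x * (norm (F x) powr (r - 2) * (F x \<bullet> H x)))" for x by (simp add: q'_def)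
  show ?I using i1 r_gt_1 unfolding eq by simp
  have "(\<integral>x. w x * q n x \<partial>M) = (Nw (\<lambda>x. F x + t n *\<^sub>R H x) - Nw F) / t n" for n
  proof -
    have "(\<integral>x. w x * q n x \<partial>M) = (\<integral>x. (w x * norm (F x + t n *\<^sub>R H x) powr r - w x * norm (F x) powr r) / t n \<partial>M)"
      by (intro Bochner_Integration.integral_cong) (auto simp: q_def algebra_simps)
    then show ?thesis
      using Lw_integrable[OF F] Lw_integrable[OF Lw_add[OF F Lw_scaleR[OF H]]] by (simp add: Nw_def)
  qed
  with T1 show ?T unfolding eq by (simp add: t_def)
qed

end

section \<open>The Sobolev-Poincare inequality on convex sets\<close>

text \<open>The tangent of the power function at the mean of \<open>Z\<close> is integrated; its
  linear part has integral 0.\<close>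

lemma jensen_powr:
  fixes Z :: "'x \<Rightarrow> real"
  assumes M: "finite_measure M" "emeasure M (space M) = 1"
    and Z: "integrable M Z" "integrable M (\<lambda>x. Z x powr r)" "AE x in M. 0 \<le> Z x" and r: "1 \<le> r"
  shows "(\<integral>x. Z x \<partial>M) powr r \<le> (\<integral>x. Z x powr r \<partial>M)"
proof -
  interpret finite_measure M by fact
  have one: "measure M (space M) = 1" using M(2) by (simp add: measure_def)
  define c where "c = (\<integral>x. Z x \<partial>M)"
  have c: "0 \<le> c" unfolding c_def using Z(3) by (intro integral_nonneg_AE)
  have "(\<integral>x. c powr r + r * c powr (r - 1) * (Z x - c) \<partial>M) \<le> (\<integral>x. Z x powr r \<partial>M)"
    using Z r c by (intro integral_mono_AE) (auto intro: powr_tangent)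
  moreover have "(\<integral>x. c powr r + r * c powr (r - 1) * (Z x - c) \<partial>M) = c powr r"
    using Z(1) by (simp add: one flip: c_def)
  ultimately show ?thesis by (simp add: c_def)
qed

locale convex_cell =
  fixes Q :: "'a::euclidean_space set"
  assumes convex_Q: "convex Q" and Q_borel [measurable]: "Q \<in> sets borel"
    and bounded_Q: "bounded Q" and Q_pos: "emeasure lborel Q \<noteq> 0"
begin

text \<open>Averages over the cell, as a probability measure on the whole space: Jensen's inequality
  applies as it stands, and the Sobolev-Poincare constant depends on the cell only through its
  diameter.\<close>

definition \<mu> :: "'a measure" where "\<mu> = uniform_measure lborel Q"

lemma emeasure_Q_finite: "emeasure lborel Q \<noteq> \<infinity>"
  using emeasure_bounded_finite[OF bounded_Q] by (simp add: top.not_eq_extremum)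

lemma sets_\<mu> [measurable_cong, simp]: "sets \<mu> = sets borel" and space_\<mu> [simp]: "space \<mu> = UNIV"
  by (simp_all add: \<mu>_def)

lemma emeasure_\<mu>: "emeasure \<mu> UNIV = 1"
  unfolding \<mu>_def using Q_pos emeasure_Q_finite
  by (subst emeasure_uniform_measure) (auto simp: top.not_eq_extremum zero_less_iff_neq_zero intro!: ennreal_divide_self)

lemma finite_measure_\<mu>: "finite_measure \<mu>"
  by (rule finite_measureI) (simp add: emeasure_\<mu>)

sublocale \<mu>: finite_measure \<mu> by (rule finite_measure_\<mu>)

lemma measure_\<mu> [simp]: "measure \<mu> UNIV = 1"
  by (simp add: measure_def emeasure_\<mu>)

lemma AE_\<mu>: "AE x in \<mu>. x \<in> Q"
  unfolding \<mu>_def by (subst AE_uniform_measure) (use Q_pos emeasure_Q_finite in \<open>auto simp: top.not_eq_extremum zero_less_iff_neq_zero\<close>)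

lemma integrable_\<mu>:
  fixes F :: "'a \<Rightarrow> real"
  assumes "F \<in> borel_measurable borel" "\<And>x. \<bar>F x\<bar> \<le> B"
  shows "integrable \<mu> F"
  using assms by (intro \<mu>.integrable_const_bound[of _ B]) auto

lemma nn_integral_\<mu>:
  assumes [measurable]: "F \<in> borel_measurable borel"
  shows "(\<integral>\<^sup>+x. F x \<partial>\<mu>) = (\<integral>\<^sup>+x. F x * indicator Q x \<partial>lborel) / emeasure lborel Q"
  unfolding \<mu>_def by (rule nn_integral_uniform_measure) measurable

text \<open>Convexity keeps x + c (y - x) in the cell, so the indicator may be moved to the new
  variable; the substitution has Jacobian c^N. The factor 1/c^N is the singularity that the curve
  parameter t^k has to compensate.\<close>

lemma nn_integral_\<mu>_affine:
  assumes [measurable]: "F \<in> borel_measurable borel" and x: "x \<in> Q" and c: "0 < c" "c \<le> 1"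
  shows "(\<integral>\<^sup>+y. F (x + c *\<^sub>R (y - x)) \<partial>\<mu>) \<le> ennreal (1 / c ^ DIM('a)) * (\<integral>\<^sup>+y. F y \<partial>\<mu>)"
proof -
  have Q: "x + c *\<^sub>R (y - x) \<in> Q" if "y \<in> Q" for y
  proof -
    have "x + c *\<^sub>R (y - x) = (1 - c) *\<^sub>R x + c *\<^sub>R y" by (simp add: algebra_simps)
    then show ?thesis using convexD_alt[OF convex_Q x that, of c] c by simp
  qed
  have "(\<integral>\<^sup>+y. F (x + c *\<^sub>R (y - x)) * indicator Q y \<partial>lborel)
      \<le> (\<integral>\<^sup>+y. F (x + c *\<^sub>R (y - x)) * indicator Q (x + c *\<^sub>R (y - x)) \<partial>lborel)"
    using Q by (intro nn_integral_mono) (auto simp: indicator_def)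
  also have "\<dots> = ennreal (1 / c ^ DIM('a)) * (\<integral>\<^sup>+y. F y * indicator Q y \<partial>lborel)"
  proof -
    have "(\<integral>\<^sup>+y. F y * indicator Q y \<partial>lborel)
       = (\<integral>\<^sup>+y. F y * indicator Q y \<partial>density (distr lborel borel (\<lambda>y. (x - c *\<^sub>R x) + c *\<^sub>R y)) (\<lambda>_. ennreal (\<bar>c\<bar> ^ DIM('a))))"
      using c by (subst lborel_affine[of c "x - c *\<^sub>R x"]) auto
    also have "\<dots> = ennreal (c ^ DIM('a)) * (\<integral>\<^sup>+y. F (x - c *\<^sub>R x + c *\<^sub>R y) * indicator Q (x - c *\<^sub>R x + c *\<^sub>R y) \<partial>lborel)"
      using c by (simp add: nn_integral_density nn_integral_distr nn_integral_cmult)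
    finally have *: "(\<integral>\<^sup>+y. F y * indicator Q y \<partial>lborel)
        = ennreal (c ^ DIM('a)) * (\<integral>\<^sup>+y. F (x + c *\<^sub>R (y - x)) * indicator Q (x + c *\<^sub>R (y - x)) \<partial>lborel)"
      by (simp add: algebra_simps)
    have "ennreal (1 / c ^ DIM('a)) * ennreal (c ^ DIM('a)) = 1"
      using c by (simp flip: ennreal_mult)
    then show ?thesis unfolding * by (simp flip: mult.assoc)
  qed
  finally have "(\<integral>\<^sup>+y. F (x + c *\<^sub>R (y - x)) * indicator Q y \<partial>lborel) / emeasure lborel Q
      \<le> ennreal (1 / c ^ DIM('a)) * (\<integral>\<^sup>+y. F y * indicator Q y \<partial>lborel) / emeasure lborel Q"
    by (rule divide_right_mono_ennreal)
  then show ?thesis by (simp add: nn_integral_\<mu> ennreal_times_divide)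
qed

lemma integral_\<mu>_affine:
  fixes F :: "'a \<Rightarrow> real"
  assumes [measurable]: "F \<in> borel_measurable borel" and B: "\<And>x. 0 \<le> F x" "\<And>x. F x \<le> B"
    and x: "x \<in> Q" and c: "0 < c" "c \<le> 1"
  shows "(\<integral>y. F (x + c *\<^sub>R (y - x)) \<partial>\<mu>) \<le> 1 / c ^ DIM('a) * (\<integral>y. F y \<partial>\<mu>)"
proof -
  have i: "integrable \<mu> (\<lambda>y. F (x + c *\<^sub>R (y - x)))" "integrable \<mu> F"
    using B by (auto intro!: integrable_\<mu>[of _ B])
  have "(\<integral>\<^sup>+y. ennreal (F (x + c *\<^sub>R (y - x))) \<partial>\<mu>) \<le> ennreal (1 / c ^ DIM('a)) * (\<integral>\<^sup>+y. ennreal (F y) \<partial>\<mu>)"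
    using x c by (intro nn_integral_\<mu>_affine) measurable
  then show ?thesis
    using i B c by (simp add: nn_integral_eq_integral flip: ennreal_mult)
qed

text \<open>After averaging in x as well, the singularity at c = 0 disappears: for c < 1/2 the roles
  of x and y are exchanged, which replaces c by 1 - c > 1/2.\<close>

lemma integral_\<mu>_\<mu>_affine:
  fixes F :: "'a \<Rightarrow> real"
  assumes F [measurable]: "F \<in> borel_measurable borel" and B: "\<And>x. 0 \<le> F x" "\<And>x. F x \<le> B"
    and c: "0 \<le> c" "c \<le> 1"
  shows "(\<integral>x. \<integral>y. F (x + c *\<^sub>R (y - x)) \<partial>\<mu> \<partial>\<mu>) \<le> 2 ^ DIM('a) * (\<integral>y. F y \<partial>\<mu>)"
proof -
  have half: "(\<integral>x. \<integral>y. F (x + c *\<^sub>R (y - x)) \<partial>\<mu> \<partial>\<mu>) \<le> 2 ^ DIM('a) * (\<integral>y. F y \<partial>\<mu>)"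
    if c: "1/2 \<le> c" "c \<le> 1" for c
  proof -
    have I: "0 \<le> (\<integral>y. F y \<partial>\<mu>)" using B by (intro integral_nonneg_AE) auto
    have "(\<integral>x. \<integral>y. F (x + c *\<^sub>R (y - x)) \<partial>\<mu> \<partial>\<mu>) \<le> (\<integral>x. 2 ^ DIM('a) * (\<integral>y. F y \<partial>\<mu>) \<partial>\<mu>)"
    proof (rule integral_mono_AE)
      have B': "\<bar>\<integral>y. F (x + c *\<^sub>R (y - x)) \<partial>\<mu>\<bar> \<le> B" for x
      proof -
        have "(\<integral>y. F (x + c *\<^sub>R (y - x)) \<partial>\<mu>) \<le> (\<integral>y. B \<partial>\<mu>)"
          using B order_trans[OF B] by (intro integral_mono integrable_\<mu>[of _ B]) auto
        moreover have "0 \<le> (\<integral>y. F (x + c *\<^sub>R (y - x)) \<partial>\<mu>)" using B by (intro integral_nonneg_AE) auto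
        ultimately show ?thesis by simp
      qed
      show "integrable \<mu> (\<lambda>x. \<integral>y. F (x + c *\<^sub>R (y - x)) \<partial>\<mu>)"
        by (rule integrable_\<mu>[OF _ B']) measurable
      show "AE x in \<mu>. (\<integral>y. F (x + c *\<^sub>R (y - x)) \<partial>\<mu>) \<le> 2 ^ DIM('a) * (\<integral>y. F y \<partial>\<mu>)"
        using AE_\<mu>
      proof eventually_elim
        case (elim x)
        have "(\<integral>y. F (x + c *\<^sub>R (y - x)) \<partial>\<mu>) \<le> 1 / c ^ DIM('a) * (\<integral>y. F y \<partial>\<mu>)"
          using elim c by (intro integral_\<mu>_affine[OF F B]) auto
        also have "1 / c ^ DIM('a) = (1 / c) ^ DIM('a)" by (simp add: power_one_over)
        also have "(1 / c) ^ DIM('a) * (\<integral>y. F y \<partial>\<mu>) \<le> 2 ^ DIM('a) * (\<integral>y. F y \<partial>\<mu>)"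
          using c I by (intro mult_right_mono power_mono) (auto simp: field_simps)
        finally show ?case .
      qed
    qed simp
    then show ?thesis by simp
  qed
  show ?thesis
  proof (cases "1/2 \<le> c")
    case True then show ?thesis using half c by simp
  next
    case False
    interpret P: pair_sigma_finite \<mu> \<mu> by standard
    interpret PF: finite_measure "\<mu> \<Otimes>\<^sub>M \<mu>" by (rule finite_measure_pair_measure) unfold_locales
    have "(\<integral>x. \<integral>y. F (x + c *\<^sub>R (y - x)) \<partial>\<mu> \<partial>\<mu>) = (\<integral>y. \<integral>x. F (x + c *\<^sub>R (y - x)) \<partial>\<mu> \<partial>\<mu>)"
      using B by (intro P.Fubini_integral[symmetric] PF.integrable_const_bound[of _ B]) auto
    also have "\<dots> = (\<integral>y. \<integral>x. F (y + (1 - c) *\<^sub>R (x - y)) \<partial>\<mu> \<partial>\<mu>)"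
      by (simp add: algebra_simps)
    also have "\<dots> \<le> 2 ^ DIM('a) * (\<integral>y. F y \<partial>\<mu>)" using False c by (intro half) auto
    finally show ?thesis .
  qed
qed

text \<open>The curve contributes t^(r(k-1)), while r/p - 1 powers of the averaged gradient cost
  t^(-kN(r/p-1)); the condition on k says that the product is at most 1. One power of the average is
  kept and integrated in x without any loss in t. For r = p the choice k = 1 is admissible and gives
  Poincare's inequality.\<close>

theorem sobolev_poincare:
  fixes f :: "'a \<Rightarrow> real" and g :: "'a \<Rightarrow> 'a"
  assumes f: "\<And>x. (f has_derivative (\<lambda>h. g x \<bullet> h)) (at x)"
    and fB: "\<And>x. \<bar>f x\<bar> \<le> Bf" and g: "continuous_on UNIV g" and gB: "\<And>x. norm (g x) \<le> B"
    and d: "\<And>x y. x \<in> Q \<Longrightarrow> y \<in> Q \<Longrightarrow> norm (y - x) \<le> d"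
    and p: "1 \<le> p" "p \<le> r" and k: "1 \<le> k" "real DIM('a) * (r / p - 1) * real k \<le> r * (real k - 1)"
  shows "(\<integral>x. \<bar>f x - (\<integral>y. f y \<partial>\<mu>)\<bar> powr r \<partial>\<mu>)
     \<le> 2 ^ DIM('a) * (real k * d) powr r * (\<integral>x. norm (g x) powr p \<partial>\<mu>) powr (r / p)"
proof -
  define \<nu> where "\<nu> = uniform_measure lborel {0..1::real}"
  interpret \<nu>: convex_cell "{0..1::real}" by unfold_locales auto
  have \<nu>: "\<nu>.\<mu> = \<nu>" by (simp add: \<nu>.\<mu>_def \<nu>_def)
  interpret \<nu>f: finite_measure \<nu> using \<nu>.finite_measure_\<mu> by (simp add: \<nu>)
  have [measurable_cong, simp]: "sets \<nu> = sets borel" and [simp]: "space \<nu> = UNIV" by (simp_all add: \<nu>_def)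
  have [simp]: "emeasure \<nu> UNIV = 1" using \<nu>.emeasure_\<mu> by (simp add: \<nu>)
  have AE_\<nu>: "AE t in \<nu>. t \<in> {0..1}" using \<nu>.AE_\<mu> unfolding \<nu> .
  have int_\<nu>: "(\<integral>t. h t \<partial>\<nu>) = (\<integral>t. indicator {0..1} t *\<^sub>R h t \<partial>lborel)" if "h \<in> borel_measurable borel" for h :: "real \<Rightarrow> real"
  proof -
    have "\<nu> = density lborel (\<lambda>t. ennreal (indicator {0..1} t))"
      unfolding \<nu>_def uniform_measure_def
      by (intro arg_cong2[where f=density]) (auto simp: indicator_def divide_ennreal_def)
    then show ?thesis using that by (simp add: integral_density)
  qed
  interpret P1: pair_sigma_finite \<nu> \<mu> by standard
  interpret PF1: finite_measure "\<nu> \<Otimes>\<^sub>M \<mu>" by (rule finite_measure_pair_measure) unfold_locales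
  have gm [measurable]: "g \<in> borel_measurable borel" using g by (rule borel_measurable_continuous_onI)
  have fc: "continuous_on UNIV f" using f by (meson has_derivative_continuous_on has_derivative_at_withinI)
  have fm [measurable]: "f \<in> borel_measurable borel" using fc by (rule borel_measurable_continuous_onI)
  have B: "0 \<le> B" using gB[of 0] norm_ge_zero order_trans by blast
  obtain x0 where "x0 \<in> Q" using Q_pos by fastforce
  then have d0: "0 \<le> d" using d[of x0 x0] by simp
  have r: "1 \<le> r" using p by simp
  \<comment> \<open>Clamping to [0,1] makes the curve and its speed bounded for every real t. The
    probability measure \<open>\<nu>\<close> lives on the whole line, and the integrability proofs
    use bounds that hold everywhere.\<close>
  define m :: "real \<Rightarrow> real" where "m t = max 0 (min 1 t)" for t
  have m: "0 \<le> m t" "m t \<le> 1" for t by (auto simp: m_def)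
  have mid: "m t = t" if "t \<in> {0..1}" for t using that by (auto simp: m_def)
  have [measurable]: "m \<in> borel_measurable borel" unfolding m_def[abs_def] by measurable
  define \<theta> where "\<theta> t = m t ^ k" for t
  have \<theta>: "0 \<le> \<theta> t" "\<theta> t \<le> 1" for t using m by (auto simp: \<theta>_def power_le_one)
  have [measurable]: "\<theta> \<in> borel_measurable borel" unfolding \<theta>_def[abs_def] by measurable
  define \<kappa> where "\<kappa> t = real k * m t ^ (k - 1) * d" for t
  have \<kappa>: "0 \<le> \<kappa> t" "\<kappa> t \<le> real k * d" for t
    using m d0 mult_right_mono[OF power_le_one[OF m], of "real k * d" t "k - 1"] by (auto simp: \<kappa>_def mult_ac)
  have [measurable]: "\<kappa> \<in> borel_measurable borel" unfolding \<kappa>_def[abs_def] by measurable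
  define z where "z t x y = x + \<theta> t *\<^sub>R (y - x)" for t :: real and x y :: 'a
  have [measurable]: "(\<lambda>(t, y). z t x y) \<in> borel \<Otimes>\<^sub>M borel \<rightarrow>\<^sub>M borel"
    "(\<lambda>(t, x). z t x y) \<in> borel \<Otimes>\<^sub>M borel \<rightarrow>\<^sub>M borel" "(\<lambda>y. z t x y) \<in> borel \<rightarrow>\<^sub>M borel" "(\<lambda>t. z t x y) \<in> borel \<rightarrow>\<^sub>M borel" 
    "(\<lambda>x. z (fst x) (fst (snd x)) (snd (snd x))) \<in> borel \<Otimes>\<^sub>M borel \<Otimes>\<^sub>M borel \<rightarrow>\<^sub>M borel" for x y t
    unfolding z_def by measurable
  define P where "P t x = (\<integral>y. norm (g (z t x y)) powr p \<partial>\<mu>)" for t x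
  define \<Gamma> where "\<Gamma> = (\<integral>y. norm (g y) powr p \<partial>\<mu>)"
  have gp: "norm (g x) powr p \<le> B powr p" for x using gB p by (intro powr_mono2) auto
  have P0: "0 \<le> P t x" for t x unfolding P_def by (intro integral_nonneg_AE) auto
  have \<Gamma>0: "0 \<le> \<Gamma>" unfolding \<Gamma>_def by (intro integral_nonneg_AE) auto
  have PB: "P t x \<le> B powr p" for t x
  proof -
    have "P t x \<le> (\<integral>y. B powr p \<partial>\<mu>)" unfolding P_def
      using gp by (intro integral_mono integrable_\<mu>[of _ "B powr p"]) auto
    then show ?thesis by simp
  qed
  have Pm [measurable]: "(\<lambda>(t, x). P t x) \<in> borel_measurable (borel \<Otimes>\<^sub>M borel)"
    unfolding P_def z_def by measurable
  have Pm1 [measurable]: "(\<lambda>t. P t x) \<in> borel_measurable borel" for x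
    unfolding P_def z_def by measurable
  have diff: "\<bar>f x - f y\<bar> \<le> (\<integral>t. \<kappa> t * norm (g (z t x y)) \<partial>\<nu>)" if xy: "x \<in> Q" "y \<in> Q" for x y
  proof -
    define h where "h t = (real k * t ^ (k - 1)) * (g (x + t ^ k *\<^sub>R (y - x)) \<bullet> (y - x))" for t
    have hc: "continuous_on {0..1} h"
      unfolding h_def by (intro continuous_intros continuous_on_compose2[OF g]) auto
    have "has_bochner_integral lborel (\<lambda>t. indicator {0..1} t *\<^sub>R h t) (f (x + 1 ^ k *\<^sub>R (y - x)) - f (x + 0 ^ k *\<^sub>R (y - x)))"
    proof (rule has_bochner_integral_FTC_Icc[OF _ _ hc])
      fix t :: real
      have "((\<lambda>t. f (x + t ^ k *\<^sub>R (y - x))) has_derivative (\<lambda>s. g (x + t ^ k *\<^sub>R (y - x)) \<bullet> ((real k * s * t ^ (k - 1)) *\<^sub>R (y - x)))) (at t within {0..1})"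
        by (rule has_derivative_compose[OF _ f]) (auto intro!: derivative_eq_intros)
      moreover have "(\<lambda>s. g (x + t ^ k *\<^sub>R (y - x)) \<bullet> ((real k * s * t ^ (k - 1)) *\<^sub>R (y - x))) = (\<lambda>s. s *\<^sub>R h t)"
        by (auto simp: h_def algebra_simps)
      ultimately show "((\<lambda>t. f (x + t ^ k *\<^sub>R (y - x))) has_vector_derivative h t) (at t within {0..1})"
        by (simp add: has_vector_derivative_def)
    qed simp
    then have "f y - f x = (\<integral>t. indicator {0..1} t *\<^sub>R h t \<partial>lborel)"
      using k(1) by (simp add: has_bochner_integral_iff power_0_left)
    also have "\<dots> = (\<integral>t. h t \<partial>\<nu>)" by (rule int_\<nu>[symmetric]) (unfold h_def, measurable)
    finally have "\<bar>f x - f y\<bar> = \<bar>\<integral>t. h t \<partial>\<nu>\<bar>" by simp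
    also have "\<dots> \<le> (\<integral>t. \<bar>h t\<bar> \<partial>\<nu>)" by (rule integral_abs_bound)
    also have "\<dots> \<le> (\<integral>t. \<kappa> t * norm (g (z t x y)) \<partial>\<nu>)"
    proof (rule integral_mono_AE')
      have "\<kappa> t * norm (g (z t x y)) \<le> (real k * d) * B" for t
        using \<kappa>[of t] gB d0 by (intro mult_mono) auto
      then show "integrable \<nu> (\<lambda>t. \<kappa> t * norm (g (z t x y)))"
        using \<kappa> by (intro \<nu>f.integrable_const_bound[of _ "real k * d * B"]) auto
      show "AE t in \<nu>. \<bar>h t\<bar> \<le> \<kappa> t * norm (g (z t x y))" using AE_\<nu>
      proof eventually_elim
        case (elim t)
        then have "\<bar>h t\<bar> \<le> (real k * t ^ (k - 1)) * (norm (g (z t x y)) * norm (y - x))"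
          unfolding h_def using Cauchy_Schwarz_ineq2[of "g (z t x y)" "y - x"]
          by (simp add: abs_mult z_def \<theta>_def mid mult_left_mono)
        also have "\<dots> \<le> (real k * t ^ (k - 1)) * (norm (g (z t x y)) * d)"
          using d[OF xy] elim by (intro mult_left_mono) auto
        finally show ?case using elim by (simp add: \<kappa>_def mid mult_ac)
      qed
      show "AE t in \<nu>. 0 \<le> \<kappa> t * norm (g (z t x y))" using \<kappa> by simp
    qed
    finally show ?thesis .
  qed
  \<comment> \<open>The mean over y is exchanged with the integral over t, and Jensen's inequality
    in y replaces the mean of norm g by the 1/p-th power of the mean of its p-th power.\<close>
  have dev: "\<bar>f x - (\<integral>y. f y \<partial>\<mu>)\<bar> \<le> (\<integral>t. \<kappa> t * P t x powr (1 / p) \<partial>\<nu>)" if x: "x \<in> Q" for x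
  proof -
    have fi: "integrable \<mu> f" using fB by (intro integrable_\<mu>) auto
    have "\<bar>f x - (\<integral>y. f y \<partial>\<mu>)\<bar> = \<bar>\<integral>y. f x - f y \<partial>\<mu>\<bar>" using fi by simp
    also have "\<dots> \<le> (\<integral>y. \<bar>f x - f y\<bar> \<partial>\<mu>)" by (rule integral_abs_bound)
    also have "\<dots> \<le> (\<integral>y. \<integral>t. \<kappa> t * norm (g (z t x y)) \<partial>\<nu> \<partial>\<mu>)"
    proof (rule integral_mono_AE')
      have bd: "\<kappa> t * norm (g (z t x y)) \<le> (real k * d) * B" for t y
        using \<kappa>[of t] gB d0 by (intro mult_mono) auto
      have "\<bar>\<integral>t. \<kappa> t * norm (g (z t x y)) \<partial>\<nu>\<bar> \<le> (real k * d) * B" for y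
      proof -
        have "(\<integral>t. \<kappa> t * norm (g (z t x y)) \<partial>\<nu>) \<le> (\<integral>t. (real k * d) * B \<partial>\<nu>)"
          using bd \<kappa> d0 B by (intro integral_mono \<nu>f.integrable_const_bound[of _ "real k * d * B"]) auto
        moreover have "0 \<le> (\<integral>t. \<kappa> t * norm (g (z t x y)) \<partial>\<nu>)" using \<kappa> by (intro integral_nonneg_AE) auto
        ultimately show ?thesis by (simp add: measure_def)
      qed
      then show "integrable \<mu> (\<lambda>y. \<integral>t. \<kappa> t * norm (g (z t x y)) \<partial>\<nu>)"
        by (rule integrable_\<mu>[rotated]) (unfold z_def, measurable)
      show "AE y in \<mu>. \<bar>f x - f y\<bar> \<le> (\<integral>t. \<kappa> t * norm (g (z t x y)) \<partial>\<nu>)"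
        using AE_\<mu> by eventually_elim (rule diff[OF x])
      show "AE y in \<mu>. 0 \<le> (\<integral>t. \<kappa> t * norm (g (z t x y)) \<partial>\<nu>)"
        using \<kappa> by (auto intro!: integral_nonneg_AE)
    qed
    also have "\<dots> = (\<integral>t. \<integral>y. \<kappa> t * norm (g (z t x y)) \<partial>\<mu> \<partial>\<nu>)"
    proof (rule P1.Fubini_integral)
      have "\<kappa> t * norm (g (z t x y)) \<le> (real k * d) * B" for t y
        using \<kappa>[of t] gB d0 by (intro mult_mono) auto
      then show "integrable (\<nu> \<Otimes>\<^sub>M \<mu>) (\<lambda>(t, y). \<kappa> t * norm (g (z t x y)))"
        using \<kappa> by (intro PF1.integrable_const_bound[of _ "real k * d * B"]) (auto simp: z_def)
    qed
    also have "\<dots> \<le> (\<integral>t. \<kappa> t * P t x powr (1 / p) \<partial>\<nu>)"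
    proof (rule integral_mono_AE')
      have "\<kappa> t * P t x powr (1 / p) \<le> (real k * d) * (B powr p) powr (1 / p)" for t
        using \<kappa>[of t] PB P0 p d0 by (intro mult_mono powr_mono2) auto
      then show "integrable \<nu> (\<lambda>t. \<kappa> t * P t x powr (1 / p))"
        using \<kappa> by (intro \<nu>f.integrable_const_bound[of _ "real k * d * (B powr p) powr (1 / p)"]) auto
      have "(\<integral>y. norm (g (z t x y)) \<partial>\<mu>) \<le> P t x powr (1 / p)" for t
      proof -
        have "(\<integral>y. norm (g (z t x y)) \<partial>\<mu>) powr p \<le> P t x"
          unfolding P_def using p gB gp finite_measure_\<mu>
          by (intro jensen_powr integrable_\<mu>[of _ B] integrable_\<mu>[of _ "B powr p"]) (auto simp: emeasure_\<mu>)
        then have "((\<integral>y. norm (g (z t x y)) \<partial>\<mu>) powr p) powr (1 / p) \<le> P t x powr (1 / p)"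
          using p by (intro powr_mono2) auto
        moreover have "0 \<le> (\<integral>y. norm (g (z t x y)) \<partial>\<mu>)" by (intro integral_nonneg_AE) auto
        ultimately show ?thesis using p by (simp add: powr_powr)
      qed
      then show "AE t in \<nu>. (\<integral>y. \<kappa> t * norm (g (z t x y)) \<partial>\<mu>) \<le> \<kappa> t * P t x powr (1 / p)"
        using \<kappa> by (auto intro!: mult_left_mono)
      show "AE t in \<nu>. 0 \<le> \<kappa> t * P t x powr (1 / p)" using \<kappa> by simp
    qed
    finally show ?thesis .
  qed
  define A where "A = (real k * d) powr r * \<Gamma> powr (r / p - 1)"
  have A0: "0 \<le> A" by (simp add: A_def)
  have powr_dev: "\<bar>f x - (\<integral>y. f y \<partial>\<mu>)\<bar> powr r \<le> A * (\<integral>t. P t x \<partial>\<nu>)" if x: "x \<in> Q" for x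
  proof -
    have b1: "\<kappa> t * P t x powr (1 / p) \<le> (real k * d) * (B powr p) powr (1 / p)" for t
      using \<kappa>[of t] PB P0 p d0 by (intro mult_mono powr_mono2) auto
    then have b2: "(\<kappa> t * P t x powr (1 / p)) powr r \<le> ((real k * d) * (B powr p) powr (1 / p)) powr r" for t
      using \<kappa>[of t] r by (intro powr_mono2) auto
    have i: "integrable \<nu> (\<lambda>t. \<kappa> t * P t x powr (1 / p))" "integrable \<nu> (\<lambda>t. (\<kappa> t * P t x powr (1 / p)) powr r)"
      using \<kappa> b1 b2 by (auto intro!: \<nu>f.integrable_const_bound[OF AE_I2])
    have "\<bar>f x - (\<integral>y. f y \<partial>\<mu>)\<bar> powr r \<le> (\<integral>t. \<kappa> t * P t x powr (1 / p) \<partial>\<nu>) powr r"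
      using dev[OF x] r by (intro powr_mono2) auto
    also have "\<dots> \<le> (\<integral>t. (\<kappa> t * P t x powr (1 / p)) powr r \<partial>\<nu>)"
      using i r \<kappa> \<nu>f.finite_measure_axioms by (intro jensen_powr) auto
    also have "\<dots> \<le> (\<integral>t. A * P t x \<partial>\<nu>)"
    proof (rule integral_mono_AE[OF i(2)])
      show "integrable \<nu> (\<lambda>t. A * P t x)"
        using P0 PB by (intro integrable_mult_right \<nu>f.integrable_const_bound[of _ "B powr p"]) auto
      \<comment> \<open>The bound by t^(-kN) fails at t = 0, where \<open>0 powr c\<close> evaluates
        to 0 in place of infinity.\<close>
      have "AE t in \<nu>. t \<noteq> 0"
        unfolding \<nu>_def by (subst AE_uniform_measure) (auto intro: AE_lborel_singleton[THEN eventually_mono])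
      with AE_\<nu> show "AE t in \<nu>. (\<kappa> t * P t x powr (1 / p)) powr r \<le> A * P t x"
      proof eventually_elim
        case (elim t)
        then have t: "0 < t" "t \<le> 1" by auto
        have "P t x \<le> 1 / \<theta> t ^ DIM('a) * \<Gamma>"
          unfolding P_def z_def \<Gamma>_def
          by (rule integral_\<mu>_affine[of "\<lambda>y. norm (g y) powr p" "B powr p"]) (use gp x \<theta> t in \<open>auto simp: \<theta>_def mid power_le_one\<close>)
        then have Ple: "P t x \<le> t powr (- real (k * DIM('a))) * \<Gamma>"
          using t powr_realpow[of t "k * DIM('a)"] by (simp add: \<theta>_def mid powr_minus divide_simps flip: power_mult)
        have "(\<kappa> t * P t x powr (1 / p)) powr r = \<kappa> t powr r * P t x powr (r / p)"
          using \<kappa>[of t] P0[of t x] by (simp add: powr_mult powr_powr)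
        also have "\<kappa> t powr r = (real k * d) powr r * t powr (r * (real k - 1))"
          using t d0 k by (simp add: \<kappa>_def mid powr_mult powr_powr of_nat_diff mult_ac flip: powr_realpow)
        \<comment> \<open>One factor \<open>P t x\<close> is split off: the pointwise bound is spent
          on the remaining power only, and the single factor is later integrated over x, where no
          singularity arises.\<close>
        also have "P t x powr (r / p) = P t x powr (r / p - 1) * P t x"
        proof (cases "P t x = 0")
          case False
          then have "0 < P t x" using P0[of t x] by simp
          then show ?thesis by (simp add: powr_diff)
        qed simp
        also have "(real k * d) powr r * t powr (r * (real k - 1)) * (P t x powr (r / p - 1) * P t x)
           \<le> (real k * d) powr r * t powr (r * (real k - 1)) * ((t powr (- real (k * DIM('a))) * \<Gamma>) powr (r / p - 1) * P t x)"
          using Ple P0 p by (intro mult_left_mono mult_right_mono powr_mono2) auto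
        also have "\<dots> = (t powr (r * (real k - 1)) * t powr (- real (k * DIM('a)) * (r / p - 1))) * (A * P t x)"
          using \<Gamma>0 by (simp add: powr_mult powr_powr A_def mult_ac)
        also have "t powr (r * (real k - 1)) * t powr (- real (k * DIM('a)) * (r / p - 1)) \<le> 1"
        proof -
          have "t powr (r * (real k - 1) + (- real (k * DIM('a)) * (r / p - 1))) \<le> 1"
            using t k(2) by (intro powr_le_one_le[THEN order_trans] powr_le1) (auto simp: algebra_simps)
          then show ?thesis by (simp only: powr_add)
        qed
        then have "(t powr (r * (real k - 1)) * t powr (- real (k * DIM('a)) * (r / p - 1))) * (A * P t x) \<le> A * P t x"
          using A0 P0[of t x] by (intro mult_left_le_one_le) auto
        finally show ?case .
      qed
    qed
    finally show ?thesis by simp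
  qed
  have Pint: "integrable (\<nu> \<Otimes>\<^sub>M \<mu>) (\<lambda>(t, x). P t x)"
    using P0 PB by (intro PF1.integrable_const_bound[of _ "B powr p"]) auto
  have "(\<integral>x. \<bar>f x - (\<integral>y. f y \<partial>\<mu>)\<bar> powr r \<partial>\<mu>) \<le> (\<integral>x. A * (\<integral>t. P t x \<partial>\<nu>) \<partial>\<mu>)"
  proof (rule integral_mono_AE')
    show "integrable \<mu> (\<lambda>x. A * (\<integral>t. P t x \<partial>\<nu>))" using P1.integrable_snd[OF Pint] by simp
    show "AE x in \<mu>. \<bar>f x - (\<integral>y. f y \<partial>\<mu>)\<bar> powr r \<le> A * (\<integral>t. P t x \<partial>\<nu>)"
      using AE_\<mu> by eventually_elim (rule powr_dev)
    show "AE x in \<mu>. 0 \<le> A * (\<integral>t. P t x \<partial>\<nu>)"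
      using A0 P0 by (auto intro!: mult_nonneg_nonneg integral_nonneg_AE)
  qed
  also have "\<dots> = A * (\<integral>t. \<integral>x. P t x \<partial>\<mu> \<partial>\<nu>)"
    by (simp add: P1.Fubini_integral[OF Pint])
  also have "\<dots> \<le> A * (\<integral>t. 2 ^ DIM('a) * \<Gamma> \<partial>\<nu>)"
  proof (intro mult_left_mono integral_mono A0)
    show "integrable \<nu> (\<lambda>t. \<integral>x. P t x \<partial>\<mu>)" using P1.integrable_fst[OF Pint] by simp
    show "(\<integral>x. P t x \<partial>\<mu>) \<le> 2 ^ DIM('a) * \<Gamma>" for t
      unfolding P_def z_def \<Gamma>_def
      by (rule integral_\<mu>_\<mu>_affine[of "\<lambda>y. norm (g y) powr p" "B powr p"]) (use gp \<theta> in auto)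
  qed simp
  also have "\<dots> = 2 ^ DIM('a) * (real k * d) powr r * (\<Gamma> powr (r / p - 1) * \<Gamma>)"
    by (simp add: A_def measure_def)
  also have "\<Gamma> powr (r / p - 1) * \<Gamma> = \<Gamma> powr (r / p)"
    using \<Gamma>0 by (cases "\<Gamma> = 0") (auto simp: powr_diff)
  finally show ?thesis by (simp add: \<Gamma>_def)
qed

end

section \<open>Calculus of smooth functions\<close>

lemma GDERIV_has_derivative: "GDERIV f x :> D \<longleftrightarrow> (f has_derivative (\<lambda>h. D \<bullet> h)) (at x)"
  by (simp add: gderiv_def inner_commute)

lemma grad_eqI:
  assumes "(f has_derivative (\<lambda>h. D \<bullet> h)) (at x)"
  shows "grad f x = D"
  unfolding grad_def
proof (rule the_equality)
  show "GDERIV f x :> D" using assms by (simp add: GDERIV_has_derivative)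
  fix D' assume "GDERIV f x :> D'"
  then have eq: "(\<lambda>h. D' \<bullet> h) = (\<lambda>h. D \<bullet> h)"
    unfolding GDERIV_has_derivative using assms by (rule has_derivative_unique)
  have "\<forall>h. D' \<bullet> h = D \<bullet> h" using fun_cong[OF eq] by blast
  then show "D' = D" by (simp only: vector_eq_rdot)
qed

lemma has_derivative_grad:
  assumes "f differentiable (at x)"
  shows "(f has_derivative (\<lambda>h. grad f x \<bullet> h)) (at x)"
proof -
  obtain f' where f': "(f has_derivative f') (at x)" using assms by (auto simp: differentiable_def)
  interpret bounded_linear f' using f' by (rule has_derivative_bounded_linear)
  define D where "D = (\<Sum>i\<in>Basis. f' i *\<^sub>R i)"
  have "f' h = D \<bullet> h" for h
  proof -
    have "f' h = f' (\<Sum>i\<in>Basis. (h \<bullet> i) *\<^sub>R i)" by (simp add: euclidean_representation)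
    also have "\<dots> = (\<Sum>i\<in>Basis. (h \<bullet> i) * f' i)" by (simp add: sum scale)
    also have "\<dots> = D \<bullet> h"
      unfolding D_def inner_sum_left by (intro sum.cong refl) (simp add: inner_commute)
    finally show ?thesis .
  qed
  then have "f' = (\<lambda>h. D \<bullet> h)" by (rule ext)
  with f' have D: "(f has_derivative (\<lambda>h. D \<bullet> h)) (at x)" by simp
  with grad_eqI[OF D] show ?thesis by simp
qed

text \<open>\<open>grad\<close> is a definite description; exhibiting a gradient g determines it, so
  smoothness proofs need never compute \<open>grad\<close>.\<close>

lemma C_k_SucI:
  assumes "\<And>x. (f has_derivative (\<lambda>h. g x \<bullet> h)) (at x)" "\<And>i. i \<in> Basis \<Longrightarrow> C_k n (\<lambda>x. g x \<bullet> i)"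
  shows "C_k (Suc n) f"
proof -
  have "grad f = g" using grad_eqI[OF assms(1)] by auto
  then show ?thesis
    using assms by (auto simp: differentiable_on_def intro: differentiableI has_derivative_at_withinI)
qed

lemma C_k_Suc_has_derivative:
  "C_k (Suc n) f \<Longrightarrow> (f has_derivative (\<lambda>h. grad f x \<bullet> h)) (at x)"
  by (rule has_derivative_grad) (auto simp: differentiable_on_def)

lemma C_k_SucD: "C_k (Suc n) f \<Longrightarrow> C_k n f"
proof (induction n arbitrary: f)
  case 0
  then show ?case by (simp add: differentiable_imp_continuous_on)
next
  case (Suc n)
  then show ?case by (auto simp only: C_k.simps(2))
qed

lemma C_k_const: "C_k n (\<lambda>x. c)"
proof (induction n arbitrary: c)
  case (Suc n)
  show ?case by (rule C_k_SucI[of _ "\<lambda>x. 0"]) (use Suc in auto)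
qed simp

lemma C_k_inner: "C_k n (\<lambda>x. x \<bullet> v)"
proof (cases n)
  case (Suc m)
  show ?thesis unfolding Suc
    by (rule C_k_SucI[of _ "\<lambda>x. v"]) (auto intro!: derivative_eq_intros C_k_const simp: inner_commute)
qed (simp add: continuous_intros)

lemma C_k_add: "C_k n f \<Longrightarrow> C_k n g \<Longrightarrow> C_k n (\<lambda>x. f x + g x)"
proof (induction n arbitrary: f g)
  case 0
  then show ?case by (simp add: continuous_intros)
next
  case (Suc n)
  show ?case
    by (rule C_k_SucI[of _ "\<lambda>x. grad f x + grad g x"])
       (use Suc in \<open>auto intro!: derivative_eq_intros C_k_Suc_has_derivative simp: inner_add_left simp del: C_k.simps\<close>,
        use Suc.prems in \<open>auto intro!: Suc.IH\<close>)
qed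

lemma C_k_mult: "C_k n f \<Longrightarrow> C_k n g \<Longrightarrow> C_k n (\<lambda>x. f x * g x)"
proof (induction n arbitrary: f g)
  case 0
  then show ?case by (simp add: continuous_intros)
next
  case (Suc n)
  show ?case
  proof (rule C_k_SucI)
    show "((\<lambda>x. f x * g x) has_derivative (\<lambda>h. (f x *\<^sub>R grad g x + g x *\<^sub>R grad f x) \<bullet> h)) (at x)" for x
      using Suc.prems by (auto intro!: derivative_eq_intros C_k_Suc_has_derivative simp: inner_add_left simp del: C_k.simps)
    fix i :: 'a assume "i \<in> Basis"
    then have "C_k n (\<lambda>x. f x * (grad g x \<bullet> i) + g x * (grad f x \<bullet> i))"
      using Suc.prems C_k_SucD[of n f] C_k_SucD[of n g] by (intro C_k_add Suc.IH) auto
    then show "C_k n (\<lambda>x. (f x *\<^sub>R grad g x + g x *\<^sub>R grad f x) \<bullet> i)" by (simp add: inner_add_left)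
  qed
qed

lemma C_k_prod: "(\<And>i. i \<in> I \<Longrightarrow> C_k n (f i)) \<Longrightarrow> C_k n (\<lambda>x. \<Prod>i\<in>I. f i x)"
  by (induction I rule: infinite_finite_induct) (auto intro: C_k_mult C_k_const)

text \<open>The whole sequence of derivatives is a parameter: the chain rule moves from
  \<open>D j\<close> to \<open>D (Suc j)\<close>, so the induction on n closes only if it runs for
  all j at once.\<close>

lemma C_k_compose:
  assumes D: "\<And>j t. (D j has_real_derivative D (Suc j) t) (at t)"
  shows "C_k n f \<Longrightarrow> C_k n (\<lambda>x. D j (f x))"
proof (induction n arbitrary: f j)
  case 0
  have "continuous_on UNIV (D j)"
    using D by (meson DERIV_isCont continuous_at_imp_continuous_on)
  then show ?case using 0 by (auto intro: continuous_on_compose2)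
next
  case (Suc n)
  show ?case
  proof (rule C_k_SucI)
    show "((\<lambda>x. D j (f x)) has_derivative (\<lambda>h. (D (Suc j) (f x) *\<^sub>R grad f x) \<bullet> h)) (at x)" for x
      using has_derivative_compose[OF C_k_Suc_has_derivative[OF Suc.prems] D[unfolded has_field_derivative_def]]
      by simp
    fix i :: 'a assume "i \<in> Basis"
    then have "C_k n (\<lambda>x. D (Suc j) (f x) * (grad f x \<bullet> i))"
      using Suc.prems C_k_SucD[OF Suc.prems] by (intro C_k_mult Suc.IH) auto
    then show "C_k n (\<lambda>x. (D (Suc j) (f x) *\<^sub>R grad f x) \<bullet> i)" by simp
  qed
qed

subsection \<open>A flat function and a smooth absolute value\<close>

definition flat :: "real \<Rightarrow> real" where
  "flat t = (if t \<le> 0 then 0 else exp (- 1 / t))"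

lemma flat_bounds: "0 \<le> flat t" "flat t \<le> 1"
  by (auto simp: flat_def)

text \<open>The derivative of P(1/t) exp(-1/t) is (1/t)^2 (P - P')(1/t) exp(-1/t), which is the
  recursion for the polynomial in 1/t.\<close>

primrec flat_poly :: "nat \<Rightarrow> real poly" where
  "flat_poly 0 = 1"
| "flat_poly (Suc k) = [:0, 0, 1:] * (flat_poly k - pderiv (flat_poly k))"

definition flat_deriv :: "nat \<Rightarrow> real \<Rightarrow> real" where
  "flat_deriv k t = (if t \<le> 0 then 0 else poly (flat_poly k) (1 / t) * exp (- 1 / t))"

lemma flat_deriv_0: "flat_deriv 0 = flat"
  by (auto simp: flat_deriv_def flat_def)

lemma tendsto_poly_times_exp_neg: "((\<lambda>x. poly P x * exp (- x)) \<longlongrightarrow> 0) at_top" for P :: "real poly"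
proof -
  have "((\<lambda>x. \<Sum>i\<le>degree P. coeff P i * (x ^ i / exp x)) \<longlongrightarrow> (\<Sum>i\<le>degree P. coeff P i * 0)) at_top"
    by (intro tendsto_sum tendsto_mult tendsto_const tendsto_power_div_exp_0)
  then show ?thesis
    by (simp add: poly_altdef sum_distrib_right sum_divide_distrib exp_minus field_simps)
qed

text \<open>Only t = 0 is delicate: the right-hand quotient is again a polynomial in 1/h times
  exp(-1/h), and the exponential wins.\<close>

lemma flat_deriv_has_derivative:
  "(flat_deriv k has_real_derivative flat_deriv (Suc k) t) (at t)"
proof -
  consider "t < 0" | "t = 0" | "0 < t" by linarith
  then show ?thesis
  proof cases
    case 1
    then have "((\<lambda>t. 0) has_real_derivative flat_deriv (Suc k) t) (at t)" by (simp add: flat_deriv_def)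
    then show ?thesis
      by (rule has_field_derivative_transform_within_open[of _ _ _ "{..<0}"]) (use 1 in \<open>auto simp: flat_deriv_def\<close>)
  next
    case 2
    have "((\<lambda>h. flat_deriv k h / h) \<longlongrightarrow> 0) (at 0)"
      unfolding filterlim_at_split
    proof
      have "\<forall>\<^sub>F h in at_left 0. flat_deriv k h / h = (0::real)"
        by (auto simp: eventually_at_filter flat_deriv_def)
      then show "((\<lambda>h. flat_deriv k h / h) \<longlongrightarrow> 0) (at_left 0)" by (rule tendsto_eventually)
      have "((\<lambda>h. poly (pCons 0 (flat_poly k)) (inverse h) * exp (- inverse h)) \<longlongrightarrow> 0) (at_right 0)"
        by (rule filterlim_compose[OF tendsto_poly_times_exp_neg filterlim_inverse_at_top_right])
      moreover have "\<forall>\<^sub>F h in at_right 0. poly (pCons 0 (flat_poly k)) (inverse h) * exp (- inverse h) = flat_deriv k h / h"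
        unfolding eventually_at_filter by (auto simp: flat_deriv_def field_simps intro!: always_eventually)
      ultimately show "((\<lambda>h. flat_deriv k h / h) \<longlongrightarrow> 0) (at_right 0)" by (rule Lim_transform_eventually)
    qed
    then show ?thesis using 2 by (simp add: DERIV_def flat_deriv_def)
  next
    case 3
    have "((\<lambda>t. poly (flat_poly k) (1 / t) * exp (- 1 / t)) has_real_derivative
       (poly (pderiv (flat_poly k)) (1 / t) * (- 1 / t^2) * exp (- 1 / t) + poly (flat_poly k) (1 / t) * (exp (- 1 / t) * (1 / t^2)))) (at t)"
      using 3 by (auto intro!: derivative_eq_intros DERIV_chain2[OF poly_DERIV] simp: power2_eq_square)
    also have "(poly (pderiv (flat_poly k)) (1 / t) * (- 1 / t^2) * exp (- 1 / t) + poly (flat_poly k) (1 / t) * (exp (- 1 / t) * (1 / t^2)))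
       = flat_deriv (Suc k) t"
      using 3 by (simp add: flat_deriv_def field_simps power2_eq_square)
    finally show ?thesis
      by (rule has_field_derivative_transform_within_open[of _ _ _ "{0<..}"]) (use 3 in \<open>auto simp: flat_deriv_def\<close>)
  qed
qed

lemma C_k_flat: "C_k n f \<Longrightarrow> C_k n (\<lambda>x. flat (f x))"
  using C_k_compose[of flat_deriv, OF flat_deriv_has_derivative, of n f 0] by (simp add: flat_deriv_0)

text \<open>The k-th derivative of sqrt(t^2 + e^2) is P(t) (t^2 + e^2)^(1/2 - k) for a polynomial P;
  differentiating once more yields P' (t^2 + e^2) + (1 - 2k) t P as the next numerator.\<close>

primrec sqrt_poly :: "real \<Rightarrow> nat \<Rightarrow> real poly" where
  "sqrt_poly e 0 = 1"
| "sqrt_poly e (Suc k) = pderiv (sqrt_poly e k) * [:e^2, 0, 1:] + [:0, 1 - 2 * real k:] * sqrt_poly e k"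

lemma C_k_sqrt:
  assumes e: "0 < e" and f: "C_k n f"
  shows "C_k n (\<lambda>x. sqrt (f x ^ 2 + e ^ 2))"
proof -
  define D where "D k t = poly (sqrt_poly e k) t * (t^2 + e^2) powr (1/2 - real k)" for k t
  have pos: "0 < t^2 + e^2" for t using e by (simp add: add_nonneg_pos)
  have "(D k has_real_derivative D (Suc k) t) (at t)" for k t
  proof -
    have "(D k has_real_derivative (poly (pderiv (sqrt_poly e k)) t * (t^2 + e^2) powr (1/2 - real k)
       + poly (sqrt_poly e k) t * ((1/2 - real k) * (t^2 + e^2) powr (1/2 - real k - 1) * (2 * t)))) (at t)"
      unfolding D_def using pos[of t]
      by (auto intro!: derivative_eq_intros poly_DERIV DERIV_powr[THEN DERIV_cong] simp: field_simps powr_diff)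
    moreover have "(t^2 + e^2) powr (1/2 - real k) = (t^2 + e^2) powr (1/2 - real (Suc k)) * (t^2 + e^2)"
    proof -
      have "(t^2 + e^2) powr (1/2 - real k) = (t^2 + e^2) powr ((1/2 - real (Suc k)) + 1)" by simp
      also have "\<dots> = (t^2 + e^2) powr (1/2 - real (Suc k)) * (t^2 + e^2)"
        using pos[of t] by (subst powr_add) simp
      finally show ?thesis .
    qed
    moreover have "1/2 - real k - 1 = 1/2 - real (Suc k)" by simp
    ultimately show ?thesis by (simp add: D_def algebra_simps power2_eq_square)
  qed
  from C_k_compose[of D, OF this f, of 0] pos show ?thesis
    by (simp add: D_def powr_half_sqrt less_imp_le)
qed

subsection \<open>Compactly supported smooth functions\<close>

lemma Cc_inftyD: "f \<in> Cc_infty S \<Longrightarrow> C_k n f"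
  by (simp add: Cc_infty_def)

lemma Cc_infty_UNIV_iff: "f \<in> Cc_infty UNIV \<longleftrightarrow> (\<forall>n. C_k n f) \<and> bounded {x. f x \<noteq> 0}"
  using bounded_closure bounded_subset[OF _ closure_subset]
  by (auto simp: Cc_infty_def compact_eq_bounded_closed)

lemma Cc_infty_mono: "S \<subseteq> T \<Longrightarrow> Cc_infty S \<subseteq> Cc_infty T"
  by (auto simp: Cc_infty_def)

lemma Cc_infty_has_derivative:
  assumes "f \<in> Cc_infty S" shows "(f has_derivative (\<lambda>h. grad f x \<bullet> h)) (at x)"
  by (rule C_k_Suc_has_derivative[OF Cc_inftyD[OF assms, of "Suc 0"]])

lemma Cc_infty_continuous: "f \<in> Cc_infty S \<Longrightarrow> continuous_on UNIV f"
  using Cc_inftyD[of f S 0] by simp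

lemma Cc_infty_continuous_grad:
  assumes "f \<in> Cc_infty S" shows "continuous_on UNIV (grad f)"
proof -
  have "continuous_on UNIV (\<lambda>x. grad f x \<bullet> i)" if "i \<in> Basis" for i
    using Cc_inftyD[OF assms, of "Suc 0"] that by simp
  then have "continuous_on UNIV (\<lambda>x. \<Sum>i\<in>Basis. (grad f x \<bullet> i) *\<^sub>R i)"
    by (intro continuous_on_sum continuous_on_scaleR continuous_on_const)
  then show ?thesis by (simp add: euclidean_representation)
qed

lemma Cc_infty_measurable:
  assumes "f \<in> Cc_infty S"
  shows "f \<in> borel_measurable borel" "grad f \<in> borel_measurable borel"
  using Cc_infty_continuous[OF assms] Cc_infty_continuous_grad[OF assms]
  by (auto intro: borel_measurable_continuous_onI)

lemma grad_eq_0_outside_support: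
  assumes "x \<notin> closure {x. f x \<noteq> 0}"
  shows "grad f x = 0"
proof (rule grad_eqI)
  have "((\<lambda>x. 0) has_derivative (\<lambda>h. 0 \<bullet> h)) (at x)" by simp
  then show "(f has_derivative (\<lambda>h. 0 \<bullet> h)) (at x)"
    by (rule has_derivative_transform_within_open[of _ _ _ _ "- closure {x. f x \<noteq> 0}"])
       (use assms closure_subset[of "{x. f x \<noteq> 0}"] in auto)
qed

lemma Cc_infty_support:
  fixes f :: "'a::euclidean_space \<Rightarrow> real"
  assumes "f \<in> Cc_infty S"
  obtains R where "0 < R" "\<And>x. R \<le> norm x \<Longrightarrow> f x = 0 \<and> grad f x = 0"
proof -
  have "bounded (closure {x. f x \<noteq> 0})" using assms by (auto simp: Cc_infty_def compact_imp_bounded)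
  then obtain R where R: "0 < R" "\<And>x. x \<in> closure {x. f x \<noteq> 0} \<Longrightarrow> norm x < R"
    by (meson bounded_normE_less)
  show ?thesis
  proof
    fix x :: 'a assume "R \<le> norm x"
    then have "x \<notin> closure {x. f x \<noteq> 0}" using R(2) by force
    then show "f x = 0 \<and> grad f x = 0"
      using grad_eq_0_outside_support closure_subset[of "{x. f x \<noteq> 0}"] by blast
  qed (rule R(1))
qed

lemma Cc_infty_bounded:
  assumes "f \<in> Cc_infty S"
  obtains B where "0 \<le> B" "\<And>x. norm (grad f x) \<le> B" "\<And>x. \<bar>f x\<bar> \<le> B"
proof -
  obtain R where R: "0 < R" "\<And>x. R \<le> norm x \<Longrightarrow> f x = 0 \<and> grad f x = 0"
    using Cc_infty_support[OF assms] by blast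
  have "bounded (f ` cball 0 R)" "bounded (grad f ` cball 0 R)"
    using Cc_infty_continuous[OF assms] Cc_infty_continuous_grad[OF assms]
    by (auto intro!: compact_imp_bounded compact_continuous_image intro: continuous_on_subset)
  then obtain B1 B2 where B: "\<And>x. x \<in> cball 0 R \<Longrightarrow> norm (f x) \<le> B1" "\<And>x. x \<in> cball 0 R \<Longrightarrow> norm (grad f x) \<le> B2"
    unfolding bounded_iff by blast
  show ?thesis
  proof
    show "0 \<le> \<bar>B1\<bar> + \<bar>B2\<bar>" by simp
    fix x
    have "norm (f x) \<le> \<bar>B1\<bar> + \<bar>B2\<bar> \<and> norm (grad f x) \<le> \<bar>B1\<bar> + \<bar>B2\<bar>"
    proof (cases "norm x \<le> R")
      case True
      then show ?thesis using B(1)[of x] B(2)[of x] by auto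
    next
      case False
      then show ?thesis using R(2)[of x] by auto
    qed
    then show "norm (grad f x) \<le> \<bar>B1\<bar> + \<bar>B2\<bar>" "\<bar>f x\<bar> \<le> \<bar>B1\<bar> + \<bar>B2\<bar>" by auto
  qed
qed

lemma Cc_infty_add:
  assumes "f \<in> Cc_infty UNIV" "g \<in> Cc_infty UNIV"
  shows "(\<lambda>x. f x + g x) \<in> Cc_infty UNIV"
proof -
  have "{x. f x + g x \<noteq> 0} \<subseteq> {x. f x \<noteq> 0} \<union> {x. g x \<noteq> 0}" by auto
  moreover have "bounded ({x. f x \<noteq> 0} \<union> {x. g x \<noteq> 0})" using assms by (simp add: Cc_infty_UNIV_iff)
  ultimately have "bounded {x. f x + g x \<noteq> 0}" by (rule bounded_subset[rotated])
  then show ?thesis using assms by (auto simp: Cc_infty_UNIV_iff intro: C_k_add)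
qed

lemma Cc_infty_scale:
  assumes "f \<in> Cc_infty UNIV" shows "(\<lambda>x. c * f x) \<in> Cc_infty UNIV"
proof -
  have "{x. c * f x \<noteq> 0} \<subseteq> {x. f x \<noteq> 0}" by auto
  then show ?thesis using assms bounded_subset by (auto simp: Cc_infty_UNIV_iff intro: C_k_mult C_k_const)
qed

lemma grad_add:
  assumes "f \<in> Cc_infty S" "g \<in> Cc_infty T"
  shows "grad (\<lambda>x. f x + g x) x = grad f x + grad g x"
  using assms by (intro grad_eqI) (auto intro!: derivative_eq_intros Cc_infty_has_derivative simp: inner_add_left)

lemma grad_scale:
  assumes "f \<in> Cc_infty S" shows "grad (\<lambda>x. c * f x) x = c *\<^sub>R grad f x"
  using assms by (intro grad_eqI) (auto intro!: derivative_eq_intros Cc_infty_has_derivative)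

lemma Cc_infty_mult:
  assumes "f \<in> Cc_infty UNIV" "g \<in> Cc_infty S"
  shows "(\<lambda>x. f x * g x) \<in> Cc_infty S"
proof -
  have "closure {x. f x * g x \<noteq> 0} \<subseteq> closure {x. g x \<noteq> 0}" by (intro closure_mono) auto
  moreover from this have "compact (closure {x. f x * g x \<noteq> 0})"
    using assms(2) by (auto simp: Cc_infty_def compact_eq_bounded_closed intro: bounded_subset)
  ultimately show ?thesis using assms by (auto simp: Cc_infty_def intro: C_k_mult)
qed

lemma grad_mult:
  assumes "f \<in> Cc_infty S" "g \<in> Cc_infty T"
  shows "grad (\<lambda>x. f x * g x) x = f x *\<^sub>R grad g x + g x *\<^sub>R grad f x"
  using assms by (intro grad_eqI) (auto intro!: derivative_eq_intros Cc_infty_has_derivative simp: inner_add_left)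

text \<open>Test functions are not closed under the absolute value. Subtracting e from the
  regularised modulus preserves the compact support, and the chain rule factor f / sqrt(f^2 + e^2)
  has modulus at most 1, so the gradient does not grow.\<close>

lemma smooth_abs:
  assumes f: "f \<in> Cc_infty UNIV" and e: "0 < e"
  defines "g \<equiv> \<lambda>x. sqrt (f x ^ 2 + e ^ 2) - e"
  shows "g \<in> Cc_infty UNIV" "\<And>x. 0 \<le> g x" "\<And>x. g x \<le> \<bar>f x\<bar>" "\<And>x. \<bar>f x\<bar> - e \<le> g x"
    "\<And>x. norm (grad g x) \<le> norm (grad f x)"
proof -
  have "C_k n g" for n
    using C_k_add[OF C_k_sqrt[OF e Cc_inftyD[OF f]] C_k_const, of n "- e"] by (simp add: g_def)
  moreover have "{x. g x \<noteq> 0} \<subseteq> {x. f x \<noteq> 0}" using e by (auto simp: g_def)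
  ultimately show "g \<in> Cc_infty UNIV" using f by (auto simp: Cc_infty_UNIV_iff intro: bounded_subset)
  show "0 \<le> g x" for x using e by (simp add: g_def real_le_rsqrt)
  have "sqrt (f x ^ 2 + e ^ 2) \<le> \<bar>f x\<bar> + e" for x
    using sqrt_add_le_add_sqrt[of "f x ^ 2" "e ^ 2"] e by simp
  then show "g x \<le> \<bar>f x\<bar>" for x by (simp add: g_def algebra_simps)
  have sq: "\<bar>f x\<bar> \<le> sqrt (f x ^ 2 + e ^ 2)" for x
    using real_sqrt_le_mono[of "f x ^ 2" "f x ^ 2 + e ^ 2"] by simp
  then show "\<bar>f x\<bar> - e \<le> g x" for x using e by (simp add: g_def)
  have pos: "0 < f x ^ 2 + e ^ 2" for x using e by (simp add: add_nonneg_pos)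
  have "grad g x = (f x / sqrt (f x ^ 2 + e ^ 2)) *\<^sub>R grad f x" for x
    unfolding g_def using pos[of x]
    by (intro grad_eqI) (auto intro!: derivative_eq_intros Cc_infty_has_derivative[OF f] simp: field_simps)
  moreover have "\<bar>f x / sqrt (f x ^ 2 + e ^ 2)\<bar> \<le> 1" for x
    using sq[of x] pos[of x] by (simp add: abs_divide)
  ultimately show "norm (grad g x) \<le> norm (grad f x)" for x
    by (simp del: abs_divide) (metis mult_left_le_one_le norm_ge_zero abs_ge_zero)
qed

text \<open>Products of \<open>flat\<close> in the distances to the faces, scaled by n: each factor
  exp(-1/(n c)) tends to 1 inside the box. Boxes suffice because they generate the Borel
  sets.\<close>

lemma smooth_box_indicator:
  fixes a b :: "'a::euclidean_space"
  assumes ab: "cbox a b \<subseteq> S"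
  obtains \<psi> :: "nat \<Rightarrow> 'a \<Rightarrow> real" where "\<And>n. \<psi> n \<in> Cc_infty S"
    "\<And>n x. \<bar>\<psi> n x\<bar> \<le> indicator (box a b) x" "\<And>x. (\<lambda>n. \<psi> n x) \<longlonglongrightarrow> indicator (box a b) x"
proof -
  define \<psi> where "\<psi> n x = (\<Prod>i\<in>Basis. flat (real n * (x \<bullet> i - a \<bullet> i)) * flat (real n * (b \<bullet> i - x \<bullet> i)))" for n and x :: 'a
  have smooth: "C_k k (\<psi> n)" for n k
  proof -
    have "C_k k (\<lambda>x::'a. real n * (x \<bullet> i - a \<bullet> i))" for i
      using C_k_mult[OF C_k_const[of k "real n"] C_k_add[OF C_k_inner[of k i] C_k_const[of k "- (a \<bullet> i)"]]] by simp
    moreover have "C_k k (\<lambda>x::'a. real n * (b \<bullet> i - x \<bullet> i))" for i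
      using C_k_mult[OF C_k_const[of k "real n"] C_k_add[OF C_k_const[of k "b \<bullet> i"] C_k_inner[of k "- i"]]] by simp
    ultimately show ?thesis unfolding \<psi>_def by (intro C_k_prod C_k_mult[OF C_k_flat C_k_flat])
  qed
  have zero: "\<psi> n x = 0" if x: "x \<notin> box a b" for n x
  proof -
    obtain i where i: "i \<in> Basis" "x \<bullet> i \<le> a \<bullet> i \<or> b \<bullet> i \<le> x \<bullet> i" using x by (auto simp: mem_box not_less)
    then have "flat (real n * (x \<bullet> i - a \<bullet> i)) = 0 \<or> flat (real n * (b \<bullet> i - x \<bullet> i)) = 0"
      by (auto simp: flat_def mult_nonneg_nonpos)
    then show ?thesis using i(1) by (auto simp: \<psi>_def)
  qed
  have le1: "0 \<le> \<psi> n x" "\<psi> n x \<le> 1" for n x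
    unfolding \<psi>_def by (auto intro!: prod_nonneg prod_le_1 mult_le_one flat_bounds mult_nonneg_nonneg)
  show ?thesis
  proof
    fix n
    have "closure {x. \<psi> n x \<noteq> 0} \<subseteq> cbox a b"
      using zero box_subset_cbox[of a b] by (intro closure_minimal) auto
    then show "\<psi> n \<in> Cc_infty S"
      using smooth ab bounded_subset[OF bounded_cbox] by (auto simp: Cc_infty_def compact_eq_bounded_closed)
    show "\<bar>\<psi> n x\<bar> \<le> indicator (box a b) x" for x
      using le1[of n x] zero[of x n] by (auto simp: indicator_def)
  next
    fix x
    show "(\<lambda>n. \<psi> n x) \<longlonglongrightarrow> indicator (box a b) x"
    proof (cases "x \<in> box a b")
      case True
      have fl: "(\<lambda>n. flat (real n * c)) \<longlonglongrightarrow> 1" if "0 < c" for c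
      proof -
        have "(\<lambda>n. exp (- (1 / c) * (1 / real n))) \<longlonglongrightarrow> exp (- (1 / c) * 0)"
          by (intro tendsto_intros lim_1_over_n)
        then have "(\<lambda>n. exp (- (1 / c) * (1 / real n))) \<longlonglongrightarrow> 1" by simp
        moreover have "\<forall>\<^sub>F n in sequentially. exp (- (1 / c) * (1 / real n)) = flat (real n * c)"
          using eventually_gt_at_top[of 0] by eventually_elim (use that in \<open>auto simp: flat_def mult_le_0_iff\<close>)
        ultimately show ?thesis by (rule Lim_transform_eventually)
      qed
      have "(\<lambda>n. \<psi> n x) \<longlonglongrightarrow> (\<Prod>i\<in>(Basis::'a set). 1 * 1)"
        unfolding \<psi>_def using True by (intro tendsto_prod tendsto_mult fl) (auto simp: mem_box)
      then show ?thesis using True by simp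
    qed (simp add: zero)
  qed
qed

section \<open>Integration over the half-space\<close>

lemma open_halfspace: "open (halfspace :: ((real^'m) \<times> real) set)"
  unfolding halfspace_def by (intro open_Collect_less continuous_intros)

lemma halfspace_measurable [measurable]:
  "(halfspace :: ((real^'m) \<times> real) set) \<in> sets borel" "(halfspace :: ((real^'m) \<times> real) set) \<in> sets lebesgue"
proof -
  show 1: "(halfspace :: ((real^'m) \<times> real) set) \<in> sets borel" using open_halfspace by (rule borel_open)
  show "(halfspace :: ((real^'m) \<times> real) set) \<in> sets lebesgue" by (rule sets_completionI_sets) (simp add: 1)
qed

lemma borel_measurable_snd [measurable]: "(\<lambda>x::(real^'m) \<times> real. snd x) \<in> borel_measurable borel"
  by (intro borel_measurable_continuous_onI continuous_intros)

lemma borel_measurable_weight [measurable]: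
  "(\<lambda>x::(real^'m) \<times> real. (1 + snd x) powr a) \<in> borel_measurable borel"
  by (rule measurable_compose[OF borel_measurable_snd]) measurable

lemma space_dxH [simp]: "space dxH = halfspace"
  by simp

lemma borel_measurable_dxH:
  fixes f :: "(real^'m) \<times> real \<Rightarrow> 'b::topological_space"
  shows "f \<in> borel_measurable borel \<Longrightarrow> f \<in> borel_measurable dxH"
  by (intro measurable_restrict_space1 measurable_completion) simp

lemma integrable_dxH_iff:
  fixes f :: "(real^'m) \<times> real \<Rightarrow> 'b::euclidean_space"
  shows "integrable dxH f \<longleftrightarrow> integrable lebesgue (\<lambda>x. indicator halfspace x *\<^sub>R f x)"
  by (rule integrable_restrict_space) simp

lemma integral_dxH:
  fixes f :: "(real^'m) \<times> real \<Rightarrow> 'b::euclidean_space"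
  shows "(\<integral>x. f x \<partial>dxH) = (\<integral>x. indicator halfspace x *\<^sub>R f x \<partial>lebesgue)"
  by (rule integral_restrict_space) simp

lemma nn_integral_dxH:
  fixes f :: "(real^'m) \<times> real \<Rightarrow> ennreal"
  shows "(\<integral>\<^sup>+x. f x \<partial>dxH) = (\<integral>\<^sup>+x. f x * indicator halfspace x \<partial>lborel)"
  by (subst nn_integral_restrict_space) (auto simp: nn_integral_completion)

lemma AE_dxH_iff:
  "(AE x in (dxH :: ((real^'m) \<times> real) measure). P x) \<longleftrightarrow> (AE x in lebesgue. x \<in> halfspace \<longrightarrow> P x)"
  by (rule AE_restrict_space_iff) simp

lemma integrable_dxH_bounded:
  fixes f :: "(real^'m) \<times> real \<Rightarrow> 'b::euclidean_space"
  assumes f: "f \<in> borel_measurable dxH" and B: "\<And>x. x \<in> halfspace \<Longrightarrow> norm (f x) \<le> B"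
    and R: "\<And>x. x \<in> halfspace \<Longrightarrow> R \<le> norm x \<Longrightarrow> f x = 0"
  shows "integrable dxH f"
proof (rule Bochner_Integration.integrable_bound[OF _ f])
  have "integrable lebesgue (\<lambda>x::(real^'m) \<times> real. indicator (halfspace \<inter> cball 0 R) x *\<^sub>R \<bar>B\<bar>)"
  proof (intro integrable_scaleR_left integrable_real_indicator)
    show "emeasure lebesgue ((halfspace :: ((real^'m) \<times> real) set) \<inter> cball 0 R) < \<infinity>"
      using emeasure_mono[of "(halfspace :: ((real^'m) \<times> real) set) \<inter> cball 0 R" "cball 0 R" lebesgue]
        emeasure_lborel_cball_finite[of "0 :: (real^'m) \<times> real" R] by (auto intro: le_less_trans)
  qed auto
  then show "integrable dxH (\<lambda>x::(real^'m) \<times> real. indicator (cball 0 R) x *\<^sub>R \<bar>B\<bar>)"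
    unfolding integrable_dxH_iff by (simp add: indicator_inter_arith mult.assoc)
  show "AE x in dxH. norm (f x) \<le> norm (indicator (cball 0 R) x *\<^sub>R \<bar>B\<bar>)"
    using B R by (intro AE_I2) (fastforce simp: indicator_def)
qed

subsection \<open>Differentiation under translations\<close>

text \<open>Dominated convergence for translations in one direction. The set \<open>S\<close> and
  positive steps only are allowed for because the half-space is stable under upward translations
  alone.\<close>

lemma difference_quotient_integral:
  fixes F G :: "'a::euclidean_space \<Rightarrow> real"
  assumes F [measurable]: "F \<in> borel_measurable borel" and G [measurable]: "G \<in> borel_measurable borel"
    and S [measurable]: "S \<in> sets borel"
    and L: "0 \<le> L" and lip: "\<And>x t. x \<in> S \<Longrightarrow> 0 < t \<Longrightarrow> t \<le> 1 \<Longrightarrow> \<bar>F (x + t *\<^sub>R e) - F x\<bar> \<le> L * t * indicator (cball 0 R) x"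
    and lim: "\<And>x. x \<in> S \<Longrightarrow> ((\<lambda>t. (F (x + t *\<^sub>R e) - F x) / t) \<longlongrightarrow> G x) (at_right 0)"
  shows "integrable lborel (\<lambda>x. indicator S x * G x)"
    "\<And>n. integrable lborel (\<lambda>x. indicator S x * ((F (x + (1 / real (Suc n)) *\<^sub>R e) - F x) / (1 / real (Suc n))))"
    "(\<lambda>n. \<integral>x. indicator S x * ((F (x + (1 / real (Suc n)) *\<^sub>R e) - F x) / (1 / real (Suc n))) \<partial>lborel) \<longlonglongrightarrow> (\<integral>x. indicator S x * G x \<partial>lborel)"
proof -
  have i: "integrable lborel (\<lambda>x::'a. indicator (cball 0 R) x * L)"
    by (intro integrable_mult_left integrable_real_indicator emeasure_lborel_cball_finite) auto
  have tau: "filterlim (\<lambda>n. 1 / real (Suc n)) (at_right 0) sequentially"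
    unfolding filterlim_at using LIMSEQ_Suc[OF lim_1_over_n] by (simp add: eventually_sequentially)
  have l: "(\<lambda>n. indicator S x * ((F (x + (1 / real (Suc n)) *\<^sub>R e) - F x) / (1 / real (Suc n)))) \<longlonglongrightarrow> indicator S x * G x" for x
  proof (cases "x \<in> S")
    case True
    show ?thesis by (intro tendsto_mult tendsto_const filterlim_compose[OF lim[OF True] tau])
  qed simp
  have b: "norm (indicator S x * ((F (x + (1 / real (Suc n)) *\<^sub>R e) - F x) / (1 / real (Suc n)))) \<le> indicator (cball 0 R) x * L" for x n
  proof (cases "x \<in> S")
    case True
    have "\<bar>F (x + (1 / real (Suc n)) *\<^sub>R e) - F x\<bar> \<le> L * (1 / real (Suc n)) * indicator (cball 0 R) x"
      by (rule lip[OF True]) auto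
    then have "\<bar>F (x + (1 / real (Suc n)) *\<^sub>R e) - F x\<bar> / (1 / real (Suc n)) \<le> L * indicator (cball 0 R) x"
      by (subst pos_divide_le_eq) (auto simp: mult_ac)
    then show ?thesis using True by (simp add: abs_mult mult_ac)
  next
    case False
    then show ?thesis using L by simp
  qed
  have m: "(\<lambda>x. indicator S x * G x) \<in> borel_measurable lborel"
    "(\<lambda>x. indicator S x * ((F (x + (1 / real (Suc n)) *\<^sub>R e) - F x) / (1 / real (Suc n)))) \<in> borel_measurable lborel" for n
    by measurable
  show "integrable lborel (\<lambda>x. indicator S x * G x)"
    using integrable_dominated_convergence[OF m(1) m(2) i, of "\<lambda>n. n"] l b by auto
  show "integrable lborel (\<lambda>x. indicator S x * ((F (x + (1 / real (Suc n)) *\<^sub>R e) - F x) / (1 / real (Suc n))))" for n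
    using b[of _ n] m(2)[of n] by (intro Bochner_Integration.integrable_bound[OF i]) (auto intro: order_trans[OF _ abs_ge_self])
  show "(\<lambda>n. \<integral>x. indicator S x * ((F (x + (1 / real (Suc n)) *\<^sub>R e) - F x) / (1 / real (Suc n))) \<partial>lborel)
      \<longlonglongrightarrow> (\<integral>x. indicator S x * G x \<partial>lborel)"
    using integral_dominated_convergence[OF m(1) m(2) i, of "\<lambda>n. n"] l b by auto
qed

lemma integral_translate:
  fixes F :: "'a::euclidean_space \<Rightarrow> real"
  shows "(\<integral>x. F (x + c) \<partial>lborel) = (\<integral>x. F x \<partial>lborel)"
    and "integrable lborel F \<Longrightarrow> integrable lborel (\<lambda>x. F (x + c))"
proof -
  have *: "distr lborel lborel (\<lambda>x. x + c) = (lborel :: 'a measure)"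
    using lborel_distr_plus[of c] by (simp add: add.commute cong: distr_cong)
  show i: "integrable lborel F \<Longrightarrow> integrable lborel (\<lambda>x. F (x + c))"
    using integrable_distr[of "\<lambda>x. x + c" lborel lborel F] unfolding * by simp
  show "(\<integral>x. F (x + c) \<partial>lborel) = (\<integral>x. F x \<partial>lborel)"
  proof (cases "F \<in> borel_measurable borel")
    case True
    then show ?thesis using integral_distr[of "\<lambda>x. x + c" lborel lborel F] unfolding * by simp
  next
    \<comment> \<open>A translate of a non-measurable function is non-measurable as well, so both
      integrals have the default value 0.\<close>
    case False
    have "(\<lambda>x. F (x + c)) \<notin> borel_measurable borel"
    proof
      assume "(\<lambda>x. F (x + c)) \<in> borel_measurable borel"
      then have "(\<lambda>x. F ((x - c) + c)) \<in> borel_measurable borel" by (rule measurable_compose[rotated]) measurable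
      then show False using False by simp
    qed
    then show ?thesis using False
      by (metis borel_measurable_integrable measurable_lborel2 not_integrable_integral_eq)
  qed
qed

text \<open>The mean value theorem on the segment. The ball has radius R + 1 because a shift of
  length at most 1 can move a point outside it no closer to the origin than R.\<close>

lemma line_difference_bound:
  fixes F :: "'a::euclidean_space \<Rightarrow> real"
  assumes d: "\<And>s. 0 \<le> s \<Longrightarrow> s \<le> 1 \<Longrightarrow> ((\<lambda>s. F (x + s *\<^sub>R e)) has_real_derivative D (x + s *\<^sub>R e)) (at s)"
    and D: "\<And>s. 0 \<le> s \<Longrightarrow> s \<le> 1 \<Longrightarrow> \<bar>D (x + s *\<^sub>R e)\<bar> \<le> L"
    and supp: "\<And>s. 0 \<le> s \<Longrightarrow> s \<le> 1 \<Longrightarrow> R \<le> norm (x + s *\<^sub>R e) \<Longrightarrow> F (x + s *\<^sub>R e) = 0"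
    and e: "norm e \<le> 1" and L: "0 \<le> L" and t: "0 < t" "t \<le> 1"
  shows "\<bar>F (x + t *\<^sub>R e) - F x\<bar> \<le> L * t * indicator (cball 0 (R + 1)) x"
proof (cases "x \<in> cball 0 (R + 1)")
  case True
  obtain s where s: "0 < s" "s < t" "F (x + t *\<^sub>R e) - F (x + 0 *\<^sub>R e) = (t - 0) * D (x + s *\<^sub>R e)"
    using MVT2[of 0 t "\<lambda>s. F (x + s *\<^sub>R e)" "\<lambda>s. D (x + s *\<^sub>R e)"] t d by fastforce
  then have "\<bar>F (x + t *\<^sub>R e) - F x\<bar> = t * \<bar>D (x + s *\<^sub>R e)\<bar>" using t by (simp add: abs_mult)
  also have "\<dots> \<le> t * L" using D s t by (intro mult_left_mono) auto
  finally show ?thesis using True by (simp add: mult.commute)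
next
  case False
  have "R \<le> norm (x + s *\<^sub>R e)" if "0 \<le> s" "s \<le> 1" for s
  proof -
    have "norm (s *\<^sub>R e) \<le> 1" using that e by (simp add: mult_le_one)
    then show ?thesis using False norm_triangle_ineq4[of "x + s *\<^sub>R e" "s *\<^sub>R e"] by simp
  qed
  then have "F (x + t *\<^sub>R e) = 0" "F (x + 0 *\<^sub>R e) = 0" using supp t by (metis less_imp_le order_refl zero_le_one)+
  then show ?thesis using L t by simp
qed

lemma quotient_limit:
  fixes F :: "'a::real_normed_vector \<Rightarrow> real"
  assumes "((\<lambda>s. F (x + s *\<^sub>R e)) has_real_derivative D) (at 0)"
  shows "((\<lambda>t. (F (x + t *\<^sub>R e) - F x) / t) \<longlongrightarrow> D) (at_right 0)"
proof -
  have "((\<lambda>t. (F (x + t *\<^sub>R e) - F x) / t) \<longlongrightarrow> D) (at 0)" using assms unfolding DERIV_def by simp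
  then show ?thesis by (rule tendsto_mono[OF at_le, rotated]) simp
qed

lemma Cc_infty_line_derivative:
  assumes "f \<in> Cc_infty S"
  shows "((\<lambda>s. f (x + s *\<^sub>R e)) has_real_derivative grad f (x + s *\<^sub>R e) \<bullet> e) (at s)"
proof -
  have "((\<lambda>s. f (x + s *\<^sub>R e)) has_derivative (\<lambda>h. grad f (x + s *\<^sub>R e) \<bullet> (h *\<^sub>R e))) (at s)"
    by (rule has_derivative_compose[OF _ Cc_infty_has_derivative[OF assms]]) (auto intro!: derivative_eq_intros)
  then show ?thesis by (simp add: has_field_derivative_def mult_commute_abs)
qed

text \<open>Translation invariance makes the integral of every difference quotient vanish, so the
  divergence theorem for compact support follows without iterated integrals.\<close>

lemma integral_grad_eq_0:
  fixes f :: "'a::euclidean_space \<Rightarrow> real"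
  assumes f: "f \<in> Cc_infty UNIV" and e: "e \<in> Basis"
  shows "(\<integral>x. grad f x \<bullet> e \<partial>lborel) = 0"
proof -
  note [measurable] = Cc_infty_measurable[OF f]
  obtain B where B: "0 \<le> B" "\<And>x. norm (grad f x) \<le> B" "\<And>x. \<bar>f x\<bar> \<le> B"
    using Cc_infty_bounded[OF f] by blast
  obtain R where R: "0 < R" "\<And>x. R \<le> norm x \<Longrightarrow> f x = 0 \<and> grad f x = 0" using Cc_infty_support[OF f] by blast
  have gb: "\<bar>grad f x \<bullet> e\<bar> \<le> B" for x
    using Basis_le_norm[OF e, of "grad f x"] B(2)[of x] by simp
  have lip: "\<bar>f (x + t *\<^sub>R e) - f x\<bar> \<le> B * t * indicator (cball 0 (R + 1)) x" if "0 < t" "t \<le> 1" for x t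
  proof (rule line_difference_bound[where D = "\<lambda>x. grad f x \<bullet> e"])
    show "((\<lambda>s. f (x + s *\<^sub>R e)) has_real_derivative grad f (x + s *\<^sub>R e) \<bullet> e) (at s)" for s
      by (rule Cc_infty_line_derivative[OF f])
    show "f (x + s *\<^sub>R e) = 0" if "R \<le> norm (x + s *\<^sub>R e)" for s using R(2)[OF that] by simp
  qed (use gb B(1) e that in auto)
  have lim: "((\<lambda>t. (f (x + t *\<^sub>R e) - f x) / t) \<longlongrightarrow> grad f x \<bullet> e) (at_right 0)" for x
    
  proof (rule quotient_limit)
    show "((\<lambda>s. f (x + s *\<^sub>R e)) has_real_derivative grad f x \<bullet> e) (at 0)"
      using Cc_infty_line_derivative[OF f, of x e 0] by simp
  qed
  have fi: "integrable lborel f"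
  proof (rule Bochner_Integration.integrable_bound)
    show "integrable lborel (\<lambda>x::'a. indicator (cball 0 R) x * B)"
      by (intro integrable_mult_left integrable_real_indicator emeasure_lborel_cball_finite) auto
    show "AE x in lborel. norm (f x) \<le> norm (indicator (cball 0 R) x * B)"
    proof (rule AE_I2)
      fix x
      show "norm (f x) \<le> norm (indicator (cball 0 R) x * B)"
        using R(2)[of x] B(3)[of x] B(1) by (cases "norm x \<le> R") auto
    qed
  qed measurable
  have "(\<lambda>n. \<integral>x. indicator UNIV x * ((f (x + (1 / real (Suc n)) *\<^sub>R e) - f x) / (1 / real (Suc n))) \<partial>lborel)
      \<longlonglongrightarrow> (\<integral>x. indicator UNIV x * (grad f x \<bullet> e) \<partial>lborel)"
    by (rule difference_quotient_integral(3)[where L = B and R = "R + 1"]) (auto intro: lip lim B(1))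
  moreover have "(\<integral>x. indicator UNIV x * ((f (x + (1 / real (Suc n)) *\<^sub>R e) - f x) / (1 / real (Suc n))) \<partial>lborel) = 0" for n
    using integral_translate(1)[of f "(1 / real (Suc n)) *\<^sub>R e"] integral_translate(2)[OF fi, of "(1 / real (Suc n)) *\<^sub>R e"] fi
    by simp
  ultimately show ?thesis by (simp only: LIMSEQ_const_iff indicator_UNIV mult_1)
qed

subsection \<open>Hardy's inequality\<close>

text \<open>Instead of optimising constants, the cases p z \<le> k y and p z > k y are separated; in
  each one term on the right already suffices.\<close>

lemma young_powr:
  fixes p y z k :: real
  assumes "1 < p" "0 \<le> y" "0 \<le> z" "0 < k"
  shows "p * y powr (p - 1) * z \<le> k * y powr p + p * (p / k) powr (p - 1) * z powr p"
proof (cases "p * z \<le> k * y")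
  case True
  have "p * y powr (p - 1) * z = (p * z) * y powr (p - 1)" by simp
  also have "\<dots> \<le> (k * y) * y powr (p - 1)" using True by (intro mult_right_mono) auto
  also have "\<dots> = k * y powr p" using assms by (cases "y = 0") (auto simp: powr_diff)
  finally show ?thesis using assms by (simp add: add_increasing2)
next
  case False
  then have "y \<le> (p / k) * z" using assms by (simp add: field_simps)
  then have "y powr (p - 1) \<le> ((p / k) * z) powr (p - 1)" using assms by (intro powr_mono2) auto
  then have "p * y powr (p - 1) * z \<le> p * ((p / k) * z) powr (p - 1) * z"
    using assms by (intro mult_right_mono mult_left_mono) auto
  also have "\<dots> = p * (p / k) powr (p - 1) * (z powr (p - 1) * z)"
    using powr_mult[of "p / k" z "p - 1"] by (simp add: assms del: times_divide_eq_left)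
  also have "z powr (p - 1) * z = z powr p" using assms by (cases "z = 0") (auto simp: powr_diff)
  finally show ?thesis using assms by (simp add: add_increasing)
qed

text \<open>The vertical derivative of (1 + x_N)^\<kappa> times the p-th power of the modulus of f
  has integral at most 0, because the boundary contribution at x_N = 0 is nonpositive. Its two terms
  are the Hardy integral times \<kappa> > 0 and a mixed term, half of which Young's inequality
  absorbs.\<close>

theorem hardy_halfspace:
  fixes f :: "(real^'m) \<times> real \<Rightarrow> real" and p \<gamma> :: real
  assumes f: "f \<in> Cc_infty UNIV" and p: "1 < p" and \<gamma>: "p - 1 < \<gamma>"
  defines "\<kappa> \<equiv> \<gamma> - p + 1"
  shows "integrable dxH (\<lambda>x. (1 + snd x) powr (\<gamma> - p) * \<bar>f x\<bar> powr p)"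
    "integrable dxH (\<lambda>x. (1 + snd x) powr \<gamma> * norm (grad f x) powr p)"
    "(\<integral>x. (1 + snd x) powr (\<gamma> - p) * \<bar>f x\<bar> powr p \<partial>dxH)
      \<le> 2 / \<kappa> * (p * (2 * p / \<kappa>) powr (p - 1)) * (\<integral>x. (1 + snd x) powr \<gamma> * norm (grad f x) powr p \<partial>dxH)"
proof -
  let ?e = "(0, 1) :: (real^'m) \<times> real"
  have \<kappa>: "0 < \<kappa>" using \<gamma> by (simp add: \<kappa>_def)
  note fm [measurable] = Cc_infty_measurable[OF f]
  obtain B where B: "0 \<le> B" "\<And>x. norm (grad f x) \<le> B" "\<And>x. \<bar>f x\<bar> \<le> B"
    using Cc_infty_bounded[OF f] by blast
  obtain R where R: "0 < R" "\<And>x. R \<le> norm x \<Longrightarrow> f x = 0 \<and> grad f x = 0" using Cc_infty_support[OF f] by blast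
  have pw: "(1 + snd x) powr a \<le> (1 + R) powr \<bar>a\<bar>" if "x \<in> halfspace" "norm x \<le> R" for x :: "(real^'m) \<times> real" and a
  proof -
    have x: "1 \<le> 1 + snd x" "1 + snd x \<le> 1 + R" using that norm_snd_le[of "snd x" "fst x"] by (auto simp: halfspace_def)
    have "(1 + snd x) powr a \<le> (1 + snd x) powr \<bar>a\<bar>" using x(1) by (intro powr_mono) auto
    also have "\<dots> \<le> (1 + R) powr \<bar>a\<bar>" using x by (intro powr_mono2) auto
    finally show ?thesis .
  qed
  have int: "integrable dxH (\<lambda>x. (1 + snd x) powr a * h x)"
    if [measurable]: "h \<in> borel_measurable borel" and h: "\<And>x. \<bar>h x\<bar> \<le> C" "\<And>x. R \<le> norm x \<Longrightarrow> h x = 0"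
    for h :: "(real^'m) \<times> real \<Rightarrow> real" and a C
  proof (rule integrable_dxH_bounded[of _ "(1 + R) powr \<bar>a\<bar> * C" R])
    show "(\<lambda>x. (1 + snd x) powr a * h x) \<in> borel_measurable dxH" by (rule borel_measurable_dxH) measurable
    have C: "0 \<le> C" using h(1)[of 0] by simp
    show "norm ((1 + snd x) powr a * h x) \<le> (1 + R) powr \<bar>a\<bar> * C" if "x \<in> halfspace" for x
    proof (cases "norm x \<le> R")
      case True
      then show ?thesis unfolding norm_mult using pw[OF that] h(1) by (intro mult_mono) auto
    qed (use h C in simp_all)
  qed (use h in simp_all)
  have fp: "\<bar>\<bar>f x\<bar> powr p\<bar> \<le> B powr p" "\<bar>norm (grad f x) powr p\<bar> \<le> B powr p" for x
    using B(2)[of x] B(3)[of x] p by (auto intro!: powr_mono2)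
  show i1: "integrable dxH (\<lambda>x. (1 + snd x) powr (\<gamma> - p) * \<bar>f x\<bar> powr p)"
    by (rule int[of _ "B powr p"]) (use fp R(2) in simp_all)
  show i2: "integrable dxH (\<lambda>x. (1 + snd x) powr \<gamma> * norm (grad f x) powr p)"
    by (rule int[of _ "B powr p"]) (use fp R(2) in simp_all)
  define F where "F x = (1 + snd x) powr \<kappa> * \<bar>f x\<bar> powr p" for x
  define g where "g x = p * \<bar>f x\<bar> powr (p - 2) * (f x * (grad f x \<bullet> ?e))" for x
  define G where "G x = \<kappa> * (1 + snd x) powr (\<gamma> - p) * \<bar>f x\<bar> powr p + (1 + snd x) powr \<kappa> * g x" for x
  have [measurable]: "F \<in> borel_measurable borel" "g \<in> borel_measurable borel" "G \<in> borel_measurable borel"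
    unfolding F_def[abs_def] G_def[abs_def] g_def[abs_def] by measurable
  have gle: "\<bar>g x\<bar> \<le> p * \<bar>f x\<bar> powr (p - 1) * norm (grad f x)" for x
  proof -
    have "\<bar>grad f x \<bullet> ?e\<bar> \<le> norm (grad f x)" using Basis_le_norm[of ?e "grad f x"] by (simp add: Basis_prod_def)
    moreover have "\<bar>f x\<bar> powr (p - 2) * \<bar>f x\<bar> = \<bar>f x\<bar> powr (p - 1)"
      using powr_add[of "\<bar>f x\<bar>" "p - 2" 1] by simp
    ultimately show ?thesis
      using p by (simp add: g_def abs_mult mult.assoc[symmetric]) (simp add: mult.assoc mult_left_mono)
  qed
  have gB: "\<bar>g x\<bar> \<le> p * B powr (p - 1) * B" for x
    by (rule order_trans[OF gle]) (use B(1) B(2)[of x] B(3)[of x] p in \<open>intro mult_mono powr_mono2, simp_all\<close>)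
  have g0: "g x = 0" "F x = 0" if "R \<le> norm x" for x using R(2)[OF that] p by (auto simp: g_def F_def)
  define L where "L = \<kappa> * (1 + R) powr \<bar>\<gamma> - p\<bar> * B powr p + (1 + R) powr \<bar>\<kappa>\<bar> * (p * B powr (p - 1) * B)"
  have L: "0 \<le> L" using B p \<kappa> by (auto simp: L_def)
  have GL: "\<bar>G x\<bar> \<le> L" if x: "x \<in> halfspace" for x
  proof (cases "norm x \<le> R")
    case True
    have "\<bar>G x\<bar> \<le> \<kappa> * (1 + snd x) powr (\<gamma> - p) * \<bar>f x\<bar> powr p + (1 + snd x) powr \<kappa> * \<bar>g x\<bar>"
      unfolding G_def using \<kappa> by (intro abs_triangle_ineq[THEN order_trans]) (auto simp: abs_mult)
    also have "\<dots> \<le> L"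
      unfolding L_def using pw[OF x True, of "\<gamma> - p"] pw[OF x True, of \<kappa>] fp(1)[of x] gB[of x] \<kappa>
      by (intro add_mono mult_mono) simp_all
    finally show ?thesis .
  next
    case False
    then show ?thesis using L R(2)[of x] g0(1)[of x] p by (simp add: G_def)
  qed
  have DF: "((\<lambda>s. F (x + s *\<^sub>R ?e)) has_real_derivative G (x + s *\<^sub>R ?e)) (at s)" if x: "x \<in> halfspace" "0 \<le> s" for x s
  proof -
    have sn: "0 < 1 + (snd x + s)" using x by (simp add: halfspace_def)
    have "((\<lambda>s. \<bar>f (x + s *\<^sub>R ?e)\<bar> powr p) has_derivative (\<lambda>h. p * \<bar>f (x + s *\<^sub>R ?e)\<bar> powr (p - 2) * (f (x + s *\<^sub>R ?e) * ((grad f (x + s *\<^sub>R ?e) \<bullet> ?e) * h)))) (at s)"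
      using has_derivative_compose[OF Cc_infty_line_derivative[OF f, of x ?e s, unfolded has_field_derivative_def]
          has_derivative_norm_powr[OF p, of "f (x + s *\<^sub>R ?e)"]] by simp
    then have 1: "((\<lambda>s. \<bar>f (x + s *\<^sub>R ?e)\<bar> powr p) has_real_derivative g (x + s *\<^sub>R ?e)) (at s)"
      unfolding has_field_derivative_def g_def by (rule has_derivative_eq_rhs) (simp add: fun_eq_iff)
    have 2: "((\<lambda>s. (1 + (snd x + s)) powr \<kappa>) has_real_derivative \<kappa> * (1 + (snd x + s)) powr (\<gamma> - p)) (at s)"
    proof -
      have "((\<lambda>s. 1 + (snd x + s)) has_real_derivative 1) (at s)" by (auto intro!: derivative_eq_intros)
      from DERIV_chain2[OF has_real_derivative_powr[OF sn, of \<kappa>] this] show ?thesis by (simp add: \<kappa>_def)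
    qed
    show ?thesis
      unfolding F_def using DERIV_mult[OF 2 1] by (simp add: G_def algebra_simps)
  qed
  have stable: "x + t *\<^sub>R ?e \<in> halfspace" if "x \<in> halfspace" "0 \<le> t" for x t
    using that by (simp add: halfspace_def)
  have lip: "\<bar>F (x + t *\<^sub>R ?e) - F x\<bar> \<le> L * t * indicator (cball 0 (R + 1)) x" if x: "x \<in> halfspace" and t: "0 < t" "t \<le> 1" for x t
    by (rule line_difference_bound[of F x ?e G]) (use DF[OF x] GL stable[OF x] g0(2) L t in \<open>simp_all add: norm_Pair\<close>)
  have lim: "((\<lambda>t. (F (x + t *\<^sub>R ?e) - F x) / t) \<longlongrightarrow> G x) (at_right 0)" if x: "x \<in> halfspace" for x
    using quotient_limit[of F x ?e "G x"] DF[OF x, of 0] by (simp add: zero_prod_def[symmetric])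
  have FB: "\<bar>indicator halfspace x * F x\<bar> \<le> indicator (cball 0 R) x * ((1 + R) powr \<bar>\<kappa>\<bar> * B powr p)" for x
  proof (cases "x \<in> halfspace \<and> norm x \<le> R")
    case True
    then show ?thesis unfolding F_def using pw[of x \<kappa>] fp(1)[of x] by (simp add: abs_mult mult_mono)
  next
    case False
    then show ?thesis using g0(2)[of x] by (cases "x \<in> halfspace") simp_all
  qed
  have iF: "integrable lborel (\<lambda>x. indicator halfspace x * F x)"
  proof (rule Bochner_Integration.integrable_bound)
    show "integrable lborel (\<lambda>x::(real^'m) \<times> real. indicator (cball 0 R) x * ((1 + R) powr \<bar>\<kappa>\<bar> * B powr p))"
      by (intro integrable_mult_left integrable_real_indicator emeasure_lborel_cball_finite) auto
    show "AE x in lborel. norm (indicator halfspace x * F x) \<le> norm (indicator (cball 0 R) x * ((1 + R) powr \<bar>\<kappa>\<bar> * B powr p))"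
      using FB by (intro AE_I2) (metis abs_ge_self order_trans real_norm_def)
  qed measurable
  have GI: "integrable lborel (\<lambda>x. indicator halfspace x * G x)"
    and QI: "\<And>n. integrable lborel (\<lambda>x. indicator halfspace x * ((F (x + (1 / real (Suc n)) *\<^sub>R ?e) - F x) / (1 / real (Suc n))))"
    and GT: "(\<lambda>n. \<integral>x. indicator halfspace x * ((F (x + (1 / real (Suc n)) *\<^sub>R ?e) - F x) / (1 / real (Suc n))) \<partial>lborel)
       \<longlonglongrightarrow> (\<integral>x. indicator halfspace x * G x \<partial>lborel)"
    using difference_quotient_integral[of F G halfspace L ?e "R + 1"] lip lim L by auto
  \<comment> \<open>The boundary sign in discrete form: an upward translate of the half-space lies
    inside it, so the integral of the nonnegative F over the translate cannot exceed the original
    one.\<close>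
  have "(\<integral>x. indicator halfspace x * ((F (x + (1 / real (Suc n)) *\<^sub>R ?e) - F x) / (1 / real (Suc n))) \<partial>lborel) \<le> 0" for n
  proof -
    define t where "t = 1 / real (Suc n)"
    have t: "0 < t" by (simp add: t_def)
    define J where "J x = indicator halfspace x * F x" for x
    have F0: "0 \<le> F x" for x by (simp add: F_def)
    have JI: "integrable lborel J" "integrable lborel (\<lambda>x. J (x + t *\<^sub>R ?e))"
      using iF integral_translate(2)[of J "t *\<^sub>R ?e"] by (auto simp: J_def[abs_def])
    have "(\<integral>x. indicator halfspace x * ((F (x + t *\<^sub>R ?e) - F x) / t) \<partial>lborel) \<le> (\<integral>x. (J (x + t *\<^sub>R ?e) - J x) / t \<partial>lborel)"
    proof (rule integral_mono)
      show "integrable lborel (\<lambda>x. indicator halfspace x * ((F (x + t *\<^sub>R ?e) - F x) / t))"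
        using QI[of n] by (simp add: t_def)
      show "integrable lborel (\<lambda>x. (J (x + t *\<^sub>R ?e) - J x) / t)" using JI by auto
      show "indicator halfspace x * ((F (x + t *\<^sub>R ?e) - F x) / t) \<le> (J (x + t *\<^sub>R ?e) - J x) / t" for x
        using stable[of x t] t F0[of "x + t *\<^sub>R ?e"] by (auto simp: J_def indicator_def)
    qed
    also have "\<dots> = 0" using JI integral_translate(1)[of J "t *\<^sub>R ?e"] by simp
    finally show ?thesis by (simp add: t_def)
  qed
  then have "(\<integral>x. indicator halfspace x * G x \<partial>lborel) \<le> 0"
    by (intro LIMSEQ_le_const2[OF GT]) blast
  then have Gle: "(\<integral>x. G x \<partial>dxH) \<le> 0"
    by (simp add: integral_dxH integral_completion)
  have iG: "integrable dxH G"
    unfolding integrable_dxH_iff using GI by (simp add: integrable_completion)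
  \<comment> \<open>The constant of \<open>young_powr\<close> with k = \<kappa>/2, which leaves the
    other half of \<kappa> in front of the Hardy integral.\<close>
  define C where "C = p * (p / (\<kappa> / 2)) powr (p - 1)"
  have low: "\<kappa> / 2 * ((1 + snd x) powr (\<gamma> - p) * \<bar>f x\<bar> powr p) - C * ((1 + snd x) powr \<gamma> * norm (grad f x) powr p) \<le> G x"
    if x: "x \<in> halfspace" for x
  proof -
    define w where "w = 1 + snd x"
    have w: "0 < w" using x by (simp add: w_def halfspace_def)
    have "w powr \<kappa> * \<bar>g x\<bar> \<le> w powr \<kappa> * (p * \<bar>f x\<bar> powr (p - 1) * norm (grad f x))"
      using gle[of x] by (intro mult_left_mono) auto
    also have "\<dots> = w powr (\<gamma> - p) * (p * \<bar>f x\<bar> powr (p - 1) * (w * norm (grad f x)))"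
      using w by (simp add: \<kappa>_def powr_add)
    also have "\<dots> \<le> w powr (\<gamma> - p) * (\<kappa> / 2 * \<bar>f x\<bar> powr p + C * (w * norm (grad f x)) powr p)"
      unfolding C_def using p w \<kappa> by (intro mult_left_mono young_powr) auto
    also have "\<dots> = \<kappa> / 2 * (w powr (\<gamma> - p) * \<bar>f x\<bar> powr p) + C * (w powr \<gamma> * norm (grad f x) powr p)"
      using w by (simp add: powr_mult powr_diff field_simps)
    finally have "w powr \<kappa> * \<bar>g x\<bar> \<le> \<kappa> / 2 * (w powr (\<gamma> - p) * \<bar>f x\<bar> powr p) + C * (w powr \<gamma> * norm (grad f x) powr p)" .
    moreover have "w powr \<kappa> * (- \<bar>g x\<bar>) \<le> w powr \<kappa> * g x" by (intro mult_left_mono) auto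
    moreover have "G x = \<kappa> * (w powr (\<gamma> - p) * \<bar>f x\<bar> powr p) + w powr \<kappa> * g x" by (simp add: G_def w_def)
    ultimately show ?thesis by (simp add: w_def)
  qed
  have "\<kappa> / 2 * (\<integral>x. (1 + snd x) powr (\<gamma> - p) * \<bar>f x\<bar> powr p \<partial>dxH) - C * (\<integral>x. (1 + snd x) powr \<gamma> * norm (grad f x) powr p \<partial>dxH)
     = (\<integral>x. \<kappa> / 2 * ((1 + snd x) powr (\<gamma> - p) * \<bar>f x\<bar> powr p) - C * ((1 + snd x) powr \<gamma> * norm (grad f x) powr p) \<partial>dxH)"
    using i1 i2 by simp
  also have "\<dots> \<le> (\<integral>x. G x \<partial>dxH)"
    using i1 i2 iG low by (intro integral_mono) auto
  finally have "\<kappa> / 2 * (\<integral>x. (1 + snd x) powr (\<gamma> - p) * \<bar>f x\<bar> powr p \<partial>dxH) \<le> C * (\<integral>x. (1 + snd x) powr \<gamma> * norm (grad f x) powr p \<partial>dxH)"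
    using Gle by simp
  then show "(\<integral>x. (1 + snd x) powr (\<gamma> - p) * \<bar>f x\<bar> powr p \<partial>dxH)
      \<le> 2 / \<kappa> * (p * (2 * p / \<kappa>) powr (p - 1)) * (\<integral>x. (1 + snd x) powr \<gamma> * norm (grad f x) powr p \<partial>dxH)"
    using \<kappa> by (simp add: C_def field_simps)
qed

section \<open>Decomposition of the half-space into cells\<close>

text \<open>The half-open sides are those of the level sets of \<open>floor\<close> in the
  tangential directions and of \<open>ceiling\<close> in the normal one. The ceiling is used there
  because it keeps the cells inside x_N > 0.\<close>

definition cell :: "real \<Rightarrow> ('m \<Rightarrow> real) \<Rightarrow> real \<Rightarrow> real \<Rightarrow> ((real^'m) \<times> real) set" where
  "cell \<delta> \<alpha> \<beta> \<beta>' = {x. (\<forall>i. \<alpha> i \<le> fst x $ i \<and> fst x $ i < \<alpha> i + \<delta>) \<and> \<beta> < snd x \<and> snd x \<le> \<beta>'}"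

lemma cell_diameter:
  assumes "x \<in> cell \<delta> \<alpha> \<beta> \<beta>'" "y \<in> (cell \<delta> \<alpha> \<beta> \<beta>' :: ((real^'m) \<times> real) set)"
  shows "norm (y - x) \<le> real CARD('m) * \<delta> + (\<beta>' - \<beta>)"
proof -
  have "norm (fst y - fst x) \<le> (\<Sum>i\<in>UNIV. \<bar>(fst y - fst x) $ i\<bar>)" by (rule norm_le_l1_cart)
  also have "\<dots> \<le> (\<Sum>i\<in>(UNIV::'m set). \<delta>)"
  proof (rule sum_mono)
    fix i :: 'm
    have "\<alpha> i \<le> fst x $ i" "fst x $ i < \<alpha> i + \<delta>" "\<alpha> i \<le> fst y $ i" "fst y $ i < \<alpha> i + \<delta>"
      using assms by (auto simp: cell_def)
    then show "\<bar>(fst y - fst x) $ i\<bar> \<le> \<delta>" by simp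
  qed
  finally have "norm (fst (y - x)) \<le> real CARD('m) * \<delta>" by simp
  moreover have "norm (snd (y - x)) \<le> \<beta>' - \<beta>" using assms by (auto simp: cell_def abs_le_iff)
  moreover have "norm (y - x) \<le> norm (fst (y - x)) + norm (snd (y - x))"
    using norm_Pair_le[of "fst (y - x)" "snd (y - x)"] by (simp only: prod.collapse)
  ultimately show ?thesis by linarith
qed

lemma convex_cell_set: "convex (cell \<delta> \<alpha> \<beta> \<beta>' :: ((real^'m) \<times> real) set)"
proof (rule convexI)
  fix x y :: "(real^'m) \<times> real" and u v :: real
  assume xy: "x \<in> cell \<delta> \<alpha> \<beta> \<beta>'" "y \<in> cell \<delta> \<alpha> \<beta> \<beta>'" and uv: "0 \<le> u" "0 \<le> v" "u + v = 1"
  have ge: "a \<le> u * b + v * c" if "a \<le> b" "a \<le> c" for a b c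
    using convex_bound_le[of "- b" "- a" "- c" u v] that uv by simp
  have gt: "a < u * b + v * c" if "a < b" "a < c" for a b c
    using convex_bound_lt[of "- b" "- a" "- c" u v] that uv by simp
  show "u *\<^sub>R x + v *\<^sub>R y \<in> cell \<delta> \<alpha> \<beta> \<beta>'"
    using xy uv by (auto simp: cell_def intro!: ge gt convex_bound_lt convex_bound_le)
qed

lemma cell_borel: "(cell \<delta> \<alpha> \<beta> \<beta>' :: ((real^'m) \<times> real) set) \<in> sets borel"
proof -
  have eq: "cell \<delta> \<alpha> \<beta> \<beta>' = (\<Inter>i. {x. \<alpha> i \<le> fst x $ i} \<inter> {x. fst x $ i < \<alpha> i + \<delta>}) \<inter> ({x. \<beta> < snd x} \<inter> {x::(real^'m) \<times> real. snd x \<le> \<beta>'})"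
    by (auto simp: cell_def)
  show ?thesis unfolding eq
    by (intro sets.Int sets.countable_INT'' borel_closed borel_open closed_Collect_le open_Collect_less continuous_intros) auto
qed

lemma cell_emeasure:
  assumes "0 < \<delta>" "\<beta> < \<beta>'"
  shows "ennreal (\<delta> ^ CARD('m) * (\<beta>' - \<beta>)) \<le> emeasure lborel (cell \<delta> \<alpha> \<beta> \<beta>' :: ((real^'m) \<times> real) set)"
proof -
  define a :: "real^'m" where "a = (\<chi> i. \<alpha> i)"
  define b :: "real^'m" where "b = (\<chi> i. \<alpha> i + \<delta>)"
  have ab: "(b - a) \<bullet> e = \<delta>" if e: "e \<in> Basis" for e
  proof -
    obtain i where "e = axis i 1" using e by (auto simp: Basis_vec_def)
    then show ?thesis by (simp add: inner_axis a_def b_def)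
  qed
  have le: "a \<bullet> e \<le> b \<bullet> e" if "e \<in> Basis" for e using ab[OF that] assms by (simp add: inner_diff_left)
  have "emeasure lborel (box a b \<times> {\<beta><..<\<beta>'}) = emeasure lborel (box a b) * emeasure lborel {\<beta><..<\<beta>'}"
    unfolding lborel_prod[symmetric] by (rule lborel.emeasure_pair_measure_Times) auto
  also have "emeasure lborel (box a b) = ennreal (\<delta> ^ CARD('m))"
    using le ab by (simp add: emeasure_lborel_box)
  also have "emeasure lborel {\<beta><..<\<beta>'} = ennreal (\<beta>' - \<beta>)" using assms by simp
  finally have "ennreal (\<delta> ^ CARD('m) * (\<beta>' - \<beta>)) = emeasure lborel (box a b \<times> {\<beta><..<\<beta>'})"
    using assms by (simp add: ennreal_mult)
  also have "\<dots> \<le> emeasure lborel (cell \<delta> \<alpha> \<beta> \<beta>' :: ((real^'m) \<times> real) set)"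
  proof (rule emeasure_mono)
    show "box a b \<times> {\<beta><..<\<beta>'} \<subseteq> cell \<delta> \<alpha> \<beta> \<beta>'"
      by (auto simp: cell_def a_def b_def mem_box_cart less_imp_le)
  qed (use cell_borel in auto)
  finally show ?thesis .
qed

lemma convex_cell_cell:
  assumes "0 < \<delta>" "\<beta> < \<beta>'"
  shows "convex_cell (cell \<delta> \<alpha> \<beta> \<beta>' :: ((real^'m) \<times> real) set)"
proof
  show "bounded (cell \<delta> \<alpha> \<beta> \<beta>' :: ((real^'m) \<times> real) set)"
    unfolding bounded_two_points dist_norm by (intro exI ballI) (rule cell_diameter, assumption+)
  have "0 < ennreal (\<delta> ^ CARD('m) * (\<beta>' - \<beta>))" using assms by simp
  then show "emeasure lborel (cell \<delta> \<alpha> \<beta> \<beta>' :: ((real^'m) \<times> real) set) \<noteq> 0"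
    using cell_emeasure[OF assms, where \<alpha> = \<alpha> and 'm = 'm] assms by auto
qed (rule convex_cell_set cell_borel)+

text \<open>A local inequality with a common constant is summed over the level sets of a countably
  valued index; the sum is an integral over a counting measure, so exchange of integrals does the
  work. No integrability is presupposed.\<close>

lemma nn_integral_partition_le:
  fixes c :: "'x \<Rightarrow> 'i::countable" and u v :: "'x \<Rightarrow> ennreal"
  assumes [measurable]: "u \<in> borel_measurable M" "v \<in> borel_measurable M"
    and cell: "\<And>x0. x0 \<in> space M \<Longrightarrow> {x \<in> space M. c x = c x0} \<in> sets M"
    and le: "\<And>x0. x0 \<in> space M \<Longrightarrow>
      (\<integral>\<^sup>+x. u x * indicator {x \<in> space M. c x = c x0} x \<partial>M) \<le> K * (\<integral>\<^sup>+x. v x * indicator {x \<in> space M. c x = c x0} x \<partial>M)"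
  shows "(\<integral>\<^sup>+x. u x \<partial>M) \<le> K * (\<integral>\<^sup>+x. v x \<partial>M)"
proof -
  define A where "A i = {x \<in> space M. c x = i}" for i
  have A_cases: "A i = {} \<or> (\<exists>x0\<in>space M. A i = {x \<in> space M. c x = c x0})" for i
    by (auto simp: A_def)
  have [measurable]: "A i \<in> sets M" for i using A_cases[of i] cell by auto
  have split: "(\<integral>\<^sup>+x. w x \<partial>M) = (\<integral>\<^sup>+i. \<integral>\<^sup>+x. w x * indicator (A i) x \<partial>M \<partial>count_space UNIV)"
    if [measurable]: "w \<in> borel_measurable M" for w :: "'x \<Rightarrow> ennreal"
  proof -
    have "(\<integral>\<^sup>+x. w x \<partial>M) = (\<integral>\<^sup>+x. \<integral>\<^sup>+i. w x * indicator (A i) x \<partial>count_space UNIV \<partial>M)"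
    proof (rule nn_integral_cong)
      fix x assume "x \<in> space M"
      then have "(\<integral>\<^sup>+i. w x * indicator (A i) x \<partial>count_space UNIV) = (\<integral>\<^sup>+i. w x * indicator {c x} i \<partial>count_space UNIV)"
        by (intro nn_integral_cong) (auto simp: A_def indicator_def)
      then show "w x = (\<integral>\<^sup>+i. w x * indicator (A i) x \<partial>count_space UNIV)" by simp
    qed
    also have "\<dots> = (\<integral>\<^sup>+i. \<integral>\<^sup>+x. w x * indicator (A i) x \<partial>M \<partial>count_space UNIV)"
      by (rule nn_integral_count_space_nn_integral) auto
    finally show ?thesis .
  qed
  have "(\<integral>\<^sup>+x. u x * indicator (A i) x \<partial>M) \<le> K * (\<integral>\<^sup>+x. v x * indicator (A i) x \<partial>M)" for i
    using A_cases[of i] le by auto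
  then have "(\<integral>\<^sup>+x. u x \<partial>M) \<le> (\<integral>\<^sup>+i. K * (\<integral>\<^sup>+x. v x * indicator (A i) x \<partial>M) \<partial>count_space UNIV)"
    unfolding split[OF assms(1)] by (intro nn_integral_mono)
  also have "\<dots> = K * (\<integral>\<^sup>+i. \<integral>\<^sup>+x. v x * indicator (A i) x \<partial>M \<partial>count_space UNIV)"
    by (rule nn_integral_cmult) simp
  also have "(\<integral>\<^sup>+i. \<integral>\<^sup>+x. v x * indicator (A i) x \<partial>M \<partial>count_space UNIV) = (\<integral>\<^sup>+x. v x \<partial>M)"
    by (rule split[OF assms(2), symmetric])
  finally show ?thesis .
qed

lemma nn_integral_dxH_subset:
  fixes u :: "(real^'m) \<times> real \<Rightarrow> ennreal"
  assumes "Q \<subseteq> halfspace"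
  shows "(\<integral>\<^sup>+x. u x * indicator Q x \<partial>dxH) = (\<integral>\<^sup>+x. u x * indicator Q x \<partial>lborel)"
  unfolding nn_integral_dxH using assms by (intro nn_integral_cong) (auto simp: indicator_def)

lemma (in convex_cell) measure_Q_pos: "0 < measure lborel Q"
proof -
  have "emeasure lborel Q = ennreal (measure lborel Q)"
    using emeasure_Q_finite by (simp add: emeasure_eq_ennreal_measure)
  then show ?thesis using Q_pos by (cases "measure lborel Q = 0") (auto simp: less_le)
qed

text \<open>Translates the normalised averages of the Sobolev-Poincare inequality into unnormalised
  integrals in [0,\<infinity>], which can be summed over cells.\<close>

lemma (in convex_cell) nn_integral_Q:
  fixes F :: "'a \<Rightarrow> real"
  assumes "F \<in> borel_measurable borel" "\<And>x. 0 \<le> F x" "\<And>x. F x \<le> B"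
  shows "(\<integral>\<^sup>+x. ennreal (F x) * indicator Q x \<partial>lborel) = ennreal (measure lborel Q * (\<integral>x. F x \<partial>\<mu>))"
proof -
  have V: "emeasure lborel Q = ennreal (measure lborel Q)"
    using emeasure_Q_finite by (simp add: emeasure_eq_ennreal_measure)
  have V0: "0 < measure lborel Q" by (rule measure_Q_pos)
  have "integrable \<mu> F" using assms by (intro integrable_\<mu>[of _ B]) auto
  then have "ennreal (\<integral>x. F x \<partial>\<mu>) = (\<integral>\<^sup>+x. ennreal (F x) \<partial>\<mu>)"
    using assms by (intro nn_integral_eq_integral[symmetric]) auto
  also have "\<dots> = (\<integral>\<^sup>+x. ennreal (F x) * indicator Q x \<partial>lborel) / emeasure lborel Q"
    using assms by (intro nn_integral_\<mu>) measurable
  finally have "ennreal (measure lborel Q) * ennreal (\<integral>x. F x \<partial>\<mu>)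
      = emeasure lborel Q * ((\<integral>\<^sup>+x. ennreal (F x) * indicator Q x \<partial>lborel) / emeasure lborel Q)"
    by (simp add: V)
  also have "\<dots> = (\<integral>\<^sup>+x. ennreal (F x) * indicator Q x \<partial>lborel)"
    using Q_pos emeasure_Q_finite by (simp add: ennreal_times_divide mult.commute[of "emeasure lborel Q"] mult_divide_eq_ennreal)
  finally show ?thesis using V0 by (simp add: ennreal_mult')
qed

lemma floor_cell:
  fixes L :: real assumes "0 < L"
  shows "\<lfloor>L * s\<rfloor> = \<lfloor>L * t\<rfloor> \<longleftrightarrow> of_int \<lfloor>L * t\<rfloor> / L \<le> s \<and> s < of_int \<lfloor>L * t\<rfloor> / L + 1 / L"
  using assms by (auto simp: floor_eq_iff field_simps)

section \<open>The weighted Sobolev inequality\<close>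

text \<open>Unit cells tangentially and dyadic layers 2^(j-1) < 1 + x_N \<le> 2^j vertically, so
  that each power of 1 + x_N is constant on a cell up to a fixed factor.\<close>

definition layer_index :: "(real^'m) \<times> real \<Rightarrow> ('m \<Rightarrow> int) \<times> int" where
  "layer_index x = (\<lambda>i. \<lfloor>fst x $ i\<rfloor>, \<lceil>log 2 (1 + snd x)\<rceil>)"

lemma layer_cell:
  fixes x0 :: "(real^'m) \<times> real"
  assumes x0: "x0 \<in> halfspace"
  defines "h \<equiv> 2 powr (real_of_int \<lceil>log 2 (1 + snd x0)\<rceil> - 1)"
  shows "{x \<in> halfspace. layer_index x = layer_index x0} = cell 1 (\<lambda>i. of_int \<lfloor>fst x0 $ i\<rfloor>) (h - 1) (2 * h - 1)"
    and "1 \<le> h"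
proof -
  define j where "j = \<lceil>log 2 (1 + snd x0)\<rceil>"
  have "0 < log 2 (1 + snd x0)" using x0 by (simp add: halfspace_def)
  then have j: "1 \<le> j" unfolding j_def by (simp add: Suc_le_eq flip: zero_less_ceiling)
  then show h1: "1 \<le> h" unfolding h_def j_def[symmetric] by (simp add: ge_one_powr_ge_zero)
  have h2: "2 * h = 2 powr real_of_int j" unfolding h_def j_def[symmetric] by (simp add: powr_diff)
  have "x \<in> halfspace \<and> layer_index x = layer_index x0 \<longleftrightarrow> x \<in> cell 1 (\<lambda>i. of_int \<lfloor>fst x0 $ i\<rfloor>) (h - 1) (2 * h - 1)" for x
  proof (cases "x \<in> halfspace")
    case True
    then have t: "0 < 1 + snd x" by (simp add: halfspace_def)
    have "\<lceil>log 2 (1 + snd x)\<rceil> = j \<longleftrightarrow> real_of_int j - 1 < log 2 (1 + snd x) \<and> log 2 (1 + snd x) \<le> real_of_int j"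
      by (simp add: ceiling_eq_iff)
    also have "\<dots> \<longleftrightarrow> h < 1 + snd x \<and> 1 + snd x \<le> 2 * h"
      using t by (simp add: less_log_iff log_le_iff h2) (simp add: h_def j_def)
    finally have "\<lceil>log 2 (1 + snd x)\<rceil> = \<lceil>log 2 (1 + snd x0)\<rceil> \<longleftrightarrow> h - 1 < snd x \<and> snd x \<le> 2 * h - 1"
      by (auto simp: j_def)
    moreover have "\<lfloor>fst x $ i\<rfloor> = \<lfloor>fst x0 $ i\<rfloor> \<longleftrightarrow> of_int \<lfloor>fst x0 $ i\<rfloor> \<le> fst x $ i \<and> fst x $ i < of_int \<lfloor>fst x0 $ i\<rfloor> + 1" for i
      by (simp add: floor_eq_iff)
    ultimately show ?thesis using True by (simp add: layer_index_def cell_def fun_eq_iff)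
  next
    case False
    then show ?thesis using h1 by (auto simp: cell_def halfspace_def)
  qed
  then show "{x \<in> halfspace. layer_index x = layer_index x0} = cell 1 (\<lambda>i. of_int \<lfloor>fst x0 $ i\<rfloor>) (h - 1) (2 * h - 1)"
    by auto
qed

text \<open>The quotient w/h lies in [1,2], hence each of its powers with exponent a or -a is at
  most 2 to the modulus of a, whatever the sign of a.\<close>

lemma layer_weight:
  fixes h w a :: real
  assumes "1 \<le> h" "h \<le> w" "w \<le> 2 * h"
  shows "w powr a \<le> 2 powr \<bar>a\<bar> * h powr a" "h powr a \<le> 2 powr \<bar>a\<bar> * w powr a"
proof -
  define q where "q = w / h"
  have q: "1 \<le> q" "q \<le> 2" "w = q * h" using assms by (auto simp: q_def field_simps)
  have "q powr b \<le> 2 powr \<bar>a\<bar>" if "b = a \<or> b = - a" for b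
  proof -
    have "q powr b \<le> q powr \<bar>b\<bar>" using q by (intro powr_mono) auto
    also have "\<dots> \<le> 2 powr \<bar>b\<bar>" using q by (intro powr_mono2) auto
    finally show ?thesis using that by auto
  qed
  from this[of a] this[of "- a"] have b: "q powr a \<le> 2 powr \<bar>a\<bar>" "q powr (- a) \<le> 2 powr \<bar>a\<bar>" by auto
  have w: "w powr a = q powr a * h powr a" using q assms by (simp add: powr_mult)
  show "w powr a \<le> 2 powr \<bar>a\<bar> * h powr a" unfolding w using b by (intro mult_right_mono) auto
  have "h powr a = q powr (- a) * w powr a" unfolding w using q by (simp add: powr_minus field_simps)
  then show "h powr a \<le> 2 powr \<bar>a\<bar> * w powr a" using b by (simp add: mult_right_mono)
qed

lemma powr_sum_le:
  fixes x y a :: real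
  assumes "0 \<le> x" "0 \<le> y" "0 \<le> a"
  shows "x powr a + y powr a \<le> 2 * (x + y) powr a"
proof -
  have "x powr a \<le> (x + y) powr a" "y powr a \<le> (x + y) powr a" using assms by (auto intro!: powr_mono2)
  then show ?thesis by simp
qed

text \<open>The required inequality is s \<le> k D with the subcritical gap D = s - N(s/p - 1), so
  every integer k \<ge> s/D will do.\<close>

lemma sobolev_exponent:
  fixes p s N :: real
  assumes "N * (s / p - 1) < s" "0 < s"
  obtains k :: nat where "1 \<le> k" "N * (s / p - 1) * real k \<le> s * (real k - 1)"
proof -
  define D where "D = s - N * (s / p - 1)"
  have D: "0 < D" using assms by (simp add: D_def)
  obtain k :: nat where k: "s / D \<le> real k" using real_arch_simple by blast
  have "0 < s / D" using D assms by simp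
  then have "1 \<le> k" using k by (cases k) auto
  moreover have "N * (s / p - 1) * real k \<le> s * (real k - 1)"
    using k D by (simp add: pos_divide_le_eq) (simp add: D_def algebra_simps)
  ultimately show ?thesis by (rule that)
qed

text \<open>The function is split into its deviation from the mean, controlled later by
  \<open>sobolev_poincare\<close>, and the mean itself, controlled by Jensen's inequality.\<close>

lemma (in convex_cell) power_mean_bound:
  fixes f :: "'a \<Rightarrow> real"
  assumes f [measurable]: "f \<in> borel_measurable borel" and fB: "\<And>x. \<bar>f x\<bar> \<le> B"
    and p: "1 \<le> p" "p \<le> s"
  shows "(\<integral>x. \<bar>f x\<bar> powr s \<partial>\<mu>)
    \<le> 2 powr s * ((\<integral>x. \<bar>f x - (\<integral>y. f y \<partial>\<mu>)\<bar> powr s \<partial>\<mu>) + (\<integral>x. \<bar>f x\<bar> powr p \<partial>\<mu>) powr (s / p))"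
    and "\<bar>\<integral>y. f y \<partial>\<mu>\<bar> powr p \<le> (\<integral>x. \<bar>f x\<bar> powr p \<partial>\<mu>)"
proof -
  define m where "m = (\<integral>y. f y \<partial>\<mu>)"
  have B0: "0 \<le> B" using fB[of 0] by simp
  have i: "integrable \<mu> (\<lambda>x. \<bar>f x + c\<bar> powr a)" if "0 \<le> a" for a c
  proof (rule integrable_\<mu>)
    show "\<bar>\<bar>f x + c\<bar> powr a\<bar> \<le> (B + \<bar>c\<bar>) powr a" for x
      using fB[of x] that by (auto intro!: powr_mono2)
  qed measurable
  have "\<bar>m\<bar> \<le> (\<integral>y. \<bar>f y\<bar> \<partial>\<mu>)" unfolding m_def by (rule integral_abs_bound)
  then have "\<bar>m\<bar> powr p \<le> (\<integral>y. \<bar>f y\<bar> \<partial>\<mu>) powr p" using p by (intro powr_mono2) auto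
  also have "\<dots> \<le> (\<integral>y. \<bar>f y\<bar> powr p \<partial>\<mu>)"
    using p i[of p 0] i[of 1 0] finite_measure_\<mu> by (intro jensen_powr) (auto simp: emeasure_\<mu>)
  finally have mp: "\<bar>m\<bar> powr p \<le> (\<integral>y. \<bar>f y\<bar> powr p \<partial>\<mu>)" .
  then show "\<bar>\<integral>y. f y \<partial>\<mu>\<bar> powr p \<le> (\<integral>x. \<bar>f x\<bar> powr p \<partial>\<mu>)" by (simp add: m_def)
  have "\<bar>m\<bar> powr s = (\<bar>m\<bar> powr p) powr (s / p)" using p by (simp add: powr_powr)
  also have "\<dots> \<le> (\<integral>y. \<bar>f y\<bar> powr p \<partial>\<mu>) powr (s / p)" using mp p by (intro powr_mono2) auto
  finally have ms: "\<bar>m\<bar> powr s \<le> (\<integral>y. \<bar>f y\<bar> powr p \<partial>\<mu>) powr (s / p)" .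
  have i2: "integrable \<mu> (\<lambda>x. \<bar>f x\<bar> powr s)" "integrable \<mu> (\<lambda>x. \<bar>f x - m\<bar> powr s)"
    using i[of s 0] i[of s "- m"] p by auto
  have "(\<integral>x. \<bar>f x\<bar> powr s \<partial>\<mu>) \<le> (\<integral>x. 2 powr s * (\<bar>f x - m\<bar> powr s + \<bar>m\<bar> powr s) \<partial>\<mu>)"
  proof (rule integral_mono)
    show "\<bar>f x\<bar> powr s \<le> 2 powr s * (\<bar>f x - m\<bar> powr s + \<bar>m\<bar> powr s)" for x
      using norm_add_powr_le[of s "f x - m" m] p by simp
  qed (use i2 in auto)
  also have "\<dots> = 2 powr s * ((\<integral>x. \<bar>f x - m\<bar> powr s \<partial>\<mu>) + \<bar>m\<bar> powr s)"
    using i2 by simp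
  also have "\<dots> \<le> 2 powr s * ((\<integral>x. \<bar>f x - m\<bar> powr s \<partial>\<mu>) + (\<integral>x. \<bar>f x\<bar> powr p \<partial>\<mu>) powr (s / p))"
    using ms by (intro mult_left_mono) auto
  finally show "(\<integral>x. \<bar>f x\<bar> powr s \<partial>\<mu>)
    \<le> 2 powr s * ((\<integral>x. \<bar>f x - (\<integral>y. f y \<partial>\<mu>)\<bar> powr s \<partial>\<mu>) + (\<integral>x. \<bar>f x\<bar> powr p \<partial>\<mu>) powr (s / p))"
    by (simp add: m_def)
qed

text \<open>The layers have height \<open>h\<close> comparable to \<open>1 + x\<^sub>N\<close>, while the cells have side 1 in the
  tangential directions; the resulting power \<open>h^((\<gamma> - p + 1)(1 - s/p))\<close> is at most 1.\<close>

lemma layer_sobolev: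
  fixes f :: "(real^'m) \<times> real \<Rightarrow> real" and p s \<gamma> h T :: real and \<alpha> :: "'m \<Rightarrow> real"
  assumes f: "f \<in> Cc_infty UNIV" and p: "1 < p" "p < s" and \<gamma>: "p - 1 < \<gamma>"
    and k: "1 \<le> k" "real DIM((real^'m) \<times> real) * (s / p - 1) * real k \<le> s * (real k - 1)"
    and h: "1 \<le> h"
  defines "Q \<equiv> cell 1 \<alpha> (h - 1) (2 * h - 1) :: ((real^'m) \<times> real) set"
    and "C \<equiv> 2 powr \<bar>\<gamma> - p\<bar> * (2 powr s * (2 ^ DIM((real^'m) \<times> real) * (real k * real DIM((real^'m) \<times> real)) powr s + 1) * 2)"
    and "M \<equiv> 2 powr (\<bar>\<gamma>\<bar> + \<bar>\<gamma> - p\<bar>)"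
    and "E \<equiv> \<lambda>x. ennreal ((1 + snd x) powr \<gamma> * norm (grad f x) powr p + (1 + snd x) powr (\<gamma> - p) * \<bar>f x\<bar> powr p)"
  assumes T: "0 \<le> T" "(\<integral>\<^sup>+x. E x * indicator Q x \<partial>lborel) \<le> ennreal T"
  shows "(\<integral>\<^sup>+x. ennreal ((1 + snd x) powr (\<gamma> - p) * \<bar>f x\<bar> powr s) * indicator Q x \<partial>lborel)
     \<le> ennreal (C * (M * T) powr (s / p - 1) * M) * (\<integral>\<^sup>+x. E x * indicator Q x \<partial>lborel)"
proof -
  let ?N = "real DIM((real^'m) \<times> real)"
  interpret Q: convex_cell Q unfolding Q_def using h by (intro convex_cell_cell) auto
  note fm [measurable] = Cc_infty_measurable[OF f]
  have [measurable]: "Q \<in> sets borel" by (rule Q.Q_borel)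
  obtain B where B: "0 \<le> B" "\<And>x. norm (grad f x) \<le> B" "\<And>x. \<bar>f x\<bar> \<le> B" using Cc_infty_bounded[OF f] by blast
  have hp: "0 < h" using h by simp
  define a where "a = \<gamma> - p"
  define \<sigma> where "\<sigma> = s / p"
  have \<sigma>: "1 < \<sigma>" using p by (simp add: \<sigma>_def)
  have ps: "p * \<sigma> = s" using p by (simp add: \<sigma>_def)
  define V where "V = measure lborel Q"
  have V0: "0 < V" unfolding V_def by (rule Q.measure_Q_pos)
  have Vh: "h \<le> V"
  proof -
    have "ennreal h \<le> emeasure lborel Q"
      unfolding Q_def using cell_emeasure[of 1 "h - 1" "2 * h - 1" \<alpha>] h by simp
    also have "\<dots> = ennreal V" unfolding V_def using Q.emeasure_Q_finite by (simp add: emeasure_eq_ennreal_measure)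
    finally show ?thesis using V0 by simp
  qed
  define \<Gamma> where "\<Gamma> = (\<integral>x. norm (grad f x) powr p \<partial>Q.\<mu>)"
  define \<Phi> where "\<Phi> = (\<integral>x. \<bar>f x\<bar> powr p \<partial>Q.\<mu>)"
  define S where "S = (\<integral>x. \<bar>f x\<bar> powr s \<partial>Q.\<mu>)"
  have nn: "0 \<le> \<Gamma>" "0 \<le> \<Phi>" "0 \<le> S" unfolding \<Gamma>_def \<Phi>_def S_def by (auto intro!: integral_nonneg_AE)
  \<comment> \<open>The energy of the cell with the weights frozen at height h. The gradient carries
    the additional power h^p, which is just what the diameter in the Poincare term produces.\<close>
  define Y where "Y = h powr \<gamma> * (V * \<Gamma>) + h powr a * (V * \<Phi>)"
  have Y0: "0 \<le> Y" using nn V0 by (simp add: Y_def)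
  have diam: "norm (y - x) \<le> ?N * h" if "x \<in> Q" "y \<in> Q" for x y
  proof -
    have "norm (y - x) \<le> real CARD('m) * 1 + (2 * h - 1 - (h - 1))"
      using that unfolding Q_def by (rule cell_diameter)
    also have "\<dots> \<le> real CARD('m) * h + h" using h by simp
    finally show ?thesis by (simp add: algebra_simps)
  qed
  have "(\<integral>x. \<bar>f x - (\<integral>y. f y \<partial>Q.\<mu>)\<bar> powr s \<partial>Q.\<mu>) \<le> 2 ^ DIM((real^'m) \<times> real) * (real k * (?N * h)) powr s * \<Gamma> powr \<sigma>"
    unfolding \<Gamma>_def \<sigma>_def
    by (rule Q.sobolev_poincare[OF Cc_infty_has_derivative[OF f] B(3) Cc_infty_continuous_grad[OF f] B(2) diam])
      (use p k in auto)
  then have "S \<le> 2 powr s * (2 ^ DIM((real^'m) \<times> real) * (real k * (?N * h)) powr s * \<Gamma> powr \<sigma> + \<Phi> powr \<sigma>)"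
    unfolding S_def \<Phi>_def \<sigma>_def using Q.power_mean_bound(1)[OF fm(1) B(3), of p s] p
    by (smt (verit, best) mult_left_mono powr_ge_zero)
  also have "(real k * (?N * h)) powr s = (real k * ?N) powr s * h powr s"
    using hp by (subst mult.assoc[symmetric], subst powr_mult) auto
  also have "2 ^ DIM((real^'m) \<times> real) * ((real k * ?N) powr s * h powr s) * \<Gamma> powr \<sigma> + \<Phi> powr \<sigma>
     \<le> (2 ^ DIM((real^'m) \<times> real) * (real k * ?N) powr s + 1) * (h powr s * \<Gamma> powr \<sigma> + \<Phi> powr \<sigma>)"
    by (simp add: distrib_left distrib_right mult.assoc)
  also have "h powr s * \<Gamma> powr \<sigma> = (h powr p * \<Gamma>) powr \<sigma>"
    using nn by (simp add: powr_mult powr_powr ps)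
  also have "(h powr p * \<Gamma>) powr \<sigma> + \<Phi> powr \<sigma> \<le> 2 * (h powr p * \<Gamma> + \<Phi>) powr \<sigma>"
    using nn \<sigma> by (intro powr_sum_le) auto
  also have "h powr p * \<Gamma> + \<Phi> = Y * (h powr (- a) / V)"
    using V0 hp by (simp add: Y_def a_def powr_minus powr_diff field_simps)
  also have "(Y * (h powr (- a) / V)) powr \<sigma> = Y powr \<sigma> * (h powr (- a * \<sigma>) / V powr \<sigma>)"
    using Y0 V0 by (simp add: powr_mult powr_divide powr_powr)
  finally have S: "S \<le> 2 powr s * ((2 ^ DIM((real^'m) \<times> real) * (real k * ?N) powr s + 1) * (2 * (Y powr \<sigma> * (h powr (- a * \<sigma>) / V powr \<sigma>))))"
    by (simp add: mult_left_mono)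
  \<comment> \<open>Collecting powers leaves h^(a - a \<sigma>) V^(1-\<sigma>) with 1 - \<sigma> <
    0. Since V \<ge> h, this is at most h^((a+1)(1-\<sigma>)), and a + 1 = \<gamma> - p + 1 is
    positive.\<close>
  have fac: "h powr a * (V * (h powr (- a * \<sigma>) / V powr \<sigma>)) \<le> 1"
  proof -
    have "V * (h powr (- a * \<sigma>) / V powr \<sigma>) = h powr (- a * \<sigma>) * V powr (1 - \<sigma>)"
      using V0 by (simp add: powr_diff)
    also have "\<dots> \<le> h powr (- a * \<sigma>) * h powr (1 - \<sigma>)"
      using Vh hp \<sigma> by (intro mult_left_mono powr_mono2') auto
    finally have "h powr a * (V * (h powr (- a * \<sigma>) / V powr \<sigma>)) \<le> h powr a * (h powr (- a * \<sigma>) * h powr (1 - \<sigma>))"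
      by (intro mult_left_mono) auto
    also have "\<dots> = h powr ((a + 1) * (1 - \<sigma>))" by (simp add: algebra_simps flip: powr_add)
    also have "\<dots> \<le> h powr 0" using h \<sigma> \<gamma> by (intro powr_mono) (auto simp: a_def mult_nonneg_nonpos)
    finally show ?thesis using hp by simp
  qed
  have main: "2 powr \<bar>a\<bar> * h powr a * (V * S) \<le> C * Y powr \<sigma>"
  proof -
    define K where "K = 2 powr s * (2 ^ DIM((real^'m) \<times> real) * (real k * ?N) powr s + 1) * 2"
    have K: "0 \<le> K" by (simp add: K_def)
    have "S \<le> K * (Y powr \<sigma> * (h powr (- a * \<sigma>) / V powr \<sigma>))" using S unfolding K_def mult.assoc .
    then have "2 powr \<bar>a\<bar> * h powr a * (V * S) \<le> 2 powr \<bar>a\<bar> * h powr a * (V * (K * (Y powr \<sigma> * (h powr (- a * \<sigma>) / V powr \<sigma>))))"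
      using V0 by (intro mult_left_mono) auto
    also have "\<dots> = 2 powr \<bar>a\<bar> * K * Y powr \<sigma> * (h powr a * (V * (h powr (- a * \<sigma>) / V powr \<sigma>)))" by simp
    also have "\<dots> \<le> 2 powr \<bar>a\<bar> * K * Y powr \<sigma> * 1" using K fac by (intro mult_left_mono) auto
    finally show ?thesis by (simp add: C_def K_def a_def)
  qed
  have wt: "(1 + snd x) powr b \<le> 2 powr \<bar>b\<bar> * h powr b" "h powr b \<le> 2 powr \<bar>b\<bar> * (1 + snd x) powr b" if "x \<in> Q" for x b
    using that layer_weight[OF h, of "1 + snd x" b] by (auto simp: Q_def cell_def)
  have "(\<integral>\<^sup>+x. ennreal ((1 + snd x) powr (\<gamma> - p) * \<bar>f x\<bar> powr s) * indicator Q x \<partial>lborel)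
      \<le> (\<integral>\<^sup>+x. ennreal (2 powr \<bar>a\<bar> * h powr a) * (ennreal (\<bar>f x\<bar> powr s) * indicator Q x) \<partial>lborel)"
  proof (rule nn_integral_mono)
    fix x
    have "(1 + snd x) powr (\<gamma> - p) * \<bar>f x\<bar> powr s \<le> (2 powr \<bar>a\<bar> * h powr a) * \<bar>f x\<bar> powr s" if "x \<in> Q"
      using wt(1)[OF that, of a] by (intro mult_right_mono) (auto simp: a_def)
    then show "ennreal ((1 + snd x) powr (\<gamma> - p) * \<bar>f x\<bar> powr s) * indicator Q x
      \<le> ennreal (2 powr \<bar>a\<bar> * h powr a) * (ennreal (\<bar>f x\<bar> powr s) * indicator Q x)"
      by (cases "x \<in> Q") (auto simp flip: ennreal_mult intro!: ennreal_leI)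
  qed
  also have "\<dots> = ennreal (2 powr \<bar>a\<bar> * h powr a) * ennreal (V * S)"
  proof -
    have "(\<integral>\<^sup>+x. ennreal (\<bar>f x\<bar> powr s) * indicator Q x \<partial>lborel) = ennreal (V * S)"
      unfolding V_def S_def by (rule Q.nn_integral_Q[of _ "B powr s"]) (use B p in \<open>auto intro!: powr_mono2\<close>)
    then show ?thesis by (subst nn_integral_cmult) auto
  qed
  also have "\<dots> = ennreal (2 powr \<bar>a\<bar> * h powr a * (V * S))" using nn V0 by (simp flip: ennreal_mult)
  also have "\<dots> \<le> ennreal (C * Y powr \<sigma>)" using main by (rule ennreal_leI)
  finally have 1: "(\<integral>\<^sup>+x. ennreal ((1 + snd x) powr (\<gamma> - p) * \<bar>f x\<bar> powr s) * indicator Q x \<partial>lborel) \<le> ennreal (C * Y powr \<sigma>)" .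
  have "ennreal Y = ennreal (h powr \<gamma>) * ennreal (V * \<Gamma>) + ennreal (h powr a) * ennreal (V * \<Phi>)"
    using nn V0 by (simp add: Y_def ennreal_plus ennreal_mult)
  also have "ennreal (V * \<Gamma>) = (\<integral>\<^sup>+x. ennreal (norm (grad f x) powr p) * indicator Q x \<partial>lborel)"
    unfolding V_def \<Gamma>_def by (rule Q.nn_integral_Q[of _ "B powr p", symmetric]) (use B p in \<open>auto intro!: powr_mono2\<close>)
  also have "ennreal (V * \<Phi>) = (\<integral>\<^sup>+x. ennreal (\<bar>f x\<bar> powr p) * indicator Q x \<partial>lborel)"
    unfolding V_def \<Phi>_def by (rule Q.nn_integral_Q[of _ "B powr p", symmetric]) (use B p in \<open>auto intro!: powr_mono2\<close>)
  also have "ennreal (h powr \<gamma>) * (\<integral>\<^sup>+x. ennreal (norm (grad f x) powr p) * indicator Q x \<partial>lborel)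
      + ennreal (h powr a) * (\<integral>\<^sup>+x. ennreal (\<bar>f x\<bar> powr p) * indicator Q x \<partial>lborel)
     = (\<integral>\<^sup>+x. ennreal (h powr \<gamma>) * (ennreal (norm (grad f x) powr p) * indicator Q x)
         + ennreal (h powr a) * (ennreal (\<bar>f x\<bar> powr p) * indicator Q x) \<partial>lborel)"
    by (simp add: nn_integral_add nn_integral_cmult)
  also have "\<dots> \<le> (\<integral>\<^sup>+x. ennreal M * (E x * indicator Q x) \<partial>lborel)"
  proof (rule nn_integral_mono)
    fix x
    have "h powr \<gamma> * norm (grad f x) powr p + h powr a * \<bar>f x\<bar> powr p
       \<le> M * ((1 + snd x) powr \<gamma> * norm (grad f x) powr p + (1 + snd x) powr (\<gamma> - p) * \<bar>f x\<bar> powr p)" if x: "x \<in> Q"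
    proof -
      have "h powr \<gamma> \<le> M * (1 + snd x) powr \<gamma>" "h powr a \<le> M * (1 + snd x) powr a"
        by (rule order_trans[OF wt(2)[OF x] mult_right_mono]; simp add: M_def a_def powr_mono)+
      then have "h powr \<gamma> * norm (grad f x) powr p \<le> (M * (1 + snd x) powr \<gamma>) * norm (grad f x) powr p"
        "h powr a * \<bar>f x\<bar> powr p \<le> (M * (1 + snd x) powr a) * \<bar>f x\<bar> powr p"
        by (auto intro!: mult_right_mono)
      then show ?thesis by (simp add: distrib_left mult.assoc a_def)
    qed
    then show "ennreal (h powr \<gamma>) * (ennreal (norm (grad f x) powr p) * indicator Q x)
         + ennreal (h powr a) * (ennreal (\<bar>f x\<bar> powr p) * indicator Q x) \<le> ennreal M * (E x * indicator Q x)"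
      unfolding E_def M_def by (cases "x \<in> Q") (auto simp flip: ennreal_mult ennreal_plus intro!: ennreal_leI)
  qed
  also have "\<dots> = ennreal M * (\<integral>\<^sup>+x. E x * indicator Q x \<partial>lborel)"
    unfolding E_def by (rule nn_integral_cmult) measurable
  finally have 2: "ennreal Y \<le> ennreal M * (\<integral>\<^sup>+x. E x * indicator Q x \<partial>lborel)" .
  have M0: "0 \<le> M" and C0: "0 \<le> C" by (simp_all add: M_def C_def)
  have "ennreal Y \<le> ennreal M * ennreal T" using 2 T(2) by (meson mult_left_mono order_trans zero_le)
  then have YT: "Y \<le> M * T" using M0 T(1) by (simp flip: ennreal_mult)
  \<comment> \<open>The superlinear power of the cell energy is made linear: \<sigma> - 1 powers are
    estimated by the global bound T, and the remaining one can be summed over the cells.\<close>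
  have "C * Y powr \<sigma> = C * Y powr (\<sigma> - 1) * Y" using Y0 by (cases "Y = 0") (auto simp: powr_diff)
  also have "\<dots> \<le> C * (M * T) powr (\<sigma> - 1) * Y"
    using YT Y0 C0 \<sigma> by (intro mult_right_mono mult_left_mono powr_mono2) auto
  finally have "ennreal (C * Y powr \<sigma>) \<le> ennreal (C * (M * T) powr (\<sigma> - 1)) * ennreal Y"
    using C0 Y0 by (simp add: ennreal_leI flip: ennreal_mult)
  also have "\<dots> \<le> ennreal (C * (M * T) powr (\<sigma> - 1)) * (ennreal M * (\<integral>\<^sup>+x. E x * indicator Q x \<partial>lborel))"
    using 2 by (rule mult_left_mono) simp
  also have "\<dots> = ennreal (C * (M * T) powr (s / p - 1) * M) * (\<integral>\<^sup>+x. E x * indicator Q x \<partial>lborel)"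
    using C0 M0 by (simp add: \<sigma>_def ennreal_mult mult.assoc)
  finally show ?thesis using 1 order_trans by blast
qed

text \<open>The cell estimates are linear in the cell energy, with the total energy \<open>T\<close>
  raised to s/p - 1 as a common factor, so summation over the partition restores the power
  s/p.\<close>

theorem weighted_sobolev:
  fixes p s \<gamma> :: real
  assumes p: "1 < p" "p < s" and \<gamma>: "p - 1 < \<gamma>"
    and sub: "real DIM((real^'m) \<times> real) * (s / p - 1) < s"
  obtains K where "0 \<le> K" "\<And>f :: (real^'m) \<times> real \<Rightarrow> real. f \<in> Cc_infty UNIV \<Longrightarrow>
    (\<integral>\<^sup>+x. ennreal ((1 + snd x) powr (\<gamma> - p) * \<bar>f x\<bar> powr s) \<partial>dxH)
      \<le> ennreal (K * ((\<integral>x. (1 + snd x) powr \<gamma> * norm (grad f x) powr p \<partial>dxH)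
          + (\<integral>x. (1 + snd x) powr (\<gamma> - p) * \<bar>f x\<bar> powr p \<partial>dxH)) powr (s / p))"
proof -
  let ?N = "real DIM((real^'m) \<times> real)"
  obtain k :: nat where k: "1 \<le> k" "?N * (s / p - 1) * real k \<le> s * (real k - 1)"
    using sobolev_exponent[OF sub] p by auto
  define C where "C = 2 powr \<bar>\<gamma> - p\<bar> * (2 powr s * (2 ^ DIM((real^'m) \<times> real) * (real k * ?N) powr s + 1) * 2)"
  define M where "M = 2 powr (\<bar>\<gamma>\<bar> + \<bar>\<gamma> - p\<bar>)"
  have CM: "0 \<le> C" "0 \<le> M" by (simp_all add: C_def M_def)
  have "(\<integral>\<^sup>+x. ennreal ((1 + snd x) powr (\<gamma> - p) * \<bar>f x\<bar> powr s) \<partial>dxH)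
      \<le> ennreal (C * M powr (s / p - 1) * M * ((\<integral>x. (1 + snd x) powr \<gamma> * norm (grad f x) powr p \<partial>dxH)
          + (\<integral>x. (1 + snd x) powr (\<gamma> - p) * \<bar>f x\<bar> powr p \<partial>dxH)) powr (s / p))"
    if f: "f \<in> Cc_infty UNIV" for f :: "(real^'m) \<times> real \<Rightarrow> real"
  proof -
    note fm [measurable] = Cc_infty_measurable[OF f]
    note hi = hardy_halfspace(1,2)[OF f p(1) \<gamma>]
    define e where "e x = (1 + snd x) powr \<gamma> * norm (grad f x) powr p + (1 + snd x) powr (\<gamma> - p) * \<bar>f x\<bar> powr p" for x
    define T where "T = (\<integral>x. e x \<partial>dxH)"
    have T_eq: "T = (\<integral>x. (1 + snd x) powr \<gamma> * norm (grad f x) powr p \<partial>dxH) + (\<integral>x. (1 + snd x) powr (\<gamma> - p) * \<bar>f x\<bar> powr p \<partial>dxH)"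
      unfolding T_def e_def using hi by simp
    have T0: "0 \<le> T" unfolding T_def e_def by (intro integral_nonneg_AE) auto
    have ei: "integrable dxH e" unfolding e_def[abs_def] using hi by simp
    have eT: "(\<integral>\<^sup>+x. ennreal (e x) \<partial>dxH) = ennreal T"
      unfolding T_def by (rule nn_integral_eq_integral[OF ei]) (simp add: e_def)
    have [measurable]: "e \<in> borel_measurable borel" unfolding e_def[abs_def] by measurable
    have "(\<integral>\<^sup>+x. ennreal ((1 + snd x) powr (\<gamma> - p) * \<bar>f x\<bar> powr s) \<partial>dxH)
       \<le> ennreal (C * (M * T) powr (s / p - 1) * M) * (\<integral>\<^sup>+x. ennreal (e x) \<partial>dxH)"
    proof (rule nn_integral_partition_le[where c = layer_index])
      show "(\<lambda>x. ennreal ((1 + snd x) powr (\<gamma> - p) * \<bar>f x\<bar> powr s)) \<in> borel_measurable dxH"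
        by (rule borel_measurable_dxH) measurable
      show "(\<lambda>x. ennreal (e x)) \<in> borel_measurable dxH"
        by (rule borel_measurable_dxH) measurable
      fix x0 :: "(real^'m) \<times> real" assume "x0 \<in> space dxH"
      then have x0: "x0 \<in> halfspace" by simp
      define h where "h = 2 powr (real_of_int \<lceil>log 2 (1 + snd x0)\<rceil> - 1)"
      define Q :: "((real^'m) \<times> real) set" where "Q = cell 1 (\<lambda>i. of_int \<lfloor>fst x0 $ i\<rfloor>) (h - 1) (2 * h - 1)"
      have h: "1 \<le> h" and Q: "{x \<in> space dxH. layer_index x = layer_index x0} = Q"
        unfolding h_def Q_def space_dxH using layer_cell[OF x0] by simp_all
      have QH: "Q \<subseteq> halfspace" using Q by auto
      show "{x \<in> space dxH. layer_index x = layer_index x0} \<in> sets dxH"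
      proof -
        have "Q \<in> sets lborel" using cell_borel by (simp add: Q_def)
        then have "Q \<in> sets lebesgue" by (rule sets_completionI_sets)
        then show ?thesis unfolding Q using QH by (simp add: sets_restrict_space_iff)
      qed
      have "(\<integral>\<^sup>+x. ennreal (e x) * indicator Q x \<partial>lborel) \<le> (\<integral>\<^sup>+x. ennreal (e x) \<partial>dxH)"
        unfolding nn_integral_dxH_subset[OF QH, symmetric]
        by (intro nn_integral_mono) (auto simp: indicator_def)
      then have T: "(\<integral>\<^sup>+x. ennreal (e x) * indicator Q x \<partial>lborel) \<le> ennreal T" by (simp add: eT)
      show "(\<integral>\<^sup>+x. ennreal ((1 + snd x) powr (\<gamma> - p) * \<bar>f x\<bar> powr s) * indicator {x \<in> space dxH. layer_index x = layer_index x0} x \<partial>dxH)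
         \<le> ennreal (C * (M * T) powr (s / p - 1) * M) * (\<integral>\<^sup>+x. ennreal (e x) * indicator {x \<in> space dxH. layer_index x = layer_index x0} x \<partial>dxH)"
        unfolding Q nn_integral_dxH_subset[OF QH]
        using layer_sobolev[OF f p \<gamma> k h T0 T[unfolded e_def Q_def]] unfolding e_def Q_def C_def M_def .
    qed
    also have "\<dots> = ennreal (C * (M * T) powr (s / p - 1) * M * T)"
      unfolding eT using CM T0 by (intro ennreal_mult[symmetric]) auto
    also have "C * (M * T) powr (s / p - 1) * M * T = C * M powr (s / p - 1) * M * (T powr (s / p - 1) * T)"
      using CM T0 by (simp add: powr_mult)
    also have "T powr (s / p - 1) * T = T powr (s / p)"
      using T0 by (cases "T = 0") (auto simp: powr_diff)
    finally show ?thesis by (simp add: T_eq)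
  qed
  then show ?thesis using that[of "C * M powr (s / p - 1) * M"] CM by auto
qed

section \<open>Local compactness\<close>

text \<open>\<open>L\<close> is the reciprocal of the mesh width, so refinement means L tending to
  infinity.\<close>

definition grid_index :: "real \<Rightarrow> (real^'m) \<times> real \<Rightarrow> ('m \<Rightarrow> int) \<times> int" where
  "grid_index L x = (\<lambda>i. \<lfloor>L * fst x $ i\<rfloor>, \<lceil>L * snd x\<rceil>)"

definition grid_cell :: "real \<Rightarrow> (real^'m) \<times> real \<Rightarrow> ((real^'m) \<times> real) set" where
  "grid_cell L x0 = {x \<in> halfspace. grid_index L x = grid_index L x0}"

lemma grid_cell:
  fixes x0 :: "(real^'m) \<times> real"
  assumes L: "1 \<le> L" and x0: "x0 \<in> halfspace"
  shows "convex_cell (grid_cell L x0)"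
    and "\<And>x y. x \<in> grid_cell L x0 \<Longrightarrow> y \<in> grid_cell L x0 \<Longrightarrow> norm (y - x) \<le> real DIM((real^'m) \<times> real) / L"
    and "(1 / L) ^ DIM((real^'m) \<times> real) \<le> measure lborel (grid_cell L x0)"
proof -
  define \<beta> where "\<beta> = (real_of_int \<lceil>L * snd x0\<rceil> - 1) / L"
  have c: "grid_cell L x0 = cell (1 / L) (\<lambda>i. of_int \<lfloor>L * fst x0 $ i\<rfloor> / L) \<beta> (\<beta> + 1 / L)"
  proof -
    have "0 < L * snd x0" using L x0 by (simp add: halfspace_def)
    then have "1 \<le> \<lceil>L * snd x0\<rceil>" by (simp add: Suc_le_eq flip: zero_less_ceiling)
    then have \<beta>: "0 \<le> \<beta>" using L by (simp add: \<beta>_def)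
    have "\<lceil>L * t\<rceil> = \<lceil>L * snd x0\<rceil> \<longleftrightarrow> \<beta> < t \<and> t \<le> \<beta> + 1 / L" for t
      using L by (auto simp: ceiling_eq_iff \<beta>_def field_simps)
    moreover have "\<lfloor>L * t\<rfloor> = \<lfloor>L * fst x0 $ i\<rfloor> \<longleftrightarrow> of_int \<lfloor>L * fst x0 $ i\<rfloor> / L \<le> t \<and> t < of_int \<lfloor>L * fst x0 $ i\<rfloor> / L + 1 / L" for t i
      using L by (intro floor_cell) simp
    ultimately show ?thesis using \<beta>
      by (auto simp: grid_cell_def grid_index_def cell_def fun_eq_iff halfspace_def)
  qed
  have L0: "0 < 1 / L" "\<beta> < \<beta> + 1 / L" using L by auto
  show cc: "convex_cell (grid_cell L x0)" unfolding c using L0 by (rule convex_cell_cell)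
  show "norm (y - x) \<le> real DIM((real^'m) \<times> real) / L" if "x \<in> grid_cell L x0" "y \<in> grid_cell L x0" for x y
    using cell_diameter[of x "1 / L" _ \<beta> "\<beta> + 1 / L" y] that L unfolding c by (force simp: field_simps)
  have "ennreal ((1 / L) ^ CARD('m) * (\<beta> + 1 / L - \<beta>)) \<le> emeasure lborel (grid_cell L x0)"
    unfolding c using L0 by (rule cell_emeasure)
  also have "\<dots> = ennreal (measure lborel (grid_cell L x0))"
    using convex_cell.emeasure_Q_finite[OF cc] by (simp add: emeasure_eq_ennreal_measure)
  finally show "(1 / L) ^ DIM((real^'m) \<times> real) \<le> measure lborel (grid_cell L x0)"
    by (simp add: mult.commute)
qed

definition grid_average :: "real \<Rightarrow> ((real^'m) \<times> real \<Rightarrow> real) \<Rightarrow> (real^'m) \<times> real \<Rightarrow> real" where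
  "grid_average L f x = (\<integral>y. f y \<partial>uniform_measure lborel (grid_cell L x))"

lemma grid_average_cong: "grid_index L x = grid_index L y \<Longrightarrow> grid_average L f x = grid_average L f y"
  by (simp add: grid_average_def grid_cell_def)

lemma grid_cell_sets:
  assumes "1 \<le> L" "x0 \<in> halfspace"
  shows "{x \<in> space dxH. grid_index L x = grid_index L x0} \<in> sets (dxH :: ((real^'m) \<times> real) measure)"
proof -
  have "grid_cell L x0 \<in> sets borel" using grid_cell(1)[OF assms] by (rule convex_cell.Q_borel)
  then show ?thesis by (simp add: grid_cell_def sets_restrict_space_iff)
qed

lemma grid_average_measurable:
  assumes L: "1 \<le> L"
  shows "grid_average L f \<in> borel_measurable (dxH :: ((real^'m) \<times> real) measure)"
proof -
  have c: "grid_index L \<in> dxH \<rightarrow>\<^sub>M count_space (UNIV :: (('m \<Rightarrow> int) \<times> int) set)"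
  proof (subst measurable_count_space_eq_countable, safe)
    fix a :: "'m \<Rightarrow> int" and b
    have "grid_index L -` {(a, b)} \<inter> space dxH = {} \<or> (\<exists>x0\<in>halfspace. grid_index L -` {(a, b)} \<inter> space dxH = {x \<in> space dxH. grid_index L x = grid_index L x0})"
    proof (cases "grid_index L -` {(a, b)} \<inter> (space dxH :: ((real^'m) \<times> real) set) = {}")
      case False
      then obtain x0 where "x0 \<in> (halfspace :: ((real^'m) \<times> real) set)" "grid_index L x0 = (a, b)" by auto
      then show ?thesis by (intro disjI2 bexI[of _ x0]) auto
    qed simp
    then show "grid_index L -` {(a, b)} \<inter> space dxH \<in> sets (dxH :: ((real^'m) \<times> real) measure)"
      using grid_cell_sets[OF L] by auto
  qed auto
  \<comment> \<open>The average depends on the grid index alone, so it factors through a countable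
    type with an arbitrary representative of each cell. This gives measurability without
    estimates.\<close>
  define G where "G i = grid_average L f (SOME x. grid_index L x = i)" for i
  have "grid_average L f x = G (grid_index L x)" for x
  proof -
    have "grid_index L (SOME y. grid_index L y = grid_index L x) = grid_index L x" by (rule someI[of _ x]) (rule refl)
    then show ?thesis unfolding G_def by (intro grid_average_cong) simp
  qed
  then have "grid_average L f = (\<lambda>x. G (grid_index L x))" by auto
  moreover have "(\<lambda>x. G (grid_index L x)) \<in> borel_measurable dxH"
    by (rule measurable_compose[OF c]) simp
  ultimately show ?thesis by simp
qed

text \<open>\<open>sobolev_poincare\<close> with r = p and k = 1 on cells of diameter at most N/L:
  the error of piecewise constant approximation tends to 0 with the mesh, uniformly over functions
  with bounded gradient integral.\<close>

lemma grid_poincare: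
  fixes f :: "(real^'m) \<times> real \<Rightarrow> real"
  assumes f: "f \<in> Cc_infty UNIV" and p: "1 \<le> p" and L: "1 \<le> L"
  shows "(\<integral>\<^sup>+x. ennreal (\<bar>f x - grid_average L f x\<bar> powr p) \<partial>dxH)
    \<le> ennreal (2 ^ DIM((real^'m) \<times> real) * (real DIM((real^'m) \<times> real) / L) powr p) * (\<integral>\<^sup>+x. ennreal (norm (grad f x) powr p) \<partial>dxH)"
proof (rule nn_integral_partition_le[where c = "grid_index L"])
  let ?N = "real DIM((real^'m) \<times> real)"
  note fm [measurable] = Cc_infty_measurable[OF f]
  obtain B where B: "0 \<le> B" "\<And>x. norm (grad f x) \<le> B" "\<And>x. \<bar>f x\<bar> \<le> B" using Cc_infty_bounded[OF f] by blast
  have [measurable]: "f \<in> borel_measurable dxH" by (rule borel_measurable_dxH) measurable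
  have [measurable]: "grad f \<in> borel_measurable dxH" by (rule borel_measurable_dxH) measurable
  have [measurable]: "grid_average L f \<in> borel_measurable dxH" using L by (rule grid_average_measurable)
  show "(\<lambda>x. ennreal (\<bar>f x - grid_average L f x\<bar> powr p)) \<in> borel_measurable dxH" by measurable
  show "(\<lambda>x. ennreal (norm (grad f x) powr p)) \<in> borel_measurable dxH" by measurable
  fix x0 :: "(real^'m) \<times> real" assume "x0 \<in> space dxH"
  then have x0: "x0 \<in> halfspace" by simp
  show "{x \<in> space dxH. grid_index L x = grid_index L x0} \<in> sets dxH" using grid_cell_sets[OF L x0] .
  define Q where "Q = grid_cell L x0"
  interpret Q: convex_cell Q unfolding Q_def using grid_cell(1)[OF L x0] .
  have QH: "Q \<subseteq> halfspace" by (auto simp: Q_def grid_cell_def)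
  have Q: "{x \<in> space dxH. grid_index L x = grid_index L x0} = Q" by (simp add: Q_def grid_cell_def)
  define m where "m = (\<integral>y. f y \<partial>Q.\<mu>)"
  have m: "grid_average L f x = m" if "x \<in> Q" for x
    using that grid_average_cong[of L x x0 f] by (simp add: m_def Q.\<mu>_def grid_average_def) (simp add: Q_def grid_cell_def)
  have "(\<integral>\<^sup>+x. ennreal (\<bar>f x - grid_average L f x\<bar> powr p) * indicator Q x \<partial>lborel)
     = (\<integral>\<^sup>+x. ennreal (\<bar>f x - m\<bar> powr p) * indicator Q x \<partial>lborel)"
    by (intro nn_integral_cong) (auto simp: indicator_def m)
  also have "\<dots> = ennreal (measure lborel Q * (\<integral>x. \<bar>f x - m\<bar> powr p \<partial>Q.\<mu>))"
  proof (rule Q.nn_integral_Q[of _ "(B + \<bar>m\<bar>) powr p"])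
    show "\<bar>f x - m\<bar> powr p \<le> (B + \<bar>m\<bar>) powr p" for x using B(3)[of x] p by (intro powr_mono2) auto
  qed (use p in auto)
  also have "\<dots> \<le> ennreal (measure lborel Q * (2 ^ DIM((real^'m) \<times> real) * (?N / L) powr p * (\<integral>x. norm (grad f x) powr p \<partial>Q.\<mu>)))"
  proof (intro ennreal_leI mult_left_mono)
    have "(\<integral>x. \<bar>f x - m\<bar> powr p \<partial>Q.\<mu>) \<le> 2 ^ DIM((real^'m) \<times> real) * (real 1 * (?N / L)) powr p * (\<integral>x. norm (grad f x) powr p \<partial>Q.\<mu>) powr (p / p)"
      unfolding m_def
      by (rule Q.sobolev_poincare[OF Cc_infty_has_derivative[OF f] B(3) Cc_infty_continuous_grad[OF f] B(2)])
        (use p grid_cell(2)[OF L x0] in \<open>auto simp: Q_def\<close>)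
    moreover have "0 \<le> (\<integral>x. norm (grad f x) powr p \<partial>Q.\<mu>)" by (intro integral_nonneg_AE) auto
    ultimately show "(\<integral>x. \<bar>f x - m\<bar> powr p \<partial>Q.\<mu>) \<le> 2 ^ DIM((real^'m) \<times> real) * (?N / L) powr p * (\<integral>x. norm (grad f x) powr p \<partial>Q.\<mu>)"
      using p by simp
  qed simp
  also have "\<dots> = ennreal (2 ^ DIM((real^'m) \<times> real) * (?N / L) powr p) * ennreal (measure lborel Q * (\<integral>x. norm (grad f x) powr p \<partial>Q.\<mu>))"
    by (subst ennreal_mult[symmetric]) (auto intro!: mult_nonneg_nonneg integral_nonneg_AE simp: mult_ac)
  also have "ennreal (measure lborel Q * (\<integral>x. norm (grad f x) powr p \<partial>Q.\<mu>)) = (\<integral>\<^sup>+x. ennreal (norm (grad f x) powr p) * indicator Q x \<partial>lborel)"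
    by (rule Q.nn_integral_Q[of _ "B powr p", symmetric]) (use B p in \<open>auto intro!: powr_mono2\<close>)
  finally show "(\<integral>\<^sup>+x. ennreal (\<bar>f x - grid_average L f x\<bar> powr p) * indicator {x \<in> space dxH. grid_index L x = grid_index L x0} x \<partial>dxH)
    \<le> ennreal (2 ^ DIM((real^'m) \<times> real) * (?N / L) powr p) * (\<integral>\<^sup>+x. ennreal (norm (grad f x) powr p) * indicator {x \<in> space dxH. grid_index L x = grid_index L x0} x \<partial>dxH)"
    unfolding Q nn_integral_dxH_subset[OF QH] .
qed

text \<open>A pointwise bound that does not depend on the function: it makes a diagonal argument
  possible and provides the majorant for dominated convergence of the averages. The factor L^N is
  the reciprocal of the least cell volume.\<close>

lemma grid_average_bound:
  fixes f :: "(real^'m) \<times> real \<Rightarrow> real"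
  assumes f: "f \<in> Cc_infty UNIV" and p: "1 < p" and \<gamma>: "p - 1 < \<gamma>" and L: "1 \<le> L" and x0: "x0 \<in> halfspace"
    and K: "(\<integral>x. (1 + snd x) powr (\<gamma> - p) * \<bar>f x\<bar> powr p \<partial>dxH) \<le> K"
  shows "\<bar>grid_average L f x0\<bar> powr p \<le> L ^ DIM((real^'m) \<times> real) * (2 + snd x0) powr \<bar>\<gamma> - p\<bar> * K"
proof -
  note fm [measurable] = Cc_infty_measurable[OF f]
  obtain B where B: "0 \<le> B" "\<And>x. norm (grad f x) \<le> B" "\<And>x. \<bar>f x\<bar> \<le> B" using Cc_infty_bounded[OF f] by blast
  define Q where "Q = grid_cell L x0"
  interpret Q: convex_cell Q unfolding Q_def using grid_cell(1)[OF L x0] .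
  have QH: "Q \<subseteq> halfspace" by (auto simp: Q_def grid_cell_def)
  define \<Phi> where "\<Phi> = (\<integral>x. \<bar>f x\<bar> powr p \<partial>Q.\<mu>)"
  define V where "V = measure lborel Q"
  have V0: "0 < V" unfolding V_def by (rule Q.measure_Q_pos)
  have V: "1 \<le> L ^ DIM((real^'m) \<times> real) * V"
  proof -
    have "(1 / L) ^ DIM((real^'m) \<times> real) * L ^ DIM((real^'m) \<times> real) \<le> V * L ^ DIM((real^'m) \<times> real)"
      unfolding V_def Q_def using L by (intro mult_right_mono grid_cell(3)[OF L x0]) auto
    moreover have "(1 / L) ^ DIM((real^'m) \<times> real) * L ^ DIM((real^'m) \<times> real) = 1"
      unfolding power_mult_distrib[symmetric] using L by simp
    ultimately show ?thesis by (simp add: mult.commute)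
  qed
  have Phi0: "0 \<le> \<Phi>" unfolding \<Phi>_def by (intro integral_nonneg_AE) auto
  \<comment> \<open>Compensates the weight of the Hardy space on the cell for either sign of
    \<gamma> - p; the height 1/L \<le> 1 of a cell explains the 2.\<close>
  define W where "W = (2 + snd x0) powr \<bar>\<gamma> - p\<bar>"
  have W: "1 \<le> W * (1 + snd x) powr (\<gamma> - p)" if x: "x \<in> Q" for x
  proof -
    have xs: "1 \<le> 1 + snd x" using x QH by (auto simp: halfspace_def)
    have "\<lceil>L * snd x\<rceil> = \<lceil>L * snd x0\<rceil>" using x by (simp add: Q_def grid_cell_def grid_index_def)
    then have "L * snd x \<le> L * snd x0 + 1" by linarith
    then have "L * snd x \<le> L * (snd x0 + 1)" using L by (simp add: algebra_simps)
    then have "1 + snd x \<le> 2 + snd x0" using L by simp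
    then have "(1 + snd x) powr \<bar>\<gamma> - p\<bar> \<le> W" unfolding W_def using xs by (intro powr_mono2) auto
    then have "(1 + snd x) powr \<bar>\<gamma> - p\<bar> * (1 + snd x) powr (\<gamma> - p) \<le> W * (1 + snd x) powr (\<gamma> - p)" by (intro mult_right_mono) auto
    moreover have "1 \<le> (1 + snd x) powr (\<bar>\<gamma> - p\<bar> + (\<gamma> - p))" using xs by (intro ge_one_powr_ge_zero) auto
    ultimately show ?thesis by (simp only: powr_add)
  qed
  have "ennreal (V * \<Phi>) = (\<integral>\<^sup>+x. ennreal (\<bar>f x\<bar> powr p) * indicator Q x \<partial>lborel)"
    unfolding V_def \<Phi>_def by (rule Q.nn_integral_Q[of _ "B powr p", symmetric]) (use B p in \<open>auto intro!: powr_mono2\<close>)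
  also have "\<dots> = (\<integral>\<^sup>+x. ennreal (\<bar>f x\<bar> powr p) * indicator Q x \<partial>dxH)"
    by (rule nn_integral_dxH_subset[OF QH, symmetric])
  also have "\<dots> \<le> (\<integral>\<^sup>+x. ennreal (W * ((1 + snd x) powr (\<gamma> - p) * \<bar>f x\<bar> powr p)) \<partial>dxH)"
  proof (rule nn_integral_mono)
    fix x
    show "ennreal (\<bar>f x\<bar> powr p) * indicator Q x \<le> ennreal (W * ((1 + snd x) powr (\<gamma> - p) * \<bar>f x\<bar> powr p))"
    proof (cases "x \<in> Q")
      case True
      have "1 * \<bar>f x\<bar> powr p \<le> (W * (1 + snd x) powr (\<gamma> - p)) * \<bar>f x\<bar> powr p"
        by (intro mult_right_mono W True) auto
      then show ?thesis using True by (simp add: ennreal_leI mult.assoc)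
    qed simp
  qed
  also have "\<dots> = ennreal (\<integral>x. W * ((1 + snd x) powr (\<gamma> - p) * \<bar>f x\<bar> powr p) \<partial>dxH)"
    using hardy_halfspace(1)[OF f p \<gamma>] by (intro nn_integral_eq_integral) (auto simp: W_def)
  also have "\<dots> \<le> ennreal (W * K)"
    using K by (intro ennreal_leI) (simp add: W_def mult_left_mono)
  finally have "V * \<Phi> \<le> W * K"
  proof -
    assume a: "ennreal (V * \<Phi>) \<le> ennreal (W * K)"
    have "0 \<le> (\<integral>x. (1 + snd x) powr (\<gamma> - p) * \<bar>f x\<bar> powr p \<partial>dxH)" by (intro integral_nonneg_AE) auto
    then have "0 \<le> K" using K by linarith
    then have "0 \<le> W * K" by (simp add: W_def)
    then show ?thesis using a by simp
  qed
  have "\<bar>grid_average L f x0\<bar> powr p \<le> \<Phi>"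
    unfolding \<Phi>_def using Q.power_mean_bound(2)[OF fm(1) B(3), of p p] p
    by (simp add: grid_average_def Q.\<mu>_def) (simp add: Q_def)
  also have "\<Phi> \<le> (L ^ DIM((real^'m) \<times> real) * V) * \<Phi>" using V Phi0 mult_right_mono[OF V Phi0] by simp
  also have "\<dots> \<le> L ^ DIM((real^'m) \<times> real) * (W * K)"
    using \<open>V * \<Phi> \<le> W * K\<close> L unfolding mult.assoc by (intro mult_left_mono) auto
  finally show ?thesis by (simp add: W_def mult.assoc)
qed

text \<open>The averages are bounded pointwise but not by a globally integrable function. A positive
  auxiliary weight, obtained from \<sigma>-finiteness of Lebesgue measure, turns their pointwise
  convergence into norm convergence and has no nontrivial null sets.\<close>

lemma integrable_weight_halfspace:
  fixes a :: real
  obtains \<omega> :: "(real^'m) \<times> real \<Rightarrow> real" where "\<omega> \<in> borel_measurable borel"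
    "\<And>x. 0 < \<omega> x" "\<And>x. \<omega> x \<le> 1" "integrable dxH (\<lambda>x. \<omega> x * (2 + snd x) powr \<bar>a\<bar>)"
proof -
  obtain h :: "(real^'m) \<times> real \<Rightarrow> ennreal" where hm: "h \<in> borel_measurable lborel"
    and hf: "(\<integral>\<^sup>+x. h x \<partial>lborel) \<noteq> \<infinity>" and h0: "\<forall>x\<in>space lborel. 0 < h x \<and> h x < \<infinity>"
    using sigma_finite_measure.Ex_finite_integrable_function[OF lborel.sigma_finite_measure_axioms] by blast
  define k where "k x = enn2real (h x)" for x
  have km [measurable]: "k \<in> borel_measurable borel" using hm unfolding k_def[abs_def] by simp
  have k: "0 < k x" "ennreal (k x) = h x" for x
    using h0[rule_format, of x] by (simp_all add: k_def enn2real_positive_iff)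
  have ki: "integrable lborel k"
    using km hf k by (intro integrableI_nonneg) (auto simp: less_imp_le less_top)
  \<comment> \<open>Truncation keeps the base of the power at least 2 outside the half-space too,
    where \<open>snd x\<close> may be negative.\<close>
  define m where "m x = max 0 (snd x)" for x :: "(real^'m) \<times> real"
  have mm [measurable]: "m \<in> borel_measurable borel"
    unfolding m_def[abs_def] by (intro borel_measurable_max borel_measurable_const borel_measurable_snd)
  define \<omega> where "\<omega> x = k x / ((1 + k x) * (2 + m x) powr \<bar>a\<bar>)" for x
  have m0: "1 \<le> (2 + m x) powr \<bar>a\<bar>" for x by (intro ge_one_powr_ge_zero) (auto simp: m_def)
  show ?thesis
  proof
    show wm [measurable]: "\<omega> \<in> borel_measurable borel" unfolding \<omega>_def[abs_def] by measurable
    show "0 < \<omega> x" for x using k(1)[of x] m0[of x] unfolding \<omega>_def by (intro divide_pos_pos mult_pos_pos) linarith+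
    have le: "\<omega> x * (2 + m x) powr \<bar>a\<bar> \<le> k x" "\<omega> x \<le> 1" for x
    proof -
      have "\<omega> x * (2 + m x) powr \<bar>a\<bar> = k x / (1 + k x)"
        
      proof -
        define q where "q = (2 + m x) powr \<bar>a\<bar>"
        have "q \<noteq> 0" using m0[of x] by (auto simp: q_def)
        then show ?thesis unfolding \<omega>_def q_def[symmetric] by simp
      qed
      also have "\<dots> \<le> k x" using k(1)[of x] by (simp add: field_simps)
      finally show "\<omega> x * (2 + m x) powr \<bar>a\<bar> \<le> k x" .
      have "k x * 1 \<le> (1 + k x) * (2 + m x) powr \<bar>a\<bar>" using k(1)[of x] m0[of x] by (intro mult_mono) auto
      moreover have "0 < (1 + k x) * (2 + m x) powr \<bar>a\<bar>" using k(1)[of x] m0[of x] by (intro mult_pos_pos) linarith+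
      ultimately show "\<omega> x \<le> 1" unfolding \<omega>_def by (subst divide_le_eq_1_pos) simp_all
    qed
    then show "\<omega> x \<le> 1" for x by blast
    have "integrable lebesgue k" using ki km by (simp add: integrable_completion)
    then have kH: "integrable dxH k"
      unfolding integrable_dxH_iff by (intro integrable_mult_indicator) auto
    show "integrable dxH (\<lambda>x. \<omega> x * (2 + snd x) powr \<bar>a\<bar>)"
    proof (rule Bochner_Integration.integrable_bound[OF kH])
      have "(\<lambda>x::(real^'m) \<times> real. (2 + snd x) powr \<bar>a\<bar>) \<in> borel_measurable borel"
        by (rule measurable_compose[OF borel_measurable_snd]) measurable
      then show "(\<lambda>x. \<omega> x * (2 + snd x) powr \<bar>a\<bar>) \<in> borel_measurable dxH"
        by (intro borel_measurable_dxH borel_measurable_times wm)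
      show "AE x in dxH. norm (\<omega> x * (2 + snd x) powr \<bar>a\<bar>) \<le> norm (k x)"
      proof (rule AE_I2)
        fix x :: "(real^'m) \<times> real" assume "x \<in> space dxH"
        then have "m x = snd x" by (simp add: halfspace_def m_def)
        moreover have "0 \<le> \<omega> x" using k(1)[of x] by (simp add: \<omega>_def)
        ultimately show "norm (\<omega> x * (2 + snd x) powr \<bar>a\<bar>) \<le> norm (k x)"
          using le(1)[of x] k(1)[of x] by simp
      qed
    qed
  qed
qed

text \<open>For all mesh widths together there are only countably many cells, hence countably many
  bounded real sequences, and one diagonal subsequence serves them all.\<close>

lemma grid_averages_subsequence:
  fixes \<phi> :: "nat \<Rightarrow> (real^'m) \<times> real \<Rightarrow> real" and \<Lambda> :: "nat \<Rightarrow> real"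
  assumes bd: "\<And>l x n. x \<in> halfspace \<Longrightarrow> \<bar>grid_average (\<Lambda> l) (\<phi> n) x\<bar> \<le> b l x"
  obtains \<sigma> where "strict_mono \<sigma>" "\<And>l x. x \<in> halfspace \<Longrightarrow> convergent (\<lambda>n. grid_average (\<Lambda> l) (\<phi> (\<sigma> n)) x)"
proof -
  define r where "r l i = (SOME x. x \<in> halfspace \<and> grid_index (\<Lambda> l) x = i)" for l and i :: "('m \<Rightarrow> int) \<times> int"
  define S where "S = {(l, i). \<exists>x\<in>halfspace. grid_index (\<Lambda> l) x = (i :: ('m \<Rightarrow> int) \<times> int)}"
  have r: "r l i \<in> halfspace \<and> grid_index (\<Lambda> l) (r l i) = i" if "(l, i) \<in> S" for l i
  proof -
    from that obtain x where "x \<in> halfspace \<and> grid_index (\<Lambda> l) x = i" by (auto simp: S_def)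
    then show ?thesis unfolding r_def by (rule someI)
  qed
  \<comment> \<open>Division by 1 plus the modulus of the bound makes the values uniformly bounded
    by 1, as the subsequence theorem requires; convergence is unaffected since the divisor does not
    depend on n.\<close>
  define f where "f n z = grid_average (\<Lambda> (fst z)) (\<phi> n) (r (fst z) (snd z)) / (1 + \<bar>b (fst z) (r (fst z) (snd z))\<bar>)" for n z
  have "countable S" by (rule countableI_type)
  moreover have "norm (f n z) \<le> 1" if "z \<in> S" for n z
  proof -
    obtain l i where z: "z = (l, i)" by (cases z)
    have "\<bar>grid_average (\<Lambda> l) (\<phi> n) (r l i)\<bar> \<le> b l (r l i)" using r that z by (intro bd) auto
    then have "\<bar>grid_average (\<Lambda> l) (\<phi> n) (r l i)\<bar> \<le> 1 + \<bar>b l (r l i)\<bar>" by linarith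
    then show ?thesis by (simp add: f_def z abs_divide divide_le_eq_1 add_pos_nonneg)
  qed
  ultimately obtain \<sigma> :: "nat \<Rightarrow> nat" where \<sigma>: "strict_mono \<sigma>" "\<And>z. z \<in> S \<Longrightarrow> \<exists>t. (\<lambda>n. f (\<sigma> n) z) \<longlonglongrightarrow> t"
    using function_convergent_subsequence[of S f 1] by blast
  show ?thesis
  proof
    fix l x assume x: "x \<in> (halfspace :: ((real^'m) \<times> real) set)"
    define i where "i = grid_index (\<Lambda> l) x"
    have S: "(l, i) \<in> S" using x by (auto simp: S_def i_def)
    then have eq: "grid_average (\<Lambda> l) (\<phi> n) x = f n (l, i) * (1 + \<bar>b l (r l i)\<bar>)" for n
      using r[OF S] grid_average_cong[of "\<Lambda> l" x "r l i"] by (simp add: f_def i_def add_nonneg_eq_0_iff)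
    from \<sigma>(2)[OF S] obtain t where "(\<lambda>n. f (\<sigma> n) (l, i)) \<longlonglongrightarrow> t" by blast
    then have "(\<lambda>n. f (\<sigma> n) (l, i) * (1 + \<bar>b l (r l i)\<bar>)) \<longlonglongrightarrow> t * (1 + \<bar>b l (r l i)\<bar>)"
      by (intro tendsto_mult tendsto_const)
    then show "convergent (\<lambda>n. grid_average (\<Lambda> l) (\<phi> (\<sigma> n)) x)" unfolding eq convergent_def by blast
  qed (rule \<sigma>(1))
qed

text \<open>The sequence is within a uniformly small distance of its averages on a fine grid, and
  for each grid the averages converge along the chosen subsequence. Hence it is Cauchy for the
  auxiliary weight, which is enough for a limit almost everywhere.\<close>

theorem rellich_halfspace:
  fixes \<phi> :: "nat \<Rightarrow> (real^'m) \<times> real \<Rightarrow> real"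
  assumes \<phi>: "\<And>n. \<phi> n \<in> Cc_infty UNIV" and p: "1 < p" and \<gamma>: "p - 1 < \<gamma>"
    and K: "\<And>n. (\<integral>x. (1 + snd x) powr \<gamma> * norm (grad (\<phi> n) x) powr p \<partial>dxH) \<le> K"
  obtains \<sigma> u where "strict_mono \<sigma>" "u \<in> borel_measurable dxH" "AE x in dxH. (\<lambda>n. \<phi> (\<sigma> n) x) \<longlonglongrightarrow> u x"
proof -
  let ?N = "real DIM((real^'m) \<times> real)"
  have K0: "0 \<le> K"
    by (rule order_trans[OF _ K[of 0]], intro integral_nonneg_AE) auto
  define K' where "K' = 2 / (\<gamma> - p + 1) * (p * (2 * p / (\<gamma> - p + 1)) powr (p - 1)) * K"
  have K'0: "0 \<le> K'" using p \<gamma> K0 by (simp add: K'_def)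
  have K': "(\<integral>x. (1 + snd x) powr (\<gamma> - p) * \<bar>\<phi> n x\<bar> powr p \<partial>dxH) \<le> K'" for n
  proof -
    have "(\<integral>x. (1 + snd x) powr (\<gamma> - p) * \<bar>\<phi> n x\<bar> powr p \<partial>dxH)
       \<le> 2 / (\<gamma> - p + 1) * (p * (2 * p / (\<gamma> - p + 1)) powr (p - 1)) * (\<integral>x. (1 + snd x) powr \<gamma> * norm (grad (\<phi> n) x) powr p \<partial>dxH)"
      by (rule hardy_halfspace(3)[OF \<phi> p \<gamma>])
    also have "\<dots> \<le> K'" unfolding K'_def using p \<gamma> by (intro mult_left_mono K) auto
    finally show ?thesis .
  qed
  have grad_le: "(\<integral>\<^sup>+x. ennreal (norm (grad (\<phi> n) x) powr p) \<partial>dxH) \<le> ennreal K" for n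
  proof -
    have "(\<integral>\<^sup>+x. ennreal (norm (grad (\<phi> n) x) powr p) \<partial>dxH) \<le> (\<integral>\<^sup>+x. ennreal ((1 + snd x) powr \<gamma> * norm (grad (\<phi> n) x) powr p) \<partial>dxH)"
    proof (rule nn_integral_mono)
      fix x :: "(real^'m) \<times> real" assume "x \<in> space dxH"
      then have "1 \<le> (1 + snd x) powr \<gamma>" using p \<gamma> by (intro ge_one_powr_ge_zero) (auto simp: halfspace_def)
      then have "1 * norm (grad (\<phi> n) x) powr p \<le> (1 + snd x) powr \<gamma> * norm (grad (\<phi> n) x) powr p" by (intro mult_right_mono) auto
      then show "ennreal (norm (grad (\<phi> n) x) powr p) \<le> ennreal ((1 + snd x) powr \<gamma> * norm (grad (\<phi> n) x) powr p)" by (intro ennreal_leI) simp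
    qed
    also have "\<dots> = ennreal (\<integral>x. (1 + snd x) powr \<gamma> * norm (grad (\<phi> n) x) powr p \<partial>dxH)"
      by (rule nn_integral_eq_integral[OF hardy_halfspace(2)[OF \<phi> p \<gamma>]]) simp
    also have "\<dots> \<le> ennreal K" by (intro ennreal_leI K)
    finally show ?thesis .
  qed
  define \<Lambda> where "\<Lambda> l = real (Suc l)" for l
  have \<Lambda>: "1 \<le> \<Lambda> l" for l by (simp add: \<Lambda>_def)
  define b where "b l x = \<Lambda> l ^ DIM((real^'m) \<times> real) * (2 + snd x) powr \<bar>\<gamma> - p\<bar> * K'" for l and x :: "(real^'m) \<times> real"
  have bp: "\<bar>grid_average (\<Lambda> l) (\<phi> n) x\<bar> powr p \<le> b l x" if "x \<in> halfspace" for l n x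
    unfolding b_def by (rule grid_average_bound[OF \<phi> p \<gamma> \<Lambda> that K'])
  have "\<bar>grid_average (\<Lambda> l) (\<phi> n) x\<bar> \<le> b l x powr (1 / p)" if "x \<in> halfspace" for l n x
    using powr_mono2[of "1 / p", OF _ _ bp[OF that, of l n]] p by (simp add: powr_powr)
  then obtain \<tau> where \<tau>: "strict_mono \<tau>" "\<And>l x. x \<in> halfspace \<Longrightarrow> convergent (\<lambda>n. grid_average (\<Lambda> l) (\<phi> (\<tau> n)) x)"
    using grid_averages_subsequence[of \<Lambda> \<phi> "\<lambda>l x. b l x powr (1 / p)"] by blast
  define A where "A l n = grid_average (\<Lambda> l) (\<phi> (\<tau> n))" for l n
  define \<phi>' where "\<phi>' n = \<phi> (\<tau> n)" for n
  have Am [measurable]: "A l n \<in> borel_measurable dxH" for l n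
    unfolding A_def by (rule grid_average_measurable[OF \<Lambda>])
  define A' where "A' l x = lim (\<lambda>n. A l n x)" for l x
  have A'm [measurable]: "A' l \<in> borel_measurable dxH" for l
    unfolding A'_def[abs_def] by (rule borel_measurable_lim_metric) measurable
  have A': "(\<lambda>n. A l n x) \<longlonglongrightarrow> A' l x" if "x \<in> halfspace" for l x
    using \<tau>(2)[OF that, of l] by (simp add: A'_def A_def convergent_LIMSEQ_iff)
  have Ab: "\<bar>A l n x\<bar> powr p \<le> b l x" if "x \<in> halfspace" for l n x
    unfolding A_def by (rule bp[OF that])
  have A'b: "\<bar>A' l x\<bar> powr p \<le> b l x" if x: "x \<in> halfspace" for l x
  proof (rule LIMSEQ_le_const2)
    show "(\<lambda>n. \<bar>A l n x\<bar> powr p) \<longlonglongrightarrow> \<bar>A' l x\<bar> powr p"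
      using A'[OF x] p by (intro tendsto_powr' tendsto_rabs tendsto_const) auto
  qed (use Ab[OF x] in auto)
  obtain \<omega> :: "(real^'m) \<times> real \<Rightarrow> real" where \<omega>: "\<omega> \<in> borel_measurable borel"
    "\<And>x. 0 < \<omega> x" "\<And>x. \<omega> x \<le> 1" "integrable dxH (\<lambda>x. \<omega> x * (2 + snd x) powr \<bar>\<gamma> - p\<bar>)"
    using integrable_weight_halfspace[of "\<gamma> - p"] by blast
  interpret W: weighted_Lp dxH \<omega> p
    by unfold_locales (use \<omega> p borel_measurable_dxH in auto)
  have \<omega>b: "integrable dxH (\<lambda>x. \<omega> x * b l x)" for l
  proof -
    have "integrable dxH (\<lambda>x. (\<omega> x * (2 + snd x) powr \<bar>\<gamma> - p\<bar>) * (\<Lambda> l ^ DIM((real^'m) \<times> real) * K'))"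
      by (rule integrable_mult_left[OF \<omega>(4)])
    then show ?thesis by (simp add: b_def mult_ac)
  qed
  have LA: "W.Lw (A l n)" "W.Lw (A' l)" for l n
    by (rule W.Lw_dominated[OF _ \<omega>b[of l]]; use Ab A'b \<omega>(2) in \<open>auto intro!: mult_left_mono simp: less_imp_le\<close>)+
  \<comment> \<open>Poincare error at mesh 1/(l+1), independent of n.\<close>
  define \<epsilon> where "\<epsilon> l = 2 ^ DIM((real^'m) \<times> real) * (?N / \<Lambda> l) powr p * K" for l
  have D: "W.Lw (\<lambda>x. \<phi>' n x - A l n x)" "W.Nw (\<lambda>x. \<phi>' n x - A l n x) \<le> \<epsilon> l" for l n
  proof -
    have m: "(\<lambda>x. \<phi>' n x - A l n x) \<in> borel_measurable dxH"
      unfolding \<phi>'_def by (intro borel_measurable_diff borel_measurable_dxH Cc_infty_measurable(1)[OF \<phi>] Am)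
    have "(\<integral>\<^sup>+x. ennreal (\<omega> x * norm (\<phi>' n x - A l n x) powr p) \<partial>dxH) \<le> (\<integral>\<^sup>+x. ennreal (\<bar>\<phi>' n x - A l n x\<bar> powr p) \<partial>dxH)"
      using \<omega> by (intro nn_integral_mono ennreal_leI) (simp add: mult_left_le_one_le less_imp_le)
    also have "\<dots> \<le> ennreal (2 ^ DIM((real^'m) \<times> real) * (?N / \<Lambda> l) powr p) * (\<integral>\<^sup>+x. ennreal (norm (grad (\<phi>' n) x) powr p) \<partial>dxH)"
      unfolding A_def \<phi>'_def using p by (intro grid_poincare \<phi> \<Lambda>) auto
    also have "\<dots> \<le> ennreal (2 ^ DIM((real^'m) \<times> real) * (?N / \<Lambda> l) powr p) * ennreal K"
      unfolding \<phi>'_def by (intro mult_left_mono grad_le) auto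
    also have "\<dots> = ennreal (\<epsilon> l)" using K0 by (simp add: \<epsilon>_def ennreal_mult)
    finally show "W.Lw (\<lambda>x. \<phi>' n x - A l n x)" "W.Nw (\<lambda>x. \<phi>' n x - A l n x) \<le> \<epsilon> l"
      using W.LwI_nn_integral[OF m] K0 by (auto simp: \<epsilon>_def)
  qed
  have L\<phi>: "W.Lw (\<phi>' n)" for n
    using W.Lw_add[OF D(1)[of n 0] LA(1)[of 0 n]] by simp
  have conv: "(\<lambda>n. W.Nw (\<lambda>x. A l n x - A' l x)) \<longlonglongrightarrow> 0" for l
  proof -
    have "(\<lambda>n. \<integral>x. \<omega> x * norm (A l n x - A' l x) powr p \<partial>dxH) \<longlonglongrightarrow> (\<integral>x. 0 \<partial>(dxH :: ((real^'m) \<times> real) measure))"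
    proof (rule integral_dominated_convergence)
      show "integrable dxH (\<lambda>x. 2 powr p * (2 * (\<omega> x * b l x)))" using \<omega>b by simp
      show "(\<lambda>x. \<omega> x * norm (A l n x - A' l x) powr p) \<in> borel_measurable dxH" for n by measurable
      show "AE x in dxH. (\<lambda>n. \<omega> x * norm (A l n x - A' l x) powr p) \<longlonglongrightarrow> 0"
      proof (rule AE_I2)
        fix x :: "(real^'m) \<times> real" assume "x \<in> space dxH"
        then have x: "x \<in> halfspace" by simp
        have "(\<lambda>n. \<omega> x * norm (A l n x - A' l x) powr p) \<longlonglongrightarrow> \<omega> x * norm (A' l x - A' l x) powr p"
          using A'[OF x, of l] p by (intro tendsto_mult tendsto_const tendsto_powr' tendsto_norm tendsto_diff) auto
        then show "(\<lambda>n. \<omega> x * norm (A l n x - A' l x) powr p) \<longlonglongrightarrow> 0" by simp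
      qed
      show "AE x in dxH. norm (\<omega> x * norm (A l n x - A' l x) powr p) \<le> 2 powr p * (2 * (\<omega> x * b l x))" for n
      proof (rule AE_I2)
        fix x :: "(real^'m) \<times> real" assume "x \<in> space dxH"
        then have x: "x \<in> halfspace" by simp
        have "norm (A l n x - A' l x) powr p \<le> 2 powr p * (norm (A l n x) powr p + norm (A' l x) powr p)"
          using p by (intro norm_diff_powr_le) auto
        also have "\<dots> \<le> 2 powr p * (b l x + b l x)" using Ab[OF x] A'b[OF x] by (intro mult_left_mono add_mono) auto
        finally have "\<omega> x * norm (A l n x - A' l x) powr p \<le> \<omega> x * (2 powr p * (b l x + b l x))"
          using \<omega>(2) by (intro mult_left_mono) (auto simp: less_imp_le)
        then show "norm (\<omega> x * norm (A l n x - A' l x) powr p) \<le> 2 powr p * (2 * (\<omega> x * b l x))"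
          using \<omega>(2)[of x] by (simp add: abs_mult algebra_simps)
      qed
    qed simp
    then show ?thesis by (simp add: W.Nw_def)
  qed
  have \<epsilon>: "\<epsilon> \<longlonglongrightarrow> 0"
  proof -
    have "(\<lambda>l. ?N * (1 / real (Suc l))) \<longlonglongrightarrow> ?N * 0" by (intro tendsto_intros LIMSEQ_Suc[OF lim_1_over_n])
    then have "(\<lambda>l. (?N / \<Lambda> l) powr p) \<longlonglongrightarrow> 0 powr p"
      using p by (intro tendsto_powr' tendsto_const) (auto simp: \<Lambda>_def)
    then have "(\<lambda>l. 2 ^ DIM((real^'m) \<times> real) * (?N / \<Lambda> l) powr p * K) \<longlonglongrightarrow> 2 ^ DIM((real^'m) \<times> real) * 0 powr p * K"
      by (intro tendsto_mult tendsto_const)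
    then show ?thesis by (simp add: \<epsilon>_def[abs_def])
  qed
  have "W.Cauchy_Nw \<phi>'"
    unfolding W.Cauchy_Nw_def
  proof (intro allI impI)
    fix e :: real assume e: "0 < e"
    \<comment> \<open>The generalised triangle inequality is used twice, first through the averages
      and then through their limit, which costs 2^p each time and four errors of size d.\<close>
    define d where "d = e / (4 * (2 powr p * 2 powr p))"
    have d: "0 < d" using e by (simp add: d_def)
    obtain l where l: "\<epsilon> l < d" using order_tendstoD(2)[OF \<epsilon> d] by (auto simp: eventually_sequentially)
    obtain k where k: "\<And>n. k \<le> n \<Longrightarrow> W.Nw (\<lambda>x. A l n x - A' l x) < d"
      using order_tendstoD(2)[OF conv[of l] d] by (auto simp: eventually_sequentially)
    have near: "W.Nw (\<lambda>x. \<phi>' n x - A' l x) < 2 powr p * (2 * d)" if "k \<le> n" for n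
    proof -
      have "W.Nw (\<lambda>x. \<phi>' n x - A' l x) \<le> 2 powr p * (W.Nw (\<lambda>x. \<phi>' n x - A l n x) + W.Nw (\<lambda>x. A l n x - A' l x))"
        by (intro W.Nw_triangle L\<phi> LA)
      also have "\<dots> < 2 powr p * (d + d)"
        using D(2)[of n l] l k[OF that] by (intro mult_strict_left_mono) auto
      finally show ?thesis by simp
    qed
    have "W.Nw (\<lambda>x. \<phi>' m x - \<phi>' n x) < e" if "k \<le> m" "k \<le> n" for m n
    proof -
      have "W.Nw (\<lambda>x. \<phi>' m x - \<phi>' n x) \<le> 2 powr p * (W.Nw (\<lambda>x. \<phi>' m x - A' l x) + W.Nw (\<lambda>x. A' l x - \<phi>' n x))"
        by (intro W.Nw_triangle L\<phi> LA)
      also have "\<dots> < 2 powr p * (2 powr p * (2 * d) + 2 powr p * (2 * d))"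
        using near that by (intro mult_strict_left_mono add_strict_mono) (auto simp: W.Nw_minus_commute[of "A' l"])
      also have "\<dots> = e" by (simp add: d_def)
      finally show ?thesis .
    qed
    then show "\<exists>k. \<forall>m\<ge>k. \<forall>n\<ge>k. W.Nw (\<lambda>x. \<phi>' m x - \<phi>' n x) < e" by blast
  qed
  from W.Cauchy_Nw_AE_subseq[OF L\<phi> this] obtain \<rho> u where u: "strict_mono \<rho>" "u \<in> borel_measurable dxH"
    "AE x in dxH. (\<lambda>n. \<phi>' (\<rho> n) x) \<longlonglongrightarrow> u x" by blast
  show ?thesis
  proof
    show "strict_mono (\<tau> \<circ> \<rho>)" using \<tau>(1) u(1) by (rule strict_mono_o)
    show "AE x in dxH. (\<lambda>n. \<phi> ((\<tau> \<circ> \<rho>) n) x) \<longlonglongrightarrow> u x" using u(3) by (simp add: \<phi>'_def)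
  qed (rule u(2))
qed

section \<open>Weak gradients\<close>

text \<open>Local integrability gives measurability only on each compact piece; countably many
  pieces are glued together.\<close>

lemma measurable_dxH_exhaust:
  fixes f :: "(real^'m) \<times> real \<Rightarrow> 'b::topological_space" and S :: "nat \<Rightarrow> ((real^'m) \<times> real) set"
  assumes S: "\<And>n. S n \<in> sets lebesgue" "\<And>n. S n \<subseteq> halfspace" "halfspace \<subseteq> (\<Union>n. S n)"
    and f: "\<And>n. f \<in> borel_measurable (lebesgue_on (S n))"
  shows "f \<in> borel_measurable dxH"
proof (rule measurable_piecewise_restrict[of "range S"])
  fix \<Omega> assume "\<Omega> \<in> range S"
  then obtain n where n: "\<Omega> = S n" by auto
  have "restrict_space dxH \<Omega> = lebesgue_on (S n)"
    using S(1,2)[of n] by (simp add: n restrict_restrict_space Int_absorb1)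
  then show "f \<in> restrict_space dxH \<Omega> \<rightarrow>\<^sub>M borel" using f by simp
  show "\<Omega> \<inter> space dxH \<in> sets dxH" using S(1)[of n] S(2)[of n] by (simp add: n sets_restrict_space_iff Int_absorb2)
qed (use S(3) in auto)

definition exhaustion :: "nat \<Rightarrow> ((real^'m) \<times> real) set" where
  "exhaustion n = cball 0 (real n) \<inter> {x. 1 / real (Suc n) \<le> snd x}"

lemma exhaustion:
  "compact (exhaustion n :: ((real^'m) \<times> real) set)" "exhaustion n \<subseteq> (halfspace :: ((real^'m) \<times> real) set)"
  "(halfspace :: ((real^'m) \<times> real) set) \<subseteq> (\<Union>n. exhaustion n)"
proof -
  show "compact (exhaustion n :: ((real^'m) \<times> real) set)"
    unfolding exhaustion_def by (intro compact_Int_closed compact_cball closed_Collect_le continuous_intros)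
  show "exhaustion n \<subseteq> (halfspace :: ((real^'m) \<times> real) set)"
  proof
    fix x :: "(real^'m) \<times> real" assume "x \<in> exhaustion n"
    then have "1 / real (Suc n) \<le> snd x" by (simp add: exhaustion_def)
    then show "x \<in> halfspace" unfolding halfspace_def mem_Collect_eq by (rule less_le_trans[rotated]) simp
  qed
  show "(halfspace :: ((real^'m) \<times> real) set) \<subseteq> (\<Union>n. exhaustion n)"
  proof
    fix x :: "(real^'m) \<times> real" assume "x \<in> halfspace"
    then have "0 < snd x" by (simp add: halfspace_def)
    then obtain k where k: "1 / real (Suc k) < snd x" using nat_approx_posE by blast
    obtain j where j: "norm x \<le> real j" using real_arch_simple by blast
    define n where "n = max j k"
    have "1 / real (Suc n) \<le> 1 / real (Suc k)" by (intro divide_left_mono) (auto simp: n_def)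
    then have "x \<in> exhaustion n" using k j by (auto simp: exhaustion_def n_def)
    then show "x \<in> (\<Union>n. exhaustion n)" by blast
  qed
qed

lemma compact_sets_lebesgue: "compact K \<Longrightarrow> K \<in> sets lebesgue"
  by (rule fmeasurableD[OF lmeasurable_compact])

lemma loc_integrable_measurable:
  fixes f :: "(real^'m) \<times> real \<Rightarrow> 'b::euclidean_space"
  assumes "loc_integrable f" shows "f \<in> borel_measurable dxH"
proof (rule measurable_dxH_exhaust[OF compact_sets_lebesgue[OF exhaustion(1)] exhaustion(2,3)])
  fix n
  have "integrable (lebesgue_on (exhaustion n)) f"
    using assms exhaustion(1,2) unfolding loc_integrable_def by blast
  then show "f \<in> borel_measurable (lebesgue_on (exhaustion n))" by (rule borel_measurable_integrable)
qed

lemma integrable_lebesgue_on_iff: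
  fixes f :: "(real^'m) \<times> real \<Rightarrow> 'b::euclidean_space"
  assumes "K \<in> sets lebesgue" "K \<subseteq> halfspace"
  shows "integrable (lebesgue_on K) f \<longleftrightarrow> integrable dxH (\<lambda>x. indicator K x *\<^sub>R f x)"
proof -
  have "(\<lambda>x. indicator halfspace x *\<^sub>R indicator K x *\<^sub>R f x) = (\<lambda>x. indicator K x *\<^sub>R f x)"
    using assms(2) by (auto simp: indicator_def fun_eq_iff)
  then show ?thesis using assms(1) by (simp add: integrable_dxH_iff integrable_restrict_space)
qed

lemma loc_integrableD:
  fixes f :: "(real^'m) \<times> real \<Rightarrow> 'b::euclidean_space"
  assumes f: "loc_integrable f" and K: "compact K" "K \<subseteq> halfspace"
  shows "integrable dxH (\<lambda>x. indicator K x *\<^sub>R f x)"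
proof -
  have "integrable (lebesgue_on K) f" using f K unfolding loc_integrable_def by blast
  then show ?thesis by (rule integrable_lebesgue_on_iff[OF compact_sets_lebesgue[OF K(1)] K(2), THEN iffD1])
qed

lemma pos_loc_integrableD:
  assumes "pos_loc_integrable w" and S: "S \<in> sets lebesgue" "S \<subseteq> halfspace" "bounded S"
  shows "integrable (lebesgue_on S) w"
proof -
  have "\<forall>S. S \<in> sets lebesgue \<and> S \<subseteq> halfspace \<and> bounded S \<longrightarrow> integrable (lebesgue_on S) w"
    using assms(1) unfolding pos_loc_integrable_def by (rule conjunct2)
  from this[rule_format, OF conjI[OF S(1) conjI[OF S(2,3)]]] show ?thesis .
qed

lemma pos_loc_integrable_measurable:
  fixes w :: "(real^'m) \<times> real \<Rightarrow> real"
  assumes "pos_loc_integrable w" shows "w \<in> borel_measurable dxH"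
proof (rule measurable_dxH_exhaust[OF compact_sets_lebesgue[OF exhaustion(1)] exhaustion(2,3)])
  fix n
  have "integrable (lebesgue_on (exhaustion n)) w"
    by (rule pos_loc_integrableD[OF assms compact_sets_lebesgue[OF exhaustion(1)] exhaustion(2) compact_imp_bounded[OF exhaustion(1)]])
  then show "w \<in> borel_measurable (lebesgue_on (exhaustion n))" by (rule borel_measurable_integrable)
qed

lemma pos_loc_integrable_mult:
  fixes w h :: "(real^'m) \<times> real \<Rightarrow> real"
  assumes w: "pos_loc_integrable w" and hm: "h \<in> borel_measurable dxH"
    and h: "\<And>x. \<bar>h x\<bar> \<le> B" "\<And>x. R \<le> norm x \<Longrightarrow> h x = 0"
  shows "integrable dxH (\<lambda>x. w x * h x)"
proof -
  define S where "S = halfspace \<inter> cball (0::(real^'m) \<times> real) R"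
  have S: "S \<in> sets lebesgue" "S \<subseteq> halfspace" "bounded S"
    using bounded_subset[OF bounded_cball] by (auto simp: S_def)
  have "integrable (lebesgue_on S) w" by (rule pos_loc_integrableD[OF w S])
  then have "integrable dxH (\<lambda>x. indicator S x *\<^sub>R w x)"
    by (rule integrable_lebesgue_on_iff[OF S(1,2), THEN iffD1])
  then have i: "integrable dxH (\<lambda>x. (indicator S x *\<^sub>R w x) * B)" by (rule integrable_mult_left)
  show ?thesis
  proof (rule Bochner_Integration.integrable_bound[OF i])
    show "(\<lambda>x. w x * h x) \<in> borel_measurable dxH"
      by (intro borel_measurable_times pos_loc_integrable_measurable w hm)
    show "AE x in dxH. norm (w x * h x) \<le> norm ((indicator S x *\<^sub>R w x) * B)"
    proof (rule AE_I2)
      fix x :: "(real^'m) \<times> real" assume "x \<in> space dxH"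
      then have x: "x \<in> halfspace" by simp
      show "norm (w x * h x) \<le> norm ((indicator S x *\<^sub>R w x) * B)"
      proof (cases "x \<in> S")
        case True
        then show ?thesis using h(1)[of x] by (auto simp: abs_mult intro!: mult_left_mono)
      next
        case False
        then show ?thesis using x h(2)[of x] by (simp add: S_def)
      qed
    qed
  qed
qed

text \<open>Boxes form an intersection-stable generator, so vanishing integrals pass to all Borel
  sets, in particular to those where d > 0 and d < 0. The support condition makes the total integral
  a box integral, as the complement step demands.\<close>

lemma AE_zero_if_box_integrals_zero:
  fixes d :: "'a::euclidean_space \<Rightarrow> real"
  assumes d: "integrable lborel d" and supp: "\<And>x. x \<notin> box A B \<Longrightarrow> d x = 0"
    and z: "\<And>a b. (\<integral>x. indicator (box a b) x * d x \<partial>lborel) = 0"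
  shows "AE x in lborel. d x = 0"
proof -
  have [measurable]: "d \<in> borel_measurable borel" using borel_measurable_integrable[OF d] by simp
  have total: "(\<integral>x. d x \<partial>lborel) = 0"
  proof -
    have "(\<integral>x. d x \<partial>lborel) = (\<integral>x. indicator (box A B) x * d x \<partial>lborel)"
      by (intro Bochner_Integration.integral_cong) (auto simp: indicator_def supp)
    then show ?thesis using z by simp
  qed
  have di: "integrable lborel (\<lambda>x. indicator E x * d x)" if "E \<in> sets borel" for E
    using integrable_mult_indicator[of E lborel d] d that by simp
  have sets0: "(\<integral>x. indicator E x * d x \<partial>lborel) = 0" if E: "E \<in> sets borel" for E :: "'a set"
  proof -
    let ?G = "range (\<lambda>(a, b). box a b :: 'a set)"
    have "E \<in> sigma_sets UNIV ?G" using E unfolding borel_eq_box by simp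
    have "Int_stable ?G"
      by (auto simp: Int_stable_def box_Int_box)
    then show ?thesis
    proof (rule sigma_sets_induct_disjoint[OF _ _ \<open>E \<in> sigma_sets UNIV ?G\<close>])
      fix F assume "F \<in> ?G" then show "(\<integral>x. indicator F x * d x \<partial>lborel) = 0" using z by auto
    next
      fix F assume "F \<in> sigma_sets UNIV ?G" and F0: "(\<integral>x. indicator F x * d x \<partial>lborel) = 0"
      then have F: "F \<in> sets borel" unfolding borel_eq_box by simp
      have "(\<lambda>x. indicator (UNIV - F) x * d x) = (\<lambda>x. d x - indicator F x * d x)" by (auto simp: indicator_def)
      then show "(\<integral>x. indicator (UNIV - F) x * d x \<partial>lborel) = 0" using d di[OF F] F0 total by simp
    next
      fix F :: "nat \<Rightarrow> 'a set"
      assume disj: "disjoint_family F" and F: "range F \<subseteq> sigma_sets UNIV ?G"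
        and F0: "\<And>i. (\<integral>x. indicator (F i) x * d x \<partial>lborel) = 0"
      have Fb: "F i \<in> sets borel" for i using F unfolding borel_eq_box by auto
      then have "(LINT x:(\<Union>i. F i)|lborel. d x) = (\<Sum>i. (LINT x:(F i)|lborel. d x))"
        using disj di[of "\<Union>i. F i"]
        by (intro lebesgue_integral_countable_add) (auto simp: disjoint_family_on_def set_integrable_def)
      then show "(\<integral>x. indicator (\<Union>i. F i) x * d x \<partial>lborel) = 0"
        using F0 by (simp add: set_lebesgue_integral_def)
    qed auto
  qed
  have half: "AE x in lborel. indicator {x. 0 < s * d x} x * (s * d x) = 0" for s :: real
  proof -
    have E: "{x. 0 < s * d x} \<in> sets borel" by measurable
    have "(\<integral>x. indicator {x. 0 < s * d x} x * (s * d x) \<partial>lborel) = s * (\<integral>x. indicator {x. 0 < s * d x} x * d x \<partial>lborel)"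
      by (simp add: mult.left_commute)
    also have "\<dots> = 0" using sets0[OF E] by simp
    finally have "(\<integral>x. indicator {x. 0 < s * d x} x * (s * d x) \<partial>lborel) = 0" .
    moreover have "integrable lborel (\<lambda>x. indicator {x. 0 < s * d x} x * (s * d x))"
      using integrable_mult_right[OF di[OF E], of s] by (simp add: mult.left_commute)
    ultimately show ?thesis
      by (subst (asm) integral_nonneg_eq_0_iff_AE) (auto simp: indicator_def)
  qed
  show ?thesis
    using half[of 1] half[of "-1"]
  proof eventually_elim
    case (elim x)
    then show ?case by (auto simp: indicator_def split: if_splits)
  qed
qed

lemma halfspace_boxes:
  fixes x :: "(real^'m) \<times> real"
  assumes x: "x \<in> halfspace"
  obtains n where "x \<in> box (- real n *\<^sub>R One, 1 / real (Suc n)) (real n *\<^sub>R One, real n)"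
proof -
  have "0 < snd x" using x by (simp add: halfspace_def)
  then obtain k where k: "1 / real (Suc k) < snd x" using nat_approx_posE by blast
  obtain j where j: "norm x < real j" using reals_Archimedean2 by blast
  define n where "n = max j k"
  have 1: "1 / real (Suc n) < snd x"
    by (rule le_less_trans[OF _ k], intro divide_left_mono) (auto simp: n_def)
  have 2: "norm x < real n" using j by (simp add: n_def)
  have "\<bar>fst x \<bullet> i\<bar> < real n" if "i \<in> Basis" for i
    using Basis_le_norm[OF that, of "fst x"] norm_fst_le[of "fst x" "snd x"] 2 by simp
  moreover have "snd x < real n" using norm_snd_le[of "snd x" "fst x"] 2 by simp
  ultimately have "x \<in> box (- real n *\<^sub>R One, 1 / real (Suc n)) (real n *\<^sub>R One, real n)"
    using 1 by (cases x) (auto simp: mem_box Basis_prod_def abs_less_iff inner_Pair minus_less_iff)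
  then show ?thesis by (rule that)
qed

text \<open>The fundamental lemma of the calculus of variations: smooth approximations of box
  indicators reduce it to integrals over boxes whose closure lies in the half-space, and countably
  many of these cover it.\<close>

lemma AE_zero_if_test_integrals_zero:
  fixes d :: "(real^'m) \<times> real \<Rightarrow> real"
  assumes d: "loc_integrable d"
    and test: "\<And>\<psi>. \<psi> \<in> Cc_infty halfspace \<Longrightarrow> (\<integral>x. \<psi> x * d x \<partial>dxH) = 0"
  shows "AE x in dxH. d x = 0"
proof -
  note [measurable] = loc_integrable_measurable[OF d]
  have boxes: "(\<integral>x. indicator (box a b) x * d x \<partial>dxH) = 0" if ab: "cbox a b \<subseteq> halfspace" for a b
  proof -
    obtain \<psi> :: "nat \<Rightarrow> (real^'m) \<times> real \<Rightarrow> real" where \<psi>: "\<And>n. \<psi> n \<in> Cc_infty halfspace"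
      "\<And>n x. \<bar>\<psi> n x\<bar> \<le> indicator (box a b) x" "\<And>x. (\<lambda>n. \<psi> n x) \<longlonglongrightarrow> indicator (box a b) x"
      using smooth_box_indicator[OF ab] by blast
    have "(\<lambda>n. \<integral>x. \<psi> n x * d x \<partial>dxH) \<longlonglongrightarrow> (\<integral>x. indicator (box a b) x * d x \<partial>dxH)"
    proof (rule integral_dominated_convergence)
      have "integrable dxH (\<lambda>x. indicator (cbox a b) x *\<^sub>R d x)"
        by (rule loc_integrableD[OF d compact_cbox ab])
      then show "integrable dxH (\<lambda>x. norm (indicator (cbox a b) x *\<^sub>R d x))" by (rule integrable_norm)
      have "(\<lambda>x. indicator (box a b) x :: real) \<in> borel_measurable dxH"
        by (intro borel_measurable_dxH) measurable
      then show "(\<lambda>x. indicator (box a b) x * d x) \<in> borel_measurable dxH" by measurable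
      show "(\<lambda>x. \<psi> n x * d x) \<in> borel_measurable dxH" for n
        using borel_measurable_dxH[OF Cc_infty_measurable(1)[OF \<psi>(1)[of n]]] by measurable
      show "AE x in dxH. (\<lambda>n. \<psi> n x * d x) \<longlonglongrightarrow> indicator (box a b) x * d x"
        by (intro AE_I2 tendsto_mult tendsto_const \<psi>(3))
      show "AE x in dxH. norm (\<psi> n x * d x) \<le> norm (indicator (cbox a b) x *\<^sub>R d x)" for n
      proof (rule AE_I2)
        fix x
        have "indicator (box a b) x \<le> (indicator (cbox a b) x :: real)"
          using box_subset_cbox[of a b] by (auto simp: indicator_def)
        then have "\<bar>\<psi> n x\<bar> \<le> indicator (cbox a b) x" using \<psi>(2)[of n x] by linarith
        then show "norm (\<psi> n x * d x) \<le> norm (indicator (cbox a b) x *\<^sub>R d x)"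
          by (simp add: abs_mult mult_right_mono)
      qed
    qed
    then show ?thesis using test[OF \<psi>(1)] by (simp add: LIMSEQ_const_iff)
  qed
  have on_box: "AE x in lebesgue. x \<in> box A B \<longrightarrow> d x = 0" if AB: "cbox A B \<subseteq> halfspace" for A B
  proof -
    have sub: "box A B \<subseteq> halfspace" using AB box_subset_cbox by blast
    define D where "D x = indicator (box A B) x * d x" for x
    have "integrable dxH (\<lambda>x. indicator (box A B) x *\<^sub>R (indicator (cbox A B) x *\<^sub>R d x))"
      by (intro integrable_mult_indicator loc_integrableD[OF d compact_cbox AB])
         (use sub in \<open>auto simp: sets_restrict_space_iff\<close>)
    moreover have "(\<lambda>x. indicator (box A B) x *\<^sub>R (indicator (cbox A B) x *\<^sub>R d x)) = D"
      using box_subset_cbox[of A B] by (auto simp: D_def indicator_def fun_eq_iff)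
    moreover have "(\<lambda>x. indicator halfspace x *\<^sub>R D x) = D"
      using sub by (auto simp: D_def indicator_def fun_eq_iff)
    ultimately have Di: "integrable lebesgue D" by (simp only: integrable_dxH_iff)
    \<comment> \<open>The box criterion is stated for Borel measure, so a Borel representative is
      taken; a second cut-off by the indicator makes it vanish outside the box at every
      point.\<close>
    obtain D' where D': "D' \<in> borel_measurable lborel" "AE x in lborel. D x = D' x"
      using completion_ex_borel_measurable_real[OF borel_measurable_integrable[OF Di]] by blast
    then have [measurable]: "D' \<in> borel_measurable borel" by simp
    define E where "E x = indicator (box A B) x * D' x" for x
    have [measurable]: "E \<in> borel_measurable borel" unfolding E_def[abs_def] by measurable
    have ED: "AE x in lebesgue. E x = D x"
      using AE_completion[OF D'(2)] by eventually_elim (auto simp: E_def D_def indicator_def split: if_splits)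
    have [measurable]: "E \<in> borel_measurable lebesgue" by (rule measurable_completion) simp
    have Ei: "integrable lebesgue E"
      using integrable_cong_AE_imp[OF Di _ AE_symmetric[OF ED]] by simp
    have "AE x in lborel. E x = 0"
    proof (rule AE_zero_if_box_integrals_zero[of E A B])
      show "integrable lborel E" using Ei by (simp add: integrable_completion)
      show "E x = 0" if "x \<notin> box A B" for x using that by (simp add: E_def)
      fix a b
      \<comment> \<open>An arbitrary box is replaced by its intersection with the fixed one, which
        is again a box with closure in the half-space.\<close>
      define a' where "a' = (\<Sum>i\<in>Basis. max (a\<bullet>i) (A\<bullet>i) *\<^sub>R i)"
      define b' where "b' = (\<Sum>i\<in>Basis. min (b\<bullet>i) (B\<bullet>i) *\<^sub>R i)"
      have int: "box a b \<inter> box A B = box a' b'" unfolding a'_def b'_def by (rule box_Int_box)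
      have "cbox a' b' \<subseteq> cbox A B" unfolding a'_def b'_def by (auto simp: mem_box)
      then have ab': "cbox a' b' \<subseteq> halfspace" using AB by blast
      have sub': "box a' b' \<subseteq> halfspace" using ab' box_subset_cbox by blast
      have m: "(\<lambda>x. indicator (box a b) x * E x) \<in> borel_measurable lborel" by measurable
      have "(\<integral>x. indicator (box a b) x * E x \<partial>lborel) = (\<integral>x. indicator (box a b) x * E x \<partial>lebesgue)"
        by (rule integral_completion[symmetric, OF m])
      also have "\<dots> = (\<integral>x. indicator (box a b) x * D x \<partial>lebesgue)"
      proof (rule integral_cong_AE)
        show "(\<lambda>x. indicator (box a b) x * E x) \<in> borel_measurable lebesgue" by (rule measurable_completion[OF m])
        have "(\<lambda>x. indicator (box a b) x :: real) \<in> borel_measurable lebesgue" by (rule measurable_completion) simp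
        then show "(\<lambda>x. indicator (box a b) x * D x) \<in> borel_measurable lebesgue"
          by (intro borel_measurable_times borel_measurable_integrable[OF Di])
        show "AE x in lebesgue. indicator (box a b) x * E x = indicator (box a b) x * D x"
          using ED by eventually_elim simp
      qed
      also have "\<dots> = (\<integral>x. indicator halfspace x *\<^sub>R (indicator (box a' b') x * d x) \<partial>lebesgue)"
        by (intro Bochner_Integration.integral_cong) (use int sub' in \<open>auto simp: D_def indicator_def set_eq_iff\<close>)
      also have "\<dots> = 0" using boxes[OF ab'] by (simp add: integral_dxH)
      finally show "(\<integral>x. indicator (box a b) x * E x \<partial>lborel) = 0" .
    qed
    then have "AE x in lebesgue. E x = 0" by (rule AE_completion)
    with ED show ?thesis by eventually_elim (auto simp: D_def)
  qed
  have sub: "cbox (- real n *\<^sub>R One, 1 / real (Suc n)) (real n *\<^sub>R One, real n) \<subseteq> (halfspace :: ((real^'m) \<times> real) set)" for n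
  proof
    fix x :: "(real^'m) \<times> real" assume "x \<in> cbox (- real n *\<^sub>R One, 1 / real (Suc n)) (real n *\<^sub>R One, real n)"
    then have "1 / real (Suc n) \<le> snd x" by (cases x) (auto simp: cbox_Pair_eq)
    then show "x \<in> halfspace" unfolding halfspace_def mem_Collect_eq by (rule less_le_trans[rotated]) simp
  qed
  have "AE x in lebesgue. \<forall>n. x \<in> box (- real n *\<^sub>R One, 1 / real (Suc n)) (real n *\<^sub>R One, real n) \<longrightarrow> d x = 0"
    unfolding AE_all_countable using on_box[OF sub] by blast
  then have "AE x in lebesgue. x \<in> halfspace \<longrightarrow> d x = 0"
  proof eventually_elim
    case (elim x)
    then show ?case using halfspace_boxes[of x] by blast
  qed
  then show ?thesis by (simp add: AE_dxH_iff)
qed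

lemma loc_integrable_test_integrable:
  fixes G :: "(real^'m) \<times> real \<Rightarrow> 'b::euclidean_space"
  assumes G: "loc_integrable G" and h: "h \<in> borel_measurable borel" "\<And>x. \<bar>h x\<bar> \<le> B"
    "\<And>x. x \<notin> K \<Longrightarrow> h x = 0" and K: "compact K" "K \<subseteq> halfspace"
  shows "integrable dxH (\<lambda>x. h x *\<^sub>R G x)"
proof (rule Bochner_Integration.integrable_bound)
  show "integrable dxH (\<lambda>x. B *\<^sub>R (indicator K x *\<^sub>R G x))"
    by (intro integrable_scaleR_right loc_integrableD[OF G K])
  show "(\<lambda>x. h x *\<^sub>R G x) \<in> borel_measurable dxH"
    by (intro borel_measurable_scaleR borel_measurable_dxH h loc_integrable_measurable G)
  show "AE x in dxH. norm (h x *\<^sub>R G x) \<le> norm (B *\<^sub>R (indicator K x *\<^sub>R G x))"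
  proof (rule AE_I2)
    fix x
    show "norm (h x *\<^sub>R G x) \<le> norm (B *\<^sub>R (indicator K x *\<^sub>R G x))"
      using h(2)[of x] h(3)[of x] by (cases "x \<in> K") (auto intro!: mult_right_mono)
  qed
qed

lemma Cc_infty_support_compact:
  assumes "\<psi> \<in> Cc_infty S"
  shows "compact (closure {x. \<psi> x \<noteq> 0})" "closure {x. \<psi> x \<noteq> 0} \<subseteq> S"
    "x \<notin> closure {x. \<psi> x \<noteq> 0} \<Longrightarrow> \<psi> x = 0 \<and> grad \<psi> x = 0"
  using assms grad_eq_0_outside_support[of x \<psi>] closure_subset[of "{x. \<psi> x \<noteq> 0}"] by (auto simp: Cc_infty_def)

text \<open>Justifies the choice made in \<open>wgrad\<close>: any explicitly constructed weak
  gradient may be used in its place under an integral.\<close>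

lemma weak_gradient_unique:
  fixes G G' :: "(real^'m) \<times> real \<Rightarrow> (real^'m) \<times> real"
  assumes "has_weak_gradient u G" "has_weak_gradient u G'"
  shows "AE x in dxH. G x = G' x"
proof -
  have G: "loc_integrable G" "loc_integrable G'" using assms by (auto simp: has_weak_gradient_def)
  have comp: "AE x in dxH. (G x - G' x) \<bullet> e = 0" for e
  proof (rule AE_zero_if_test_integrals_zero)
    have "integrable (lebesgue_on K) (\<lambda>x. (G x - G' x) \<bullet> e)" if K: "compact K" "K \<subseteq> halfspace" for K
    proof -
      have "integrable (lebesgue_on K) G" "integrable (lebesgue_on K) G'"
        using G K unfolding loc_integrable_def by blast+
      then show ?thesis by (intro integrable_inner_left Bochner_Integration.integrable_diff)
    qed
    then show "loc_integrable (\<lambda>x. (G x - G' x) \<bullet> e)" unfolding loc_integrable_def by blast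
    fix \<psi> :: "(real^'m) \<times> real \<Rightarrow> real" assume \<psi>: "\<psi> \<in> Cc_infty halfspace"
    obtain B where B: "0 \<le> B" "\<And>x. norm (grad \<psi> x) \<le> B" "\<And>x. \<bar>\<psi> x\<bar> \<le> B" using Cc_infty_bounded[OF \<psi>] by blast
    note s = Cc_infty_support_compact[OF \<psi>]
    have z: "\<psi> x = 0" if "x \<notin> closure {x. \<psi> x \<noteq> 0}" for x using s(3)[OF that] by simp
    have i1: "integrable dxH (\<lambda>x. \<psi> x *\<^sub>R G x)"
      by (rule loc_integrable_test_integrable[OF G(1) Cc_infty_measurable(1)[OF \<psi>] B(3) z s(1,2)])
    have i2: "integrable dxH (\<lambda>x. \<psi> x *\<^sub>R G' x)"
      by (rule loc_integrable_test_integrable[OF G(2) Cc_infty_measurable(1)[OF \<psi>] B(3) z s(1,2)])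
    note i = i1 i2
    have "(\<integral>x. u x *\<^sub>R grad \<psi> x \<partial>dxH) = - (\<integral>x. \<psi> x *\<^sub>R G x \<partial>dxH)"
      using assms(1) \<psi> unfolding has_weak_gradient_def by blast
    moreover have "(\<integral>x. u x *\<^sub>R grad \<psi> x \<partial>dxH) = - (\<integral>x. \<psi> x *\<^sub>R G' x \<partial>dxH)"
      using assms(2) \<psi> unfolding has_weak_gradient_def by blast
    ultimately have "(\<integral>x. \<psi> x *\<^sub>R G x \<partial>dxH) = (\<integral>x. \<psi> x *\<^sub>R G' x \<partial>dxH)" by simp
    then have "(\<integral>x. \<psi> x *\<^sub>R G x - \<psi> x *\<^sub>R G' x \<partial>dxH) \<bullet> e = 0" using i by simp
    moreover have "(\<integral>x. (\<psi> x *\<^sub>R G x - \<psi> x *\<^sub>R G' x) \<bullet> e \<partial>dxH) = (\<integral>x. \<psi> x *\<^sub>R G x - \<psi> x *\<^sub>R G' x \<partial>dxH) \<bullet> e"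
      by (rule integral_inner_left) (intro Bochner_Integration.integrable_diff i)
    ultimately have "(\<integral>x. (\<psi> x *\<^sub>R G x - \<psi> x *\<^sub>R G' x) \<bullet> e \<partial>dxH) = 0" by simp
    then show "(\<integral>x. \<psi> x * ((G x - G' x) \<bullet> e) \<partial>dxH) = 0" by (simp add: inner_diff_left right_diff_distrib)
  qed
  have "AE x in dxH. \<forall>e\<in>Basis. (G x - G' x) \<bullet> e = 0"
    by (rule AE_finite_allI[OF finite_Basis comp])
  then show ?thesis
  proof eventually_elim
    case (elim x)
    have "G x - G' x = 0"
    proof (rule euclidean_eqI)
      fix e :: "(real^'m) \<times> real" assume "e \<in> Basis"
      with elim show "(G x - G' x) \<bullet> e = 0 \<bullet> e" unfolding inner_zero_left by (rule bspec)
    qed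
    then show ?case by simp
  qed
qed

lemma wgrad_eq:
  assumes "has_weak_gradient u G"
  shows "has_weak_gradient u (wgrad u)" "AE x in dxH. wgrad u x = G x"
proof -
  show h: "has_weak_gradient u (wgrad u)" unfolding wgrad_def by (rule someI[of "has_weak_gradient u", OF assms])
  show "AE x in dxH. wgrad u x = G x" by (rule weak_gradient_unique[OF h assms])
qed

text \<open>The support of \<psi> is compact in the open half-space, so the gradient of the product
  \<phi> \<psi> vanishes outside it and \<open>integral_grad_eq_0\<close> on the whole space
  applies; \<phi> need not vanish on the boundary.\<close>

lemma integral_by_parts:
  fixes \<phi> \<psi> :: "(real^'m) \<times> real \<Rightarrow> real"
  assumes \<phi>: "\<phi> \<in> Cc_infty UNIV" and \<psi>: "\<psi> \<in> Cc_infty halfspace"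
  shows "integrable dxH (\<lambda>x. \<phi> x *\<^sub>R grad \<psi> x)" "integrable dxH (\<lambda>x. \<psi> x *\<^sub>R grad \<phi> x)"
    "(\<integral>x. \<phi> x *\<^sub>R grad \<psi> x \<partial>dxH) = - (\<integral>x. \<psi> x *\<^sub>R grad \<phi> x \<partial>dxH)"
proof -
  note [measurable] = Cc_infty_measurable[OF \<phi>] Cc_infty_measurable[OF \<psi>]
  obtain B where B: "0 \<le> B" "\<And>x. norm (grad \<psi> x) \<le> B" "\<And>x. \<bar>\<psi> x\<bar> \<le> B" using Cc_infty_bounded[OF \<psi>] by blast
  obtain B' where B': "0 \<le> B'" "\<And>x. norm (grad \<phi> x) \<le> B'" "\<And>x. \<bar>\<phi> x\<bar> \<le> B'" using Cc_infty_bounded[OF \<phi>] by blast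
  obtain R where R: "0 < R" "\<And>x. R \<le> norm x \<Longrightarrow> \<psi> x = 0 \<and> grad \<psi> x = 0" using Cc_infty_support[OF \<psi>] by blast
  have m: "(\<lambda>x. \<phi> x *\<^sub>R grad \<psi> x) \<in> borel_measurable borel" "(\<lambda>x. \<psi> x *\<^sub>R grad \<phi> x) \<in> borel_measurable borel"
    by measurable
  show i1: "integrable dxH (\<lambda>x. \<phi> x *\<^sub>R grad \<psi> x)"
  proof (rule integrable_dxH_bounded[of _ "B' * B" R])
    show "norm (\<phi> x *\<^sub>R grad \<psi> x) \<le> B' * B" for x using B(2)[of x] B'(3)[of x] B'(1) by (simp add: mult_mono)
  qed (use R m in \<open>auto intro: borel_measurable_dxH\<close>)
  show i2: "integrable dxH (\<lambda>x. \<psi> x *\<^sub>R grad \<phi> x)"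
  proof (rule integrable_dxH_bounded[of _ "B * B'" R])
    show "norm (\<psi> x *\<^sub>R grad \<phi> x) \<le> B * B'" for x using B'(2)[of x] B(3)[of x] B(1) by (simp add: mult_mono)
  qed (use R m in \<open>auto intro: borel_measurable_dxH\<close>)
  define f where "f x = \<phi> x * \<psi> x" for x
  have fc: "f \<in> Cc_infty UNIV"
    unfolding f_def[abs_def] using Cc_infty_mult[OF \<phi> \<psi>] Cc_infty_mono[of halfspace UNIV] by blast
  have gf: "grad f x = \<phi> x *\<^sub>R grad \<psi> x + \<psi> x *\<^sub>R grad \<phi> x" for x
    unfolding f_def[abs_def] by (rule grad_mult[OF \<phi> \<psi>])
  have gf0: "grad f x = 0" if "x \<notin> halfspace" for x
  proof -
    have "x \<notin> closure {x. \<psi> x \<noteq> 0}" using Cc_infty_support_compact(2)[OF \<psi>] that by blast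
    then show ?thesis using Cc_infty_support_compact(3)[OF \<psi>, of x] by (simp add: gf)
  qed
  have "(\<integral>x. \<phi> x *\<^sub>R grad \<psi> x + \<psi> x *\<^sub>R grad \<phi> x \<partial>dxH) = 0"
  proof (rule euclidean_eqI)
    fix e :: "(real^'m) \<times> real" assume e: "e \<in> Basis"
    have "(\<integral>x. \<phi> x *\<^sub>R grad \<psi> x + \<psi> x *\<^sub>R grad \<phi> x \<partial>dxH) \<bullet> e = (\<integral>x. grad f x \<bullet> e \<partial>dxH)"
      unfolding gf by (rule integral_inner_left[symmetric]) (intro Bochner_Integration.integrable_add i1 i2)
    also have "\<dots> = (\<integral>x. grad f x \<bullet> e \<partial>lebesgue)"
      unfolding integral_dxH using gf0 by (intro Bochner_Integration.integral_cong) (auto simp: indicator_def)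
    also have "\<dots> = (\<integral>x. grad f x \<bullet> e \<partial>lborel)"
      using Cc_infty_measurable(2)[OF fc] by (intro integral_completion) simp
    also have "\<dots> = 0" by (rule integral_grad_eq_0[OF fc e])
    finally show "(\<integral>x. \<phi> x *\<^sub>R grad \<psi> x + \<psi> x *\<^sub>R grad \<phi> x \<partial>dxH) \<bullet> e = 0 \<bullet> e" by simp
  qed
  then show "(\<integral>x. \<phi> x *\<^sub>R grad \<psi> x \<partial>dxH) = - (\<integral>x. \<psi> x *\<^sub>R grad \<phi> x \<partial>dxH)"
    using i1 i2 by (simp add: eq_neg_iff_add_eq_0)
qed

section \<open>The variational problem\<close>

text \<open>Decay controls the weighted quotient far out, continuity on the closed half-space
  controls it on a compact remainder.\<close>

lemma K0_bounded:
  fixes k :: "(real^'m) \<times> real \<Rightarrow> real"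
  assumes k: "k \<in> K0 p \<gamma>"
  obtains M where "0 \<le> M" "\<And>x. x \<in> halfspace \<Longrightarrow> k x \<le> M * (1 + snd x) powr (\<gamma> - p)"
proof -
  define f where "f x = k x * (1 + snd x) powr (p - \<gamma>)" for x
  let ?H = "closure (halfspace :: ((real^'m) \<times> real) set)"
  have H: "?H \<subseteq> {x. 0 \<le> snd x}"
  proof (rule closure_minimal)
    show "closed {x::(real^'m) \<times> real. 0 \<le> snd x}" by (intro closed_Collect_le continuous_intros)
  qed (auto simp: halfspace_def)
  have lim: "(f \<longlongrightarrow> 0) (inf at_infinity (principal ?H))" and kc: "continuous_on ?H k"
    using k by (auto simp: K0_def f_def[abs_def])
  have "\<forall>\<^sub>F x in inf at_infinity (principal ?H). f x < 1" by (rule order_tendstoD(2)[OF lim]) simp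
  then obtain R where R: "\<And>x. R \<le> norm x \<Longrightarrow> x \<in> ?H \<Longrightarrow> f x < 1"
    by (auto simp: eventually_inf_principal eventually_at_infinity)
  have "continuous_on ?H f"
    unfolding f_def using H by (intro continuous_intros kc) auto
  then have "compact (f ` (?H \<inter> cball 0 R))"
    by (intro compact_continuous_image closed_Int_compact) (auto intro: continuous_on_subset)
  then have "bounded (f ` (?H \<inter> cball 0 R))" by (rule compact_imp_bounded)
  then obtain C where "\<forall>y\<in>f ` (?H \<inter> cball 0 R). norm y \<le> C" unfolding bounded_iff by blast
  then have C: "\<bar>f x\<bar> \<le> C" if "x \<in> ?H" "norm x \<le> R" for x using that by simp
  have le: "f x \<le> max 1 C" if x: "x \<in> ?H" for x
    using R[OF _ x] C[OF x] by (cases "norm x \<le> R") (auto simp: less_eq_real_def)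
  have "k x \<le> max 1 C * (1 + snd x) powr (\<gamma> - p)" if x: "x \<in> halfspace" for x
  proof -
    have "k x = f x * (1 + snd x) powr (\<gamma> - p)"
      using x by (simp add: f_def halfspace_def mult.assoc powr_add[symmetric])
    also have "\<dots> \<le> max 1 C * (1 + snd x) powr (\<gamma> - p)"
      using closure_subset x by (intro mult_right_mono le) auto
    finally show ?thesis .
  qed
  then show ?thesis using that[of "max 1 C"] by simp
qed

text \<open>The form of the condition s < p* in which the Sobolev inequality uses it; it covers p =
  N, where p* is infinite, without a case distinction.\<close>

lemma subcritical:
  fixes N p s :: real
  assumes "1 < p" "p \<le> N" "ereal s < crit_exp N p"
  shows "N * (s / p - 1) < s"
proof (cases "p < N")
  case True
  then have "s < N * p / (N - p)" using assms by (simp add: crit_exp_def)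
  then have "s * (N - p) < N * p" using True by (simp add: pos_less_divide_eq)
  then show ?thesis using assms by (simp add: field_simps)
next
  case False
  then show ?thesis using assms by (simp add: field_simps)
qed

lemma pos_loc_integrable_pos:
  assumes "pos_loc_integrable w" "x \<in> halfspace" shows "0 < w x"
  using assms(1) unfolding pos_loc_integrable_def by (elim conjE) (rule bspec[OF _ assms(2)])

text \<open>Either the term e b v^s already suffices, or v^(s-q) < a/(e b); substituting the latter
  into a v^q leaves a^(s/(s-q)) / b^(q/(s-q)), which is the given power of the ratio.\<close>

lemma young_weighted:
  fixes a b v q s e :: real
  assumes "0 < a" "0 < b" "0 \<le> v" "1 < q" "q < s" "0 < e"
  shows "a * v powr q \<le> e * (b * v powr s) + e powr (- (q / (s - q))) * \<bar>a powr (1 / q) / b powr (1 / s)\<bar> powr (s * q / (s - q))"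
proof -
  define R where "R = \<bar>a powr (1 / q) / b powr (1 / s)\<bar> powr (s * q / (s - q))"
  have R: "R = a powr (s / (s - q)) / b powr (q / (s - q))"
    using assms by (simp add: R_def powr_divide powr_powr)
  show ?thesis
  proof (cases "a * v powr q \<le> e * (b * v powr s)")
    case True
    then show ?thesis by (simp add: add_increasing2)
  next
    case False
    have v: "0 < v" using False assms by (cases "v = 0") auto
    have "v powr s = v powr q * v powr (s - q)" by (simp flip: powr_add)
    then have "e * b * v powr (s - q) * v powr q < a * v powr q" using False by (simp add: mult_ac)
    then have "v powr (s - q) < a / (e * b)" using v assms by (simp add: pos_less_divide_eq mult_ac)
    then have "(v powr (s - q)) powr (q / (s - q)) \<le> (a / (e * b)) powr (q / (s - q))"
      using assms by (intro powr_mono2) auto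
    then have "v powr q \<le> (a / (e * b)) powr (q / (s - q))" using assms by (simp add: powr_powr)
    also have "\<dots> = e powr (- (q / (s - q))) * (a powr (q / (s - q)) / b powr (q / (s - q)))"
      using assms by (simp add: powr_divide powr_mult powr_minus field_simps)
    finally have "a * v powr q \<le> a * (e powr (- (q / (s - q))) * (a powr (q / (s - q)) / b powr (q / (s - q))))"
      using assms by (intro mult_left_mono) auto
    also have "\<dots> = e powr (- (q / (s - q))) * ((a powr 1 * a powr (q / (s - q))) / b powr (q / (s - q)))"
      using assms by simp
    also have "a powr 1 * a powr (q / (s - q)) = a powr (s / (s - q))"
    proof -
      have "s / (s - q) = 1 + q / (s - q)" using assms by (simp add: field_simps)
      then show ?thesis by (simp only: powr_add)
    qed
    finally have "a * v powr q \<le> e powr (- (q / (s - q))) * R" by (simp add: R)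
    then show ?thesis using assms by (simp add: R_def add_increasing)
  qed
qed

text \<open>The elementary y \<le> e + e^(1-r) y^r takes the place of Holder's inequality on sets of
  finite measure; the free parameter e is what \<open>L1_tendsto\<close> exploits.\<close>

lemma (in weighted_Lp) L1_bound:
  fixes F :: "'x \<Rightarrow> 'b::euclidean_space"
  assumes K: "K \<in> sets M" "emeasure M K < \<infinity>" and c: "0 < c" "AE x in M. x \<in> K \<longrightarrow> c \<le> w x"
    and F: "Lw F"
  shows "integrable M (\<lambda>x. indicator K x *\<^sub>R F x)"
    and "0 < e \<Longrightarrow> (\<integral>x. indicator K x * norm (F x) \<partial>M) \<le> e * measure M K + e powr (1 - r) / c * Nw F"
proof -
  have [measurable]: "K \<in> sets M" "F \<in> borel_measurable M" using K F by (auto simp: Lw_def)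
  have pt: "y \<le> e + e powr (1 - r) * y powr r" if "0 < e" "0 \<le> y" for e y :: real
  proof (cases "y \<le> e")
    case False
    have "y powr 1 = y powr (1 - r) * y powr r" by (subst powr_add[symmetric]) simp
    also have "\<dots> \<le> e powr (1 - r) * y powr r"
      using False that r_gt_1 by (intro mult_right_mono powr_mono2') auto
    finally show ?thesis using that False by simp
  qed (simp add: add_increasing2)
  have bd: "AE x in M. indicator K x * norm (F x) \<le> e * indicator K x + e powr (1 - r) / c * (w x * norm (F x) powr r)"
    if e: "0 < e" for e
    using c(2) AE_space
  proof eventually_elim
    case (elim x)
    show ?case
    proof (cases "x \<in> K")
      case True
      have "e powr (1 - r) * norm (F x) powr r = e powr (1 - r) / c * (c * norm (F x) powr r)" using c by simp
      also have "\<dots> \<le> e powr (1 - r) / c * (w x * norm (F x) powr r)"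
        using True elim c by (intro mult_left_mono mult_right_mono) auto
      finally have "norm (F x) \<le> e + e powr (1 - r) / c * (w x * norm (F x) powr r)"
        using pt[OF e norm_ge_zero[of "F x"]] by linarith
      then show ?thesis using True by simp
    next
      case False
      then show ?thesis using elim w_pos[of x] c by simp
    qed
  qed
  have i: "integrable M (\<lambda>x. e * indicator K x + e powr (1 - r) / c * (w x * norm (F x) powr r))" for e
    using K by (intro Bochner_Integration.integrable_add integrable_mult_right Lw_integrable F) auto
  show 1: "integrable M (\<lambda>x. indicator K x *\<^sub>R F x)"
  proof (rule Bochner_Integration.integrable_bound[OF i[of 1]])
    show "AE x in M. norm (indicator K x *\<^sub>R F x) \<le> norm (1 * indicator K x + 1 powr (1 - r) / c * (w x * norm (F x) powr r))"
      using bd[OF zero_less_one] by eventually_elim simp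
  qed measurable
  show "(\<integral>x. indicator K x * norm (F x) \<partial>M) \<le> e * measure M K + e powr (1 - r) / c * Nw F" if e: "0 < e"
  proof -
    have "integrable M (\<lambda>x. indicator K x * norm (F x))" using integrable_norm[OF 1] by simp
    then have "(\<integral>x. indicator K x * norm (F x) \<partial>M) \<le> (\<integral>x. e * indicator K x + e powr (1 - r) / c * (w x * norm (F x) powr r) \<partial>M)"
      using bd[OF e] i by (intro integral_mono_AE)
    also have "\<dots> = e * measure M K + e powr (1 - r) / c * Nw F"
      using K Lw_integrable[OF F] by (subst Bochner_Integration.integral_add) (auto simp: Nw_def measure_def Int_absorb2 sets.sets_into_space)
    finally show ?thesis .
  qed
qed

lemma (in weighted_Lp) L1_tendsto:
  fixes F :: "nat \<Rightarrow> 'x \<Rightarrow> 'b::euclidean_space"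
  assumes K: "K \<in> sets M" "emeasure M K < \<infinity>" and c: "0 < c" "AE x in M. x \<in> K \<longrightarrow> c \<le> w x"
    and F: "\<And>n. Lw (F n)" and lim: "(\<lambda>n. Nw (F n)) \<longlonglongrightarrow> 0"
  shows "(\<lambda>n. \<integral>x. indicator K x * norm (F n x) \<partial>M) \<longlonglongrightarrow> 0"
proof (rule LIMSEQ_I)
  fix d :: real assume d: "0 < d"
  define e where "e = d / (2 * (measure M K + 1))"
  have e: "0 < e" using d by (simp add: e_def add_nonneg_pos)
  have e2: "e * measure M K \<le> d / 2"
  proof -
    have "measure M K / (measure M K + 1) \<le> 1" by (simp add: divide_le_eq_1 add_nonneg_pos)
    then have "d / 2 * (measure M K / (measure M K + 1)) \<le> d / 2 * 1" using d by (intro mult_left_mono) auto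
    moreover have "e * measure M K = d / 2 * (measure M K / (measure M K + 1))" by (simp add: e_def)
    ultimately show ?thesis by linarith
  qed
  have "(\<lambda>n. e powr (1 - r) / c * Nw (F n)) \<longlonglongrightarrow> e powr (1 - r) / c * 0"
    by (intro tendsto_mult tendsto_const lim)
  then have "\<forall>\<^sub>F n in sequentially. e powr (1 - r) / c * Nw (F n) < d / 2"
    by (rule order_tendstoD(2)) (use d in simp)
  then obtain k where k: "\<And>n. k \<le> n \<Longrightarrow> e powr (1 - r) / c * Nw (F n) < d / 2"
    by (auto simp: eventually_sequentially)
  have "norm ((\<integral>x. indicator K x * norm (F n x) \<partial>M) - 0) < d" if "k \<le> n" for n
  proof -
    have "0 \<le> (\<integral>x. indicator K x * norm (F n x) \<partial>M)" by (intro integral_nonneg_AE) auto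
    moreover have "(\<integral>x. indicator K x * norm (F n x) \<partial>M) \<le> e * measure M K + e powr (1 - r) / c * Nw (F n)"
      by (rule L1_bound(2)[OF K c F e])
    ultimately show ?thesis using k[OF that] e2 unfolding real_norm_def diff_zero by linarith
  qed
  then show "\<exists>k. \<forall>n\<ge>k. norm ((\<integral>x. indicator K x * norm (F n x) \<partial>M) - 0) < d" by blast
qed

locale variational_problem =
  fixes \<rho> a b :: "(real^'m) \<times> real \<Rightarrow> real" and p q s \<rho>0 \<gamma> :: real
  assumes p: "1 < p" "p \<le> real DIM((real^'m) \<times> real)" and pq: "p < q" and qs: "q < s"
    and s_crit: "ereal s < crit_exp (real DIM((real^'m) \<times> real)) p"
    and \<rho>: "pos_loc_integrable \<rho>" and a: "pos_loc_integrable a" and b: "pos_loc_integrable b"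
    and \<rho>0: "0 < \<rho>0" and \<gamma>: "p - 1 < \<gamma>"
    and lower: "AE x in dxH. \<rho>0 * (1 + snd x) powr \<gamma> \<le> \<rho> x"
    and b_K0: "b \<in> K0 p \<gamma>"
    and ratio: "in_Lp dxH (s * q / (s - q)) (\<lambda>x. a x powr (1 / q) / b x powr (1 / s))"
begin

definition v :: "(real^'m) \<times> real \<Rightarrow> real" where "v x = (1 + snd x) powr (\<gamma> - p)"

lemma v_measurable: "v \<in> borel_measurable dxH"
  unfolding v_def[abs_def] by (intro borel_measurable_dxH borel_measurable_weight)

lemma coefficients_pos:
  assumes "x \<in> halfspace" shows "0 < \<rho> x" "0 < a x" "0 < b x" "0 < v x"
  using assms pos_loc_integrable_pos[OF \<rho>] pos_loc_integrable_pos[OF a] pos_loc_integrable_pos[OF b]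
  by (simp_all add: v_def halfspace_def)

text \<open>Four instances with different weights: \<open>R.Nw\<close> of the gradient is the p-th
  power of the norm of E, \<open>V\<close> is the Hardy space in which E is realised, and
  \<open>A.Nw\<close>, \<open>B.Nw\<close> are the two lower order terms.\<close>

sublocale R: weighted_Lp dxH \<rho> p
  by unfold_locales (use p(1) in \<open>simp_all add: coefficients_pos pos_loc_integrable_measurable[OF \<rho>]\<close>)

sublocale V: weighted_Lp dxH v p
  by unfold_locales (use p(1) in \<open>simp_all add: coefficients_pos v_measurable\<close>)

sublocale A: weighted_Lp dxH a q
  by unfold_locales (use p(1) pq in \<open>simp_all add: coefficients_pos pos_loc_integrable_measurable[OF a]\<close>)

sublocale B: weighted_Lp dxH b s
  by unfold_locales (use p(1) pq qs in \<open>simp_all add: coefficients_pos pos_loc_integrable_measurable[OF b]\<close>)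

lemma pos_loc_integrable_Lp:
  fixes F :: "(real^'m) \<times> real \<Rightarrow> 'b::euclidean_space"
  assumes w: "pos_loc_integrable w" and r: "0 < r" and F: "F \<in> borel_measurable borel"
    and B: "\<And>x. norm (F x) \<le> B" and supp: "\<And>x. R \<le> norm x \<Longrightarrow> F x = 0"
  shows "integrable dxH (\<lambda>x. w x * norm (F x) powr r)"
proof (rule pos_loc_integrable_mult[OF w])
  show "(\<lambda>x. norm (F x) powr r) \<in> borel_measurable dxH"
    using F by (intro borel_measurable_dxH) measurable
  show "\<bar>norm (F x) powr r\<bar> \<le> B powr r" for x using B[of x] r by (simp add: powr_mono2)
  show "norm (F x) powr r = 0" if "R \<le> norm x" for x using supp[OF that] by simp
qed

lemma Cc_infty_Lw:
  assumes f: "f \<in> Cc_infty UNIV"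
  shows "R.Lw (grad f)" "V.Lw f" "A.Lw f" "B.Lw f"
proof -
  note m = Cc_infty_measurable[OF f]
  obtain B where B: "0 \<le> B" "\<And>x. norm (grad f x) \<le> B" "\<And>x. \<bar>f x\<bar> \<le> B" using Cc_infty_bounded[OF f] by blast
  obtain R where R: "0 < R" "\<And>x. R \<le> norm x \<Longrightarrow> f x = 0 \<and> grad f x = 0" using Cc_infty_support[OF f] by blast
  have f': "norm (f x) \<le> B" "R \<le> norm x \<Longrightarrow> f x = 0" "R \<le> norm x \<Longrightarrow> grad f x = 0" for x
    using B(3)[of x] R(2)[of x] by auto
  have "integrable dxH (\<lambda>x. \<rho> x * norm (grad f x) powr p)"
    using p by (intro pos_loc_integrable_Lp[OF \<rho> _ m(2) B(2) f'(3)]) auto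
  then show "R.Lw (grad f)" by (simp add: R.Lw_def borel_measurable_dxH[OF m(2)])
  have "integrable dxH (\<lambda>x. a x * norm (f x) powr q)"
    using p pq by (intro pos_loc_integrable_Lp[OF a _ m(1) f'(1,2)]) auto
  then show "A.Lw f" by (simp add: A.Lw_def borel_measurable_dxH[OF m(1)])
  have "integrable dxH (\<lambda>x. b x * norm (f x) powr s)"
    using p pq qs by (intro pos_loc_integrable_Lp[OF b _ m(1) f'(1,2)]) auto
  then show "B.Lw f" by (simp add: B.Lw_def borel_measurable_dxH[OF m(1)])
  have "integrable dxH (\<lambda>x. v x * norm (f x) powr p)"
    using hardy_halfspace(1)[OF f p(1) \<gamma>] by (simp add: v_def)
  then show "V.Lw f" by (simp add: V.Lw_def borel_measurable_dxH[OF m(1)])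
qed

lemma weighted_gradient_le:
  assumes f: "f \<in> Cc_infty UNIV"
  shows "(\<integral>x. (1 + snd x) powr \<gamma> * norm (grad f x) powr p \<partial>dxH) \<le> 1 / \<rho>0 * R.Nw (grad f)"
proof -
  have "(\<integral>x. (1 + snd x) powr \<gamma> * norm (grad f x) powr p \<partial>dxH) \<le> (\<integral>x. 1 / \<rho>0 * (\<rho> x * norm (grad f x) powr p) \<partial>dxH)"
  proof (rule integral_mono_AE)
    show "integrable dxH (\<lambda>x. (1 + snd x) powr \<gamma> * norm (grad f x) powr p)"
      by (rule hardy_halfspace(2)[OF f p(1) \<gamma>])
    show "integrable dxH (\<lambda>x. 1 / \<rho>0 * (\<rho> x * norm (grad f x) powr p))"
      by (intro integrable_mult_right R.Lw_integrable Cc_infty_Lw(1) f)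
    show "AE x in dxH. (1 + snd x) powr \<gamma> * norm (grad f x) powr p \<le> 1 / \<rho>0 * (\<rho> x * norm (grad f x) powr p)"
      using lower
    proof eventually_elim
      case (elim x)
      then have "\<rho>0 * (1 + snd x) powr \<gamma> * norm (grad f x) powr p \<le> \<rho> x * norm (grad f x) powr p"
        by (rule mult_right_mono) simp
      then show ?case using \<rho>0 by (simp add: field_simps)
    qed
  qed
  then show ?thesis by (simp add: R.Nw_def)
qed

lemma hardy:
  obtains C where "0 \<le> C" "\<And>f. f \<in> Cc_infty UNIV \<Longrightarrow> V.Nw f \<le> C * R.Nw (grad f)"
proof -
  define C where "C = 2 / (\<gamma> - p + 1) * (p * (2 * p / (\<gamma> - p + 1)) powr (p - 1))"
  have C: "0 \<le> C" using p \<gamma> by (simp add: C_def)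
  have "V.Nw f \<le> C * (1 / \<rho>0) * R.Nw (grad f)" if f: "f \<in> Cc_infty UNIV" for f
  proof -
    have "V.Nw f \<le> C * (\<integral>x. (1 + snd x) powr \<gamma> * norm (grad f x) powr p \<partial>dxH)"
      unfolding V.Nw_def v_def C_def using hardy_halfspace(3)[OF f p(1) \<gamma>] by simp
    also have "\<dots> \<le> C * (1 / \<rho>0 * R.Nw (grad f))"
      by (intro mult_left_mono weighted_gradient_le f C)
    finally show ?thesis by simp
  qed
  then show ?thesis using that[of "C * (1 / \<rho>0)"] C \<rho>0 by auto
qed

text \<open>\<open>K0_bounded\<close> for b and the lower bound on \<rho> reduce this to
  \<open>weighted_sobolev\<close>.\<close>

lemma sobolev:
  obtains C where "0 \<le> C" "\<And>f. f \<in> Cc_infty UNIV \<Longrightarrow> B.Nw f \<le> C * (R.Nw (grad f) + V.Nw f) powr (s / p)"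
proof -
  have ps: "p < s" using pq qs by simp
  obtain M where M: "0 \<le> M" "\<And>x. x \<in> halfspace \<Longrightarrow> b x \<le> M * (1 + snd x) powr (\<gamma> - p)"
    using K0_bounded[OF b_K0] by blast
  obtain K where K: "0 \<le> K" "\<And>f :: (real^'m) \<times> real \<Rightarrow> real. f \<in> Cc_infty UNIV \<Longrightarrow>
    (\<integral>\<^sup>+x. ennreal ((1 + snd x) powr (\<gamma> - p) * \<bar>f x\<bar> powr s) \<partial>dxH)
      \<le> ennreal (K * ((\<integral>x. (1 + snd x) powr \<gamma> * norm (grad f x) powr p \<partial>dxH)
          + (\<integral>x. (1 + snd x) powr (\<gamma> - p) * \<bar>f x\<bar> powr p \<partial>dxH)) powr (s / p))"
    using weighted_sobolev[OF p(1) ps \<gamma> subcritical[OF p s_crit]] by blast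
  define c where "c = 1 / \<rho>0 + 1"
  have c: "0 \<le> c" using \<rho>0 by (simp add: c_def)
  have "B.Nw f \<le> M * K * c powr (s / p) * (R.Nw (grad f) + V.Nw f) powr (s / p)" if f: "f \<in> Cc_infty UNIV" for f
  proof -
    have fm: "f \<in> borel_measurable dxH" by (rule borel_measurable_dxH[OF Cc_infty_measurable(1)[OF f]])
    let ?T = "(\<integral>x. (1 + snd x) powr \<gamma> * norm (grad f x) powr p \<partial>dxH) + V.Nw f"
    have T0: "0 \<le> ?T" using V.Nw_nonneg[of f] by (intro add_nonneg_nonneg integral_nonneg_AE) auto
    have "ennreal (B.Nw f) = (\<integral>\<^sup>+x. ennreal (b x * norm (f x) powr s) \<partial>dxH)"
      by (rule B.nn_integral_eq_Nw[OF Cc_infty_Lw(4)[OF f], symmetric])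
    also have "\<dots> \<le> (\<integral>\<^sup>+x. ennreal M * ennreal ((1 + snd x) powr (\<gamma> - p) * \<bar>f x\<bar> powr s) \<partial>dxH)"
    proof (rule nn_integral_mono)
      fix x :: "(real^'m) \<times> real" assume "x \<in> space dxH"
      then have "b x * norm (f x) powr s \<le> (M * (1 + snd x) powr (\<gamma> - p)) * norm (f x) powr s"
        using M(2)[of x] by (intro mult_right_mono) auto
      then show "ennreal (b x * norm (f x) powr s) \<le> ennreal M * ennreal ((1 + snd x) powr (\<gamma> - p) * \<bar>f x\<bar> powr s)"
        using M(1) by (simp add: ennreal_leI mult.assoc flip: ennreal_mult)
    qed
    also have "\<dots> = ennreal M * (\<integral>\<^sup>+x. ennreal ((1 + snd x) powr (\<gamma> - p) * \<bar>f x\<bar> powr s) \<partial>dxH)"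
    proof (rule nn_integral_cmult)
      show "(\<lambda>x. ennreal ((1 + snd x) powr (\<gamma> - p) * \<bar>f x\<bar> powr s)) \<in> borel_measurable dxH"
        using v_measurable fm unfolding v_def[abs_def] by measurable
    qed
    also have "\<dots> \<le> ennreal M * ennreal (K * ?T powr (s / p))"
      using K(2)[OF f] by (intro mult_left_mono) (auto simp: V.Nw_def v_def)
    also have "\<dots> = ennreal (M * (K * ?T powr (s / p)))" using M(1) K(1) by (intro ennreal_mult[symmetric]) auto
    finally have 1: "B.Nw f \<le> M * (K * ?T powr (s / p))"
      using M(1) K(1) by (subst (asm) ennreal_le_iff) auto
    have "?T \<le> c * (R.Nw (grad f) + V.Nw f)"
      using weighted_gradient_le[OF f] V.Nw_nonneg[of f] R.Nw_nonneg[of "grad f"] \<rho>0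
      by (simp add: c_def distrib_left distrib_right add_increasing add_increasing2)
    then have "?T powr (s / p) \<le> (c * (R.Nw (grad f) + V.Nw f)) powr (s / p)"
      using T0 p ps by (intro powr_mono2) auto
    also have "\<dots> = c powr (s / p) * (R.Nw (grad f) + V.Nw f) powr (s / p)"
      using c V.Nw_nonneg[of f] R.Nw_nonneg[of "grad f"] by (simp add: powr_mult)
    finally have "M * (K * ?T powr (s / p)) \<le> M * (K * (c powr (s / p) * (R.Nw (grad f) + V.Nw f) powr (s / p)))"
      using M(1) K(1) by (intro mult_left_mono) auto
    with 1 show ?thesis by (simp add: mult.assoc)
  qed
  then show ?thesis using that[of "M * K * c powr (s / p)"] M(1) K(1) by auto
qed

text \<open>Equal to a^(s/(s-q)) / b^(q/(s-q)) in the half-space, the remainder in Young's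
  inequality between the two lower order terms.\<close>

definition ratio_power :: "(real^'m) \<times> real \<Rightarrow> real" where
  "ratio_power x = \<bar>a x powr (1 / q) / b x powr (1 / s)\<bar> powr (s * q / (s - q))"

lemma ratio_power_integrable: "integrable dxH ratio_power"
  using ratio by (simp add: in_Lp_def ratio_power_def[abs_def])

lemma ratio_power_nonneg: "0 \<le> ratio_power x"
  by (simp add: ratio_power_def)

lemma young:
  assumes "x \<in> halfspace" "0 < e"
  shows "a x * norm (t::real) powr q \<le> e * (b x * norm t powr s) + e powr (- (q / (s - q))) * ratio_power x"
  unfolding ratio_power_def using assms p pq qs coefficients_pos by (intro young_weighted) auto

text \<open>Young's inequality integrated. A small e gives coercivity of the energy, a large e gives
  continuity of A with respect to B.\<close>

lemma A_from_B:
  fixes F :: "(real^'m) \<times> real \<Rightarrow> real"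
  assumes F: "B.Lw F"
  shows "A.Lw F" "0 < e \<Longrightarrow> A.Nw F \<le> e * B.Nw F + e powr (- (q / (s - q))) * (\<integral>x. ratio_power x \<partial>dxH)"
proof -
  have i: "integrable dxH (\<lambda>x. e * (b x * norm (F x) powr s) + e powr (- (q / (s - q))) * ratio_power x)" for e
    by (intro Bochner_Integration.integrable_add integrable_mult_right B.Lw_integrable F ratio_power_integrable)
  show L: "A.Lw F"
    by (rule A.Lw_dominated[OF B.Lw_measurable[OF F] i[of 1]]) (use young[of _ 1] in auto)
  show "A.Nw F \<le> e * B.Nw F + e powr (- (q / (s - q))) * (\<integral>x. ratio_power x \<partial>dxH)" if e: "0 < e"
  proof -
    have "A.Nw F \<le> (\<integral>x. e * (b x * norm (F x) powr s) + e powr (- (q / (s - q))) * ratio_power x \<partial>dxH)"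
      unfolding A.Nw_def by (rule integral_mono[OF A.Lw_integrable[OF L] i]) (use young[OF _ e] in auto)
    also have "\<dots> = e * B.Nw F + e powr (- (q / (s - q))) * (\<integral>x. ratio_power x \<partial>dxH)"
      unfolding B.Nw_def using B.Lw_integrable[OF F] ratio_power_integrable by simp
    finally show ?thesis .
  qed
qed

text \<open>First e is taken large, which makes the term with the ratio small because its exponent
  is negative; then n is taken large to beat e.\<close>

lemma A_tendsto_from_B:
  fixes F :: "nat \<Rightarrow> (real^'m) \<times> real \<Rightarrow> real"
  assumes F: "\<And>n. B.Lw (F n)" and lim: "(\<lambda>n. B.Nw (F n)) \<longlonglongrightarrow> 0"
  shows "(\<lambda>n. A.Nw (F n)) \<longlonglongrightarrow> 0"
proof (rule LIMSEQ_I)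
  fix d :: real assume d: "0 < d"
  define r0 where "r0 = (\<integral>x. ratio_power x \<partial>dxH)"
  have r0: "0 \<le> r0" unfolding r0_def by (intro integral_nonneg_AE) (simp add: ratio_power_nonneg)
  have "((\<lambda>e::real. e powr (- (q / (s - q)))) \<longlongrightarrow> 0) at_top"
    using p pq qs by (intro tendsto_neg_powr filterlim_ident) auto
  then have "((\<lambda>e::real. e powr (- (q / (s - q))) * r0) \<longlongrightarrow> 0 * r0) at_top" by (intro tendsto_mult tendsto_const)
  then have "\<forall>\<^sub>F e in at_top. e powr (- (q / (s - q))) * r0 < d / 2"
    by (rule order_tendstoD(2)) (use d in simp)
  then have "\<forall>\<^sub>F e in at_top. 0 < e \<and> e powr (- (q / (s - q))) * r0 < d / 2"
    using eventually_gt_at_top[of 0] by eventually_elim simp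
  then obtain e where e: "0 < e" "e powr (- (q / (s - q))) * r0 < d / 2"
    by (auto simp: eventually_at_top_linorder)
  have "(\<lambda>n. e * B.Nw (F n)) \<longlonglongrightarrow> e * 0" by (intro tendsto_mult tendsto_const lim)
  then have "\<forall>\<^sub>F n in sequentially. e * B.Nw (F n) < d / 2" by (rule order_tendstoD(2)) (use d in simp)
  then obtain k where k: "\<And>n. k \<le> n \<Longrightarrow> e * B.Nw (F n) < d / 2" by (auto simp: eventually_sequentially)
  have "norm (A.Nw (F n) - 0) < d" if "k \<le> n" for n
    using A_from_B(2)[OF F[of n] e(1)] k[OF that] e(2) A.Nw_nonneg[of "F n"]
    unfolding r0_def real_norm_def diff_zero by linarith
  then show "\<exists>k. \<forall>n\<ge>k. norm (A.Nw (F n) - 0) < d" by blast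
qed

end

text \<open>Elements of \<open>C_delta\<close> are arbitrary outside the half-space, so their
  gradient is meaningful only at its points; openness makes it agree there with that of the smooth
  extension.\<close>

lemma C_delta_grad:
  fixes \<phi> f :: "(real^'m) \<times> real \<Rightarrow> real"
  assumes f: "f \<in> Cc_infty UNIV" "\<forall>x\<in>halfspace. \<phi> x = f x" and x: "x \<in> halfspace"
  shows "grad \<phi> x = grad f x"
proof (rule grad_eqI)
  show "(\<phi> has_derivative (\<lambda>h. grad f x \<bullet> h)) (at x)"
    by (rule has_derivative_transform_within_open[OF Cc_infty_has_derivative[OF f(1)] open_halfspace x])
       (use f(2) in simp)
qed

section \<open>The energy space as a closure of smooth functions\<close>

context variational_problem
begin

text \<open>The limit G of the gradients is carried along explicitly. Calculus with the chosen
  representative \<open>wgrad u\<close> would require an almost everywhere argument at every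
  step.\<close>

definition approximates :: "(nat \<Rightarrow> (real^'m) \<times> real \<Rightarrow> real) \<Rightarrow> ((real^'m) \<times> real \<Rightarrow> real)
    \<Rightarrow> ((real^'m) \<times> real \<Rightarrow> (real^'m) \<times> real) \<Rightarrow> bool" where
  "approximates \<phi> u G \<longleftrightarrow> (\<forall>n. \<phi> n \<in> Cc_infty UNIV) \<and> V.Lw u \<and> R.Lw G \<and>
     (\<lambda>n. R.Nw (\<lambda>x. grad (\<phi> n) x - G x)) \<longlonglongrightarrow> 0 \<and> (\<lambda>n. V.Nw (\<lambda>x. \<phi> n x - u x)) \<longlonglongrightarrow> 0"

lemma grad_diff:
  assumes "f \<in> Cc_infty UNIV" "g \<in> Cc_infty UNIV"
  shows "(\<lambda>x. f x - g x) \<in> Cc_infty UNIV" "grad (\<lambda>x. f x - g x) x = grad f x - grad g x"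
  using Cc_infty_add[OF assms(1) Cc_infty_scale[OF assms(2), of "-1"]]
    grad_add[OF assms(1) Cc_infty_scale[OF assms(2), of "-1"], of x] grad_scale[OF assms(2), of "-1" x]
  by simp_all

text \<open>The Sobolev inequality is applied to differences of test functions, which are test
  functions; the bound d below solves C d^(s/p) < e.\<close>

lemma Cauchy_B:
  assumes \<phi>: "\<And>n. \<phi> n \<in> Cc_infty UNIV" and R: "R.Cauchy_Nw (\<lambda>n. grad (\<phi> n))" and V: "V.Cauchy_Nw \<phi>"
  shows "B.Cauchy_Nw \<phi>"
  unfolding B.Cauchy_Nw_def
proof (intro allI impI)
  fix e :: real assume e: "0 < e"
  obtain C where C: "0 \<le> C" "\<And>f. f \<in> Cc_infty UNIV \<Longrightarrow> B.Nw f \<le> C * (R.Nw (grad f) + V.Nw f) powr (s / p)"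
    using sobolev by blast
  have sp: "0 < s / p" using p(1) pq qs by simp
  define d where "d = (e / (C + 1)) powr (p / s)"
  have d: "0 < d" using e C(1) by (simp add: d_def)
  have de: "C * d powr (s / p) < e"
  proof -
    have "d powr (s / p) = e / (C + 1)" using e C(1) p(1) pq qs by (simp add: d_def powr_powr)
    then have "C * d powr (s / p) + d powr (s / p) = e" using C(1) by (simp add: field_simps)
    moreover have "0 < d powr (s / p)" using d by simp
    ultimately show ?thesis by linarith
  qed
  obtain k1 where k1: "\<And>m n. k1 \<le> m \<Longrightarrow> k1 \<le> n \<Longrightarrow> R.Nw (\<lambda>x. grad (\<phi> m) x - grad (\<phi> n) x) < d / 2"
    using R d unfolding R.Cauchy_Nw_def by (meson half_gt_zero)
  obtain k2 where k2: "\<And>m n. k2 \<le> m \<Longrightarrow> k2 \<le> n \<Longrightarrow> V.Nw (\<lambda>x. \<phi> m x - \<phi> n x) < d / 2"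
    using V d unfolding V.Cauchy_Nw_def by (meson half_gt_zero)
  have "B.Nw (\<lambda>x. \<phi> m x - \<phi> n x) < e" if mn: "max k1 k2 \<le> m" "max k1 k2 \<le> n" for m n
  proof -
    let ?f = "\<lambda>x. \<phi> m x - \<phi> n x"
    have g: "grad ?f = (\<lambda>x. grad (\<phi> m) x - grad (\<phi> n) x)" by (rule ext) (rule grad_diff(2)[OF \<phi> \<phi>])
    have "R.Nw (grad ?f) + V.Nw ?f \<le> d" unfolding g using k1[of m n] k2[of m n] mn by simp
    then have "C * (R.Nw (grad ?f) + V.Nw ?f) powr (s / p) \<le> C * d powr (s / p)"
      using C(1) sp R.Nw_nonneg[of "grad ?f"] V.Nw_nonneg[of ?f] by (intro mult_left_mono powr_mono2) auto
    then show ?thesis using C(2)[OF grad_diff(1)[OF \<phi> \<phi>], of m n] de by linarith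
  qed
  then show "\<exists>k. \<forall>m\<ge>k. \<forall>n\<ge>k. B.Nw (\<lambda>x. \<phi> m x - \<phi> n x) < e" by blast
qed

text \<open>The Cauchy property for B yields some limit; that it is u is seen through almost
  everywhere convergence of a subsequence, which the convergence in \<open>V\<close>
  supplies.\<close>

lemma approximates_B_A:
  assumes ap: "approximates \<phi> u G"
  shows "B.Lw u" "(\<lambda>n. B.Nw (\<lambda>x. \<phi> n x - u x)) \<longlonglongrightarrow> 0" "A.Lw u" "(\<lambda>n. A.Nw (\<lambda>x. \<phi> n x - u x)) \<longlonglongrightarrow> 0"
proof -
  have \<phi>: "\<phi> n \<in> Cc_infty UNIV" for n using ap by (simp add: approximates_def)
  have u: "V.Lw u" "R.Lw G" "(\<lambda>n. R.Nw (\<lambda>x. grad (\<phi> n) x - G x)) \<longlonglongrightarrow> 0" "(\<lambda>n. V.Nw (\<lambda>x. \<phi> n x - u x)) \<longlonglongrightarrow> 0"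
    using ap by (auto simp: approximates_def)
  note L = Cc_infty_Lw[OF \<phi>]
  have RC: "R.Cauchy_Nw (\<lambda>n. grad (\<phi> n))" by (rule R.Nw_tendsto_imp_Cauchy[OF L(1) u(2,3)])
  have VC: "V.Cauchy_Nw \<phi>" by (rule V.Nw_tendsto_imp_Cauchy[OF L(2) u(1,4)])
  have BC: "B.Cauchy_Nw \<phi>" by (rule Cauchy_B[OF \<phi> RC VC])
  have VD: "V.Cauchy_Nw (\<lambda>n x. \<phi> n x - u x)"
    using VC unfolding V.Cauchy_Nw_def by simp
  obtain \<sigma> h where h: "strict_mono \<sigma>" "AE x in dxH. (\<lambda>n. \<phi> (\<sigma> n) x - u x) \<longlonglongrightarrow> h x" "h \<in> borel_measurable dxH"
    using V.Cauchy_Nw_AE_subseq[OF V.Lw_diff[OF L(2) u(1)] VD] by blast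
  have h0: "V.Lw h" "(\<lambda>n. V.Nw (\<lambda>x. (\<phi> n x - u x) - h x)) \<longlonglongrightarrow> 0"
    using V.Cauchy_Nw_tendsto[OF V.Lw_diff[OF L(2) u(1)] VD h(1,3,2)] by auto
  have "(\<lambda>n. V.Nw (\<lambda>x. \<phi> n x - u x)) \<longlonglongrightarrow> V.Nw h"
    by (rule V.Nw_tendsto[OF V.Lw_diff[OF L(2) u(1)] h0])
  then have "V.Nw h = 0" using u(4) LIMSEQ_unique by blast
  \<comment> \<open>A subsequence of the differences converges almost everywhere to h, and h has
    norm 0; positivity of the weight makes h vanish almost everywhere.\<close>
  then have "AE x in dxH. v x * norm (h x) powr p = 0"
    unfolding V.Nw_def using coefficients_pos(4)
    by (subst (asm) integral_nonneg_eq_0_iff_AE[OF V.Lw_integrable[OF h0(1)]]) (auto intro!: AE_I2 simp: less_imp_le)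
  then have lim: "AE x in dxH. (\<lambda>n. \<phi> (\<sigma> n) x) \<longlonglongrightarrow> u x"
    using h(2) AE_space
  proof eventually_elim
    case (elim x)
    then have "h x = 0" using coefficients_pos(4)[of x] by simp
    then have "(\<lambda>n. (\<phi> (\<sigma> n) x - u x) + u x) \<longlonglongrightarrow> 0 + u x" using elim by (intro tendsto_add tendsto_const) simp
    then show ?case by simp
  qed
  have "u \<in> borel_measurable dxH" using u(1) by (rule V.Lw_measurable)
  from B.Cauchy_Nw_tendsto[OF L(4) BC h(1) this lim]
  show B: "B.Lw u" "(\<lambda>n. B.Nw (\<lambda>x. \<phi> n x - u x)) \<longlonglongrightarrow> 0" by auto
  show "A.Lw u" by (rule A_from_B(1)[OF B(1)])
  show "(\<lambda>n. A.Nw (\<lambda>x. \<phi> n x - u x)) \<longlonglongrightarrow> 0" by (rule A_tendsto_from_B[OF B.Lw_diff[OF L(4) B(1)] B(2)])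
qed

lemma weights_bounded_below:
  assumes "bounded K"
  obtains c where "0 < c" "AE x in dxH. x \<in> K \<longrightarrow> c \<le> \<rho> x" "AE x in dxH. x \<in> K \<longrightarrow> c \<le> v x"
proof -
  obtain R where R: "\<And>x. x \<in> K \<Longrightarrow> norm x \<le> R" using assms unfolding bounded_iff by blast
  define c where "c = min \<rho>0 ((2 + \<bar>R\<bar>) powr (- \<bar>\<gamma> - p\<bar>))"
  have c: "0 < c" using \<rho>0 by (simp add: c_def)
  have 1: "AE x in dxH. x \<in> K \<longrightarrow> c \<le> \<rho> x"
    using lower AE_space
  proof eventually_elim
    case (elim x)
    then have "1 \<le> (1 + snd x) powr \<gamma>" using p(1) \<gamma> by (intro ge_one_powr_ge_zero) (auto simp: halfspace_def)
    then have "\<rho>0 * 1 \<le> \<rho>0 * (1 + snd x) powr \<gamma>" using \<rho>0 by (intro mult_left_mono) auto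
    moreover have "c \<le> \<rho>0" by (simp add: c_def)
    ultimately show ?case using elim by linarith
  qed
  have 2: "AE x in dxH. x \<in> K \<longrightarrow> c \<le> v x"
  proof (rule AE_I2, rule impI)
    fix x :: "(real^'m) \<times> real" assume x: "x \<in> space dxH" "x \<in> K"
    then have t: "1 \<le> 1 + snd x" "1 + snd x \<le> 2 + \<bar>R\<bar>"
      using R[OF x(2)] norm_snd_le[of "snd x" "fst x"] by (auto simp: halfspace_def)
    have "(2 + \<bar>R\<bar>) powr (- \<bar>\<gamma> - p\<bar>) \<le> (1 + snd x) powr (- \<bar>\<gamma> - p\<bar>)" using t by (intro powr_mono2') auto
    also have "\<dots> \<le> v x" unfolding v_def using t by (intro powr_mono) auto
    finally show "c \<le> v x" by (simp add: c_def)
  qed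
  from c 1 2 show ?thesis by (rule that)
qed

lemma compact_dxH:
  assumes "compact K" "K \<subseteq> (halfspace :: ((real^'m) \<times> real) set)"
  shows "K \<in> sets dxH" "emeasure dxH K < \<infinity>"
proof -
  have K: "K \<in> sets lebesgue" by (rule compact_sets_lebesgue[OF assms(1)])
  then show "K \<in> sets dxH" using assms(2) by (simp add: sets_restrict_space_iff)
  have "emeasure dxH K = emeasure lebesgue K" using assms(2) K by (simp add: emeasure_restrict_space)
  also have "\<dots> < \<infinity>" using lmeasurable_compact[OF assms(1)] unfolding fmeasurable_def by blast
  finally show "emeasure dxH K < \<infinity>" .
qed

text \<open>Integration by parts passes to the limit: the test functions have compact support in the
  half-space, where both weights are bounded below, so both convergences hold in L^1 on the
  support.\<close>

lemma approximates_weak_gradient: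
  assumes ap: "approximates \<phi> u G"
  shows "has_weak_gradient u G"
proof -
  have \<phi>: "\<phi> n \<in> Cc_infty UNIV" for n using ap by (simp add: approximates_def)
  have u: "V.Lw u" "R.Lw G" "(\<lambda>n. R.Nw (\<lambda>x. grad (\<phi> n) x - G x)) \<longlonglongrightarrow> 0" "(\<lambda>n. V.Nw (\<lambda>x. \<phi> n x - u x)) \<longlonglongrightarrow> 0"
    using ap by (auto simp: approximates_def)
  note L = Cc_infty_Lw[OF \<phi>]
  have loc_u: "loc_integrable u"
    unfolding loc_integrable_def
  proof (intro allI impI, elim conjE)
    fix K :: "((real^'m) \<times> real) set" assume K: "compact K" "K \<subseteq> halfspace"
    obtain c where c: "0 < c" "AE x in dxH. x \<in> K \<longrightarrow> c \<le> \<rho> x" "AE x in dxH. x \<in> K \<longrightarrow> c \<le> v x"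
      using weights_bounded_below[OF compact_imp_bounded[OF K(1)]] by blast
    show "integrable (lebesgue_on K) u"
      by (rule integrable_lebesgue_on_iff[OF compact_sets_lebesgue[OF K(1)] K(2), THEN iffD2])
         (rule V.L1_bound(1)[OF compact_dxH[OF K] c(1,3) u(1)])
  qed
  have loc_G: "loc_integrable G"
    unfolding loc_integrable_def
  proof (intro allI impI, elim conjE)
    fix K :: "((real^'m) \<times> real) set" assume K: "compact K" "K \<subseteq> halfspace"
    obtain c where c: "0 < c" "AE x in dxH. x \<in> K \<longrightarrow> c \<le> \<rho> x" "AE x in dxH. x \<in> K \<longrightarrow> c \<le> v x"
      using weights_bounded_below[OF compact_imp_bounded[OF K(1)]] by blast
    show "integrable (lebesgue_on K) G"
      by (rule integrable_lebesgue_on_iff[OF compact_sets_lebesgue[OF K(1)] K(2), THEN iffD2])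
         (rule R.L1_bound(1)[OF compact_dxH[OF K] c(1,2) u(2)])
  qed
  have "(\<integral>x. u x *\<^sub>R grad \<psi> x \<partial>dxH) = - (\<integral>x. \<psi> x *\<^sub>R G x \<partial>dxH)" if \<psi>: "\<psi> \<in> Cc_infty halfspace" for \<psi> :: "(real^'m) \<times> real \<Rightarrow> real"
  proof -
    obtain B where B: "0 \<le> B" "\<And>x. norm (grad \<psi> x) \<le> B" "\<And>x. \<bar>\<psi> x\<bar> \<le> B" using Cc_infty_bounded[OF \<psi>] by blast
    define K where "K = closure {x. \<psi> x \<noteq> 0}"
    have K: "compact K" "K \<subseteq> halfspace" and z: "\<And>x. x \<notin> K \<Longrightarrow> \<psi> x = 0 \<and> grad \<psi> x = 0"
      unfolding K_def using Cc_infty_support_compact[OF \<psi>] by blast+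
    obtain c where c: "0 < c" "AE x in dxH. x \<in> K \<longrightarrow> c \<le> \<rho> x" "AE x in dxH. x \<in> K \<longrightarrow> c \<le> v x"
      using weights_bounded_below[OF compact_imp_bounded[OF K(1)]] by blast
    note KV = compact_dxH[OF K] c(1,3) and KR = compact_dxH[OF K] c(1,2)
    have Lu: "V.Lw (\<lambda>x. \<phi> n x - u x)" and LG: "R.Lw (\<lambda>x. grad (\<phi> n) x - G x)" for n
      by (intro V.Lw_diff R.Lw_diff L u)+
    have ind: "integrable dxH (\<lambda>x. B * (indicator K x * norm (F x)))" if "integrable dxH (\<lambda>x. indicator K x *\<^sub>R F x)"
      for F :: "(real^'m) \<times> real \<Rightarrow> 'c::euclidean_space"
      using integrable_norm[OF that] by simp
    have gm: "grad \<psi> \<in> borel_measurable dxH" "\<psi> \<in> borel_measurable dxH"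
      using Cc_infty_measurable[OF \<psi>] borel_measurable_dxH by blast+
    have bu: "norm (F x *\<^sub>R grad \<psi> x) \<le> norm (B * (indicator K x * norm (F x)))" for F :: "(real^'m) \<times> real \<Rightarrow> real" and x
    proof (cases "x \<in> K")
      case True
      then show ?thesis using B(1) B(2)[of x] by (simp add: mult.commute[of B] mult_left_mono abs_mult)
    qed (simp add: z)
    have bG: "norm (\<psi> x *\<^sub>R F x) \<le> norm (B * (indicator K x * norm (F x)))" for F :: "(real^'m) \<times> real \<Rightarrow> (real^'m) \<times> real" and x
    proof (cases "x \<in> K")
      case True
      then show ?thesis using B(1) B(3)[of x] by (simp add: mult_right_mono abs_mult)
    qed (simp add: z)
    have i1: "integrable dxH (\<lambda>x. F x *\<^sub>R grad \<psi> x)" if F: "V.Lw F" for F :: "(real^'m) \<times> real \<Rightarrow> real"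
    proof (rule Bochner_Integration.integrable_bound[OF ind[OF V.L1_bound(1)[OF KV F]]])
      show "(\<lambda>x. F x *\<^sub>R grad \<psi> x) \<in> borel_measurable dxH" using V.Lw_measurable[OF F] gm(1) by (rule borel_measurable_scaleR)
      show "AE x in dxH. norm (F x *\<^sub>R grad \<psi> x) \<le> norm (B * (indicator K x * norm (F x)))" by (intro AE_I2 bu)
    qed
    have i2: "integrable dxH (\<lambda>x. \<psi> x *\<^sub>R F x)" if F: "R.Lw F" for F :: "(real^'m) \<times> real \<Rightarrow> (real^'m) \<times> real"
    proof (rule Bochner_Integration.integrable_bound[OF ind[OF R.L1_bound(1)[OF KR F]]])
      show "(\<lambda>x. \<psi> x *\<^sub>R F x) \<in> borel_measurable dxH" using gm(2) R.Lw_measurable[OF F] by (rule borel_measurable_scaleR)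
      show "AE x in dxH. norm (\<psi> x *\<^sub>R F x) \<le> norm (B * (indicator K x * norm (F x)))" by (intro AE_I2 bG)
    qed
    have l1: "(\<lambda>n. \<integral>x. (\<phi> n x - u x) *\<^sub>R grad \<psi> x \<partial>dxH) \<longlonglongrightarrow> 0"
    proof (rule Lim_null_comparison)
      show "(\<lambda>n. B * (\<integral>x. indicator K x * norm (\<phi> n x - u x) \<partial>dxH)) \<longlonglongrightarrow> 0"
        using tendsto_mult[OF tendsto_const[of B] V.L1_tendsto[OF KV Lu u(4)]] by simp
      have "norm (\<integral>x. (\<phi> n x - u x) *\<^sub>R grad \<psi> x \<partial>dxH) \<le> B * (\<integral>x. indicator K x * norm (\<phi> n x - u x) \<partial>dxH)" for n
      proof -
        have "norm (\<integral>x. (\<phi> n x - u x) *\<^sub>R grad \<psi> x \<partial>dxH) \<le> (\<integral>x. B * (indicator K x * norm (\<phi> n x - u x)) \<partial>dxH)"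
        proof (rule Bochner_Integration.integral_norm_bound_integral[OF i1[OF Lu] ind[OF V.L1_bound(1)[OF KV Lu]]])
          fix x show "norm ((\<phi> n x - u x) *\<^sub>R grad \<psi> x) \<le> B * (indicator K x * norm (\<phi> n x - u x))"
            using bu[of "\<lambda>x. \<phi> n x - u x" x] B(1) by (simp only: real_norm_def abs_mult abs_indicator abs_of_nonneg abs_abs)
        qed
        then show ?thesis by simp
      qed
      then show "\<forall>\<^sub>F n in sequentially. norm (\<integral>x. (\<phi> n x - u x) *\<^sub>R grad \<psi> x \<partial>dxH) \<le> B * (\<integral>x. indicator K x * norm (\<phi> n x - u x) \<partial>dxH)"
        by simp
    qed
    have l2: "(\<lambda>n. \<integral>x. \<psi> x *\<^sub>R (grad (\<phi> n) x - G x) \<partial>dxH) \<longlonglongrightarrow> 0"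
    proof (rule Lim_null_comparison)
      show "(\<lambda>n. B * (\<integral>x. indicator K x * norm (grad (\<phi> n) x - G x) \<partial>dxH)) \<longlonglongrightarrow> 0"
        using tendsto_mult[OF tendsto_const[of B] R.L1_tendsto[OF KR LG u(3)]] by simp
      have "norm (\<integral>x. \<psi> x *\<^sub>R (grad (\<phi> n) x - G x) \<partial>dxH) \<le> B * (\<integral>x. indicator K x * norm (grad (\<phi> n) x - G x) \<partial>dxH)" for n
      proof -
        have "norm (\<integral>x. \<psi> x *\<^sub>R (grad (\<phi> n) x - G x) \<partial>dxH) \<le> (\<integral>x. B * (indicator K x * norm (grad (\<phi> n) x - G x)) \<partial>dxH)"
        proof (rule Bochner_Integration.integral_norm_bound_integral[OF i2[OF LG] ind[OF R.L1_bound(1)[OF KR LG]]])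
          fix x show "norm (\<psi> x *\<^sub>R (grad (\<phi> n) x - G x)) \<le> B * (indicator K x * norm (grad (\<phi> n) x - G x))"
            using bG[of x "\<lambda>x. grad (\<phi> n) x - G x"] B(1) by (simp only: real_norm_def abs_mult abs_indicator abs_of_nonneg abs_norm_cancel)
        qed
        then show ?thesis by simp
      qed
      then show "\<forall>\<^sub>F n in sequentially. norm (\<integral>x. \<psi> x *\<^sub>R (grad (\<phi> n) x - G x) \<partial>dxH) \<le> B * (\<integral>x. indicator K x * norm (grad (\<phi> n) x - G x) \<partial>dxH)"
        by simp
    qed
    have s1: "(\<integral>x. (\<phi> n x - u x) *\<^sub>R grad \<psi> x \<partial>dxH) = (\<integral>x. \<phi> n x *\<^sub>R grad \<psi> x \<partial>dxH) - (\<integral>x. u x *\<^sub>R grad \<psi> x \<partial>dxH)" for n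
      unfolding scaleR_left_diff_distrib by (rule Bochner_Integration.integral_diff[OF i1[OF L(2)] i1[OF u(1)]])
    have s2: "(\<integral>x. \<psi> x *\<^sub>R (grad (\<phi> n) x - G x) \<partial>dxH) = (\<integral>x. \<psi> x *\<^sub>R grad (\<phi> n) x \<partial>dxH) - (\<integral>x. \<psi> x *\<^sub>R G x \<partial>dxH)" for n
      unfolding scaleR_right_diff_distrib by (rule Bochner_Integration.integral_diff[OF i2[OF L(1)] i2[OF u(2)]])
    have "(\<lambda>n. (\<integral>x. (\<phi> n x - u x) *\<^sub>R grad \<psi> x \<partial>dxH) + (\<integral>x. \<psi> x *\<^sub>R (grad (\<phi> n) x - G x) \<partial>dxH)) \<longlonglongrightarrow> 0 + 0"
      by (intro tendsto_add l1 l2)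
    moreover have "(\<integral>x. (\<phi> n x - u x) *\<^sub>R grad \<psi> x \<partial>dxH) + (\<integral>x. \<psi> x *\<^sub>R (grad (\<phi> n) x - G x) \<partial>dxH)
        = - ((\<integral>x. u x *\<^sub>R grad \<psi> x \<partial>dxH) + (\<integral>x. \<psi> x *\<^sub>R G x \<partial>dxH))" for n
      unfolding s1 s2 integral_by_parts(3)[OF \<phi> \<psi>] by simp
    ultimately have "(\<lambda>n::nat. - ((\<integral>x. u x *\<^sub>R grad \<psi> x \<partial>dxH) + (\<integral>x. \<psi> x *\<^sub>R G x \<partial>dxH))) \<longlonglongrightarrow> 0" by simp
    then have "(\<integral>x. u x *\<^sub>R grad \<psi> x \<partial>dxH) + (\<integral>x. \<psi> x *\<^sub>R G x \<partial>dxH) = 0" by (simp only: LIMSEQ_const_iff neg_equal_0_iff_equal)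
    then show ?thesis by (simp only: eq_neg_iff_add_eq_0)
  qed
  with loc_u loc_G show ?thesis unfolding has_weak_gradient_def by blast
qed

text \<open>The way back from pairs (u, G) to the definition of E: G agrees with the chosen weak
  gradient almost everywhere, so the two extended integrals are values of \<open>Nw\<close>.\<close>

lemma approximates_E_space:
  assumes ap: "approximates \<phi> u G"
  shows "u \<in> E_space \<rho> p \<gamma>" "AE x in dxH. wgrad u x = G x"
proof -
  have \<phi>: "\<phi> n \<in> Cc_infty UNIV" for n using ap by (simp add: approximates_def)
  have u: "V.Lw u" "R.Lw G" "(\<lambda>n. R.Nw (\<lambda>x. grad (\<phi> n) x - G x)) \<longlonglongrightarrow> 0" "(\<lambda>n. V.Nw (\<lambda>x. \<phi> n x - u x)) \<longlonglongrightarrow> 0"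
    using ap by (auto simp: approximates_def)
  note L = Cc_infty_Lw[OF \<phi>]
  note wg = approximates_weak_gradient[OF ap]
  show eq: "AE x in dxH. wgrad u x = G x" by (rule wgrad_eq(2)[OF wg])
  have um: "u \<in> borel_measurable dxH" by (rule V.Lw_measurable[OF u(1)])
  have vm: "(\<lambda>x::(real^'m) \<times> real. (1 + snd x) powr (\<gamma> - p)) \<in> borel_measurable dxH" using v_measurable by (simp add: v_def[abs_def])
  have "integrable (density dxH (\<lambda>x. ennreal ((1 + snd x) powr (\<gamma> - p)))) (\<lambda>x. \<bar>u x\<bar> powr p)"
  proof (subst integrable_density)
    show "integrable dxH (\<lambda>x. (1 + snd x) powr (\<gamma> - p) *\<^sub>R \<bar>u x\<bar> powr p)"
      using V.Lw_integrable[OF u(1)] by (simp add: v_def)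
    show "(\<lambda>x. \<bar>u x\<bar> powr p) \<in> borel_measurable dxH" using um by measurable
  qed (use vm in auto)
  then have 1: "in_Lp (density dxH (\<lambda>x. ennreal ((1 + snd x) powr (\<gamma> - p)))) p u"
    using um by (simp add: in_Lp_def)
  have 2: "\<phi> n \<in> C_delta" for n unfolding C_delta_def using \<phi>[of n] by blast
  have "(\<integral>\<^sup>+x. ennreal (\<rho> x * norm (grad (\<phi> n) x - wgrad u x) powr p) \<partial>dxH) = ennreal (R.Nw (\<lambda>x. grad (\<phi> n) x - G x))" for n
    unfolding R.nn_integral_eq_Nw[OF R.Lw_diff[OF L(1) u(2)], symmetric]
    by (rule nn_integral_cong_AE) (use eq in eventually_elim, simp)
  then have 3: "(\<lambda>n. \<integral>\<^sup>+x. ennreal (\<rho> x * norm (grad (\<phi> n) x - wgrad u x) powr p) \<partial>dxH) \<longlonglongrightarrow> 0"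
    using tendsto_ennrealI[OF u(3)] by simp
  have "(\<integral>\<^sup>+x. ennreal ((1 + snd x) powr (\<gamma> - p) * \<bar>\<phi> n x - u x\<bar> powr p) \<partial>dxH) = ennreal (V.Nw (\<lambda>x. \<phi> n x - u x))" for n
    unfolding V.nn_integral_eq_Nw[OF V.Lw_diff[OF L(2) u(1)], symmetric] by (simp add: v_def)
  then have 4: "(\<lambda>n. \<integral>\<^sup>+x. ennreal ((1 + snd x) powr (\<gamma> - p) * \<bar>\<phi> n x - u x\<bar> powr p) \<partial>dxH) \<longlonglongrightarrow> 0"
    using tendsto_ennrealI[OF u(4)] by simp
  from 1 2 3 4 wg show "u \<in> E_space \<rho> p \<gamma>"
    unfolding E_space_def mem_Collect_eq by (intro conjI exI[of _ G] exI[of _ \<phi>] allI)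
qed

text \<open>The approximants in the definition are replaced by their smooth extensions, and extended
  integrals tending to 0 are turned into integrability followed by convergence of real
  numbers.\<close>

lemma E_space_approximates:
  assumes u: "u \<in> E_space \<rho> p \<gamma>"
  obtains f where "approximates f u (wgrad u)"
proof -
  obtain \<phi> where in_Lp: "in_Lp (density dxH (\<lambda>x. ennreal ((1 + snd x) powr (\<gamma> - p)))) p u"
    and ex: "\<exists>G. has_weak_gradient u G" and \<phi>: "\<And>n::nat. \<phi> n \<in> C_delta"
    and lim: "(\<lambda>n. \<integral>\<^sup>+x. ennreal (\<rho> x * norm (grad (\<phi> n) x - wgrad u x) powr p) \<partial>dxH) \<longlonglongrightarrow> 0"
      "(\<lambda>n. \<integral>\<^sup>+x. ennreal ((1 + snd x) powr (\<gamma> - p) * \<bar>\<phi> n x - u x\<bar> powr p) \<partial>dxH) \<longlonglongrightarrow> 0"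
    using u unfolding E_space_def by blast
  have "\<exists>f. f \<in> Cc_infty UNIV \<and> (\<forall>x\<in>halfspace. \<phi> n x = f x)" for n
    using \<phi>[of n] unfolding C_delta_def by blast
  then obtain f where f: "\<And>n. f n \<in> Cc_infty UNIV" "\<And>n. \<forall>x\<in>halfspace. \<phi> n x = f n x" by metis
  note L = Cc_infty_Lw[OF f(1)]
  obtain G where "has_weak_gradient u G" using ex by blast
  then have wg: "has_weak_gradient u (wgrad u)" by (rule wgrad_eq(1))
  have um: "u \<in> borel_measurable dxH" using in_Lp by (simp add: in_Lp_def)
  have wm: "wgrad u \<in> borel_measurable dxH"
    using wg by (intro loc_integrable_measurable) (simp add: has_weak_gradient_def)
  have l1: "(\<lambda>n. \<integral>\<^sup>+x. ennreal (\<rho> x * norm (grad (f n) x - wgrad u x) powr p) \<partial>dxH) \<longlonglongrightarrow> 0"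
  proof -
    have "(\<integral>\<^sup>+x. ennreal (\<rho> x * norm (grad (\<phi> n) x - wgrad u x) powr p) \<partial>dxH) = (\<integral>\<^sup>+x. ennreal (\<rho> x * norm (grad (f n) x - wgrad u x) powr p) \<partial>dxH)" for n
      by (rule nn_integral_cong) (simp add: C_delta_grad[OF f(1) f(2)])
    then show ?thesis using lim(1) by simp
  qed
  have l2: "(\<lambda>n. \<integral>\<^sup>+x. ennreal (v x * norm (f n x - u x) powr p) \<partial>dxH) \<longlonglongrightarrow> 0"
  proof -
    have "(\<integral>\<^sup>+x. ennreal ((1 + snd x) powr (\<gamma> - p) * \<bar>\<phi> n x - u x\<bar> powr p) \<partial>dxH) = (\<integral>\<^sup>+x. ennreal (v x * norm (f n x - u x) powr p) \<partial>dxH)" for n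
      by (rule nn_integral_cong) (use f(2)[of n] in \<open>simp add: v_def\<close>)
    then show ?thesis using lim(2) by simp
  qed
  have mR: "(\<lambda>x. grad (f n) x - wgrad u x) \<in> borel_measurable dxH" for n
    using R.Lw_measurable[OF L(1)] wm by (rule borel_measurable_diff)
  have mV: "(\<lambda>x. f n x - u x) \<in> borel_measurable dxH" for n
    using V.Lw_measurable[OF L(2)] um by (rule borel_measurable_diff)
  \<comment> \<open>A single approximant at finite distance shows that the gradient of u is
    integrable, as a difference of integrable functions.\<close>
  obtain n1 where n1: "(\<integral>\<^sup>+x. ennreal (\<rho> x * norm (grad (f n1) x - wgrad u x) powr p) \<partial>dxH) < 1"
    using order_tendstoD(2)[OF l1, of 1] by (auto simp: eventually_sequentially)
  have LG: "R.Lw (wgrad u)"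
  proof -
    have "R.Lw (\<lambda>x. grad (f n1) x - wgrad u x)"
      by (rule R.LwI_nn_integral(1)[OF mR, of n1 1]) (use n1 in simp_all)
    from R.Lw_diff[OF L(1)[of n1] this] show ?thesis by simp
  qed
  obtain n2 where n2: "(\<integral>\<^sup>+x. ennreal (v x * norm (f n2 x - u x) powr p) \<partial>dxH) < 1"
    using order_tendstoD(2)[OF l2, of 1] by (auto simp: eventually_sequentially)
  have Lu: "V.Lw u"
  proof -
    have "V.Lw (\<lambda>x. f n2 x - u x)"
      by (rule V.LwI_nn_integral(1)[OF mV, of n2 1]) (use n2 in simp_all)
    from V.Lw_diff[OF L(2)[of n2] this] show ?thesis by simp
  qed
  have "(\<lambda>n. ennreal (R.Nw (\<lambda>x. grad (f n) x - wgrad u x))) \<longlonglongrightarrow> ennreal 0"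
    using l1 unfolding R.nn_integral_eq_Nw[OF R.Lw_diff[OF L(1) LG]] by simp
  then have t1: "(\<lambda>n. R.Nw (\<lambda>x. grad (f n) x - wgrad u x)) \<longlonglongrightarrow> 0"
    by (subst (asm) tendsto_ennreal_iff) (simp_all add: R.Nw_nonneg)
  have "(\<lambda>n. ennreal (V.Nw (\<lambda>x. f n x - u x))) \<longlonglongrightarrow> ennreal 0"
    using l2 unfolding V.nn_integral_eq_Nw[OF V.Lw_diff[OF L(2) Lu]] by simp
  then have t2: "(\<lambda>n. V.Nw (\<lambda>x. f n x - u x)) \<longlonglongrightarrow> 0"
    by (subst (asm) tendsto_ennreal_iff) (simp_all add: V.Nw_nonneg)
  have "approximates f u (wgrad u)" unfolding approximates_def using f(1) LG Lu t1 t2 by blast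
  then show ?thesis by (rule that)
qed

end

section \<open>Minimisation\<close>

text \<open>The value \<open>t\<close> maximises \<open>t^(q-p) A/q - t^(s-p) B/s\<close>; comparing the maximum with \<open>R/p\<close> gives the
  hypothesis of the lemma with the additional factor \<open>(s/q)^(q-p) > 1\<close> to spare.\<close>

lemma fibering_negative:
  fixes A B R p q s :: real
  assumes p: "0 < p" "p < q" "q < s" and nn: "0 \<le> A" "0 \<le> B" "0 \<le> R"
    and D: "(q / p) powr (s - q) * eta p q s * B powr (q - p) * R powr (s - q) < A powr (s - p)"
  obtains t where "0 < t" "t powr p * R / p - t powr q * A / q + t powr s * B / s < 0"
proof -
  define \<alpha> where "\<alpha> = q - p"
  define \<delta> where "\<delta> = s - q"
  define \<beta> where "\<beta> = s - p"
  have \<alpha>\<delta>: "0 < \<alpha>" "0 < \<delta>" "0 < \<beta>" "\<beta> = \<alpha> + \<delta>" "q = p + \<alpha>" "s = q + \<delta>" using p by (auto simp: \<alpha>_def \<delta>_def \<beta>_def)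
  have "0 \<le> (q / p) powr (s - q) * eta p q s * B powr (q - p) * R powr (s - q)" by (simp add: eta_def)
  then have A: "0 < A" using D nn(1) by (cases "A = 0") auto
  show ?thesis
  proof (cases "B = 0")
    case True
    \<comment> \<open>Without a B-term any t with t^(q-p) > R q / (p A) will do; the summand 1 makes
      the inequality strict and the base positive.\<close>
    define t where "t = (R * q / (p * A) + 1) powr (1 / \<alpha>)"
    have pos: "0 < R * q / (p * A) + 1" using nn p A by (intro add_nonneg_pos divide_nonneg_pos mult_nonneg_nonneg) auto
    then have t: "0 < t" by (simp add: t_def)
    have "t powr \<alpha> = R * q / (p * A) + 1" using pos \<alpha>\<delta> by (simp add: t_def powr_powr)
    then have "R * q / (p * A) < t powr \<alpha>" by simp
    then have "R / p < t powr \<alpha> * A / q" using p A by (simp add: field_simps)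
    then have "t powr p * (R / p) < t powr p * (t powr \<alpha> * A / q)" using t by (intro mult_strict_left_mono) auto
    also have "\<dots> = t powr q * A / q" unfolding \<alpha>\<delta>(5) by (simp add: powr_add)
    finally show ?thesis using that[OF t] True by simp
  next
    case False
    then have B: "0 < B" using nn by simp
    \<comment> \<open>The logarithm of the critical point: equating the derivative of t^(q-p) A/q -
      t^(s-p) B/s to 0 gives t^(s-q) = (q-p) A s / ((s-p) B q). In logarithms the hypothesis becomes
      a linear inequality.\<close>
    define T where "T = (ln \<alpha> + ln A + ln s - ln \<beta> - ln B - ln q) / \<delta>"
    have \<delta>T: "\<delta> * T = ln \<alpha> + ln A + ln s - ln \<beta> - ln B - ln q" using \<alpha>\<delta> by (simp add: T_def)
    have e\<delta>: "exp (\<delta> * T) = \<alpha> * A * s / (\<beta> * B * q)"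
      unfolding \<delta>T using \<alpha>\<delta> A B p by (simp add: exp_diff exp_add)
    have key: "R / p < exp (\<alpha> * T) * (A * \<delta> / (q * \<beta>))"
    proof (cases "R = 0")
      case True
      then show ?thesis using \<alpha>\<delta> A p by simp
    next
      case False
      then have R: "0 < R" using nn by simp
      have "ln ((q / p) powr \<delta> * (\<beta> powr \<beta> / (\<alpha> powr \<alpha> * \<delta> powr \<delta>)) * B powr \<alpha> * R powr \<delta>) < ln (A powr \<beta>)"
        using D \<alpha>\<delta>(1,2,3) A B R p by (subst ln_less_cancel_iff) (auto simp: eta_def \<alpha>_def \<beta>_def \<delta>_def)
      then have L: "\<delta> * (ln q - ln p) + (\<beta> * ln \<beta> - (\<alpha> * ln \<alpha> + \<delta> * ln \<delta>)) + \<alpha> * ln B + \<delta> * ln R < \<beta> * ln A"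
        using \<alpha>\<delta>(1,2,3) A B R p by (simp add: ln_mult ln_div)
      \<comment> \<open>The logarithmic form of the spare factor.\<close>
      have "\<alpha> * ln q < \<alpha> * ln s" using \<alpha>\<delta>(1) p by simp
      with L have "\<delta> * (ln R - ln p) < \<alpha> * (\<delta> * T) + \<delta> * (ln A + ln \<delta> - (ln q + ln \<beta>))"
        unfolding \<delta>T \<alpha>\<delta>(4) by (simp add: algebra_simps)
      then have "\<delta> * (ln R - ln p) < \<delta> * (\<alpha> * T + (ln A + ln \<delta> - (ln q + ln \<beta>)))"
        by (simp add: algebra_simps)
      then have "ln R - ln p < \<alpha> * T + (ln A + ln \<delta> - (ln q + ln \<beta>))" using \<alpha>\<delta>(2) by simp
      then have "exp (ln R - ln p) < exp (\<alpha> * T + (ln A + ln \<delta> - (ln q + ln \<beta>)))" by simp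
      then show ?thesis using \<alpha>\<delta>(1,2,3) A R p by (simp add: exp_add exp_diff)
    qed
    define t where "t = exp T"
    have t: "0 < t" by (simp add: t_def)
    have tp: "t powr c = exp (c * T)" for c by (simp add: t_def powr_def)
    have tq: "t powr q = t powr p * exp (\<alpha> * T)" unfolding tp \<alpha>\<delta>(5) by (simp add: distrib_right exp_add)
    have ts: "t powr s = t powr q * (\<alpha> * A * s / (\<beta> * B * q))" unfolding tp \<alpha>\<delta>(6) e\<delta>[unfolded \<alpha>\<delta>(6), symmetric]
      by (simp add: distrib_right exp_add)
    have "t powr s * B / s = t powr q * (\<alpha> * A / (\<beta> * q))" unfolding ts using B p by simp
    moreover have "t powr q * A / q = t powr q * (\<alpha> * A / (\<beta> * q)) + t powr q * (A * \<delta> / (q * \<beta>))"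
    proof -
      have "A / q = \<alpha> * A / (\<beta> * q) + A * \<delta> / (q * \<beta>)"
      proof -
        have "\<alpha> * A / (\<beta> * q) + A * \<delta> / (q * \<beta>) = A * (\<alpha> + \<delta>) / (\<beta> * q)"
          by (simp add: add_divide_distrib algebra_simps)
        also have "\<dots> = A / q" using \<alpha>\<delta>(3) unfolding \<alpha>\<delta>(4)[symmetric] by simp
        finally show ?thesis by simp
      qed
      then show ?thesis by (metis distrib_left times_divide_eq_right)
    qed
    moreover have "t powr p * R / p < t powr q * (A * \<delta> / (q * \<beta>))"
    proof -
      have "t powr p * (R / p) < t powr p * (exp (\<alpha> * T) * (A * \<delta> / (q * \<beta>)))"
        using key t by (intro mult_strict_left_mono) auto
      then show ?thesis by (simp add: tq mult.assoc)
    qed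
    ultimately show ?thesis using that[OF t] by simp
  qed
qed

context weighted_Lp
begin

lemma Nw_mono:
  fixes F :: "'x \<Rightarrow> 'b::euclidean_space" and G :: "'x \<Rightarrow> 'c::euclidean_space"
  assumes "Lw F" "Lw G" "\<And>x. norm (F x) \<le> norm (G x)"
  shows "Nw F \<le> Nw G"
  unfolding Nw_def
proof (rule integral_mono[OF Lw_integrable[OF assms(1)] Lw_integrable[OF assms(2)]])
  fix x assume "x \<in> space M"
  then show "w x * norm (F x) powr r \<le> w x * norm (G x) powr r"
    using w_pos r_gt_1 assms(3)[of x] by (intro mult_left_mono powr_mono2) (auto simp: less_imp_le)
qed

lemma Nw_midpoint_le:
  fixes F G :: "'x \<Rightarrow> 'b::euclidean_space"
  assumes F: "Lw F" and G: "Lw G"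
  shows "Nw (\<lambda>x. (1/2) *\<^sub>R (F x + G x)) \<le> (Nw F + Nw G) / 2"
proof -
  have pt: "norm ((1/2) *\<^sub>R (y + z)) powr r \<le> (norm y powr r + norm z powr r) / 2" for y z :: 'b
  proof (cases "y = z")
    case True
    then have "(1/2) *\<^sub>R (y + z) = y" by (simp flip: scaleR_2)
    then show ?thesis using True by simp
  next
    case False
    then show ?thesis using norm_powr_strict_midpoint[OF r_gt_1 False] by simp
  qed
  have "Nw (\<lambda>x. (1/2) *\<^sub>R (F x + G x)) \<le> (\<integral>x. (w x * norm (F x) powr r + w x * norm (G x) powr r) / 2 \<partial>M)"
    unfolding Nw_def
  proof (rule integral_mono[OF Lw_integrable[OF Lw_scaleR[OF Lw_add[OF F G]]]])
    show "integrable M (\<lambda>x. (w x * norm (F x) powr r + w x * norm (G x) powr r) / 2)"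
      by (intro integrable_divide Bochner_Integration.integrable_add Lw_integrable F G)
    fix x assume "x \<in> space M"
    then have "w x * norm ((1/2) *\<^sub>R (F x + G x)) powr r \<le> w x * ((norm (F x) powr r + norm (G x) powr r) / 2)"
      using w_pos by (intro mult_left_mono pt) (auto simp: less_imp_le)
    also have "\<dots> = (w x * norm (F x) powr r + w x * norm (G x) powr r) / 2" by (simp add: distrib_left)
    finally show "w x * norm ((1/2) *\<^sub>R (F x + G x)) powr r \<le> (w x * norm (F x) powr r + w x * norm (G x) powr r) / 2" .
  qed
  also have "\<dots> = (Nw F + Nw G) / 2"
    unfolding Nw_def using Lw_integrable[OF F] Lw_integrable[OF G] by simp
  finally show ?thesis .
qed

end

section \<open>The energy functional, its infimum and nonnegative competitors\<close>

context variational_problem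
begin

definition energy :: "((real^'m) \<times> real \<Rightarrow> real) \<Rightarrow> ((real^'m) \<times> real \<Rightarrow> (real^'m) \<times> real) \<Rightarrow> real" where
  "energy u G = R.Nw G / p - A.Nw u / q + B.Nw u / s"

text \<open>Taken over smooth functions only; \<open>energy_tendsto\<close> extends the lower bound
  to the closure, so no second infimum is needed.\<close>

definition inf_energy :: real where
  "inf_energy = Inf ((\<lambda>f. energy f (grad f)) ` Cc_infty UNIV)"

lemma energy_tendsto:
  assumes ap: "approximates \<phi> u G"
  shows "(\<lambda>n. energy (\<phi> n) (grad (\<phi> n))) \<longlonglongrightarrow> energy u G"
proof -
  have \<phi>: "\<phi> n \<in> Cc_infty UNIV" for n using ap by (simp add: approximates_def)
  have u: "R.Lw G" "(\<lambda>n. R.Nw (\<lambda>x. grad (\<phi> n) x - G x)) \<longlonglongrightarrow> 0" using ap by (auto simp: approximates_def)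
  note L = Cc_infty_Lw[OF \<phi>] and BA = approximates_B_A[OF ap]
  show ?thesis
    unfolding energy_def
    by (intro tendsto_add tendsto_diff tendsto_divide tendsto_const R.Nw_tendsto[OF L(1) u]
        A.Nw_tendsto[OF L(3) BA(3,4)] B.Nw_tendsto[OF L(4) BA(1,2)]) (use p pq qs in auto)
qed

text \<open>With e = q/(2s) Young's inequality lets A consume exactly half of the B-term and a
  constant.\<close>

lemma energy_coercive:
  obtains K where "\<And>u G. B.Lw u \<Longrightarrow> R.Nw G / p + B.Nw u / (2 * s) \<le> energy u G + K"
proof -
  define e where "e = q / (2 * s)"
  define K where "K = e powr (- (q / (s - q))) * (\<integral>x. ratio_power x \<partial>dxH) / q"
  have q: "0 < q" "0 < s" using p pq qs by auto
  have e: "0 < e" using q by (simp add: e_def)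
  have "R.Nw G / p + B.Nw u / (2 * s) \<le> energy u G + K" if u: "B.Lw u" for u G
  proof -
    have "A.Nw u / q \<le> (e * B.Nw u + e powr (- (q / (s - q))) * (\<integral>x. ratio_power x \<partial>dxH)) / q"
      using A_from_B(2)[OF u e] q by (intro divide_right_mono) auto
    also have "\<dots> = B.Nw u / (2 * s) + K" using q by (simp add: K_def e_def add_divide_distrib)
    moreover have "B.Nw u / s = B.Nw u / (2 * s) + B.Nw u / (2 * s)" using q by (simp add: field_simps)
    ultimately show ?thesis by (simp add: energy_def)
  qed
  then show ?thesis by (rule that)
qed

lemma inf_energy_le:
  assumes f: "f \<in> Cc_infty UNIV" shows "inf_energy \<le> energy f (grad f)"
  unfolding inf_energy_def
proof (rule cInf_lower)
  obtain K where K: "\<And>u G. B.Lw u \<Longrightarrow> R.Nw G / p + B.Nw u / (2 * s) \<le> energy u G + K" using energy_coercive by blast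
  show "bdd_below ((\<lambda>f. energy f (grad f)) ` Cc_infty UNIV)"
  proof (rule bdd_belowI2[of _ "- K"])
    fix g :: "(real^'m) \<times> real \<Rightarrow> real" assume "g \<in> Cc_infty UNIV"
    then have "R.Nw (grad g) / p + B.Nw g / (2 * s) \<le> energy g (grad g) + K" by (intro K Cc_infty_Lw)
    moreover have "0 \<le> R.Nw (grad g) / p + B.Nw g / (2 * s)"
      using p pq qs by (intro add_nonneg_nonneg divide_nonneg_nonneg R.Nw_nonneg B.Nw_nonneg) auto
    ultimately show "- K \<le> energy g (grad g)" by linarith
  qed
qed (use f in auto)

lemma inf_energy_le_approximates:
  assumes ap: "approximates \<phi> u G" shows "inf_energy \<le> energy u G"
proof (rule LIMSEQ_le_const[OF energy_tendsto[OF ap]])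
  have "inf_energy \<le> energy (\<phi> n) (grad (\<phi> n))" for n
    using ap by (intro inf_energy_le) (simp add: approximates_def)
  then show "\<exists>N. \<forall>n\<ge>N. inf_energy \<le> energy (\<phi> n) (grad (\<phi> n))" by blast
qed

lemma approximates_scale:
  assumes ap: "approximates \<phi> u G"
  shows "approximates (\<lambda>n x. t * \<phi> n x) (\<lambda>x. t * u x) (\<lambda>x. t *\<^sub>R G x)"
proof -
  have \<phi>: "\<phi> n \<in> Cc_infty UNIV" for n using ap by (simp add: approximates_def)
  have u: "V.Lw u" "R.Lw G" "(\<lambda>n. R.Nw (\<lambda>x. grad (\<phi> n) x - G x)) \<longlonglongrightarrow> 0" "(\<lambda>n. V.Nw (\<lambda>x. \<phi> n x - u x)) \<longlonglongrightarrow> 0"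
    using ap by (auto simp: approximates_def)
  have 1: "R.Nw (\<lambda>x. grad (\<lambda>x. t * \<phi> n x) x - t *\<^sub>R G x) = \<bar>t\<bar> powr p * R.Nw (\<lambda>x. grad (\<phi> n) x - G x)" for n
    unfolding grad_scale[OF \<phi>] scaleR_right_diff_distrib[symmetric] by (rule R.Nw_scaleR)
  have 2: "V.Nw (\<lambda>x. t * \<phi> n x - t * u x) = \<bar>t\<bar> powr p * V.Nw (\<lambda>x. \<phi> n x - u x)" for n
    using V.Nw_scaleR[of t "\<lambda>x. \<phi> n x - u x"] by (simp add: right_diff_distrib)
  show ?thesis
    unfolding approximates_def 1 2
  proof (intro conjI allI)
    show "(\<lambda>x. t * \<phi> n x) \<in> Cc_infty UNIV" for n by (rule Cc_infty_scale[OF \<phi>])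
    show "V.Lw (\<lambda>x. t * u x)" using V.Lw_scaleR[OF u(1), of t] by simp
    show "R.Lw (\<lambda>x. t *\<^sub>R G x)" by (rule R.Lw_scaleR[OF u(2)])
    show "(\<lambda>n. \<bar>t\<bar> powr p * R.Nw (\<lambda>x. grad (\<phi> n) x - G x)) \<longlonglongrightarrow> 0"
      using tendsto_mult[OF tendsto_const u(3)] by simp
    show "(\<lambda>n. \<bar>t\<bar> powr p * V.Nw (\<lambda>x. \<phi> n x - u x)) \<longlonglongrightarrow> 0"
      using tendsto_mult[OF tendsto_const u(4)] by simp
  qed
qed

lemma approximates_add:
  assumes ap: "approximates \<phi> u G" and f: "f \<in> Cc_infty UNIV"
  shows "approximates (\<lambda>n x. \<phi> n x + f x) (\<lambda>x. u x + f x) (\<lambda>x. G x + grad f x)"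
proof -
  have \<phi>: "\<phi> n \<in> Cc_infty UNIV" for n using ap by (simp add: approximates_def)
  have u: "V.Lw u" "R.Lw G" "(\<lambda>n. R.Nw (\<lambda>x. grad (\<phi> n) x - G x)) \<longlonglongrightarrow> 0" "(\<lambda>n. V.Nw (\<lambda>x. \<phi> n x - u x)) \<longlonglongrightarrow> 0"
    using ap by (auto simp: approximates_def)
  show ?thesis
    unfolding approximates_def grad_add[OF \<phi> f] add_diff_cancel_right
    by (intro conjI allI Cc_infty_add \<phi> f V.Lw_add R.Lw_add u Cc_infty_Lw)
qed

lemma inf_energy_negative:
  assumes u: "u \<in> D1 \<rho> a b p q s \<gamma>"
  shows "inf_energy < 0"
proof -
  have uE: "u \<in> E_space \<rho> p \<gamma>" using u by (simp add: D1_def)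
  obtain f where ap: "approximates f u (wgrad u)" using E_space_approximates[OF uE] by blast
  have q: "0 < p" "0 < q" "0 < s" using p pq qs by auto
  \<comment> \<open>\<open>E_norm\<close> contains a p-th root, so the exponent p (s - q) in
    \<open>D1\<close> becomes s - q for \<open>R.Nw\<close>, the form in which
    \<open>fibering_negative\<close> is stated.\<close>
  have E: "E_norm \<rho> p u powr (p * (s - q)) = R.Nw (wgrad u) powr (s - q)"
    using q by (simp add: E_norm_def R.Nw_def powr_powr)
  have D: "(q / p) powr (s - q) * eta p q s * B.Nw u powr (q - p) * R.Nw (wgrad u) powr (s - q) < A.Nw u powr (s - p)"
    using u unfolding D1_def mem_Collect_eq E pow_int_def A.Nw_def B.Nw_def real_norm_def by simp
  obtain t where t: "0 < t" "t powr p * R.Nw (wgrad u) / p - t powr q * A.Nw u / q + t powr s * B.Nw u / s < 0"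
    using fibering_negative[OF q(1) pq qs A.Nw_nonneg B.Nw_nonneg R.Nw_nonneg D] by blast
  have "energy (\<lambda>x. t * u x) (\<lambda>x. t *\<^sub>R wgrad u x) < 0"
    using t A.Nw_scaleR[of t u] B.Nw_scaleR[of t u] R.Nw_scaleR[of t "wgrad u"] by (simp add: energy_def)
  then show ?thesis using inf_energy_le_approximates[OF approximates_scale[OF ap, of t]] by linarith
qed

text \<open>The gradient and B-terms do not increase under the smooth modulus, so only the A-term,
  which enters with a minus sign, has to converge.\<close>

lemma nonnegative_competitor:
  assumes f: "f \<in> Cc_infty UNIV" and e: "0 < e"
  obtains g where "g \<in> Cc_infty UNIV" "\<And>x. 0 \<le> g x" "energy g (grad g) < energy f (grad f) + e"
proof -
  have q: "0 < p" "0 < q" "0 < s" using p pq qs by auto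
  define g where "g n x = sqrt (f x ^ 2 + (1 / real (Suc n)) ^ 2) - 1 / real (Suc n)" for n x
  have g: "g n \<in> Cc_infty UNIV" "0 \<le> g n x" "g n x \<le> \<bar>f x\<bar>" "\<bar>f x\<bar> - 1 / real (Suc n) \<le> g n x"
    "norm (grad (g n) x) \<le> norm (grad f x)" for n x
    using smooth_abs[OF f, of "1 / real (Suc n)"] by (simp_all add: g_def[abs_def])
  have lim: "(\<lambda>n. g n x) \<longlonglongrightarrow> \<bar>f x\<bar>" for x
  proof (rule tendsto_sandwich[of "\<lambda>n. \<bar>f x\<bar> - 1 / real (Suc n)" _ _ "\<lambda>n. \<bar>f x\<bar>"])
    have "(\<lambda>n. \<bar>f x\<bar> - 1 / real (Suc n)) \<longlonglongrightarrow> \<bar>f x\<bar> - 0" by (intro tendsto_diff tendsto_const LIMSEQ_Suc[OF lim_1_over_n])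
    then show "(\<lambda>n. \<bar>f x\<bar> - 1 / real (Suc n)) \<longlonglongrightarrow> \<bar>f x\<bar>" by simp
  qed (use g in auto)
  note Lf = Cc_infty_Lw[OF f] and Lg = Cc_infty_Lw[OF g(1)]
  have A: "(\<lambda>n. A.Nw (g n)) \<longlonglongrightarrow> A.Nw f"
    unfolding A.Nw_def
  proof (rule integral_dominated_convergence[where w = "\<lambda>x. a x * norm (f x) powr q"])
    show "integrable dxH (\<lambda>x. a x * norm (f x) powr q)" by (rule A.Lw_integrable[OF Lf(3)])
    then show "(\<lambda>x. a x * norm (f x) powr q) \<in> borel_measurable dxH" by (rule borel_measurable_integrable)
    show "(\<lambda>x. a x * norm (g n x) powr q) \<in> borel_measurable dxH" for n
      by (rule borel_measurable_integrable[OF A.Lw_integrable[OF Lg(3)]])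
    have "(\<lambda>n. a x * norm (g n x) powr q) \<longlonglongrightarrow> a x * norm \<bar>f x\<bar> powr q" for x
      using q by (intro tendsto_mult tendsto_const tendsto_powr' tendsto_norm lim) auto
    then show "AE x in dxH. (\<lambda>n. a x * norm (g n x) powr q) \<longlonglongrightarrow> a x * norm (f x) powr q" by simp
    show "AE x in dxH. norm (a x * norm (g n x) powr q) \<le> a x * norm (f x) powr q" for n
    proof (rule AE_I2)
      fix x :: "(real^'m) \<times> real" assume "x \<in> space dxH"
      then have "0 < a x" using coefficients_pos(2) by simp
      moreover have "norm (g n x) powr q \<le> norm (f x) powr q" using g(2,3)[of n x] q by (intro powr_mono2) auto
      ultimately show "norm (a x * norm (g n x) powr q) \<le> a x * norm (f x) powr q" by (simp add: abs_mult)
    qed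
  qed
  have "R.Nw (grad (g n)) \<le> R.Nw (grad f)" for n by (rule R.Nw_mono[OF Lg(1) Lf(1) g(5)])
  moreover have "B.Nw (g n) \<le> B.Nw f" for n
    by (rule B.Nw_mono[OF Lg(4) Lf(4)]) (use g(2,3) in simp)
  ultimately have le: "energy (g n) (grad (g n)) \<le> R.Nw (grad f) / p - A.Nw (g n) / q + B.Nw f / s" for n
    unfolding energy_def using q by (intro add_mono diff_mono divide_right_mono) auto
  have "(\<lambda>n. R.Nw (grad f) / p - A.Nw (g n) / q + B.Nw f / s) \<longlonglongrightarrow> energy f (grad f)"
    unfolding energy_def by (intro tendsto_add tendsto_diff tendsto_divide tendsto_const A) (use q in auto)
  then have "\<forall>\<^sub>F n in sequentially. R.Nw (grad f) / p - A.Nw (g n) / q + B.Nw f / s < energy f (grad f) + e"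
    by (rule order_tendstoD(2)) (use e in simp)
  then obtain n where "R.Nw (grad f) / p - A.Nw (g n) / q + B.Nw f / s < energy f (grad f) + e"
    by (auto simp: eventually_sequentially)
  then have "energy (g n) (grad (g n)) < energy f (grad f) + e" using le[of n] by linarith
  with g(1,2)[of n] show ?thesis by (intro that[of "g n"])
qed

text \<open>By Young's inequality \<open>a |D|^q\<close> exceeds \<open>e b |D|^s\<close> by at most an integrable function, so dominated
  convergence applies to the excess.\<close>

lemma A_tendsto_AE:
  fixes D :: "nat \<Rightarrow> (real^'m) \<times> real \<Rightarrow> real"
  assumes D: "\<And>n. B.Lw (D n)" and K: "\<And>n. B.Nw (D n) \<le> K" and lim: "AE x in dxH. (\<lambda>n. D n x) \<longlonglongrightarrow> 0"
  shows "(\<lambda>n. A.Nw (D n)) \<longlonglongrightarrow> 0"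
proof (rule LIMSEQ_I)
  fix d :: real assume d: "0 < d"
  have q: "0 < q" using p pq by simp
  have K0: "0 \<le> K" using K[of 0] B.Nw_nonneg[of "D 0"] by linarith
  define e where "e = d / (2 * (K + 1))"
  have e: "0 < e" using d K0 by (simp add: e_def)
  have eK: "e * K \<le> d / 2" using d K0 by (simp add: e_def field_simps)
  define C where "C = e powr (- (q / (s - q)))"
  \<comment> \<open>The truncated excess: dominated by an integrable function, convergent to 0
    almost everywhere, and by Young's inequality enough, together with e times the integrand of B,
    to bound the integrand of A.\<close>
  define h where "h n x = min (a x * norm (D n x) powr q) (C * ratio_power x)" for n x
  note LA = A_from_B(1)[OF D]
  have hm: "h n \<in> borel_measurable dxH" for n
    unfolding h_def[abs_def]
    by (intro borel_measurable_min borel_measurable_integrable[OF A.Lw_integrable[OF LA]]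
        borel_measurable_times borel_measurable_const borel_measurable_integrable[OF ratio_power_integrable])
  have hb: "norm (h n x) \<le> C * ratio_power x" if "x \<in> halfspace" for n x
    using coefficients_pos(2)[OF that] ratio_power_nonneg[of x] by (simp add: h_def C_def min_def)
  have Ci: "integrable dxH (\<lambda>x. C * ratio_power x)" by (intro integrable_mult_right ratio_power_integrable)
  have hi: "integrable dxH (h n)" for n
    by (rule Bochner_Integration.integrable_bound[OF Ci hm])
       (use hb in \<open>auto intro!: AE_I2 intro: order_trans[OF _ abs_ge_self]\<close>)
  have "(\<lambda>n. \<integral>x. h n x \<partial>dxH) \<longlonglongrightarrow> (\<integral>x. 0 \<partial>(dxH :: ((real^'m) \<times> real) measure))"
  proof (rule integral_dominated_convergence[OF _ hm Ci])
    show "AE x in dxH. (\<lambda>n. h n x) \<longlonglongrightarrow> 0"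
      using lim AE_space
    proof eventually_elim
      case (elim x)
      have "(\<lambda>n. a x * norm (D n x) powr q) \<longlonglongrightarrow> a x * norm (0::real) powr q"
        using q elim(1) by (intro tendsto_mult tendsto_const tendsto_powr' tendsto_norm) auto
      then have "(\<lambda>n. a x * norm (D n x) powr q) \<longlonglongrightarrow> 0" by simp
      then have "(\<lambda>n. min (a x * norm (D n x) powr q) (C * ratio_power x)) \<longlonglongrightarrow> min 0 (C * ratio_power x)"
        by (intro tendsto_min tendsto_const)
      then show ?case using ratio_power_nonneg[of x] by (simp add: h_def C_def)
    qed
    show "AE x in dxH. norm (h n x) \<le> C * ratio_power x" for n
      by (rule AE_I2) (use hb in simp)
  qed simp
  then have "(\<lambda>n. \<integral>x. h n x \<partial>dxH) \<longlonglongrightarrow> 0" by simp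
  then have "\<forall>\<^sub>F n in sequentially. (\<integral>x. h n x \<partial>dxH) < d / 2" by (rule order_tendstoD(2)) (use d in simp)
  then obtain k where k: "\<And>n. k \<le> n \<Longrightarrow> (\<integral>x. h n x \<partial>dxH) < d / 2" by (auto simp: eventually_sequentially)
  have "norm (A.Nw (D n) - 0) < d" if "k \<le> n" for n
  proof -
    have "A.Nw (D n) \<le> (\<integral>x. e * (b x * norm (D n x) powr s) + h n x \<partial>dxH)"
      unfolding A.Nw_def
    proof (rule integral_mono[OF A.Lw_integrable[OF LA]])
      show "integrable dxH (\<lambda>x. e * (b x * norm (D n x) powr s) + h n x)"
        by (intro Bochner_Integration.integrable_add integrable_mult_right B.Lw_integrable D hi)
      fix x :: "(real^'m) \<times> real" assume "x \<in> space dxH"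
      then have x: "x \<in> halfspace" by simp
      have "0 \<le> e * (b x * norm (D n x) powr s)" using e coefficients_pos(3)[OF x] by simp
      then show "a x * norm (D n x) powr q \<le> e * (b x * norm (D n x) powr s) + h n x"
        using young[OF x e, of "D n x"] by (auto simp: h_def C_def min_def)
    qed
    also have "\<dots> = e * B.Nw (D n) + (\<integral>x. h n x \<partial>dxH)"
      unfolding B.Nw_def using B.Lw_integrable[OF D[of n]] hi[of n] by simp
    also have "e * B.Nw (D n) \<le> e * K" using K e by (intro mult_left_mono) auto
    finally have "A.Nw (D n) < d" using k[OF that] eK by linarith
    then show ?thesis using A.Nw_nonneg[of "D n"] by simp
  qed
  then show "\<exists>k. \<forall>n\<ge>k. norm (A.Nw (D n) - 0) < d" by blast
qed

end

text \<open>The convexity defect of the gradient term expressed by the energy gap and the defects of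
  the other two terms. With the divisors written as inverses it is a polynomial identity.\<close>

lemma midpoint_gap:
  fixes r1 r2 r3 a1 a2 a3 b1 b2 b3 p q s :: real
  shows "((r1 + r2) / 2 - r3) / p = ((r1 / p - a1 / q + b1 / s) + (r2 / p - a2 / q + b2 / s)) / 2 - (r3 / p - a3 / q + b3 / s)
    + ((a1 + a2) / 2 - a3) / q - ((b1 + b2) / 2 - b3) / s"
proof -
  have id: "((r1 + r2) * H - r3) * P = ((r1 * P - a1 * Q + b1 * S) + (r2 * P - a2 * Q + b2 * S)) * H - (r3 * P - a3 * Q + b3 * S)
    + ((a1 + a2) * H - a3) * Q - ((b1 + b2) * H - b3) * S" for P Q S H :: real
    by (simp add: algebra_simps)
  show ?thesis unfolding divide_inverse by (rule id)
qed

lemma midpoint_less: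
  fixes x y c :: real
  assumes "x < c" "y < c"
  shows "(x + y) / 2 < c"
proof -
  have "x + y < c * 2" unfolding mult_2_right by (rule add_strict_mono[OF assms])
  then show ?thesis by (rule pos_divide_less_eq[THEN iffD2, OF zero_less_numeral])
qed

section \<open>Existence of a minimiser\<close>

context variational_problem
begin

lemma minimizing_sequence:
  obtains g where "\<And>n::nat. g n \<in> Cc_infty UNIV" "\<And>n x. 0 \<le> g n x"
    "\<And>n. energy (g n) (grad (g n)) < inf_energy + 1 / real (Suc n)"
proof -
  have zero: "(\<lambda>x. 0) \<in> Cc_infty (UNIV :: ((real^'m) \<times> real) set)"
    by (simp add: Cc_infty_UNIV_iff C_k_const)
  have "\<exists>g. g \<in> Cc_infty UNIV \<and> (\<forall>x. 0 \<le> g x) \<and> energy g (grad g) < inf_energy + 1 / real (Suc n)" for n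
  proof -
    \<comment> \<open>Half of the tolerance is spent on approaching the infimum, the other half on
      making the function nonnegative.\<close>
    define c where "c = 1 / (2 * real (Suc n))"
    have c: "0 < c" "c + c = 1 / real (Suc n)" unfolding c_def by (simp, simp add: field_simps)
    have "\<exists>y\<in>(\<lambda>f. energy f (grad f)) ` Cc_infty UNIV. y < inf_energy + c"
    proof (rule cInf_lessD)
      show "(\<lambda>f. energy f (grad f)) ` Cc_infty UNIV \<noteq> {}" using zero by blast
      show "Inf ((\<lambda>f. energy f (grad f)) ` Cc_infty UNIV) < inf_energy + c" using c(1) by (simp flip: inf_energy_def)
    qed
    then obtain f where f: "f \<in> Cc_infty UNIV" "energy f (grad f) < inf_energy + c" by blast
    obtain g where g: "g \<in> Cc_infty UNIV" "\<And>x. 0 \<le> g x" "energy g (grad g) < energy f (grad f) + c"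
      using nonnegative_competitor[OF f(1) c(1)] by blast
    have "energy g (grad g) < inf_energy + 1 / real (Suc n)" using g(3) f(2) c(2) by linarith
    with g(1,2) show ?thesis by blast
  qed
  then show ?thesis using that by metis
qed

theorem minimizer_exists:
  obtains \<phi> u G where "approximates \<phi> u G" "energy u G = inf_energy" "AE x in dxH. 0 \<le> u x"
proof -
  have pos: "0 < p" "0 < q" "0 < s" using p pq qs by auto
  obtain g where g: "\<And>n::nat. g n \<in> Cc_infty UNIV" "\<And>n x. 0 \<le> g n x"
    "\<And>n. energy (g n) (grad (g n)) < inf_energy + 1 / real (Suc n)"
    using minimizing_sequence by blast
  obtain K where K: "\<And>u G. B.Lw u \<Longrightarrow> R.Nw G / p + B.Nw u / (2 * s) \<le> energy u G + K" using energy_coercive by blast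
  define E where "E = inf_energy + 1 + K"
  have bd: "R.Nw (grad (g n)) \<le> p * E" "B.Nw (g n) \<le> 2 * s * E" for n
  proof -
    have "1 / real (Suc n) \<le> 1" by simp
    then have "R.Nw (grad (g n)) / p + B.Nw (g n) / (2 * s) \<le> E"
      using K[OF Cc_infty_Lw(4)[OF g(1)[of n]], of "grad (g n)"] g(3)[of n] unfolding E_def by linarith
    moreover have "0 \<le> R.Nw (grad (g n)) / p" "0 \<le> B.Nw (g n) / (2 * s)"
      using pos by (auto intro!: divide_nonneg_nonneg R.Nw_nonneg B.Nw_nonneg)
    ultimately have "R.Nw (grad (g n)) / p \<le> E" "B.Nw (g n) / (2 * s) \<le> E" by linarith+
    then show "R.Nw (grad (g n)) \<le> p * E" "B.Nw (g n) \<le> 2 * s * E"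
      using pos by (simp_all add: pos_divide_le_eq mult.commute)
  qed
  have gb: "(\<integral>x. (1 + snd x) powr \<gamma> * norm (grad (g n) x) powr p \<partial>dxH) \<le> 1 / \<rho>0 * (p * E)" for n
    using weighted_gradient_le[OF g(1)[of n]] mult_left_mono[OF bd(1)[of n], of "1 / \<rho>0"] \<rho>0 by simp
  obtain \<sigma> u where \<sigma>: "strict_mono \<sigma>" and um: "u \<in> borel_measurable dxH"
    and lim: "AE x in dxH. (\<lambda>n. g (\<sigma> n) x) \<longlonglongrightarrow> u x"
    by (rule rellich_halfspace[where \<phi> = g, OF g(1) p(1) \<gamma> gb]) (rule that)
  define \<phi> where "\<phi> n = g (\<sigma> n)" for n
  have \<phi>: "\<phi> n \<in> Cc_infty UNIV" for n by (simp add: \<phi>_def g(1))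
  note L = Cc_infty_Lw[OF \<phi>]
  have lim': "AE x in dxH. (\<lambda>n. \<phi> n x) \<longlonglongrightarrow> u x" using lim by (simp add: \<phi>_def)
  have I: "(\<lambda>n. energy (\<phi> n) (grad (\<phi> n))) \<longlonglongrightarrow> inf_energy"
  proof (rule tendsto_sandwich[of "\<lambda>n. inf_energy" _ _ "\<lambda>n. inf_energy + 1 / real (Suc n)"])
    have "(\<lambda>n. inf_energy + 1 / real (Suc n)) \<longlonglongrightarrow> inf_energy + 0"
      by (intro tendsto_add tendsto_const LIMSEQ_Suc[OF lim_1_over_n])
    then show "(\<lambda>n. inf_energy + 1 / real (Suc n)) \<longlonglongrightarrow> inf_energy" by simp
    have "energy (\<phi> n) (grad (\<phi> n)) \<le> inf_energy + 1 / real (Suc n)" for n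
    proof -
      have "1 / real (Suc (\<sigma> n)) \<le> 1 / real (Suc n)"
        using seq_suble[OF \<sigma>, of n] by (intro divide_left_mono) auto
      then show ?thesis using g(3)[of "\<sigma> n"] by (simp add: \<phi>_def)
    qed
    then show "\<forall>\<^sub>F n in sequentially. energy (\<phi> n) (grad (\<phi> n)) \<le> inf_energy + 1 / real (Suc n)" by simp
  qed (use inf_energy_le[OF \<phi>] in auto)
  have B\<phi>: "B.Nw (\<phi> n) \<le> 2 * s * E" for n by (simp add: \<phi>_def bd)
  \<comment> \<open>Fatou's lemma: the bound on B survives the limit almost everywhere, so the
    differences from u are bounded in B, as \<open>A_tendsto_AE\<close> requires.\<close>
  have Bu: "B.Lw u" "B.Nw u \<le> 2 * s * E" using B.Lw_Fatou[OF L(4) B\<phi> um lim'] by auto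
  have LD: "B.Lw (\<lambda>x. \<phi> n x - u x)" for n by (rule B.Lw_diff[OF L(4) Bu(1)])
  have ND: "B.Nw (\<lambda>x. \<phi> n x - u x) \<le> 2 powr s * (2 * s * E + 2 * s * E)" for n
  proof -
    have "B.Nw (\<lambda>x. \<phi> n x - u x) \<le> 2 powr s * (B.Nw (\<phi> n) + B.Nw u)" by (rule B.Nw_diff_le[OF L(4) Bu(1)])
    also have "\<dots> \<le> 2 powr s * (2 * s * E + 2 * s * E)" by (intro mult_left_mono add_mono B\<phi> Bu) auto
    finally show ?thesis .
  qed
  have limD: "AE x in dxH. (\<lambda>n. \<phi> n x - u x) \<longlonglongrightarrow> 0"
    using lim' by eventually_elim (simp add: LIM_zero)
  have AD: "(\<lambda>n. A.Nw (\<lambda>x. \<phi> n x - u x)) \<longlonglongrightarrow> 0" by (rule A_tendsto_AE[OF LD ND limD])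
  have Au: "A.Lw u" by (rule A_from_B(1)[OF Bu(1)])
  have RC: "R.Cauchy_Nw (\<lambda>n. grad (\<phi> n))"
  proof (rule R.Cauchy_Nw_midpoint[OF L(1)])
    show "R.Nw (grad (\<phi> n)) \<le> p * E" for n by (simp add: \<phi>_def bd)
    fix e :: real assume e: "0 < e"
    \<comment> \<open>Energy gap and A-defect are each below \<epsilon> after division by q where
      appropriate, so the gradient defect is below 2 \<epsilon> p = e/2.\<close>
    define \<epsilon> where "\<epsilon> = e / (4 * p)"
    have \<epsilon>: "0 < \<epsilon>" using e pos by (simp add: \<epsilon>_def)
    \<comment> \<open>In the defect of A two deviations count one half and the one at the midpoint
      counts fully, hence the tolerance \<epsilon> q / 2 for each.\<close>
    have \<epsilon>q: "0 < \<epsilon> * q / 2" using \<epsilon> pos by simp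
    have "\<exists>d>0. \<forall>F. A.Lw F \<longrightarrow> A.Nw (\<lambda>x. F x - u x) < d \<longrightarrow> \<bar>A.Nw F - A.Nw u\<bar> < \<epsilon> * q / 2"
    proof (rule A.Nw_continuous[OF Au \<epsilon>q])
      fix d :: real
      assume d: "0 < d" "\<And>F. A.Lw F \<Longrightarrow> A.Nw (\<lambda>x. F x - u x) < d \<Longrightarrow> \<bar>A.Nw F - A.Nw u\<bar> < \<epsilon> * q / 2"
      show ?thesis by (intro exI[of _ d] conjI allI impI d) assumption+
    qed
    then obtain d where d: "0 < d"
      and dA: "\<forall>F. A.Lw F \<longrightarrow> A.Nw (\<lambda>x. F x - u x) < d \<longrightarrow> \<bar>A.Nw F - A.Nw u\<bar> < \<epsilon> * q / 2" by (elim exE conjE) (rule that)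
    have "\<forall>\<^sub>F n in sequentially. A.Nw (\<lambda>x. \<phi> n x - u x) < d / 2 \<and> energy (\<phi> n) (grad (\<phi> n)) < inf_energy + \<epsilon>"
    proof (rule eventually_conj)
      show "\<forall>\<^sub>F n in sequentially. A.Nw (\<lambda>x. \<phi> n x - u x) < d / 2" by (rule order_tendstoD(2)[OF AD]) (use d in simp)
      show "\<forall>\<^sub>F n in sequentially. energy (\<phi> n) (grad (\<phi> n)) < inf_energy + \<epsilon>" by (rule order_tendstoD(2)[OF I]) (use \<epsilon> in simp)
    qed
    then obtain k where k: "\<And>n. k \<le> n \<Longrightarrow> A.Nw (\<lambda>x. \<phi> n x - u x) < d / 2"
      "\<And>n. k \<le> n \<Longrightarrow> energy (\<phi> n) (grad (\<phi> n)) < inf_energy + \<epsilon>"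
      unfolding eventually_sequentially by blast
    have "(R.Nw (grad (\<phi> m)) + R.Nw (grad (\<phi> n))) / 2 - R.Nw (\<lambda>x. (1/2) *\<^sub>R (grad (\<phi> m) x + grad (\<phi> n) x)) < e"
      if mn: "k \<le> m" "k \<le> n" for m n
    proof -
      define h where "h x = (1/2) * (\<phi> m x + \<phi> n x)" for x
      have h: "h \<in> Cc_infty UNIV" unfolding h_def[abs_def] by (intro Cc_infty_scale Cc_infty_add \<phi>)
      have gh: "grad h = (\<lambda>x. (1/2) *\<^sub>R (grad (\<phi> m) x + grad (\<phi> n) x))"
      proof (rule ext)
        fix x
        show "grad h x = (1/2) *\<^sub>R (grad (\<phi> m) x + grad (\<phi> n) x)"
          unfolding h_def[abs_def] grad_scale[OF Cc_infty_add[OF \<phi>[of m] \<phi>[of n]]] grad_add[OF \<phi>[of m] \<phi>[of n]] by (rule refl)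
      qed
      \<comment> \<open>The factor (1/2)^q of the midpoint cancels the 2^q of the generalised
        triangle inequality, so the midpoint also lies within the distance d of u.\<close>
      have Dh: "A.Nw (\<lambda>x. h x - u x) < d"
      proof -
        have "(\<lambda>x. h x - u x) = (\<lambda>x. (1/2) *\<^sub>R ((\<phi> m x - u x) + (\<phi> n x - u x)))" by (auto simp: h_def field_simps)
        then have "A.Nw (\<lambda>x. h x - u x) = (1/2) powr q * A.Nw (\<lambda>x. (\<phi> m x - u x) + (\<phi> n x - u x))"
          using A.Nw_scaleR[of "1/2" "\<lambda>x. (\<phi> m x - u x) + (\<phi> n x - u x)"] by simp
        also have "\<dots> \<le> (1/2) powr q * (2 powr q * (A.Nw (\<lambda>x. \<phi> m x - u x) + A.Nw (\<lambda>x. \<phi> n x - u x)))"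
          by (intro mult_left_mono A.Nw_add_le A.Lw_diff L Au) auto
        also have "\<dots> = A.Nw (\<lambda>x. \<phi> m x - u x) + A.Nw (\<lambda>x. \<phi> n x - u x)"
          by (simp add: powr_divide)
        also have "\<dots> < d" using k(1)[OF mn(1)] k(1)[OF mn(2)] by linarith
        finally show ?thesis .
      qed
      have half: "d / 2 < d" using d by simp
      have A1: "\<bar>A.Nw h - A.Nw u\<bar> < \<epsilon> * q / 2" by (rule dA[rule_format, OF Cc_infty_Lw(3)[OF h] Dh])
      have A2: "\<bar>A.Nw (\<phi> m) - A.Nw u\<bar> < \<epsilon> * q / 2" by (rule dA[rule_format, OF L(3) less_trans[OF k(1)[OF mn(1)] half]])
      have A3: "\<bar>A.Nw (\<phi> n) - A.Nw u\<bar> < \<epsilon> * q / 2" by (rule dA[rule_format, OF L(3) less_trans[OF k(1)[OF mn(2)] half]])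
      define c where "c = \<epsilon> * q / 2"
      have c: "\<epsilon> * q = 2 * c" by (simp add: c_def)
      have "A.Nw (\<phi> m) + A.Nw (\<phi> n) - 2 * A.Nw h < 4 * c"
        using A1 A2 A3 unfolding c_def[symmetric] abs_less_iff by linarith
      then have "(A.Nw (\<phi> m) + A.Nw (\<phi> n)) / 2 - A.Nw h < \<epsilon> * q" unfolding c by (simp add: field_simps)
      then have A: "((A.Nw (\<phi> m) + A.Nw (\<phi> n)) / 2 - A.Nw h) / q < \<epsilon>" using pos by (simp add: pos_divide_less_eq)
      have hB: "h = (\<lambda>x. (1/2) *\<^sub>R (\<phi> m x + \<phi> n x))" by (simp add: h_def[abs_def])
      have "B.Nw h \<le> (B.Nw (\<phi> m) + B.Nw (\<phi> n)) / 2" unfolding hB by (rule B.Nw_midpoint_le[OF L(4) L(4)])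
      then have B: "0 \<le> ((B.Nw (\<phi> m) + B.Nw (\<phi> n)) / 2 - B.Nw h) / s" using pos by simp
      have "((R.Nw (grad (\<phi> m)) + R.Nw (grad (\<phi> n))) / 2 - R.Nw (grad h)) / p
          = (energy (\<phi> m) (grad (\<phi> m)) + energy (\<phi> n) (grad (\<phi> n))) / 2 - energy h (grad h)
            + ((A.Nw (\<phi> m) + A.Nw (\<phi> n)) / 2 - A.Nw h) / q - ((B.Nw (\<phi> m) + B.Nw (\<phi> n)) / 2 - B.Nw h) / s"
        unfolding energy_def by (rule midpoint_gap)
      also have "\<dots> < 2 * \<epsilon>"
      proof -
        have ineq: "x - y + z - w < 2 * \<epsilon>" if "x < i + \<epsilon>" "i \<le> y" "z < \<epsilon>" "0 \<le> w" for x y z w i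
          using that by linarith
        show ?thesis
          by (rule ineq[OF midpoint_less[OF k(2)[OF mn(1)] k(2)[OF mn(2)]] inf_energy_le[OF h] A B])
      qed
      finally have "(R.Nw (grad (\<phi> m)) + R.Nw (grad (\<phi> n))) / 2 - R.Nw (grad h) < 2 * \<epsilon> * p"
        using pos by (simp add: pos_divide_less_eq)
      also have "\<dots> < e" using e pos by (simp add: \<epsilon>_def)
      finally show ?thesis unfolding gh .
    qed
    then show "\<exists>k. \<forall>m\<ge>k. \<forall>n\<ge>k. (R.Nw (grad (\<phi> m)) + R.Nw (grad (\<phi> n))) / 2 - R.Nw (\<lambda>x. (1/2) *\<^sub>R (grad (\<phi> m) x + grad (\<phi> n) x)) < e"
      by blast
  qed
  \<comment> \<open>Hardy's inequality transfers the Cauchy property from the gradients to the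
    functions; their limit in \<open>V\<close> is then identified as u by the pointwise
    convergence.\<close>
  have VC: "V.Cauchy_Nw \<phi>"
    unfolding V.Cauchy_Nw_def
  proof (intro allI impI)
    fix e :: real assume e: "0 < e"
    obtain C where C: "0 \<le> C" "\<And>f. f \<in> Cc_infty UNIV \<Longrightarrow> V.Nw f \<le> C * R.Nw (grad f)" using hardy by blast
    have "0 < e / (C + 1)" using e C(1) by simp
    then obtain k where k: "\<And>m n. k \<le> m \<Longrightarrow> k \<le> n \<Longrightarrow> R.Nw (\<lambda>x. grad (\<phi> m) x - grad (\<phi> n) x) < e / (C + 1)"
      using RC unfolding R.Cauchy_Nw_def by metis
    have "V.Nw (\<lambda>x. \<phi> m x - \<phi> n x) < e" if mn: "k \<le> m" "k \<le> n" for m n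
    proof -
      have gd: "grad (\<lambda>x. \<phi> m x - \<phi> n x) = (\<lambda>x. grad (\<phi> m) x - grad (\<phi> n) x)" by (rule ext) (rule grad_diff(2)[OF \<phi> \<phi>])
      have "V.Nw (\<lambda>x. \<phi> m x - \<phi> n x) \<le> C * R.Nw (\<lambda>x. grad (\<phi> m) x - grad (\<phi> n) x)"
        using C(2)[OF grad_diff(1)[OF \<phi> \<phi>], of m n] unfolding gd .
      also have "\<dots> \<le> C * (e / (C + 1))" using k[OF mn] C(1) by (intro mult_left_mono) auto
      also have "\<dots> < e" using e C(1) by (simp add: field_simps)
      finally show ?thesis .
    qed
    then show "\<exists>k. \<forall>m\<ge>k. \<forall>n\<ge>k. V.Nw (\<lambda>x. \<phi> m x - \<phi> n x) < e" by blast
  qed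
  have Vu: "V.Lw u" "(\<lambda>n. V.Nw (\<lambda>x. \<phi> n x - u x)) \<longlonglongrightarrow> 0"
    using V.Cauchy_Nw_tendsto[OF L(2) VC strict_mono_id um] lim' by auto
  obtain \<tau> G where G: "strict_mono \<tau>" "G \<in> borel_measurable dxH" "AE x in dxH. (\<lambda>n. grad (\<phi> (\<tau> n)) x) \<longlonglongrightarrow> G x"
    using R.Cauchy_Nw_AE_subseq[OF L(1) RC] by blast
  have RG: "R.Lw G" "(\<lambda>n. R.Nw (\<lambda>x. grad (\<phi> n) x - G x)) \<longlonglongrightarrow> 0"
    using R.Cauchy_Nw_tendsto[OF L(1) RC G] by auto
  have ap: "approximates \<phi> u G" unfolding approximates_def using \<phi> Vu RG by blast
  moreover have "energy u G = inf_energy" by (rule LIMSEQ_unique[OF energy_tendsto[OF ap] I])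
  moreover have "AE x in dxH. 0 \<le> u x"
    using lim'
  proof eventually_elim
    case (elim x)
    then show ?case by (rule LIMSEQ_le_const) (auto simp: \<phi>_def g(2))
  qed
  ultimately show ?thesis by (rule that)
qed

section \<open>The Euler-Lagrange equation and nontriviality\<close>

lemma minimizer_first_variation_nonneg:
  assumes ap: "approximates \<phi> u G" and m: "energy u G = inf_energy" and f: "f \<in> Cc_infty UNIV"
  shows "0 \<le> (\<integral>x. \<rho> x * (norm (G x) powr (p - 2) * (G x \<bullet> grad f x)) \<partial>dxH)
      - (\<integral>x. a x * (norm (u x) powr (q - 2) * (u x \<bullet> f x)) \<partial>dxH)
      + (\<integral>x. b x * (norm (u x) powr (s - 2) * (u x \<bullet> f x)) \<partial>dxH)" (is "0 \<le> ?R - ?A + ?B")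
proof -
  have pos: "0 < p" "0 < q" "0 < s" using p pq qs by auto
  have RG: "R.Lw G" using ap by (simp add: approximates_def)
  note BA = approximates_B_A[OF ap] and Lf = Cc_infty_Lw[OF f]
  define t where "t n = 1 / real (Suc n)" for n
  define QR where "QR n = (R.Nw (\<lambda>x. G x + t n *\<^sub>R grad f x) - R.Nw G) / t n" for n
  define QA where "QA n = (A.Nw (\<lambda>x. u x + t n *\<^sub>R f x) - A.Nw u) / t n" for n
  define QB where "QB n = (B.Nw (\<lambda>x. u x + t n *\<^sub>R f x) - B.Nw u) / t n" for n
  have "QR \<longlonglongrightarrow> p * ?R" "QA \<longlonglongrightarrow> q * ?A" "QB \<longlonglongrightarrow> s * ?B"
    unfolding QR_def[abs_def] QA_def[abs_def] QB_def[abs_def] t_def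
    by (rule R.Nw_directional_derivative(2)[OF RG Lf(1)] A.Nw_directional_derivative(2)[OF BA(3) Lf(3)]
        B.Nw_directional_derivative(2)[OF BA(1) Lf(4)])+
  then have "(\<lambda>n. QR n / p - QA n / q + QB n / s) \<longlonglongrightarrow> p * ?R / p - q * ?A / q + s * ?B / s"
    by (intro tendsto_add tendsto_diff tendsto_divide tendsto_const) (use pos in auto)
  then have "(\<lambda>n. QR n / p - QA n / q + QB n / s) \<longlonglongrightarrow> ?R - ?A + ?B" using pos by simp
  moreover have "0 \<le> QR n / p - QA n / q + QB n / s" for n
  proof -
    have tp: "0 < t n" by (simp add: t_def)
    have sf: "(\<lambda>x. t n * f x) \<in> Cc_infty UNIV" by (rule Cc_infty_scale[OF f])
    \<comment> \<open>Adding a multiple of a test function stays in the closure, so every right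
      difference quotient of the energy at u is nonnegative.\<close>
    have "inf_energy \<le> energy (\<lambda>x. u x + t n * f x) (\<lambda>x. G x + t n *\<^sub>R grad f x)"
      using inf_energy_le_approximates[OF approximates_add[OF ap sf]] unfolding grad_scale[OF f] .
    then have "0 \<le> (energy (\<lambda>x. u x + t n *\<^sub>R f x) (\<lambda>x. G x + t n *\<^sub>R grad f x) - energy u G) / t n"
      using tp m by simp
    also have "\<dots> = QR n / p - QA n / q + QB n / s"
      by (simp add: energy_def QR_def QA_def QB_def add_divide_distrib diff_divide_distrib mult.commute)
    finally show ?thesis .
  qed
  ultimately show ?thesis by (intro LIMSEQ_le_const) auto
qed

lemma minimizer_weak_solution:
  assumes ap: "approximates \<phi> u G" and m: "energy u G = inf_energy"
  shows "weak_solution \<rho> a b p q s \<gamma> u"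
  unfolding weak_solution_def
proof (intro conjI ballI)
  show "u \<in> E_space \<rho> p \<gamma>" by (rule approximates_E_space(1)[OF ap])
  fix \<psi> :: "(real^'m) \<times> real \<Rightarrow> real" assume "\<psi> \<in> C_delta"
  then obtain f where f: "f \<in> Cc_infty UNIV" "\<forall>x\<in>halfspace. \<psi> x = f x" unfolding C_delta_def by blast
  have RG: "R.Lw G" using ap by (simp add: approximates_def)
  note BA = approximates_B_A[OF ap] and Lf = Cc_infty_Lw[OF f(1)]
  define gR where "gR x = \<rho> x * (norm (G x) powr (p - 2) * (G x \<bullet> grad f x))" for x
  define gA where "gA x = a x * (norm (u x) powr (q - 2) * (u x \<bullet> f x))" for x
  define gB where "gB x = b x * (norm (u x) powr (s - 2) * (u x \<bullet> f x))" for x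
  have i: "integrable dxH gR" "integrable dxH gA" "integrable dxH gB"
    unfolding gR_def[abs_def] gA_def[abs_def] gB_def[abs_def]
    by (rule R.Nw_directional_derivative(1)[OF RG Lf(1)] A.Nw_directional_derivative(1)[OF BA(3) Lf(3)]
        B.Nw_directional_derivative(1)[OF BA(1) Lf(4)])+
  have eq0: "(\<integral>x. gR x \<partial>dxH) - (\<integral>x. gA x \<partial>dxH) + (\<integral>x. gB x \<partial>dxH) = 0"
  proof (rule antisym)
    show "0 \<le> (\<integral>x. gR x \<partial>dxH) - (\<integral>x. gA x \<partial>dxH) + (\<integral>x. gB x \<partial>dxH)"
      unfolding gR_def gA_def gB_def by (rule minimizer_first_variation_nonneg[OF ap m f(1)])
    \<comment> \<open>The first variation is linear in the test function, so nonnegativity for f and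
      for -f forces it to vanish.\<close>
    have f': "(\<lambda>x. (-1) * f x) \<in> Cc_infty UNIV" by (rule Cc_infty_scale[OF f(1)])
    have "0 \<le> (\<integral>x. - gR x \<partial>dxH) - (\<integral>x. - gA x \<partial>dxH) + (\<integral>x. - gB x \<partial>dxH)"
      using minimizer_first_variation_nonneg[OF ap m f'] unfolding grad_scale[OF f(1)]
      by (simp add: gR_def gA_def gB_def)
    then show "(\<integral>x. gR x \<partial>dxH) - (\<integral>x. gA x \<partial>dxH) + (\<integral>x. gB x \<partial>dxH) \<le> 0" by simp
  qed
  \<comment> \<open>The definition of a weak solution uses \<open>wgrad u\<close> and the gradient
    of an element of \<open>C_delta\<close>; these agree with G and \<open>grad f\<close> almost
    everywhere, respectively everywhere in the half-space.\<close>
  have AE_R: "AE x in dxH. \<rho> x * ((norm (wgrad u x) powr (p - 2) *\<^sub>R wgrad u x) \<bullet> grad \<psi> x) = gR x"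
    using approximates_E_space(2)[OF ap] AE_space
  proof eventually_elim
    case (elim x)
    then have "grad \<psi> x = grad f x" by (intro C_delta_grad[OF f]) simp
    then show ?case using elim(1) by (simp add: gR_def)
  qed
  have AB: "(a x * \<bar>u x\<bar> powr (q - 2) * u x - b x * \<bar>u x\<bar> powr (s - 2) * u x) * \<psi> x = gA x - gB x" if "x \<in> space dxH" for x
    using f(2) that by (simp add: gA_def gB_def algebra_simps)
  have rm: "(\<lambda>x. \<rho> x * ((norm (wgrad u x) powr (p - 2) *\<^sub>R wgrad u x) \<bullet> grad \<psi> x)) \<in> borel_measurable dxH"
  proof -
    have wm: "wgrad u \<in> borel_measurable dxH"
      using wgrad_eq(1)[OF approximates_weak_gradient[OF ap]]
      by (intro loc_integrable_measurable) (simp add: has_weak_gradient_def)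
    have fm: "grad f \<in> borel_measurable dxH" by (rule borel_measurable_dxH[OF Cc_infty_measurable(2)[OF f(1)]])
    have "(\<lambda>x. \<rho> x * ((norm (wgrad u x) powr (p - 2) *\<^sub>R wgrad u x) \<bullet> grad f x)) \<in> borel_measurable dxH"
      using wm fm pos_loc_integrable_measurable[OF \<rho>] by measurable
    then show ?thesis
      by (rule measurable_cong[THEN iffD1, rotated]) (simp add: C_delta_grad[OF f])
  qed
  have cR: "(\<integral>x. \<rho> x * ((norm (wgrad u x) powr (p - 2) *\<^sub>R wgrad u x) \<bullet> grad \<psi> x) \<partial>dxH) = (\<integral>x. gR x \<partial>dxH)"
    by (rule integral_cong_AE[OF rm borel_measurable_integrable[OF i(1)] AE_R])
  show "integrable dxH (\<lambda>x. \<rho> x * ((norm (wgrad u x) powr (p - 2) *\<^sub>R wgrad u x) \<bullet> grad \<psi> x))"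
    by (rule integrable_cong_AE_imp[OF i(1) rm AE_symmetric[OF AE_R]])
  have iAB: "integrable dxH (\<lambda>x. gA x - gB x)" by (intro Bochner_Integration.integrable_diff i)
  have cAB: "(\<integral>x. (a x * \<bar>u x\<bar> powr (q - 2) * u x - b x * \<bar>u x\<bar> powr (s - 2) * u x) * \<psi> x \<partial>dxH) = (\<integral>x. gA x - gB x \<partial>dxH)"
    by (rule Bochner_Integration.integral_cong[OF refl AB])
  show "integrable dxH (\<lambda>x. (a x * \<bar>u x\<bar> powr (q - 2) * u x - b x * \<bar>u x\<bar> powr (s - 2) * u x) * \<psi> x)"
    by (rule Bochner_Integration.integrable_cong[OF refl AB, THEN iffD2, OF _ iAB])
  show "(\<integral>x. \<rho> x * ((norm (wgrad u x) powr (p - 2) *\<^sub>R wgrad u x) \<bullet> grad \<psi> x) \<partial>dxH) =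
        (\<integral>x. (a x * \<bar>u x\<bar> powr (q - 2) * u x - b x * \<bar>u x\<bar> powr (s - 2) * u x) * \<psi> x \<partial>dxH)"
    unfolding cR cAB using eq0 i(2,3) by simp
qed

text \<open>Only the A-term can make the energy negative, and it vanishes for a function that is 0
  almost everywhere; the other two terms are nonnegative whatever G is.\<close>

lemma minimizer_nontrivial:
  assumes ap: "approximates \<phi> u G" and m: "energy u G < 0"
  shows "\<not> (AE x in dxH. u x = 0)"
proof
  assume z: "AE x in dxH. u x = 0"
  have "A.Nw u = A.Nw (\<lambda>x. 0 :: real)"
    by (rule A.Nw_cong_AE[OF z]) (use approximates_B_A(3)[OF ap] in \<open>auto simp: A.Lw_def\<close>)
  then have "A.Nw u = 0" by (simp add: A.Nw_def)
  moreover have "0 \<le> R.Nw G / p" "0 \<le> B.Nw u / s"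
    using p pq qs by (auto intro!: divide_nonneg_nonneg R.Nw_nonneg B.Nw_nonneg)
  ultimately show False using m by (simp add: energy_def)
qed

end

theorem theorem2p7:
  fixes \<rho> a b :: "(real^'m) \<times> real \<Rightarrow> real"
    and p q s \<rho>0 \<gamma> :: real
  assumes "1 < p" and "p \<le> real DIM((real^'m) \<times> real)"
    and "p < q" and "q < s" and "ereal s < crit_exp (real DIM((real^'m) \<times> real)) p"
    and "pos_loc_integrable \<rho>" and "pos_loc_integrable a" and "pos_loc_integrable b"
    and "0 < \<rho>0" and "p - 1 < \<gamma>"
    and "AE x in dxH. \<rho>0 * (1 + snd x) powr \<gamma> \<le> \<rho> x"
    and "a \<in> K0 p \<gamma>" and "b \<in> K0 p \<gamma>"
    and "in_Lp dxH (s * q / (s - q)) (\<lambda>x. a x powr (1 / q) / b x powr (1 / s))"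
    and "D1 \<rho> a b p q s \<gamma> \<noteq> {}"
  shows "\<exists>u. weak_solution \<rho> a b p q s \<gamma> u \<and> (AE x in dxH. 0 \<le> u x) \<and>
             \<not> (AE x in dxH. u x = 0)"
proof -
  interpret variational_problem \<rho> a b p q s \<rho>0 \<gamma>
    by (rule variational_problem.intro) (use assms in blast)+
  obtain w where "w \<in> D1 \<rho> a b p q s \<gamma>" using assms(15) by blast
  then have neg: "inf_energy < 0" by (rule inf_energy_negative)
  obtain \<phi> u G where u: "approximates \<phi> u G" "energy u G = inf_energy" "AE x in dxH. 0 \<le> u x"
    by (rule minimizer_exists)
  have "weak_solution \<rho> a b p q s \<gamma> u" by (rule minimizer_weak_solution[OF u(1,2)])
  moreover have "\<not> (AE x in dxH. u x = 0)" by (rule minimizer_nontrivial[OF u(1)]) (use u(2) neg in simp)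
  ultimately show ?thesis using u(3) by blast
qed

end
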